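(* Let $n_1,n_2\ge 3$, $r_1,r_2\ge 0$ be integers with $n_1-1\ge 2r_1+1$, $n_2-1\ge 2r_2+1$, let $\Delta$ be a regular T-mesh without cycles with domain $\Omega$, let $u_1,v_1,u_2,v_2$ satisfy the standing assumptions (A1)-(A4) listed in the context, and let $f\in C^{\mathbf n}(\Omega)$. Let $Q$ be the quasi-interpolant defined in the context, $k=\min\{n_1-1,n_2-1\}$, $H=\max_{R\in\Delta}\mathrm{diam}(R)$ and $1\le q\le\infty$. Then for every cell $R_\zeta\in\Delta$, $$\|f-Qf\|_{q,R_\zeta}= O(H^{k+1}),$$ where $\|\cdot\|_{q,R_\zeta}$ is the $L^q$-norm on $R_\zeta$; the $O$ is meant as $H\to 0$, with an implied constant depending on the mesh only through the quantities $\alpha_\Delta,\beta_\Delta,\kappa_\Delta$ of the context (and possibly on $f,\Omega,\mathbf n,\mathbf r,q,u_1,v_1,u_2,v_2$ and the lower bound in (A4)).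
   Context: **Univariate spaces.** For $n\ge 3$ and $u,v\in C^n([a,b])$, $\mathcal P^n_{u,v}([a,b])=\mathrm{span}\langle 1,s,\dots,s^{n-3},u(s),v(s)\rangle$ (functions on $[a,b]$). Conditions on $\mathcal P^n_{u,v}([a,b])$: (C1) for all $\psi\in\mathcal P^n_{u,v}([a,b])$, if $\psi^{(n-2)}(s_1)=\psi^{(n-2)}(s_2)=0$ for some $s_1\ne s_2$ in $[a,b]$, then $\psi^{(n-2)}\equiv 0$ on $[a,b]$; (C2) for all $\psi\in\mathcal P^n_{u,v}([a,b])$, if $\psi^{(n-2)}(s_1)=\psi^{(n-1)}(s_1)=0$ for some $s_1\in(a,b)$, then $\psi^{(n-2)}\equiv 0$ on $[a,b]$. **Bernstein basis.** Suppose $\dim\mathcal P^n_{u,v}([a,b])=n$ and (C1) holds. Let $U_{0,1,n-1},U_{1,1,n-1}$ be the unique elements of $\mathrm{span}\langle u^{(n-2)},v^{(n-2)}\rangle$ with $U_{0,1,n-1}(a)=1$, $U_{0,1,n-1}(b)=0$, $U_{1,1,n-1}(a)=0$, $U_{1,1,n-1}(b)=1$ (both are positive on $(a,b)$). For $k=2,\dots,n-1$ put $U_{0,k,n-1}=1-V_{0,k-1,n-1}$, $U_{i,k,n-1}=V_{i-1,k-1,n-1}-V_{i,k-1,n-1}$ for $1\le i\le k-1$, $U_{k,k,n-1}=V_{k-1,k-1,n-1}$, where $V_{i,k,n-1}(s)=\int_a^s U_{i,k,n-1}(t)\,dt\,/\,d_{i,k,n-1}$ and $d_{i,k,n-1}=\int_a^b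 U_{i,k,n-1}(t)\,dt$. The Bernstein basis of $\mathcal P^n_{u,v}([a,b])$ is $B_{i,n-1}=U_{i,n-1,n-1}$, $i=0,\dots,n-1$. **T-meshes.** A T-mesh is a finite collection $\Delta=\{R_i\}_{i=1}^N$ of axis-aligned rectangles (cells) such that $\Omega=\bigcup_i R_i$ is connected and any two cells intersect only at points on their edges. Vertices of $\Delta$ are the vertices of its cells. A vertex of a cell lying in the interior of an edge of another cell is a T-junction. A line segment $e=\langle w_1,w_2\rangle$ (along edges of cells) connecting vertices $w_1,w_2$ is an edge segment if no vertex lies in its interior; it is a composite edge if all vertices in its interior are T-junctions and it cannot be extended to a longer segment with the same property. $\Delta$ is regular if for each vertex $w$ the set of all rectangles containing $w$ has connected interior. T-junctions $w_1,\dots,w_m$ form a cycle if each $w_i$ lies in the interior of a composite edge having one of its endpoints at $w_{i+1}$ (with $w_{m+1}=w_1$). **Spline space.** Let $\mathbf n=(n_1,n_2)$, $\mathbf r=(r_1,r_2)$. The functions $u_1,v_1$ (of $s$) and $u_2,v_2$ (of $t$) are fixed real functions with $u_1,v_1\in C^{n_1}([a_R,b_R])$ and $u_2,v_2\in C^{n_2}([c_R,d_R])$ for each cell $R=[a_R,b_R]\times[c_R,d_R]$. Put $\mathcal P^{\mathbf n}_{\mathbf u,\mathbf v}(R)=\mathrm{span}\langle g_1(s)g_2(t): g_1\in\mathcal P^{n_1}_{u_1,v_1}([a_R,b_R]),\ g_2\in\mathcal P^{n_2}_{u_2,v_2}([c_R,d_R])\rangle$ and $GS^{\mathbf n,\mathbf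 r}_{\mathbf u,\mathbf v}(\Delta)=\{p\in C^{\mathbf r}(\Omega): p|_R\in\mathcal P^{\mathbf n}_{\mathbf u,\mathbf v}(R)\ \forall R\in\Delta\}$. For a pair $\mathbf m=(m_1,m_2)$, $C^{\mathbf m}(\Omega)$ is the space of functions whose derivatives $D_s^iD_t^jp$ are continuous for all $0\le i\le m_1$, $0\le j\le m_2$. **Standing assumptions.** (A1) For each cell $R$, $\mathcal P^{n_1}_{u_1,v_1}([a_R,b_R])$ and $\mathcal P^{n_2}_{u_2,v_2}([c_R,d_R])$ have dimensions $n_1$ and $n_2$ and satisfy (C1) and (C2). (A2) For each horizontal edge segment $[a_f,b_f]\times\{c_f\}$, $\dim\mathcal P^{n_1}_{u_1,v_1}([a_f,b_f])=n_1$; for each vertical edge segment $\{a_f\}\times[c_f,d_f]$, $\dim\mathcal P^{n_2}_{u_2,v_2}([c_f,d_f])=n_2$. (A3) For each horizontal composite edge $[a,b]\times\{c\}$, $\mathcal P^{n_1}_{u_1,v_1}([a,b])$ satisfies (C1); for each vertical composite edge $\{a\}\times[c,d]$, $\mathcal P^{n_2}_{u_2,v_2}([c,d])$ satisfies (C1). (A4) There is a positive lower bound, uniform in the points $(s_0,t_0)$ considered, for $|\det A|$, where $A$ is the matrix of the linear system determining the Hermite interpolant $Q_L(f;s_0,t_0)$ below in terms of its coefficients with respect to the products of the functions $\frac{(s-s_0)^i}{i!}$ ($0\le i\le n_1-3$), $u_1,v_1$ with the functions $\frac{(t-t_0)^j}{j!}$ ($0\le j\le n_2-3$), $u_2,v_2$;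 explicitly $|\det A|=|\det D_1|^{n_2}|\det D_2|^{n_1}$ with $\det D_1=u_1^{(n_1-2)}(s_0)v_1^{(n_1-1)}(s_0)-u_1^{(n_1-1)}(s_0)v_1^{(n_1-2)}(s_0)$ and $\det D_2=u_2^{(n_2-2)}(t_0)v_2^{(n_2-1)}(t_0)-u_2^{(n_2-1)}(t_0)v_2^{(n_2-2)}(t_0)$. **Domain points.** For a cell $R$, $\mathcal D_{\mathbf n,R}=\{\xi^R_{ij}\}_{0\le i\le n_1-1,\,0\le j\le n_2-1}$ with $\xi^R_{ij}=\big(\frac{(n_1-1-i)a_R+ib_R}{n_1-1},\frac{(n_2-1-j)c_R+jd_R}{n_2-1}\big)$, and $\mathcal D_{\mathbf n,\Delta}=\bigcup_{R\in\Delta}\mathcal D_{\mathbf n,R}$, where multiple appearances of the same point are allowed (points belonging to different cells are distinct elements). With $B^R_{i,n_1-1}$, $B^R_{j,n_2-1}$ the Bernstein bases of $\mathcal P^{n_1}_{u_1,v_1}([a_R,b_R])$ and $\mathcal P^{n_2}_{u_2,v_2}([c_R,d_R])$, each $p\in\mathcal P^{\mathbf n}_{\mathbf u,\mathbf v}(R)$ is written as $p(s,t)=\sum_{i,j}c^R_{ij}B^R_{i,n_1-1}(s)B^R_{j,n_2-1}(t)$; $\gamma_\xi p:=c_\xi:=c^R_{ij}$ is the B-coefficient of $p$ associated with $\xi=\xi^R_{ij}$ (applied to a spline $p$, it refers to $p|_R$). If $w=(a_R,c_R)$, the disk of size $\mathbf r$ around $w$ is $\mathcal D^R_{\mathbf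 r}(w)=\{\xi^R_{ij}\}_{0\le i\le r_1,0\le j\le r_2}$; disks around the other vertices of $R$ are defined analogously. The points $\xi^R_{ij}$ with $0\le i\le\nu$ are within distance $\nu$ from the edge $\{a_R\}\times[c_R,d_R]$, and analogously for the other edges of $R$. **The set $\mathcal M$.** For each vertex $w$ that is not a T-junction, let $R_w$ be a cell with an edge $e_w$ having one endpoint at $w$ such that any other edge with an endpoint at $w$ has length at most that of $e_w$, and let $\mathcal M_w=\mathcal D^{R_w}_{\mathbf r}(w)$. For each composite edge $e$, with an endpoint $w_1$, let $R_e$ be a cell having $w_1$ as a vertex and having an edge $\langle w_1,w_2\rangle$ lying on $e$; with $r_e=r_1$ if $e$ is vertical and $r_e=r_2$ if $e$ is horizontal, $\mathcal M_e$ is the set of domain points of $\mathcal D_{\mathbf n,R_e}$ within distance $r_e$ from $\langle w_1,w_2\rangle$ and lying outside $\mathcal D^{R_e}_{\mathbf r}(w_1)\cup\mathcal D^{R_e}_{\mathbf r}(w_2)$. For each cell $R$, $\mathcal M_R=\{\xi^R_{ij}\}_{r_1+1\le i\le n_1-r_1-2,\ r_2+1\le j\le n_2-r_2-2}$. $\mathcal M$ is the union of all $\mathcal M_w$, all $\mathcal M_e$ and all $\mathcal M_R$. For $\xi\in\mathcal M$, $\psi_\xi$ is the unique element of $GS^{\mathbf n,\mathbf r}_{\mathbf u,\mathbf v}(\Delta)$ with $\gamma_\eta\psi_\xi=\delta_{\xi,\eta}$ for all $\eta\in\mathcal M$; the $\psi_\xi$ form a basis of the spline space. **The quasi-interpolant.**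 For a cell $R$ and $(s_0,t_0)$ in its interior, $Q_L(f;s_0,t_0)$ is the unique element of $\mathcal P^{\mathbf n}_{\mathbf u,\mathbf v}(R)$ with $D_s^iD_t^jQ_L(f;s_0,t_0)(s_0,t_0)=D_s^iD_t^jf(s_0,t_0)$ for $0\le i\le n_1-1$, $0\le j\le n_2-1$. For $\xi\in\mathcal M$ let $R_\xi$ be the cell containing $\xi$ (with $\xi\in\mathcal D_{\mathbf n,R_\xi}$) and $(s_\xi,t_\xi)$ the center of the biggest circle included in $R_\xi$. Then $Qf=\sum_{\xi\in\mathcal M}\gamma_\xi\big(Q_L(f;s_\xi,t_\xi)\big)\psi_\xi$, with $Q_L(f;s_\xi,t_\xi)$ taken on $R_\xi$. **Mesh quantities.** For a composite edge $e$ consisting of consecutive edge segments $e_1,\dots,e_m$, $\alpha_e=\max\{|e|/|e_1|,|e|/|e_m|\}$. A chain ending at $e$ of length $m$ is a maximal sequence of composite edges $e_1,\dots,e_m$ such that for each $i=1,\dots,m$ one endpoint of $e_i$ lies in the interior of $e_{i+1}$, with $e_{m+1}=e$; $\beta_e$ is the length of the longest chain ending at $e$. $\kappa_R$ is the ratio of the lengths of the longest and shortest edges of $R$. $\alpha_\Delta=\max_e\alpha_e$, $\beta_\Delta=\max_e\beta_e$ (over composite edges), $\kappa_\Delta=\max_{R\in\Delta}\kappa_R$. *)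

theory Defs
  imports
    "HOL-Analysis.Analysis"
    "HOL-Library.Function_Algebras"
    "HOL-Probability.Essential_Supremum"
begin

section \<open>Spaces of functions on a set\<close>

text \<open>
  A function on a set \<open>S\<close> is represented by the total function that vanishes outside \<open>S\<close>, so that
  spans, dimensions and definite descriptions refer to functions on \<open>S\<close> only.
\<close>

definition zext :: "'a set \<Rightarrow> ('a \<Rightarrow> real) \<Rightarrow> 'a \<Rightarrow> real" where
  "zext S f = (\<lambda>x. if x \<in> S then f x else 0)"

global_interpretation fun_space: vector_space "\<lambda>(c::real) (f::'a \<Rightarrow> real) x. c * f x"
  by unfold_locales (auto simp: fun_eq_iff algebra_simps)

section \<open>Univariate spaces\<close>

text \<open>Derivatives are taken within \<open>S\<close>, hence one-sided at the endpoints of an interval.\<close>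

definition nder :: "real set \<Rightarrow> nat \<Rightarrow> (real \<Rightarrow> real) \<Rightarrow> real \<Rightarrow> real" where
  "nder S k = (\<lambda>g x. vector_derivative g (at x within S)) ^^ k"

definition Ck_on :: "nat \<Rightarrow> real set \<Rightarrow> (real \<Rightarrow> real) \<Rightarrow> bool" where
  "Ck_on k S g \<longleftrightarrow>
     (\<forall>i<k. \<forall>x\<in>S. nder S i g differentiable (at x within S)) \<and>
     (\<forall>i\<le>k. continuous_on S (nder S i g))"

definition gspace :: "nat \<Rightarrow> (real \<Rightarrow> real) \<Rightarrow> (real \<Rightarrow> real) \<Rightarrow> real \<Rightarrow> real \<Rightarrow> (real \<Rightarrow> real) set" where
  "gspace n u v a b = fun_space.span
     ((\<lambda>i. zext {a..b} (\<lambda>s. s ^ i)) ` {..n - 3} \<union> {zext {a..b} u, zext {a..b} v})"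

definition cond_C1 :: "nat \<Rightarrow> (real \<Rightarrow> real) \<Rightarrow> (real \<Rightarrow> real) \<Rightarrow> real \<Rightarrow> real \<Rightarrow> bool" where
  "cond_C1 n u v a b \<longleftrightarrow>
     (\<forall>\<psi>\<in>gspace n u v a b.
        (\<exists>s1\<in>{a..b}. \<exists>s2\<in>{a..b}. s1 \<noteq> s2 \<and>
           nder {a..b} (n - 2) \<psi> s1 = 0 \<and> nder {a..b} (n - 2) \<psi> s2 = 0) \<longrightarrow>
        (\<forall>s\<in>{a..b}. nder {a..b} (n - 2) \<psi> s = 0))"

definition cond_C2 :: "nat \<Rightarrow> (real \<Rightarrow> real) \<Rightarrow> (real \<Rightarrow> real) \<Rightarrow> real \<Rightarrow> real \<Rightarrow> bool" where
  "cond_C2 n u v a b \<longleftrightarrow>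
     (\<forall>\<psi>\<in>gspace n u v a b.
        (\<exists>s1\<in>{a<..<b}.
           nder {a..b} (n - 2) \<psi> s1 = 0 \<and> nder {a..b} (n - 1) \<psi> s1 = 0) \<longrightarrow>
        (\<forall>s\<in>{a..b}. nder {a..b} (n - 2) \<psi> s = 0))"

text \<open>\<open>bern_U n u v a b k i\<close> is \<open>U\<^bsub>i,k,n-1\<^esub>\<close>; only its values on \<open>[a,b]\<close> are meaningful.\<close>

definition bern_V :: "real \<Rightarrow> real \<Rightarrow> (real \<Rightarrow> real) \<Rightarrow> real \<Rightarrow> real" where
  "bern_V a b g s = integral {a..s} g / integral {a..b} g"

definition bern_start ::
  "nat \<Rightarrow> (real \<Rightarrow> real) \<Rightarrow> (real \<Rightarrow> real) \<Rightarrow> real \<Rightarrow> real \<Rightarrow> real \<Rightarrow> real \<Rightarrow> real \<Rightarrow> real" where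
  "bern_start n u v a b ya yb =
     (THE g. g \<in> fun_space.span {zext {a..b} (nder {a..b} (n - 2) u),
                                 zext {a..b} (nder {a..b} (n - 2) v)} \<and>
             g a = ya \<and> g b = yb)"

fun bern_U ::
  "nat \<Rightarrow> (real \<Rightarrow> real) \<Rightarrow> (real \<Rightarrow> real) \<Rightarrow> real \<Rightarrow> real \<Rightarrow> nat \<Rightarrow> nat \<Rightarrow> real \<Rightarrow> real" where
  "bern_U n u v a b 0 i = (\<lambda>s. 0)"
| "bern_U n u v a b (Suc 0) i =
     (if i = 0 then bern_start n u v a b 1 0 else bern_start n u v a b 0 1)"
| "bern_U n u v a b (Suc (Suc k)) i =
     (\<lambda>s. if i = 0 then 1 - bern_V a b (bern_U n u v a b (Suc k) 0) s
          else if i \<le> Suc k then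
            bern_V a b (bern_U n u v a b (Suc k) (i - 1)) s - bern_V a b (bern_U n u v a b (Suc k) i) s
          else bern_V a b (bern_U n u v a b (Suc k) (i - 1)) s)"

definition bern :: "nat \<Rightarrow> (real \<Rightarrow> real) \<Rightarrow> (real \<Rightarrow> real) \<Rightarrow> real \<Rightarrow> real \<Rightarrow> nat \<Rightarrow> real \<Rightarrow> real" where
  "bern n u v a b i = bern_U n u v a b (n - 1) i"

section \<open>T-meshes\<close>

datatype cell = Cell (xl: real) (xr: real) (yl: real) (yr: real)

type_synonym pt = "real \<times> real"

text \<open>An axis-aligned segment is its pair of endpoints, left to right or bottom to top.\<close>

type_synonym seg = "pt \<times> pt"

definition horizontal :: "seg \<Rightarrow> bool" where
  "horizontal e \<longleftrightarrow> snd (fst e) = snd (snd e) \<and> fst (fst e) < fst (snd e)"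

definition vertical :: "seg \<Rightarrow> bool" where
  "vertical e \<longleftrightarrow> fst (fst e) = fst (snd e) \<and> snd (fst e) < snd (snd e)"

definition seg_pts :: "seg \<Rightarrow> pt set" where
  "seg_pts e = closed_segment (fst e) (snd e)"

definition seg_int :: "seg \<Rightarrow> pt set" where
  "seg_int e = open_segment (fst e) (snd e)"

definition seg_ends :: "seg \<Rightarrow> pt set" where
  "seg_ends e = {fst e, snd e}"

definition seg_len :: "seg \<Rightarrow> real" where
  "seg_len e = dist (fst e) (snd e)"

definition region :: "cell \<Rightarrow> pt set" where
  "region R = {xl R..xr R} \<times> {yl R..yr R}"

definition left_edge :: "cell \<Rightarrow> seg" where
  "left_edge R = ((xl R, yl R), (xl R, yr R))"

definition right_edge :: "cell \<Rightarrow> seg" where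
  "right_edge R = ((xr R, yl R), (xr R, yr R))"

definition bottom_edge :: "cell \<Rightarrow> seg" where
  "bottom_edge R = ((xl R, yl R), (xr R, yl R))"

definition top_edge :: "cell \<Rightarrow> seg" where
  "top_edge R = ((xl R, yr R), (xr R, yr R))"

definition cell_edges :: "cell \<Rightarrow> seg set" where
  "cell_edges R = {left_edge R, right_edge R, bottom_edge R, top_edge R}"

definition cell_verts :: "cell \<Rightarrow> pt set" where
  "cell_verts R = {xl R, xr R} \<times> {yl R, yr R}"

definition cell_boundary :: "cell \<Rightarrow> pt set" where
  "cell_boundary R = (\<Union>e\<in>cell_edges R. seg_pts e)"

definition mesh_domain :: "cell set \<Rightarrow> pt set" where
  "mesh_domain \<Delta> = (\<Union>R\<in>\<Delta>. region R)"

definition T_mesh :: "cell set \<Rightarrow> bool" where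
  "T_mesh \<Delta> \<longleftrightarrow>
     finite \<Delta> \<and> \<Delta> \<noteq> {} \<and>
     (\<forall>R\<in>\<Delta>. xl R < xr R \<and> yl R < yr R) \<and>
     connected (mesh_domain \<Delta>) \<and>
     (\<forall>R\<in>\<Delta>. \<forall>R'\<in>\<Delta>. R \<noteq> R' \<longrightarrow>
        region R \<inter> region R' \<subseteq> cell_boundary R \<inter> cell_boundary R')"

definition verts :: "cell set \<Rightarrow> pt set" where
  "verts \<Delta> = (\<Union>R\<in>\<Delta>. cell_verts R)"

definition T_junction :: "cell set \<Rightarrow> pt \<Rightarrow> bool" where
  "T_junction \<Delta> w \<longleftrightarrow>
     (\<exists>R\<in>\<Delta>. \<exists>R'\<in>\<Delta>. R \<noteq> R' \<and> w \<in> cell_verts R \<and> (\<exists>e\<in>cell_edges R'. w \<in> seg_int e))"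

definition mesh_segment :: "cell set \<Rightarrow> seg \<Rightarrow> bool" where
  "mesh_segment \<Delta> e \<longleftrightarrow>
     (horizontal e \<or> vertical e) \<and> seg_ends e \<subseteq> verts \<Delta> \<and>
     seg_pts e \<subseteq> (\<Union>R\<in>\<Delta>. cell_boundary R)"

definition edge_segment :: "cell set \<Rightarrow> seg \<Rightarrow> bool" where
  "edge_segment \<Delta> e \<longleftrightarrow> mesh_segment \<Delta> e \<and> seg_int e \<inter> verts \<Delta> = {}"

definition T_segment :: "cell set \<Rightarrow> seg \<Rightarrow> bool" where
  "T_segment \<Delta> e \<longleftrightarrow> mesh_segment \<Delta> e \<and> (\<forall>w\<in>seg_int e \<inter> verts \<Delta>. T_junction \<Delta> w)"

definition composite_edge :: "cell set \<Rightarrow> seg \<Rightarrow> bool" where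
  "composite_edge \<Delta> e \<longleftrightarrow>
     T_segment \<Delta> e \<and> \<not> (\<exists>e'. T_segment \<Delta> e' \<and> seg_pts e \<subset> seg_pts e')"

definition regular_mesh :: "cell set \<Rightarrow> bool" where
  "regular_mesh \<Delta> \<longleftrightarrow>
     (\<forall>w\<in>verts \<Delta>. connected (interior (\<Union>{region R | R. R \<in> \<Delta> \<and> w \<in> region R})))"

definition T_cycle :: "cell set \<Rightarrow> pt list \<Rightarrow> bool" where
  "T_cycle \<Delta> ws \<longleftrightarrow>
     ws \<noteq> [] \<and> (\<forall>w\<in>set ws. T_junction \<Delta> w) \<and>
     (\<forall>i<length ws. \<exists>e. composite_edge \<Delta> e \<and> ws ! i \<in> seg_int e \<and>
        ws ! (Suc i mod length ws) \<in> seg_ends e)"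

subsection \<open>Mesh quantities\<close>

text \<open>The edge segments on \<open>e\<close> having a common endpoint with \<open>e\<close> are the first and the last one.\<close>

definition alpha_edge :: "cell set \<Rightarrow> seg \<Rightarrow> real" where
  "alpha_edge \<Delta> e =
     Max {seg_len e / seg_len g | g.
       edge_segment \<Delta> g \<and> seg_pts g \<subseteq> seg_pts e \<and> seg_ends g \<inter> seg_ends e \<noteq> {}}"

definition alpha_mesh :: "cell set \<Rightarrow> real" where
  "alpha_mesh \<Delta> = Max (alpha_edge \<Delta> ` {e. composite_edge \<Delta> e})"

definition edge_chain :: "cell set \<Rightarrow> seg list \<Rightarrow> seg \<Rightarrow> bool" where
  "edge_chain \<Delta> es e \<longleftrightarrow>
     (\<forall>g\<in>set es. composite_edge \<Delta> g) \<and>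
     (\<forall>i<length es. \<exists>w\<in>seg_ends (es ! i). w \<in> seg_int ((es @ [e]) ! Suc i))"

definition max_edge_chain :: "cell set \<Rightarrow> seg list \<Rightarrow> seg \<Rightarrow> bool" where
  "max_edge_chain \<Delta> es e \<longleftrightarrow> edge_chain \<Delta> es e \<and> \<not> (\<exists>g. edge_chain \<Delta> (g # es) e)"

definition beta_edge :: "cell set \<Rightarrow> seg \<Rightarrow> nat" where
  "beta_edge \<Delta> e = Max (length ` {es. max_edge_chain \<Delta> es e})"

definition beta_mesh :: "cell set \<Rightarrow> nat" where
  "beta_mesh \<Delta> = Max (beta_edge \<Delta> ` {e. composite_edge \<Delta> e})"

definition kappa_cell :: "cell \<Rightarrow> real" where
  "kappa_cell R = Max (seg_len ` cell_edges R) / Min (seg_len ` cell_edges R)"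

definition kappa_mesh :: "cell set \<Rightarrow> real" where
  "kappa_mesh \<Delta> = Max (kappa_cell ` \<Delta>)"

definition mesh_size :: "cell set \<Rightarrow> real" where
  "mesh_size \<Delta> = Max ((\<lambda>R. diameter (region R)) ` \<Delta>)"

section \<open>Generalized spline spaces\<close>

text \<open>
  Partial derivatives within the slices of \<open>S\<close>, hence one-sided at the boundary where necessary.
  The slices of the domain of a T-mesh are finite unions of nondegenerate intervals.
\<close>

definition Ds :: "pt set \<Rightarrow> (pt \<Rightarrow> real) \<Rightarrow> pt \<Rightarrow> real" where
  "Ds S p = (\<lambda>(s, t). vector_derivative (\<lambda>x. p (x, t)) (at s within {x. (x, t) \<in> S}))"

definition Dt :: "pt set \<Rightarrow> (pt \<Rightarrow> real) \<Rightarrow> pt \<Rightarrow> real" where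
  "Dt S p = (\<lambda>(s, t). vector_derivative (\<lambda>y. p (s, y)) (at t within {y. (s, y) \<in> S}))"

definition Dst :: "pt set \<Rightarrow> nat \<Rightarrow> nat \<Rightarrow> (pt \<Rightarrow> real) \<Rightarrow> pt \<Rightarrow> real" where
  "Dst S i j p = (Ds S ^^ i) ((Dt S ^^ j) p)"

definition Cmm_on :: "nat \<Rightarrow> nat \<Rightarrow> pt set \<Rightarrow> (pt \<Rightarrow> real) \<Rightarrow> bool" where
  "Cmm_on m1 m2 S p \<longleftrightarrow>
     (\<forall>j<m2. \<forall>(s, t)\<in>S.
        (\<lambda>y. Dst S 0 j p (s, y)) differentiable (at t within {y. (s, y) \<in> S})) \<and>
     (\<forall>i<m1. \<forall>j\<le>m2. \<forall>(s, t)\<in>S.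
        (\<lambda>x. Dst S i j p (x, t)) differentiable (at s within {x. (x, t) \<in> S})) \<and>
     (\<forall>i\<le>m1. \<forall>j\<le>m2. continuous_on S (Dst S i j p))"

definition tspace ::
  "nat \<Rightarrow> nat \<Rightarrow> (real \<Rightarrow> real) \<Rightarrow> (real \<Rightarrow> real) \<Rightarrow> (real \<Rightarrow> real) \<Rightarrow> (real \<Rightarrow> real) \<Rightarrow>
   cell \<Rightarrow> (pt \<Rightarrow> real) set" where
  "tspace n1 n2 u1 v1 u2 v2 R = fun_space.span
     {(\<lambda>(s, t). g1 s * g2 t) | g1 g2.
        g1 \<in> gspace n1 u1 v1 (xl R) (xr R) \<and> g2 \<in> gspace n2 u2 v2 (yl R) (yr R)}"

definition GS ::
  "nat \<Rightarrow> nat \<Rightarrow> nat \<Rightarrow> nat \<Rightarrow> (real \<Rightarrow> real) \<Rightarrow> (real \<Rightarrow> real) \<Rightarrow> (real \<Rightarrow> real) \<Rightarrow> (real \<Rightarrow> real) \<Rightarrow>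
   cell set \<Rightarrow> (pt \<Rightarrow> real) set" where
  "GS n1 n2 r1 r2 u1 v1 u2 v2 \<Delta> =
     {p. (\<forall>x. x \<notin> mesh_domain \<Delta> \<longrightarrow> p x = 0) \<and>
         Cmm_on r1 r2 (mesh_domain \<Delta>) p \<and>
         (\<forall>R\<in>\<Delta>. zext (region R) p \<in> tspace n1 n2 u1 v1 u2 v2 R)}"

subsection \<open>Standing assumptions\<close>

definition fun_regularity ::
  "nat \<Rightarrow> nat \<Rightarrow> (real \<Rightarrow> real) \<Rightarrow> (real \<Rightarrow> real) \<Rightarrow> (real \<Rightarrow> real) \<Rightarrow> (real \<Rightarrow> real) \<Rightarrow>
   cell set \<Rightarrow> bool" where
  "fun_regularity n1 n2 u1 v1 u2 v2 \<Delta> \<longleftrightarrow>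
     (\<forall>R\<in>\<Delta>. Ck_on n1 {xl R..xr R} u1 \<and> Ck_on n1 {xl R..xr R} v1 \<and>
             Ck_on n2 {yl R..yr R} u2 \<and> Ck_on n2 {yl R..yr R} v2)"

definition assumption_A1 ::
  "nat \<Rightarrow> nat \<Rightarrow> (real \<Rightarrow> real) \<Rightarrow> (real \<Rightarrow> real) \<Rightarrow> (real \<Rightarrow> real) \<Rightarrow> (real \<Rightarrow> real) \<Rightarrow>
   cell set \<Rightarrow> bool" where
  "assumption_A1 n1 n2 u1 v1 u2 v2 \<Delta> \<longleftrightarrow>
     (\<forall>R\<in>\<Delta>.
        fun_space.dim (gspace n1 u1 v1 (xl R) (xr R)) = n1 \<and>
        fun_space.dim (gspace n2 u2 v2 (yl R) (yr R)) = n2 \<and>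
        cond_C1 n1 u1 v1 (xl R) (xr R) \<and> cond_C2 n1 u1 v1 (xl R) (xr R) \<and>
        cond_C1 n2 u2 v2 (yl R) (yr R) \<and> cond_C2 n2 u2 v2 (yl R) (yr R))"

definition assumption_A2 ::
  "nat \<Rightarrow> nat \<Rightarrow> (real \<Rightarrow> real) \<Rightarrow> (real \<Rightarrow> real) \<Rightarrow> (real \<Rightarrow> real) \<Rightarrow> (real \<Rightarrow> real) \<Rightarrow>
   cell set \<Rightarrow> bool" where
  "assumption_A2 n1 n2 u1 v1 u2 v2 \<Delta> \<longleftrightarrow>
     (\<forall>e. edge_segment \<Delta> e \<longrightarrow>
        (horizontal e \<longrightarrow> fun_space.dim (gspace n1 u1 v1 (fst (fst e)) (fst (snd e))) = n1) \<and>
        (vertical e \<longrightarrow> fun_space.dim (gspace n2 u2 v2 (snd (fst e)) (snd (snd e))) = n2))"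

definition assumption_A3 ::
  "nat \<Rightarrow> nat \<Rightarrow> (real \<Rightarrow> real) \<Rightarrow> (real \<Rightarrow> real) \<Rightarrow> (real \<Rightarrow> real) \<Rightarrow> (real \<Rightarrow> real) \<Rightarrow>
   cell set \<Rightarrow> bool" where
  "assumption_A3 n1 n2 u1 v1 u2 v2 \<Delta> \<longleftrightarrow>
     (\<forall>e. composite_edge \<Delta> e \<longrightarrow>
        (horizontal e \<longrightarrow> cond_C1 n1 u1 v1 (fst (fst e)) (fst (snd e))) \<and>
        (vertical e \<longrightarrow> cond_C1 n2 u2 v2 (snd (fst e)) (snd (snd e))))"

definition det_D ::
  "nat \<Rightarrow> (real \<Rightarrow> real) \<Rightarrow> (real \<Rightarrow> real) \<Rightarrow> real set \<Rightarrow> real \<Rightarrow> real" where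
  "det_D n u v S x =
     nder S (n - 2) u x * nder S (n - 1) v x - nder S (n - 1) u x * nder S (n - 2) v x"

text \<open>
  The bounded quantity is the modulus of the determinant of the Hermite system at the point
  \<open>cen R\<close>: the system matrix is, up to permutations, a Kronecker product of two block
  triangular matrices with diagonal blocks an identity matrix and \<open>D\<^sub>1\<close>, respectively \<open>D\<^sub>2\<close>.
\<close>

definition assumption_A4 ::
  "nat \<Rightarrow> nat \<Rightarrow> (real \<Rightarrow> real) \<Rightarrow> (real \<Rightarrow> real) \<Rightarrow> (real \<Rightarrow> real) \<Rightarrow> (real \<Rightarrow> real) \<Rightarrow>
   real \<Rightarrow> (cell \<Rightarrow> pt) \<Rightarrow> cell set \<Rightarrow> bool" where
  "assumption_A4 n1 n2 u1 v1 u2 v2 \<delta> cen \<Delta> \<longleftrightarrow>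
     (\<forall>R\<in>\<Delta>. \<delta> \<le> \<bar>det_D n1 u1 v1 {xl R..xr R} (fst (cen R))\<bar> ^ n2 *
                \<bar>det_D n2 u2 v2 {yl R..yr R} (snd (cen R))\<bar> ^ n1)"

subsection \<open>Domain points and the set \<open>M\<close>\<close>

text \<open>
  The domain point with indices \<open>i\<close>, \<open>j\<close> of the cell \<open>R\<close> is represented by \<open>(R, i, j)\<close>; points of
  different cells are thereby distinct, and its coordinates are never used.
\<close>

type_synonym dpt = "cell \<times> nat \<times> nat"

definition dpts :: "nat \<Rightarrow> nat \<Rightarrow> cell \<Rightarrow> dpt set" where
  "dpts n1 n2 R = {(R, i, j) | i j. i \<le> n1 - 1 \<and> j \<le> n2 - 1}"

definition disk :: "nat \<Rightarrow> nat \<Rightarrow> nat \<Rightarrow> nat \<Rightarrow> cell \<Rightarrow> pt \<Rightarrow> dpt set" where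
  "disk n1 n2 r1 r2 R w =
     {(R, i, j) | i j. (R, i, j) \<in> dpts n1 n2 R \<and>
        (fst w = xl R \<and> i \<le> r1 \<or> fst w = xr R \<and> n1 - 1 - i \<le> r1) \<and>
        (snd w = yl R \<and> j \<le> r2 \<or> snd w = yr R \<and> n2 - 1 - j \<le> r2)}"

definition near_edge :: "nat \<Rightarrow> nat \<Rightarrow> nat \<Rightarrow> cell \<Rightarrow> seg \<Rightarrow> dpt set" where
  "near_edge n1 n2 \<nu> R g =
     {(R, i, j) | i j. (R, i, j) \<in> dpts n1 n2 R \<and>
        (g = left_edge R \<and> i \<le> \<nu> \<or> g = right_edge R \<and> n1 - 1 - i \<le> \<nu> \<or>
         g = bottom_edge R \<and> j \<le> \<nu> \<or> g = top_edge R \<and> n2 - 1 - j \<le> \<nu>)}"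

text \<open>
  The choices made in the construction of \<open>M\<close>: \<open>cw\<close> assigns to a vertex \<open>w\<close> the cell \<open>R\<^sub>w\<close>, and
  \<open>ce\<close> assigns to a composite edge \<open>e\<close> the cell \<open>R\<^sub>e\<close> together with its edge \<open>\<langle>w\<^sub>1,w\<^sub>2\<rangle>\<close>.
\<close>

definition M_choice :: "cell set \<Rightarrow> (pt \<Rightarrow> cell) \<Rightarrow> (seg \<Rightarrow> cell \<times> seg) \<Rightarrow> bool" where
  "M_choice \<Delta> cw ce \<longleftrightarrow>
     (\<forall>w\<in>verts \<Delta>. \<not> T_junction \<Delta> w \<longrightarrow>
        cw w \<in> \<Delta> \<and>
        (\<exists>ew\<in>cell_edges (cw w). w \<in> seg_ends ew \<and>
           (\<forall>R\<in>\<Delta>. \<forall>g\<in>cell_edges R. w \<in> seg_ends g \<longrightarrow> seg_len g \<le> seg_len ew))) \<and>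
     (\<forall>e. composite_edge \<Delta> e \<longrightarrow>
        (\<exists>w1\<in>seg_ends e. fst (ce e) \<in> \<Delta> \<and> snd (ce e) \<in> cell_edges (fst (ce e)) \<and>
           w1 \<in> seg_ends (snd (ce e)) \<and> seg_pts (snd (ce e)) \<subseteq> seg_pts e))"

definition M_vertex ::
  "nat \<Rightarrow> nat \<Rightarrow> nat \<Rightarrow> nat \<Rightarrow> (pt \<Rightarrow> cell) \<Rightarrow> pt \<Rightarrow> dpt set" where
  "M_vertex n1 n2 r1 r2 cw w = disk n1 n2 r1 r2 (cw w) w"

definition M_edge ::
  "nat \<Rightarrow> nat \<Rightarrow> nat \<Rightarrow> nat \<Rightarrow> (seg \<Rightarrow> cell \<times> seg) \<Rightarrow> seg \<Rightarrow> dpt set" where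
  "M_edge n1 n2 r1 r2 ce e =
     (let R = fst (ce e); g = snd (ce e) in
        near_edge n1 n2 (if vertical e then r1 else r2) R g -
        (disk n1 n2 r1 r2 R (fst g) \<union> disk n1 n2 r1 r2 R (snd g)))"

definition M_cell :: "nat \<Rightarrow> nat \<Rightarrow> nat \<Rightarrow> nat \<Rightarrow> cell \<Rightarrow> dpt set" where
  "M_cell n1 n2 r1 r2 R =
     {(R, i, j) | i j. r1 + 1 \<le> i \<and> i + r1 + 2 \<le> n1 \<and> r2 + 1 \<le> j \<and> j + r2 + 2 \<le> n2}"

definition M_set ::
  "nat \<Rightarrow> nat \<Rightarrow> nat \<Rightarrow> nat \<Rightarrow> cell set \<Rightarrow> (pt \<Rightarrow> cell) \<Rightarrow> (seg \<Rightarrow> cell \<times> seg) \<Rightarrow> dpt set" where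
  "M_set n1 n2 r1 r2 \<Delta> cw ce =
     (\<Union>w\<in>{w \<in> verts \<Delta>. \<not> T_junction \<Delta> w}. M_vertex n1 n2 r1 r2 cw w) \<union>
     (\<Union>e\<in>{e. composite_edge \<Delta> e}. M_edge n1 n2 r1 r2 ce e) \<union>
     (\<Union>R\<in>\<Delta>. M_cell n1 n2 r1 r2 R)"

definition B_coeff ::
  "nat \<Rightarrow> nat \<Rightarrow> (real \<Rightarrow> real) \<Rightarrow> (real \<Rightarrow> real) \<Rightarrow> (real \<Rightarrow> real) \<Rightarrow> (real \<Rightarrow> real) \<Rightarrow>
   dpt \<Rightarrow> (pt \<Rightarrow> real) \<Rightarrow> real" where
  "B_coeff n1 n2 u1 v1 u2 v2 = (\<lambda>(R, i, j) p.
     (THE x. \<exists>c.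
        (\<forall>s\<in>{xl R..xr R}. \<forall>t\<in>{yl R..yr R}.
           p (s, t) = (\<Sum>k\<le>n1 - 1. \<Sum>l\<le>n2 - 1.
             c k l * bern n1 u1 v1 (xl R) (xr R) k s * bern n2 u2 v2 (yl R) (yr R) l t)) \<and>
        x = c i j))"

definition dual_spline ::
  "nat \<Rightarrow> nat \<Rightarrow> nat \<Rightarrow> nat \<Rightarrow> (real \<Rightarrow> real) \<Rightarrow> (real \<Rightarrow> real) \<Rightarrow> (real \<Rightarrow> real) \<Rightarrow> (real \<Rightarrow> real) \<Rightarrow>
   cell set \<Rightarrow> dpt set \<Rightarrow> dpt \<Rightarrow> pt \<Rightarrow> real" where
  "dual_spline n1 n2 r1 r2 u1 v1 u2 v2 \<Delta> M \<xi> =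
     (THE p. p \<in> GS n1 n2 r1 r2 u1 v1 u2 v2 \<Delta> \<and>
        (\<forall>\<eta>\<in>M. B_coeff n1 n2 u1 v1 u2 v2 \<eta> p = (if \<xi> = \<eta> then 1 else 0)))"

section \<open>The quasi-interpolant\<close>

definition hermite ::
  "nat \<Rightarrow> nat \<Rightarrow> (real \<Rightarrow> real) \<Rightarrow> (real \<Rightarrow> real) \<Rightarrow> (real \<Rightarrow> real) \<Rightarrow> (real \<Rightarrow> real) \<Rightarrow>
   cell \<Rightarrow> pt \<Rightarrow> (pt \<Rightarrow> real) \<Rightarrow> pt \<Rightarrow> real" where
  "hermite n1 n2 u1 v1 u2 v2 R z f =
     (THE p. p \<in> tspace n1 n2 u1 v1 u2 v2 R \<and>
        (\<forall>i\<le>n1 - 1. \<forall>j\<le>n2 - 1. Dst (region R) i j p z = Dst (region R) i j f z))"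

text \<open>The center of a biggest circle in a rectangle that is not a square is not unique.\<close>

definition circle_center :: "cell \<Rightarrow> pt \<Rightarrow> bool" where
  "circle_center R z \<longleftrightarrow>
     (\<exists>\<rho>. cball z \<rho> \<subseteq> region R \<and> (\<forall>z' \<rho>'. cball z' \<rho>' \<subseteq> region R \<longrightarrow> \<rho>' \<le> \<rho>))"

definition quasi_interp ::
  "nat \<Rightarrow> nat \<Rightarrow> nat \<Rightarrow> nat \<Rightarrow> (real \<Rightarrow> real) \<Rightarrow> (real \<Rightarrow> real) \<Rightarrow> (real \<Rightarrow> real) \<Rightarrow> (real \<Rightarrow> real) \<Rightarrow>
   cell set \<Rightarrow> dpt set \<Rightarrow> (cell \<Rightarrow> pt) \<Rightarrow> (pt \<Rightarrow> real) \<Rightarrow> pt \<Rightarrow> real" where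
  "quasi_interp n1 n2 r1 r2 u1 v1 u2 v2 \<Delta> M cen f = (\<lambda>x.
     \<Sum>\<xi>\<in>M. B_coeff n1 n2 u1 v1 u2 v2 \<xi>
              (hermite n1 n2 u1 v1 u2 v2 (fst \<xi>) (cen (fst \<xi>)) f) *
            dual_spline n1 n2 r1 r2 u1 v1 u2 v2 \<Delta> M \<xi> x)"

definition Lq_norm :: "ereal \<Rightarrow> pt set \<Rightarrow> (pt \<Rightarrow> real) \<Rightarrow> ennreal" where
  "Lq_norm q S g =
     (if q = \<infinity> then esssup (lebesgue_on S) (\<lambda>x. ennreal \<bar>g x\<bar>)
      else let I = (\<integral>\<^sup>+x. ennreal (\<bar>g x\<bar> powr real_of_ereal q) \<partial>lebesgue_on S)
           in if I = \<infinity> then \<infinity> else ennreal (enn2real I powr (1 / real_of_ereal q)))"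

end

theory Submission imports Defs
begin

text \<open>
  The quasi-interpolant \<open>Qf\<close> is the spline whose Bernstein coefficients on \<open>M\<close> are those of the local
  Hermite interpolants \<open>q R\<close> (\<open>quasi_GS\<close>). On a cell \<open>R\<close> the error is \<open>(f - q R) + (q R - Qf)\<close>. The first
  summand is of the right order by Taylor's formula (\<open>hermite_error\<close>). The second one is a stability
  question: splines must depend on their coefficients on \<open>M\<close> with constants that involve the mesh only
  through \<open>\<alpha>\<close>, \<open>\<beta>\<close> and \<open>\<kappa>\<close>.

  The univariate reason for stability is that everything happens on short intervals. The lower bound
  of \<open>assumption_A4\<close> at the center of a cell spreads to the whole cell, because the determinant is Lipschitz
  (\<open>good_near\<close>). On a short interval on which the determinant is bounded away from zero, the
  first two functions in the construction of the Bernstein basis are close to the two linear hat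
  functions, and every integration step keeps the basis close to the Bernstein
  polynomials (\<open>bern_U_bounds\<close>). So the triangular matrices that relate Bernstein coefficients to
  derivatives at an end of the interval, scaled by powers of its length, are uniformly invertible
  (\<open>comb_coef_bound\<close>), and so are two-point Hermite problems (\<open>hermite_est\<close>).

  The first and the last \<open>r + 1\<close> coefficients may thus be replaced by scaled derivatives at the two
  ends. As \<open>M\<close> is a union of blocks of indices, prescribing coefficients on \<open>M\<close> means prescribing (\<open>Mset_iff\<close>):
  the jets at the vertices that are not T-junctions; for every composite edge, middle
  functionals on its first or last cell edge; for every cell, the middle block.

  Along a composite edge every normal derivative of order at most \<open>r\<close> of a spline is a single
  element of the univariate space (\<open>trace_E\<close>). It is determined, stably, by its jets of order \<open>r\<close> at the
  two ends and the middle functionals (\<open>edge_est\<close>). An end that is not a T-junction carries data of \<open>M\<close>; an end that is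
  one lies in the interior of a perpendicular composite edge, where the same derivatives are
  derivatives of the traces on that edge. Since there are no cycles, this recursion stops, and its depth is
  bounded by \<open>\<beta>\<close> (\<open>path_beta\<close>); each step costs a factor depending on \<open>\<alpha>\<close> and \<open>\<kappa>\<close>, which
  compare the lengths of the edges involved (\<open>edge_step\<close>, \<open>edge_all\<close>). The traces on the sides of a cell and
  the middle block bound the function on the cell (\<open>tensor_est\<close>).

  The same recursion, run with prescribed data, constructs splines
  (\<open>traces_exist\<close>, \<open>cells_agree\<close>, \<open>ex_spline\<close>). Hence the dual splines exist, and they are unique by the
  stability estimate for vanishing data (\<open>GS_zero\<close>). The constants do not depend on the mesh,
  since bounds for the derivatives of the functions \<open>u\<close> and \<open>v\<close> on the cells of one mesh are valid for all meshes with the same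
  domain (\<open>piecewise_Ck_bound_transfer\<close>). Finally, cells of diameter at most one have measure at most
  one, so a pointwise bound is a bound for all the norms (\<open>Lq_norm_le\<close>).
\<close>

section \<open>Iterated one-sided derivatives\<close>

lemma nder_0 [simp]: "nder S 0 g = g"
  by (simp add: nder_def)

lemma nder_Suc: "nder S (Suc k) g = (\<lambda>x. vector_derivative (nder S k g) (at x within S))"
  by (simp add: nder_def)

lemma nder_Suc2: "nder S (Suc k) g = nder S k (nder S 1 g)"
  unfolding nder_def funpow_Suc_right by simp

lemma nder_local:
  assumes "open U" "S \<inter> U = T \<inter> U" "\<And>y. y \<in> S \<inter> U \<Longrightarrow> f y = g y" "x \<in> S \<inter> U"
  shows "nder S i f x = nder T i g x"
  using assms(4)
proof (induction i arbitrary: x)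
  case 0
  then show ?case using assms(3) by simp
next
  case (Suc i)
  have eq: "at x within S = at x within T"
    by (rule at_within_nhd[of x U]) (use Suc.prems assms(1,2) in auto)
  have "eventually (\<lambda>y. y \<in> U) (nhds x)"
    using Suc.prems assms(1) by (intro eventually_nhds_in_open) auto
  then have "eventually (\<lambda>y. y \<in> S \<longrightarrow> nder S i f y = nder T i g y) (nhds x)"
    by eventually_elim (use Suc.IH in auto)
  then have "vector_derivative (nder S i f) (at x within S)
      = vector_derivative (nder T i g) (at x within S)"
    by (rule vector_derivative_cong_eq) (use Suc.prems in auto)
  then show ?case by (simp add: nder_Suc eq)
qed

lemma nder_cong: "(\<And>y. y \<in> S \<Longrightarrow> f y = g y) \<Longrightarrow> x \<in> S \<Longrightarrow> nder S i f x = nder S i g x"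
  by (rule nder_local[of UNIV]) auto

lemma Ck_on_deriv:
  assumes "Ck_on k S g" "i < k" "x \<in> S"
  shows "(nder S i g has_real_derivative nder S (Suc i) g x) (at x within S)"
  using assms unfolding Ck_on_def nder_Suc has_real_derivative_iff_has_vector_derivative
  by (auto simp: vector_derivative_works[symmetric])

lemma Ck_on_cont: "Ck_on k S g \<Longrightarrow> i \<le> k \<Longrightarrow> continuous_on S (nder S i g)"
  by (simp add: Ck_on_def)

lemma Ck_on_mono: "Ck_on k S g \<Longrightarrow> j \<le> k \<Longrightarrow> Ck_on j S g"
  by (simp add: Ck_on_def)

text \<open>Derivatives are recognised by exhibiting the whole family of them; this is how every
  function of the proof is differentiated.\<close>

lemma nder_family:
  assumes nt: "\<And>x. x \<in> S \<Longrightarrow> at x within S \<noteq> bot"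
    and G0: "\<And>x. x \<in> S \<Longrightarrow> g x = G 0 x"
    and GS: "\<And>i x. i < k \<Longrightarrow> x \<in> S \<Longrightarrow> (G i has_real_derivative G (Suc i) x) (at x within S)"
  shows "i \<le> k \<Longrightarrow> x \<in> S \<Longrightarrow> nder S i g x = G i x"
proof (induction i arbitrary: x)
  case 0
  then show ?case using G0 by simp
next
  case (Suc i)
  have "eventually (\<lambda>y. y \<in> S \<longrightarrow> nder S i g y = G i y) (nhds x)"
    using Suc by (auto intro!: always_eventually)
  then have "vector_derivative (nder S i g) (at x within S) = vector_derivative (G i) (at x within S)"
    by (rule vector_derivative_cong_eq) (use Suc.prems in auto)
  also have "\<dots> = G (Suc i) x"
    by (rule vector_derivative_within[OF nt])
       (use GS Suc.prems in \<open>auto simp: has_real_derivative_iff_has_vector_derivative\<close>)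
  finally show ?case by (simp add: nder_Suc)
qed

lemma Ck_on_family:
  assumes nt: "\<And>x. x \<in> S \<Longrightarrow> at x within S \<noteq> bot"
    and G0: "\<And>x. x \<in> S \<Longrightarrow> g x = G 0 x"
    and GS: "\<And>i x. i < k \<Longrightarrow> x \<in> S \<Longrightarrow> (G i has_real_derivative G (Suc i) x) (at x within S)"
    and GC: "continuous_on S (G k)"
  shows "Ck_on k S g"
proof -
  note eq = nder_family[where G=G, OF nt G0 GS]
  have d: "(nder S i g has_real_derivative G (Suc i) x) (at x within S)" if "i < k" "x \<in> S" for i x
    using GS[OF that] that unfolding has_real_derivative_iff_has_vector_derivative
    by (subst has_vector_derivative_cong_ev[where g="G i"]) (auto simp: eq intro!: always_eventually)
  show ?thesis unfolding Ck_on_def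
  proof safe
    fix i x assume "i < k" "x \<in> S"
    from d[OF this] show "nder S i g differentiable at x within S"
      using real_differentiable_def by blast
  next
    fix i assume i: "i \<le> k"
    show "continuous_on S (nder S i g)"
    proof (cases "i = k")
      case True
      with GC show ?thesis by (subst continuous_on_cong[where g="G k"]) (auto simp: eq)
    next
      case False
      with i show ?thesis
        by (auto simp: continuous_on_eq_continuous_within intro!: DERIV_continuous d)
    qed
  qed
qed

lemma at_within_Icc_nontrivial:
  fixes a b x :: real
  assumes "a < b" "x \<in> {a..b}"
  shows "at x within {a..b} \<noteq> bot"
  using assms by (simp add: trivial_limit_within islimpt_Icc)

lemma nder_subset:
  assumes "Ck_on k S g" "T \<subseteq> S" "\<And>x. x \<in> T \<Longrightarrow> at x within T \<noteq> bot" "i \<le> k" "x \<in> T"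
  shows "nder T i g x = nder S i g x"
  by (rule nder_family[where G="\<lambda>i. nder S i g" and k=k])
     (use assms in \<open>auto intro!: DERIV_subset[OF Ck_on_deriv]\<close>)

lemma Ck_on_subset:
  assumes "Ck_on k S g" "T \<subseteq> S" "\<And>x. x \<in> T \<Longrightarrow> at x within T \<noteq> bot"
  shows "Ck_on k T g"
  by (rule Ck_on_family[where G="\<lambda>i. nder S i g"])
     (use assms in \<open>auto intro!: DERIV_subset[OF Ck_on_deriv] intro: continuous_on_subset Ck_on_cont\<close>)

lemma nder_sum:
  assumes "finite A" "\<And>k. k \<in> A \<Longrightarrow> Ck_on m S (g k)" "\<And>x. x \<in> S \<Longrightarrow> at x within S \<noteq> bot"
    and "i \<le> m" "x \<in> S" and f: "\<And>x. x \<in> S \<Longrightarrow> f x = (\<Sum>k\<in>A. c k * g k x)"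
  shows "nder S i f x = (\<Sum>k\<in>A. c k * nder S i (g k) x)"
  by (rule nder_family[where G="\<lambda>i x. \<Sum>k\<in>A. c k * nder S i (g k) x" and k=m])
     (use assms in \<open>auto intro!: DERIV_sum DERIV_cmult Ck_on_deriv\<close>)

lemma Ck_on_sum:
  assumes "finite A" "\<And>k. k \<in> A \<Longrightarrow> Ck_on m S (g k)" "\<And>x. x \<in> S \<Longrightarrow> at x within S \<noteq> bot"
    and f: "\<And>x. x \<in> S \<Longrightarrow> f x = (\<Sum>k\<in>A. c k * g k x)"
  shows "Ck_on m S f"
  by (rule Ck_on_family[where G="\<lambda>i x. \<Sum>k\<in>A. c k * nder S i (g k) x"])
     (use assms in \<open>auto intro!: DERIV_sum DERIV_cmult Ck_on_deriv continuous_intros Ck_on_cont\<close>)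

lemma nder_lin:
  assumes "Ck_on m S f" "Ck_on m S g" "\<And>x. x \<in> S \<Longrightarrow> at x within S \<noteq> bot" "i \<le> m" "x \<in> S"
  shows "nder S i (\<lambda>x. c * f x + d * g x) x = c * nder S i f x + d * nder S i g x"
  by (rule nder_family[where G="\<lambda>i x. c * nder S i f x + d * nder S i g x" and k=m])
     (use assms in \<open>auto intro!: derivative_eq_intros Ck_on_deriv\<close>)

lemma Ck_on_lin:
  assumes "Ck_on m S f" "Ck_on m S g" "\<And>x. x \<in> S \<Longrightarrow> at x within S \<noteq> bot"
  shows "Ck_on m S (\<lambda>x. c * f x + d * g x)"
  by (rule Ck_on_family[where G="\<lambda>i x. c * nder S i f x + d * nder S i g x"])
     (use assms in \<open>auto intro!: derivative_eq_intros Ck_on_deriv continuous_intros Ck_on_cont\<close>)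

lemma nder_diff:
  assumes "Ck_on m S f" "Ck_on m S g" "\<And>x. x \<in> S \<Longrightarrow> at x within S \<noteq> bot" "i \<le> m" "x \<in> S"
  shows "nder S i (\<lambda>x. f x - g x) x = nder S i f x - nder S i g x"
  using nder_lin[OF assms, of 1 "-1"] by simp

lemma Ck_on_diff:
  assumes "Ck_on m S f" "Ck_on m S g" "\<And>x. x \<in> S \<Longrightarrow> at x within S \<noteq> bot"
  shows "Ck_on m S (\<lambda>x. f x - g x)"
  using Ck_on_lin[OF assms, of 1 "-1"] by simp

lemma power_family:
  "((\<lambda>x. (if i \<le> p then real (fact p div fact (p - i)) * x ^ (p - i) else 0)) has_real_derivative
     (if Suc i \<le> p then real (fact p div fact (p - Suc i)) * x ^ (p - Suc i) else 0)) (at x within S)"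
proof (cases "Suc i \<le> p")
  case True
  then obtain q where q: "p - i = Suc q" "p - Suc i = q" by (metis Suc_diff_le diff_Suc_Suc)
  have "fact p = (fact p div fact (p - i)) * (fact (p - i) :: nat)"
    by (simp add: fact_dvd)
  also have "\<dots> = (fact p div fact (p - i)) * (p - i) * (fact (p - Suc i) :: nat)"
    unfolding q fact_Suc by (simp only: of_nat_id mult.assoc)
  finally have "(fact p div fact (p - i)) * (p - i) = (fact p div fact (p - Suc i) :: nat)"
    by (metis fact_nonzero nonzero_mult_div_cancel_right)
  then have "real (fact p div fact (p - i)) * real (p - i) = real (fact p div fact (p - Suc i))"
    by (metis of_nat_mult)
  then have "real (fact p div fact (p - i)) * (real (Suc q) * x ^ (Suc q - Suc 0))
      = real (fact p div fact q) * x ^ q"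
    unfolding q by (simp only: diff_Suc_Suc diff_zero mult.assoc[symmetric])
  then have "((\<lambda>x. real (fact p div fact (Suc q)) * x ^ Suc q) has_real_derivative
      real (fact p div fact q) * x ^ q) (at x within S)"
    using DERIV_cmult[OF DERIV_pow[of "Suc q" x S], of "real (fact p div fact (Suc q))"]
    by (simp only: q)
  then show ?thesis using True by (simp add: q del: fact_Suc power_Suc)
next
  case False
  then show ?thesis by (cases "i = p") (auto)
qed

lemma
  assumes nt: "\<And>x. x \<in> S \<Longrightarrow> at x within S \<noteq> bot"
  shows Ck_on_power: "Ck_on k S (\<lambda>x. x ^ p)"
    and nder_power_0: "p < i \<Longrightarrow> x \<in> S \<Longrightarrow> nder S i (\<lambda>x. x ^ p) x = 0"
proof -
  let ?G = "\<lambda>i x. if i \<le> p then real (fact p div fact (p - i)) * x ^ (p - i) else 0"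
  show "Ck_on k S (\<lambda>x. x ^ p)"
    by (rule Ck_on_family[where G="?G", OF nt _ power_family])
      (cases "k \<le> p"; auto intro!: continuous_intros)+
  show "nder S i (\<lambda>x. x ^ p) x = 0" if "p < i" "x \<in> S"
    using nder_family[where G="?G" and k=i and g="\<lambda>x. x ^ p", OF nt _ power_family _ that(2), of i] that
    by auto
qed

lemma mvt_bound:
  fixes f :: "real \<Rightarrow> real"
  assumes "\<And>x. x \<in> {a..b} \<Longrightarrow> (f has_real_derivative f' x) (at x within {a..b})"
    and "\<And>x. x \<in> {a..b} \<Longrightarrow> \<bar>f' x\<bar> \<le> B" and "x \<in> {a..b}" "y \<in> {a..b}"
  shows "\<bar>f x - f y\<bar> \<le> B * \<bar>x - y\<bar>"
  using field_differentiable_bound[of "{a..b}" f f' B x y] assms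
  by (auto simp: real_norm_def abs_minus_commute)

text \<open>Descent from the highest derivative: a derivative is at most its value at \<open>z\<close> plus the length
  times the bound for the next derivative.\<close>

lemma taylor_descent:
  fixes G :: "nat \<Rightarrow> real \<Rightarrow> real"
  assumes G: "\<And>i x. i < n \<Longrightarrow> x \<in> {a..b} \<Longrightarrow> (G i has_real_derivative G (Suc i) x) (at x within {a..b})"
    and z: "z \<in> {a..b}" and h: "b - a \<le> h" "h \<le> 1"
    and e: "\<And>i. i < n \<Longrightarrow> \<bar>G i z\<bar> \<le> e" and K: "\<And>x. x \<in> {a..b} \<Longrightarrow> \<bar>G n x\<bar> \<le> K"
    and e0: "0 \<le> e"
  shows "i \<le> n \<Longrightarrow> x \<in> {a..b} \<Longrightarrow> \<bar>G i x\<bar> \<le> real (n - i) * e + K * h ^ (n - i)"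
proof (induction "n - i" arbitrary: i x)
  case 0
  then show ?case using K by auto
next
  case (Suc m)
  have K0: "0 \<le> K" using K[OF z] by simp
  have h0: "0 \<le> h" using z h by simp
  define B where "B = real (n - Suc i) * e + K * h ^ (n - Suc i)"
  have B0: "0 \<le> B" using K0 h0 e0 by (simp add: B_def)
  have B: "\<bar>G (Suc i) y\<bar> \<le> B" if "y \<in> {a..b}" for y
    unfolding B_def using Suc.hyps(1)[of "Suc i" y] Suc.hyps(2) Suc.prems that by auto
  have eq: "n - i = Suc (n - Suc i)" using Suc by simp
  have "\<bar>G i x - G i z\<bar> \<le> B * \<bar>x - z\<bar>"
    by (rule mvt_bound[where f'="G (Suc i)" and a=a and b=b]) (use Suc G B z in auto)
  also have "\<dots> \<le> B * h"
    using B0 z Suc.prems h by (intro mult_left_mono) auto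
  finally have "\<bar>G i x\<bar> \<le> e + B * h" using e[of i] Suc.hyps(2) by linarith
  also have "B * h \<le> real (n - Suc i) * e + K * h ^ (n - i)"
  proof -
    have "real (n - Suc i) * e * h \<le> real (n - Suc i) * e * 1"
      using e0 h by (intro mult_left_mono) auto
    then show ?thesis unfolding B_def eq by (simp add: algebra_simps)
  qed
  finally show ?case unfolding eq by (simp add: algebra_simps)
qed

lemma nder_taylor_descent:
  assumes "a < b" "Ck_on n {a..b} g" "z \<in> {a..b}" "b - a \<le> h" "h \<le> 1"
    and "\<And>i. i < n \<Longrightarrow> \<bar>nder {a..b} i g z\<bar> \<le> e" "\<And>x. x \<in> {a..b} \<Longrightarrow> \<bar>nder {a..b} n g x\<bar> \<le> K" "0 \<le> e"
    and "i \<le> n" "x \<in> {a..b}"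
  shows "\<bar>nder {a..b} i g x\<bar> \<le> real (n - i) * e + K * h ^ (n - i)"
  by (rule taylor_descent[where G="\<lambda>i. nder {a..b} i g" and a=a and b=b and z=z])
     (use assms Ck_on_deriv in auto)

text \<open>Supplies the polynomial part of an element of the univariate space once its derivative of order
  \<open>n - 2\<close> is known.\<close>

lemma nder_const_poly:
  assumes ab: "a < b"
  shows "Ck_on m {a..b} w \<Longrightarrow> (\<And>x. x \<in> {a..b} \<Longrightarrow> nder {a..b} m w x = 0) \<Longrightarrow>
    \<exists>c. \<forall>x\<in>{a..b}. w x = (\<Sum>k<m. c k * x ^ k)"
proof (induction m arbitrary: w)
  case 0
  then show ?case by auto
next
  case (Suc m)
  note nt = at_within_Icc_nontrivial[OF ab]
  let ?S = "{a..b}"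
  have sh: "nder ?S i (nder ?S 1 w) = nder ?S (Suc i) w" for i by (rule nder_Suc2[symmetric])
  have "Ck_on m ?S (nder ?S 1 w)"
    by (rule Ck_on_family[where G="\<lambda>i. nder ?S (Suc i) w"])
       (use Suc.prems nt in \<open>auto intro!: Ck_on_deriv Ck_on_cont\<close>)
  then obtain c where c: "\<And>x. x \<in> ?S \<Longrightarrow> nder ?S 1 w x = (\<Sum>k<m. c k * x ^ k)"
    using Suc.IH[of "nder ?S 1 w"] Suc.prems unfolding sh by blast
  define W where "W x = w x - (\<Sum>k<m. c k / (k + 1) * x ^ (k + 1))" for x
  have "(W has_real_derivative 0) (at x within ?S)" if "x \<in> ?S" for x
  proof -
    have "(\<Sum>k<m. c k / (k + 1) * (real (k + 1) * x ^ k)) = (\<Sum>k<m. c k * x ^ k)"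
      by (intro sum.cong) (auto simp del: of_nat_Suc of_nat_add)
    moreover have "((\<lambda>x. \<Sum>k<m. c k / (k + 1) * x ^ (k + 1)) has_real_derivative
        (\<Sum>k<m. c k / (k + 1) * (real (k + 1) * x ^ k))) (at x within ?S)"
    proof (intro DERIV_sum DERIV_cmult)
      fix k show "((\<lambda>x. x ^ (k + 1)) has_real_derivative real (k + 1) * x ^ k) (at x within ?S)"
        using DERIV_pow[of "k + 1" x ?S] by simp
    qed
    moreover have "(nder ?S 0 w has_real_derivative nder ?S 1 w x) (at x within ?S)"
      using Ck_on_deriv[OF Suc.prems(1), of 0 x] that by simp
    ultimately show ?thesis
      using DERIV_diff[of "nder ?S 0 w"] c[OF that] unfolding W_def nder_0 by fastforce
  qed
  then have "\<exists>d. \<forall>x\<in>?S. W x = d"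
    by (intro has_field_derivative_zero_constant) auto
  then obtain d where d: "\<And>x. x \<in> ?S \<Longrightarrow> W x = d" by blast
  show ?case
  proof (intro exI ballI)
    fix x assume "x \<in> ?S"
    then have "w x = d + (\<Sum>k<m. c k / (k + 1) * x ^ (k + 1))" using d[of x] by (simp add: W_def)
    also have "\<dots> = (\<Sum>k<Suc m. (case k of 0 \<Rightarrow> d | Suc k \<Rightarrow> c k / (k + 1)) * x ^ k)"
      by (subst sum.lessThan_Suc_shift) simp
    finally show "w x = (\<Sum>k<Suc m. (case k of 0 \<Rightarrow> d | Suc k \<Rightarrow> c k / (k + 1)) * x ^ k)" .
  qed
qed

section \<open>The univariate spaces on short intervals\<close>

definition ubasis :: "nat \<Rightarrow> (real \<Rightarrow> real) \<Rightarrow> (real \<Rightarrow> real) \<Rightarrow> nat \<Rightarrow> real \<Rightarrow> real" where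
  "ubasis n u v k = (if k + 2 < n then (\<lambda>x. x ^ k) else if k + 2 = n then u else v)"

definition uspace :: "nat \<Rightarrow> (real \<Rightarrow> real) \<Rightarrow> (real \<Rightarrow> real) \<Rightarrow> real set \<Rightarrow> (real \<Rightarrow> real) set" where
  "uspace n u v S = {g. \<exists>c. \<forall>x\<in>S. g x = (\<Sum>k<n. c k * ubasis n u v k x)}"

text \<open>The intervals on which all estimates are uniform: they only involve \<open>n\<close>, the bound \<open>M\<close> for the
  derivatives and the lower bound \<open>\<delta>\<close> for the determinant.\<close>

definition good ::
  "nat \<Rightarrow> (real \<Rightarrow> real) \<Rightarrow> (real \<Rightarrow> real) \<Rightarrow> real \<Rightarrow> real \<Rightarrow> real \<Rightarrow> real \<Rightarrow> bool" where
  "good n u v M \<delta> a b \<longleftrightarrow> 3 \<le> n \<and> 1 \<le> M \<and> 0 < \<delta> \<and> a < b \<and> b - a \<le> 1 \<and>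
     Ck_on n {a..b} u \<and> Ck_on n {a..b} v \<and>
     (\<forall>i\<le>n. \<forall>x\<in>{a..b}. \<bar>nder {a..b} i u x\<bar> \<le> M \<and> \<bar>nder {a..b} i v x\<bar> \<le> M) \<and>
     (\<forall>x\<in>{a..b}. \<delta> \<le> \<bar>det_D n u v {a..b} x\<bar>)"

lemma uspace_mono: "g \<in> uspace n u v S \<Longrightarrow> T \<subseteq> S \<Longrightarrow> g \<in> uspace n u v T"
  by (auto simp: uspace_def)

lemma uspace_cong: "(\<And>x. x \<in> S \<Longrightarrow> f x = g x) \<Longrightarrow> f \<in> uspace n u v S \<longleftrightarrow> g \<in> uspace n u v S"
  by (auto simp: uspace_def)

lemma uspace_sum:
  assumes "finite A" "\<And>l. l \<in> A \<Longrightarrow> g l \<in> uspace n u v S"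
  shows "(\<lambda>x. \<Sum>l\<in>A. d l * g l x) \<in> uspace n u v S"
proof -
  from assms(2) obtain c where c: "\<And>l x. l \<in> A \<Longrightarrow> x \<in> S \<Longrightarrow> g l x = (\<Sum>k<n. c l k * ubasis n u v k x)"
    unfolding uspace_def by simp metis
  have "(\<Sum>l\<in>A. d l * g l x) = (\<Sum>k<n. (\<Sum>l\<in>A. d l * c l k) * ubasis n u v k x)" if "x \<in> S" for x
  proof -
    have "(\<Sum>l\<in>A. d l * g l x) = (\<Sum>l\<in>A. \<Sum>k<n. d l * c l k * ubasis n u v k x)"
      using that c by (simp add: sum_distrib_left mult.assoc)
    also have "\<dots> = (\<Sum>k<n. \<Sum>l\<in>A. d l * c l k * ubasis n u v k x)" by (rule sum.swap)
    finally show ?thesis by (simp add: sum_distrib_right)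
  qed
  then show ?thesis unfolding uspace_def mem_Collect_eq
    by (intro exI[of _ "\<lambda>k. \<Sum>l\<in>A. d l * c l k"]) blast
qed

lemma uspace_lin:
  assumes "f \<in> uspace n u v S" "g \<in> uspace n u v S"
  shows "(\<lambda>x. c * f x + d * g x) \<in> uspace n u v S"
  using uspace_sum[of "{0::nat, 1}" "\<lambda>i. if i = 0 then f else g" n u v S "\<lambda>i. if i = 0 then c else d"] assms
  by auto

lemma uspace_diff:
  assumes "f \<in> uspace n u v S" "g \<in> uspace n u v S"
  shows "(\<lambda>x. f x - g x) \<in> uspace n u v S"
  using uspace_lin[OF assms, of 1 "-1"] by simp

lemma uspace_zero: "(\<lambda>x. 0) \<in> uspace n u v S"
  using uspace_sum[of "{}" undefined] by simp

lemma uspace_bas: "k < n \<Longrightarrow> ubasis n u v k \<in> uspace n u v S"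
  unfolding uspace_def by (auto intro!: exI[of _ "\<lambda>j. if j = k then 1 else 0"] simp: if_distrib[of "\<lambda>x. x * _"] cong: if_cong)

lemma good_sub:
  assumes "good n u v M \<delta> a b" "a \<le> a'" "b' \<le> b" "a' < b'"
  shows "good n u v M \<delta> a' b'"
proof -
  have sub: "{a'..b'} \<subseteq> {a..b}" using assms by auto
  note nt = at_within_Icc_nontrivial[OF assms(4)]
  have "nder {a'..b'} i w x = nder {a..b} i w x" if "w = u \<or> w = v" "i \<le> n" "x \<in> {a'..b'}" for w i x
    by (rule nder_subset[OF _ sub nt]) (use assms that in \<open>auto simp: good_def\<close>)
  then show ?thesis using assms sub Ck_on_subset[OF _ sub nt]
    unfolding good_def det_D_def by auto
qed

locale good_interval =
  fixes n u v M \<delta> a b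
  assumes gd: "good n u v M \<delta> a b"
begin

abbreviation "I \<equiv> {a..b}"

lemma n3: "3 \<le> n" and ab: "a < b" and M1: "1 \<le> M" and d0: "0 < \<delta>" and h1: "b - a \<le> 1"
  and Cu: "Ck_on n I u" and Cv: "Ck_on n I v"
  and Mu: "i \<le> n \<Longrightarrow> x \<in> I \<Longrightarrow> \<bar>nder I i u x\<bar> \<le> M"
  and Mv: "i \<le> n \<Longrightarrow> x \<in> I \<Longrightarrow> \<bar>nder I i v x\<bar> \<le> M"
  and det: "x \<in> I \<Longrightarrow> \<delta> \<le> \<bar>det_D n u v I x\<bar>"
  using gd by (auto simp: good_def)

lemma nt: "x \<in> I \<Longrightarrow> at x within I \<noteq> bot"
  by (rule at_within_Icc_nontrivial[OF ab])

lemma ubasis_Ck: "Ck_on n I (ubasis n u v k)"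
  unfolding ubasis_def using Cu Cv Ck_on_power[OF nt] by auto

lemma E_Ck: "g \<in> uspace n u v I \<Longrightarrow> Ck_on n I g"
  unfolding uspace_def using Ck_on_sum[of "{..<n}" n I "ubasis n u v" g, OF _ ubasis_Ck nt] by auto

lemma ubasis_top: "k < n - 2 \<Longrightarrow> n - 2 \<le> i \<Longrightarrow> x \<in> I \<Longrightarrow> nder I i (ubasis n u v k) x = 0"
  using nder_power_0[of I k i x, OF nt] by (auto simp: ubasis_def)

text \<open>The powers in the basis have degree below \<open>n - 2\<close>, so only \<open>u\<close> and \<open>v\<close> survive \<open>n - 2\<close> derivatives.\<close>

lemma E_top:
  assumes "g \<in> uspace n u v I"
  obtains \<alpha> \<beta> where "\<And>i x. x \<in> I \<Longrightarrow> n - 2 \<le> i \<Longrightarrow> i \<le> n \<Longrightarrow> nder I i g x = \<alpha> * nder I i u x + \<beta> * nder I i v x"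
proof -
  obtain c where c: "\<And>x. x \<in> I \<Longrightarrow> g x = (\<Sum>k<n. c k * ubasis n u v k x)"
    using assms by (auto simp: uspace_def)
  have *: "nder I i g x = c (n - 2) * nder I i u x + c (n - 1) * nder I i v x"
    if "x \<in> I" "n - 2 \<le> i" "i \<le> n" for i x
  proof -
    have "nder I i g x = (\<Sum>k<n. c k * nder I i (ubasis n u v k) x)"
      by (rule nder_sum[of _ n]) (use c that nt ubasis_Ck in auto)
    also have "\<dots> = (\<Sum>k\<in>{n-2,n-1}. c k * nder I i (ubasis n u v k) x)"
      using n3 that by (intro sum.mono_neutral_right) (auto intro!: ubasis_top)
    also have "\<dots> = c (n - 2) * nder I i u x + c (n - 1) * nder I i v x"
      using n3 by (subst sum.insert) (auto simp: ubasis_def)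
    finally show ?thesis .
  qed
  show thesis by (rule that, rule *)
qed

text \<open>Converse of the previous lemma: after subtracting the combination of \<open>u\<close> and \<open>v\<close> the derivative of
  order \<open>n - 2\<close> vanishes, and a polynomial of degree below \<open>n - 2\<close> remains. This is how the Bernstein
  functions, given by iterated integrals, are recognised as elements of the space.\<close>

lemma E_I:
  assumes C: "Ck_on (n - 2) I g"
    and t: "\<And>x. x \<in> I \<Longrightarrow> nder I (n - 2) g x = \<alpha> * nder I (n - 2) u x + \<beta> * nder I (n - 2) v x"
  shows "g \<in> uspace n u v I"
proof -
  have Cu': "Ck_on (n - 2) I u" "Ck_on (n - 2) I v" using Cu Cv Ck_on_mono by auto
  let ?l = "\<lambda>x. \<alpha> * u x + \<beta> * v x"
  have Cl: "Ck_on (n - 2) I ?l" by (intro Ck_on_lin Cu' nt)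
  have "\<exists>c. \<forall>x\<in>I. g x - ?l x = (\<Sum>k<n - 2. c k * x ^ k)"
  proof (rule nder_const_poly[OF ab])
    show "Ck_on (n - 2) I (\<lambda>x. g x - ?l x)" by (intro Ck_on_diff C Cl nt)
    show "nder I (n - 2) (\<lambda>x. g x - ?l x) x = 0" if "x \<in> I" for x
      using nder_diff[OF C Cl nt _ that, of "n - 2"] nder_lin[OF Cu' nt _ that, of "n - 2" \<alpha> \<beta>] t[OF that] by simp
  qed
  then obtain c where c: "\<And>x. x \<in> I \<Longrightarrow> g x - ?l x = (\<Sum>k<n - 2. c k * x ^ k)" by blast
  define m where "m = n - 2"
  then have m: "n = Suc (Suc m)" using n3 by simp
  have "g x = (\<Sum>k<n. (if k + 2 < n then c k else if k + 2 = n then \<alpha> else \<beta>) * ubasis n u v k x)" if "x \<in> I" for x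
    using c[OF that] unfolding m by (simp add: ubasis_def)
  then show ?thesis unfolding uspace_def mem_Collect_eq
    by (intro exI[of _ "\<lambda>k. if k + 2 < n then c k else if k + 2 = n then \<alpha> else \<beta>"]) blast
qed

text \<open>The Wronskian bound turns a bound for the jet at one point into a bound on the whole
  interval: Cramer's rule bounds the coefficients of \<open>u\<close> and \<open>v\<close>, the rest is Taylor's formula.\<close>

lemma E_jet_bound:
  assumes g: "g \<in> uspace n u v I" and z: "z \<in> I" and e: "\<And>i. i < n \<Longrightarrow> \<bar>nder I i g z\<bar> \<le> e"
    and ix: "i \<le> n" "x \<in> I"
  shows "\<bar>nder I i g x\<bar> \<le> (n + 4 * M\<^sup>2 / \<delta>) * e"
proof -
  have e0: "0 \<le> e" using e[of 0] n3 by simp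
  obtain \<alpha> \<beta> where t: "\<And>i x. x \<in> I \<Longrightarrow> n - 2 \<le> i \<Longrightarrow> i \<le> n \<Longrightarrow> nder I i g x = \<alpha> * nder I i u x + \<beta> * nder I i v x"
    using E_top[OF g] by metis
  let ?u = "nder I (n - 2) u z" and ?v = "nder I (n - 2) v z"
    and ?u' = "nder I (n - 1) u z" and ?v' = "nder I (n - 1) v z"
  let ?p = "nder I (n - 2) g z" and ?q = "nder I (n - 1) g z"
  have D: "det_D n u v I z = ?u * ?v' - ?u' * ?v" by (simp add: det_D_def)
  have p: "?p = \<alpha> * ?u + \<beta> * ?v" and q: "?q = \<alpha> * ?u' + \<beta> * ?v'" using t z n3 by auto
  have pe: "\<bar>?p\<bar> \<le> e" "\<bar>?q\<bar> \<le> e" using e n3 by auto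
  have Mz: "\<bar>?u\<bar> \<le> M" "\<bar>?v\<bar> \<le> M" "\<bar>?u'\<bar> \<le> M" "\<bar>?v'\<bar> \<le> M" using Mu Mv z by auto
  have pr: "\<bar>s * t\<bar> \<le> M * e" if "\<bar>s\<bar> \<le> e" "\<bar>t\<bar> \<le> M" for s t
    unfolding abs_mult mult.commute[of M] using that by (intro mult_mono) auto
  have "\<alpha> * det_D n u v I z = ?p * ?v' - ?q * ?v" unfolding D p q by (simp add: algebra_simps)
  then have "\<bar>\<alpha>\<bar> * \<bar>det_D n u v I z\<bar> \<le> 2 * M * e"
    using pr[OF pe(1) Mz(4)] pr[OF pe(2) Mz(2)] unfolding abs_mult[symmetric] by linarith
  moreover have "\<bar>\<alpha>\<bar> * \<delta> \<le> \<bar>\<alpha>\<bar> * \<bar>det_D n u v I z\<bar>" using det[OF z] by (intro mult_left_mono) auto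
  ultimately have al: "\<bar>\<alpha>\<bar> \<le> 2 * M * e / \<delta>" using d0 by (simp add: field_simps)
  have "\<beta> * det_D n u v I z = ?q * ?u - ?p * ?u'" unfolding D p q by (simp add: algebra_simps)
  then have "\<bar>\<beta>\<bar> * \<bar>det_D n u v I z\<bar> \<le> 2 * M * e"
    using pr[OF pe(2) Mz(1)] pr[OF pe(1) Mz(3)] unfolding abs_mult[symmetric] by linarith
  moreover have "\<bar>\<beta>\<bar> * \<delta> \<le> \<bar>\<beta>\<bar> * \<bar>det_D n u v I z\<bar>" using det[OF z] by (intro mult_left_mono) auto
  ultimately have be: "\<bar>\<beta>\<bar> \<le> 2 * M * e / \<delta>" using d0 by (simp add: field_simps)
  define K where "K = 4 * M\<^sup>2 / \<delta> * e"
  have K0: "0 \<le> K" using d0 e0 by (simp add: K_def)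
  have top: "\<bar>nder I j g y\<bar> \<le> K" if "y \<in> I" "n - 2 \<le> j" "j \<le> n" for j y
  proof -
    have "\<bar>nder I j g y\<bar> \<le> \<bar>\<alpha>\<bar> * \<bar>nder I j u y\<bar> + \<bar>\<beta>\<bar> * \<bar>nder I j v y\<bar>"
      unfolding t[OF that] by (simp flip: abs_mult)
    also have "\<dots> \<le> 2 * M * e / \<delta> * M + 2 * M * e / \<delta> * M"
      by (intro add_mono mult_mono al be Mu Mv) (use that al be e0 d0 M1 in auto)
    finally show ?thesis unfolding K_def by (simp add: power2_eq_square algebra_simps)
  qed
  show ?thesis
  proof (cases "i \<le> n - 2")
    case True
    have Cg: "Ck_on (n - 2) I g" using E_Ck[OF g] Ck_on_mono by auto
    have "\<bar>nder I i g x\<bar> \<le> real (n - 2 - i) * e + K * 1 ^ (n - 2 - i)"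
      by (rule nder_taylor_descent[OF ab Cg z _ _ _ _ _ True ix(2)]) (use h1 e top e0 n3 in auto)
    also have "\<dots> \<le> n * e + K" using e0 by (auto intro!: mult_right_mono)
    finally show ?thesis unfolding K_def by (simp add: algebra_simps)
  next
    case False
    then have "\<bar>nder I i g x\<bar> \<le> K" using top ix by auto
    also have "\<dots> \<le> n * e + K" using e0 by simp
    finally show ?thesis unfolding K_def by (simp add: algebra_simps)
  qed
qed

lemma E_zero_jet:
  assumes "g \<in> uspace n u v I" "z \<in> I" "\<And>i. i < n \<Longrightarrow> nder I i g z = 0" "i \<le> n" "x \<in> I"
  shows "nder I i g x = 0"
  using E_jet_bound[OF assms(1,2), of 0 i x] assms by auto

text \<open>Differentiating \<open>n - 2\<close> times leaves a linear system for the last two coefficients whose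
  determinant is the Wronskian; then a polynomial with infinitely many zeros remains.\<close>

lemma coef_unique:
  assumes z: "\<And>x. x \<in> I \<Longrightarrow> (\<Sum>k<n. c k * ubasis n u v k x) = 0" and k: "k < n"
  shows "c k = 0"
proof -
  let ?g = "\<lambda>x. \<Sum>k<n. c k * ubasis n u v k x"
  have z0: "nder I i ?g x = 0" if "x \<in> I" "i \<le> n" for i x
    using nder_family[where G="\<lambda>_ _. 0" and g="?g" and k=n and S=I] nt z that by auto
  have eq: "nder I i ?g x = c (n - 2) * nder I i u x + c (n - 1) * nder I i v x"
    if "x \<in> I" "n - 2 \<le> i" "i \<le> n" for i x
  proof -
    have "nder I i ?g x = (\<Sum>k<n. c k * nder I i (ubasis n u v k) x)"
      by (rule nder_sum[of _ n]) (use that nt ubasis_Ck in auto)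
    also have "\<dots> = (\<Sum>k\<in>{n-2,n-1}. c k * nder I i (ubasis n u v k) x)"
      using n3 that by (intro sum.mono_neutral_right) (auto intro!: ubasis_top)
    also have "\<dots> = c (n - 2) * nder I i u x + c (n - 1) * nder I i v x"
      using n3 by (subst sum.insert) (auto simp: ubasis_def)
    finally show ?thesis .
  qed
  have aI: "a \<in> I" using ab by simp
  have 1: "c (n - 2) * nder I (n - 2) u a + c (n - 1) * nder I (n - 2) v a = 0"
    using z0[OF aI, of "n - 2"] eq[OF aI, of "n - 2"] by simp
  have 2: "c (n - 2) * nder I (n - 1) u a + c (n - 1) * nder I (n - 1) v a = 0"
    using z0[OF aI, of "n - 1"] eq[OF aI, of "n - 1"] by simp
  have D: "det_D n u v I a \<noteq> 0" using det[OF aI] d0 by auto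
  have "c (n - 2) * det_D n u v I a
      = (c (n - 2) * nder I (n - 2) u a + c (n - 1) * nder I (n - 2) v a) * nder I (n - 1) v a
       - (c (n - 2) * nder I (n - 1) u a + c (n - 1) * nder I (n - 1) v a) * nder I (n - 2) v a"
    by (simp add: det_D_def algebra_simps)
  then have c2: "c (n - 2) = 0" using D 1 2 by simp
  have "c (n - 1) * det_D n u v I a
      = (c (n - 2) * nder I (n - 1) u a + c (n - 1) * nder I (n - 1) v a) * nder I (n - 2) u a
       - (c (n - 2) * nder I (n - 2) u a + c (n - 1) * nder I (n - 2) v a) * nder I (n - 1) u a"
    by (simp add: det_D_def algebra_simps)
  then have c1: "c (n - 1) = 0" using D 1 2 by simp
  define m where "m = n - 3"
  then have m: "n = Suc (Suc (Suc m))" using n3 by simp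
  have "(\<Sum>i\<le>m. c i * x ^ i) = 0" if "x \<in> I" for x
    using z[OF that] c1 c2 unfolding m by (simp add: ubasis_def lessThan_Suc_atMost)
  then have "I \<subseteq> {x. (\<Sum>i\<le>m. c i * x ^ i) = 0}" by auto
  then have "infinite {x. (\<Sum>i\<le>m. c i * x ^ i) = 0}"
    using infinite_Icc[OF ab] finite_subset by blast
  then have "\<forall>i\<le>m. c i = 0" using polyfun_finite_roots[of c m] by auto
  moreover have "k \<le> m \<or> k = n - 2 \<or> k = n - 1" using k m by auto
  ultimately show ?thesis using c1 c2 by auto
qed

end

section \<open>The Bernstein basis of a short interval\<close>

lemma Bernstein_deriv:
  assumes "i \<le> Suc k"
  shows "(Bernstein (Suc k) i has_real_derivative
    real (Suc k) * ((if i = 0 then 0 else Bernstein k (i - 1) t) - (if i \<le> k then Bernstein k i t else 0)))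
    (at t within S)"
proof -
  have D: "(Bernstein (Suc k) i has_real_derivative
      real (Suc k choose i) * (real i * t ^ (i - 1) * (1 - t) ^ (Suc k - i)
        - t ^ i * (real (Suc k - i) * (1 - t) ^ (Suc k - i - 1)))) (at t within S)"
    unfolding Bernstein_def by (auto intro!: derivative_eq_intros simp: algebra_simps)
  have 1: "real (Suc k choose i) * real i = real (Suc k) * (if i = 0 then 0 else real (k choose (i - 1)))"
  proof (cases i)
    case (Suc j)
    have "real (Suc j * (Suc k choose Suc j)) = real (Suc k * (k choose j))"
      by (simp only: Suc_times_binomial)
    with Suc show ?thesis by (simp only: of_nat_mult mult.commute diff_Suc_1 if_False nat.distinct)
  qed simp
  have 2: "real (Suc k choose i) * real (Suc k - i) = real (Suc k) * real (k choose i)"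
    using arg_cong[OF binomial_absorb_comp[of "Suc k" i], of real]
    by (simp only: of_nat_mult diff_Suc_1 mult.commute)
  have "real (Suc k choose i) * (real i * t ^ (i - 1) * (1 - t) ^ (Suc k - i)
        - t ^ i * (real (Suc k - i) * (1 - t) ^ (Suc k - i - 1)))
      = (real (Suc k choose i) * real i) * t ^ (i - 1) * (1 - t) ^ (Suc k - i)
        - (real (Suc k choose i) * real (Suc k - i)) * t ^ i * (1 - t) ^ (Suc k - i - 1)"
    by (simp only: algebra_simps)
  also have "\<dots> = real (Suc k) * ((if i = 0 then 0 else Bernstein k (i - 1) t) - (if i \<le> k then Bernstein k i t else 0))"
    unfolding 1 2 using assms by (auto simp: Bernstein_def algebra_simps not_le binomial_eq_0)
  finally show ?thesis using D by simp
qed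

lemma Bernstein_0: "Bernstein k i 0 = (if i = 0 then 1 else 0)"
  by (auto simp: Bernstein_def)

lemma Bernstein_1: "i \<le> k \<Longrightarrow> Bernstein k i 1 = (if i = k then 1 else 0)"
  by (auto simp: Bernstein_def)

lemma Bernstein_le_1:
  assumes "0 \<le> t" "t \<le> 1" "i \<le> k"
  shows "Bernstein k i t \<le> 1"
proof -
  have "Bernstein k i t \<le> (\<Sum>i\<le>k. Bernstein k i t)"
    by (rule member_le_sum) (use assms Bernstein_nonneg in auto)
  then show ?thesis by simp
qed

lemma Bernstein_integral:
  fixes a b :: real
  assumes ab: "a < b" and i: "i \<le> k"
  shows "((\<lambda>x. Bernstein k i ((x - a) / (b - a))) has_integral (b - a) / real (Suc k)) {a..b}"
proof -
  let ?t = "\<lambda>x. (x - a) / (b - a)"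
  define P where "P x = (b - a) / real (Suc k) * (\<Sum>j\<in>{Suc i..Suc k}. Bernstein (Suc k) j (?t x))" for x
  have tel: "(\<Sum>j\<in>{Suc i..Suc k}. (if j = 0 then 0 else Bernstein k (j - 1) t) - (if j \<le> k then Bernstein k j t else 0))
     = Bernstein k i t" for t
  proof -
    have "(\<Sum>j\<in>{Suc i..Suc k}. (if j = 0 then 0 else Bernstein k (j - 1) t) - (if j \<le> k then Bernstein k j t else 0))
      = (\<Sum>j\<in>{i..k}. (if j \<le> k then Bernstein k j t else 0) - (if Suc j \<le> k then Bernstein k (Suc j) t else 0))"
      unfolding sum.shift_bounds_cl_Suc_ivl by (intro sum.cong) auto
    also have "\<dots> = Bernstein k i t"
      using i sum_natinterval_diff[of "\<lambda>j. (if j \<le> k then Bernstein k j t else 0)" i k, unfolded Suc_eq_plus1[symmetric]] by simp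
    finally show ?thesis .
  qed
  have "(P has_vector_derivative Bernstein k i (?t x)) (at x within {a..b})" for x
  proof -
    have D: "((\<lambda>x. Bernstein (Suc k) j (?t x)) has_real_derivative
       (real (Suc k) * ((if j = 0 then 0 else Bernstein k (j - 1) (?t x)) - (if j \<le> k then Bernstein k j (?t x) else 0))) * (1 / (b - a)))
       (at x within {a..b})" if "j \<in> {Suc i..Suc k}" for j
      by (rule DERIV_chain2[OF Bernstein_deriv]) (use that ab in \<open>auto intro!: derivative_eq_intros\<close>)
    have "(P has_real_derivative (b - a) / real (Suc k) * (\<Sum>j\<in>{Suc i..Suc k}.
       (real (Suc k) * ((if j = 0 then 0 else Bernstein k (j - 1) (?t x)) - (if j \<le> k then Bernstein k j (?t x) else 0))) * (1 / (b - a))))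
        (at x within {a..b})"
      unfolding P_def by (intro DERIV_cmult DERIV_sum D)
    also have "(b - a) / real (Suc k) * (\<Sum>j\<in>{Suc i..Suc k}.
       (real (Suc k) * ((if j = 0 then 0 else Bernstein k (j - 1) (?t x)) - (if j \<le> k then Bernstein k j (?t x) else 0))) * (1 / (b - a)))
       = Bernstein k i (?t x)"
      unfolding sum_distrib_right[symmetric] sum_distrib_left[symmetric] tel using ab by simp
    finally show ?thesis by (simp add: has_real_derivative_iff_has_vector_derivative)
  qed
  then have "((\<lambda>x. Bernstein k i (?t x)) has_integral P b - P a) {a..b}"
    using ab by (intro fundamental_theorem_of_calculus) auto
  moreover have "P b - P a = (b - a) / real (Suc k)"
  proof -
    have "(\<Sum>j\<in>{Suc i..Suc k}. Bernstein (Suc k) j (?t b)) = (\<Sum>j\<in>{Suc i..Suc k}. if j = Suc k then 1 else 0)"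
      using ab by (intro sum.cong) (auto simp: Bernstein_1)
    also have "\<dots> = 1" using i by simp
    finally show ?thesis unfolding P_def by (simp add: Bernstein_0)
  qed
  ultimately show ?thesis by simp
qed

lemma antideriv_family:
  assumes nt: "\<And>x. x \<in> S \<Longrightarrow> at x within S \<noteq> bot"
    and D: "\<And>x. x \<in> S \<Longrightarrow> (G has_real_derivative g x) (at x within S)" and g: "Ck_on k S g"
  shows "Ck_on (Suc k) S G" "l \<le> k \<Longrightarrow> x \<in> S \<Longrightarrow> nder S (Suc l) G x = nder S l g x"
proof -
  let ?F = "\<lambda>l. case l of 0 \<Rightarrow> G | Suc l \<Rightarrow> nder S l g"
  have F: "(?F i has_real_derivative ?F (Suc i) x) (at x within S)" if "i < Suc k" "x \<in> S" for i x
    using that D Ck_on_deriv[OF g] by (auto split: nat.split)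
  show "Ck_on (Suc k) S G"
    by (rule Ck_on_family[where G="?F", OF nt _ F]) (use Ck_on_cont[OF g] in auto)
  show "nder S (Suc l) G x = nder S l g x" if "l \<le> k" "x \<in> S"
    using nder_family[where G="?F" and i="Suc l" and x=x and g=G, OF nt _ F] that by auto
qed

context good_interval
begin

abbreviation "h \<equiv> b - a"
abbreviation "u2 \<equiv> nder I (n - 2) u"
abbreviation "v2 \<equiv> nder I (n - 2) v"
abbreviation "u1 \<equiv> nder I (n - 1) u"
abbreviation "v1 \<equiv> nder I (n - 1) v"

lemma h0: "0 < h" using ab by simp

lemma n_Suc: "n - 1 = Suc (n - 2)" "n = Suc (n - 1)" using n3 by auto

definition W where "W p x = u2 p * v2 x - u2 x * v2 p"
definition W1 where "W1 p x = u2 p * v1 x - u1 x * v2 p"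

lemma W_deriv: "x \<in> I \<Longrightarrow> (W p has_real_derivative W1 p x) (at x within I)"
  unfolding W_def W1_def using n3 n_Suc
  by (auto intro!: derivative_eq_intros Ck_on_deriv[OF Cu, of "n - 2" x] Ck_on_deriv[OF Cv, of "n - 2" x])

lemma W1_bound: "p \<in> I \<Longrightarrow> x \<in> I \<Longrightarrow> \<bar>W1 p x\<bar> \<le> 2 * M\<^sup>2"
proof -
  assume "p \<in> I" "x \<in> I"
  then have "\<bar>u2 p * v1 x\<bar> \<le> M * M" "\<bar>u1 x * v2 p\<bar> \<le> M * M"
    unfolding abs_mult using M1 by (auto intro!: mult_mono Mu Mv)
  then show ?thesis unfolding W1_def power2_eq_square by linarith
qed

lemma W1_near:
  assumes "p \<in> I" "x \<in> I"
  shows "\<bar>W1 p x - W1 p p\<bar> \<le> 2 * M\<^sup>2 * h"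
proof -
  have B: "\<bar>nder I (n - 1) w x - nder I (n - 1) w p\<bar> \<le> M * h"
    if w: "Ck_on n I w" "\<And>y. y \<in> I \<Longrightarrow> \<bar>nder I n w y\<bar> \<le> M" for w
  proof -
    have "\<bar>nder I (n - 1) w x - nder I (n - 1) w p\<bar> \<le> M * \<bar>x - p\<bar>"
      by (rule mvt_bound[where f'="nder I n w"])
         (use assms n3 w Ck_on_deriv[OF w(1), of "n - 1"] n_Suc(2) in auto)
    also have "\<dots> \<le> M * h" using assms M1 by (intro mult_left_mono) auto
    finally show ?thesis .
  qed
  have B: "\<bar>u1 x - u1 p\<bar> \<le> M * h" "\<bar>v1 x - v1 p\<bar> \<le> M * h"
    by (intro B Cu Cv Mu Mv; simp)+
  have "\<bar>u2 p * (v1 x - v1 p)\<bar> \<le> M * (M * h)" "\<bar>v2 p * (u1 x - u1 p)\<bar> \<le> M * (M * h)"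
    unfolding abs_mult using assms M1 B by (auto intro!: mult_mono Mu Mv)
  moreover have "W1 p x - W1 p p = u2 p * (v1 x - v1 p) - v2 p * (u1 x - u1 p)"
    by (simp add: W1_def algebra_simps)
  moreover have "M * (M * h) + M * (M * h) = 2 * M\<^sup>2 * h" by (simp add: power2_eq_square)
  ultimately show ?thesis by linarith
qed

text \<open>\<open>W p\<close> is the element of the span of \<open>u2\<close> and \<open>v2\<close> vanishing at \<open>p\<close>, and its slope at \<open>p\<close> is the
  determinant there. On a short interval it is almost linear.\<close>

lemma W_lin:
  assumes "p \<in> I" "x \<in> I"
  shows "\<bar>W p x - (x - p) * W1 p p\<bar> \<le> 2 * M\<^sup>2 * h * \<bar>x - p\<bar>"
proof -
  have "\<bar>(W p x - (x - p) * W1 p p) - (W p p - (p - p) * W1 p p)\<bar> \<le> 2 * M\<^sup>2 * h * \<bar>x - p\<bar>"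
    by (rule mvt_bound[where f'="\<lambda>x. W1 p x - W1 p p"])
       (use assms W1_near[OF assms(1)] in \<open>auto intro!: derivative_eq_intros W_deriv\<close>)
  then show ?thesis by (simp add: W_def)
qed

lemma W1_pp: "p \<in> I \<Longrightarrow> \<delta> \<le> \<bar>W1 p p\<bar>"
  using det[of p] by (simp add: W1_def det_D_def)

end

locale short_interval = good_interval +
  assumes small: "4 * M\<^sup>2 * (b - a) \<le> \<delta>"
begin

lemma W_far:
  assumes "p \<in> I" "q \<in> I" "\<bar>q - p\<bar> = h"
  shows "h * \<delta> / 2 \<le> \<bar>W p q\<bar>" "\<bar>W p q\<bar> \<le> 2 * (h * \<bar>W1 p p\<bar>)"
proof -
  have "\<bar>W p q - (q - p) * W1 p p\<bar> \<le> 2 * M\<^sup>2 * h * h" using W_lin[OF assms(1,2)] assms(3) by simp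
  moreover have "2 * M\<^sup>2 * h * h \<le> \<delta> / 2 * h"
    using small h0 by (intro mult_right_mono) auto
  moreover have "\<bar>(q - p) * W1 p p\<bar> = h * \<bar>W1 p p\<bar>" by (simp add: abs_mult assms)
  moreover have "h * \<delta> \<le> h * \<bar>W1 p p\<bar>" using W1_pp[OF assms(1)] h0 by (intro mult_left_mono) auto
  ultimately show "h * \<delta> / 2 \<le> \<bar>W p q\<bar>" "\<bar>W p q\<bar> \<le> 2 * (h * \<bar>W1 p p\<bar>)"
    using h0 by (auto simp: algebra_simps)
qed

text \<open>Normalised at the other end of the interval, \<open>W p\<close> is one of the two functions that start the recursion
  for the Bernstein basis; it differs from the linear hat function by the order of the length.\<close>

lemma hat_near:
  assumes "p \<in> I" "q \<in> I" "\<bar>q - p\<bar> = h" "x \<in> I"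
  shows "\<bar>W p x / W p q - (x - p) / (q - p)\<bar> \<le> 8 * M\<^sup>2 / \<delta> * h"
proof -
  have "0 < h * \<delta> / 2" using h0 d0 by simp
  then have nz: "W p q \<noteq> 0" "q - p \<noteq> 0" using W_far[OF assms(1-3)] h0 assms(3) by auto
  have 1: "\<bar>(W p x - (x - p) * W1 p p) * (q - p)\<bar> \<le> 2 * M\<^sup>2 * h * h * h"
    unfolding abs_mult assms(3)
    using W_lin[OF assms(1,4)] h0 M1 assms(1,4)
    by (intro mult_right_mono order.trans[OF W_lin[OF assms(1,4)]] mult_left_mono) auto
  have 2: "\<bar>(x - p) * (W p q - (q - p) * W1 p p)\<bar> \<le> h * (2 * M\<^sup>2 * h * h)"
    unfolding abs_mult using W_lin[OF assms(1,2)] assms h0 by (intro mult_mono) auto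
  have "W p x / W p q - (x - p) / (q - p) =
    ((W p x - (x - p) * W1 p p) * (q - p) - (x - p) * (W p q - (q - p) * W1 p p)) / (W p q * (q - p))"
    using nz by (simp add: field_simps)
  also have "\<bar>\<dots>\<bar> \<le> (4 * M\<^sup>2 * h * h * h) / (h * \<delta> / 2 * h)"
    unfolding abs_divide
  proof (rule frac_le)
    show "\<bar>(W p x - (x - p) * W1 p p) * (q - p) - (x - p) * (W p q - (q - p) * W1 p p)\<bar> \<le> 4 * M\<^sup>2 * h * h * h"
      using 1 2 by (simp add: algebra_simps)
    show "h * \<delta> / 2 * h \<le> \<bar>W p q * (q - p)\<bar>"
      unfolding abs_mult assms(3) using W_far[OF assms(1-3)] h0 by (intro mult_right_mono) auto
  qed (use h0 d0 in auto)
  also have "\<dots> = 8 * M\<^sup>2 / \<delta> * h"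
  proof -
    have "(4 * M\<^sup>2 * t * t * t) / (t * \<delta> / 2 * t) = 8 * M\<^sup>2 / \<delta> * t" if "0 < t" for t
      using that d0 by (simp add: field_simps)
    from this[OF h0] show ?thesis .
  qed
  finally show ?thesis .
qed

text \<open>The two-point problem in the definition of the start functions is uniquely solvable because
  \<open>W a b\<close> is its determinant, which does not vanish on a short interval.\<close>

lemma bern_start_eq:
  assumes w: "\<And>x. x \<in> I \<Longrightarrow> w x = \<alpha> * u2 x + \<beta> * v2 x" and x: "x \<in> I"
  shows "bern_start n u v a b (w a) (w b) x = w x"
proof -
  have ends: "a \<in> I" "b \<in> I" using ab by auto
  define A where "A = zext I u2"
  define B where "B = zext I v2"
  have sp: "g \<in> fun_space.span {A, B} \<longleftrightarrow> (\<exists>k l. g = (\<lambda>x. k * A x + l * B x))" for g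
  proof -
    have "g \<in> fun_space.span {A, B} \<longleftrightarrow> (\<exists>k. g - (\<lambda>x. k * A x) \<in> fun_space.span {B})"
      by (rule fun_space.span_breakdown_eq)
    also have "\<dots> \<longleftrightarrow> (\<exists>k l. g - (\<lambda>x. k * A x) = (\<lambda>x. l * B x))"
      by (auto simp: fun_space.span_singleton)
    also have "\<dots> \<longleftrightarrow> (\<exists>k l. g = (\<lambda>x. k * A x + l * B x))"
      by (simp add: fun_eq_iff algebra_simps)
    finally show ?thesis .
  qed
  have "0 < h * \<delta> / 2" using h0 d0 by simp
  then have D: "W a b \<noteq> 0" using W_far[of a b] ends h0 by auto
  have "bern_start n u v a b (w a) (w b) = (\<lambda>x. \<alpha> * A x + \<beta> * B x)"
    unfolding bern_start_def A_def[symmetric] B_def[symmetric]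
  proof (rule the_equality)
    show "(\<lambda>x. \<alpha> * A x + \<beta> * B x) \<in> fun_space.span {A, B} \<and> \<alpha> * A a + \<beta> * B a = w a \<and> \<alpha> * A b + \<beta> * B b = w b"
      using w ends unfolding sp by (auto simp: A_def B_def zext_def)
  next
    fix g assume g: "g \<in> fun_space.span {A, B} \<and> g a = w a \<and> g b = w b"
    then obtain k l where kl: "g = (\<lambda>x. k * A x + l * B x)" unfolding sp by blast
    have 1: "(k - \<alpha>) * u2 a + (l - \<beta>) * v2 a = 0" "(k - \<alpha>) * u2 b + (l - \<beta>) * v2 b = 0"
      using g w ends unfolding kl by (auto simp: A_def B_def zext_def algebra_simps)
    have "(k - \<alpha>) * W a b = ((k - \<alpha>) * u2 a + (l - \<beta>) * v2 a) * v2 b - ((k - \<alpha>) * u2 b + (l - \<beta>) * v2 b) * v2 a"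
      by (simp add: W_def algebra_simps)
    then have "k = \<alpha>" using D 1 by simp
    have "(l - \<beta>) * W a b = ((k - \<alpha>) * u2 b + (l - \<beta>) * v2 b) * u2 a - ((k - \<alpha>) * u2 a + (l - \<beta>) * v2 a) * u2 b"
      by (simp add: W_def algebra_simps)
    then have "l = \<beta>" using D 1 by simp
    show "g = (\<lambda>x. \<alpha> * A x + \<beta> * B x)" unfolding kl \<open>k = \<alpha>\<close> \<open>l = \<beta>\<close> ..
  qed
  then show ?thesis using x w by (simp add: A_def B_def zext_def)
qed

end

context good_interval
begin

text \<open>What is kept of the Bernstein polynomials of degree \<open>k\<close> on \<open>[a, b]\<close>. Distance of order \<open>h\<close> to them drives
  the recursion; the zeros at both ends, with first nonvanishing derivatives bounded below after scaling, make
  the triangular systems for the coefficients uniformly invertible.\<close>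

definition bernstein_like :: "nat \<Rightarrow> real \<Rightarrow> (nat \<Rightarrow> real \<Rightarrow> real) \<Rightarrow> bool" where
  "bernstein_like k C F \<longleftrightarrow> (\<forall>i\<le>k. Ck_on k I (F i) \<and>
     (\<exists>\<alpha> \<beta>. \<forall>x\<in>I. nder I (k - 1) (F i) x = \<alpha> * u2 x + \<beta> * v2 x) \<and>
     (\<forall>x\<in>I. \<bar>F i x - Bernstein k i ((x - a) / h)\<bar> \<le> C * h) \<and>
     (\<forall>l\<le>k. \<forall>x\<in>I. h ^ l * \<bar>nder I l (F i) x\<bar> \<le> C) \<and>
     (\<forall>l<i. nder I l (F i) a = 0) \<and> (\<forall>l<k - i. nder I l (F i) b = 0) \<and>
     1 \<le> C * (h ^ i * \<bar>nder I i (F i) a\<bar>) \<and> 1 \<le> C * (h ^ (k - i) * \<bar>nder I (k - i) (F i) b\<bar>))"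

lemma bernstein_likeD:
  assumes "bernstein_like k C F" "i \<le> k"
  shows "Ck_on k I (F i)" "\<exists>\<alpha> \<beta>. \<forall>x\<in>I. nder I (k - 1) (F i) x = \<alpha> * u2 x + \<beta> * v2 x"
    "x \<in> I \<Longrightarrow> \<bar>F i x - Bernstein k i ((x - a) / h)\<bar> \<le> C * h"
    "l \<le> k \<Longrightarrow> x \<in> I \<Longrightarrow> h ^ l * \<bar>nder I l (F i) x\<bar> \<le> C"
    "l < i \<Longrightarrow> nder I l (F i) a = 0" "l < k - i \<Longrightarrow> nder I l (F i) b = 0"
    "1 \<le> C * (h ^ i * \<bar>nder I i (F i) a\<bar>)" "1 \<le> C * (h ^ (k - i) * \<bar>nder I (k - i) (F i) b\<bar>)"
  using assms unfolding bernstein_like_def by blast+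

end

context short_interval
begin

lemma hat_facts:
  assumes p: "p \<in> I" and q: "q \<in> I" and pq: "\<bar>q - p\<bar> = h"
    and F_ball: "\<forall>x\<in>I. F x = W p x / W p q"
  defines "C \<equiv> 8 * M\<^sup>2 / \<delta> + 3"
  shows "Ck_on 1 I F" "\<exists>\<alpha> \<beta>. \<forall>x\<in>I. F x = \<alpha> * u2 x + \<beta> * v2 x"
    "\<And>x. x \<in> I \<Longrightarrow> \<bar>F x - (x - p) / (q - p)\<bar> \<le> C * h"
    "\<And>l x. l \<le> 1 \<Longrightarrow> x \<in> I \<Longrightarrow> h ^ l * \<bar>nder I l F x\<bar> \<le> C"
    "F p = 0" "F q = 1" "1 \<le> C * (h * \<bar>nder I 1 F p\<bar>)"
proof -
  note F = bspec[OF F_ball]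
  have pos: "0 < h * \<delta> / 2" using h0 d0 by simp
  then have Wpos: "0 < \<bar>W p q\<bar>" using W_far(1)[OF p q pq] by linarith
  then have nz: "W p q \<noteq> 0" by simp
  have M0: "0 \<le> 8 * M\<^sup>2 / \<delta>" using d0 by simp
  let ?G = "\<lambda>i x. if i = 0 then F x else W1 p x / W p q"
  have D: "(F has_real_derivative W1 p x / W p q) (at x within I)" if x: "x \<in> I" for x
  proof -
    have "((\<lambda>x. W p x / W p q) has_real_derivative W1 p x / W p q) (at x within I)"
      by (intro DERIV_cdivide W_deriv x)
    then show ?thesis unfolding has_real_derivative_iff_has_vector_derivative
      using x F by (subst has_vector_derivative_cong_ev[where g="\<lambda>x. W p x / W p q"])
        (auto intro!: always_eventually)
  qed
  have "continuous_on I (W1 p)"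
    unfolding W1_def by (intro continuous_intros Ck_on_cont[OF Cu] Ck_on_cont[OF Cv]) auto
  then have c1: "continuous_on I (\<lambda>x. W1 p x / W p q)" using nz by (intro continuous_intros) auto
  show "Ck_on 1 I F"
    by (rule Ck_on_family[where G="?G"]) (use D c1 nt in auto)
  have n1: "nder I 1 F x = W1 p x / W p q" if "x \<in> I" for x
    using nder_family[where G="?G" and k=1 and i=1 and x=x and g=F and S=I] D nt that by auto
  have "F x = (- v2 p / W p q) * u2 x + (u2 p / W p q) * v2 x" if "x \<in> I" for x
    unfolding F[OF that] by (simp add: W_def diff_divide_distrib)
  then show "\<exists>\<alpha> \<beta>. \<forall>x\<in>I. F x = \<alpha> * u2 x + \<beta> * v2 x" by blast
  have near: "\<bar>F x - (x - p) / (q - p)\<bar> \<le> 8 * M\<^sup>2 / \<delta> * h" if "x \<in> I" for x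
    using hat_near[OF p q pq that] F[OF that] by simp
  show "\<bar>F x - (x - p) / (q - p)\<bar> \<le> C * h" if "x \<in> I" for x
    by (rule order.trans[OF near[OF that]], rule mult_right_mono) (use h0 in \<open>auto simp: C_def\<close>)
  have le1: "\<bar>(x - p) / (q - p)\<bar> \<le> 1" if "x \<in> I" for x
    unfolding abs_divide pq using that p h0 by auto
  show "h ^ l * \<bar>nder I l F x\<bar> \<le> C" if "l \<le> 1" "x \<in> I" for l x
  proof (cases "l = 0")
    case True
    have "\<bar>F x\<bar> \<le> 8 * M\<^sup>2 / \<delta> * h + 1" using near[OF that(2)] le1[OF that(2)] by linarith
    also have "\<dots> \<le> 8 * M\<^sup>2 / \<delta> * 1 + 1" using h1 M0 by (intro add_right_mono mult_left_mono) auto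
    finally show ?thesis using True by (simp add: C_def)
  next
    case False
    then have l: "l = 1" using that by simp
    have "h * \<bar>nder I 1 F x\<bar> = h * \<bar>W1 p x\<bar> / \<bar>W p q\<bar>" using n1[OF that(2)] by simp
    also have "\<dots> \<le> h * (2 * M\<^sup>2) / (h * \<delta> / 2)"
      by (intro frac_le mult_left_mono W1_bound p that(2) W_far(1)[OF p q pq]) (use pos h0 in auto)
    also have "\<dots> \<le> C"
    proof -
      have "t * (2 * M\<^sup>2) / (t * \<delta> / 2) = 4 * M\<^sup>2 / \<delta>" if "0 < t" for t
        using that d0 by (simp add: field_simps)
      from this[OF h0] have "h * (2 * M\<^sup>2) / (h * \<delta> / 2) = 4 * M\<^sup>2 / \<delta>" .
      also have "\<dots> \<le> 8 * M\<^sup>2 / \<delta>" using d0 by (intro divide_right_mono) auto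
      finally show ?thesis by (simp only: C_def)
    qed
    finally show ?thesis using l by simp
  qed
  show "F p = 0" "F q = 1" using F[OF p] F[OF q] nz by (auto simp: W_def)
  have "1 \<le> 2 * (h * \<bar>W1 p p\<bar>) / \<bar>W p q\<bar>" using W_far(2)[OF p q pq] Wpos by simp
  also have "\<dots> = 2 * (h * \<bar>nder I 1 F p\<bar>)" using n1[OF p] by simp
  also have "\<dots> \<le> C * (h * \<bar>nder I 1 F p\<bar>)"
    using M0 h0 by (intro mult_right_mono) (auto simp: C_def)
  finally show "1 \<le> C * (h * \<bar>nder I 1 F p\<bar>)" .
qed

lemma bernstein_like_base: "bernstein_like 1 (8 * M\<^sup>2 / \<delta> + 3) (bern_U n u v a b (Suc 0))"
proof -
  have e: "a \<in> I" "b \<in> I" "\<bar>b - a\<bar> = h" "\<bar>a - b\<bar> = h" using ab by auto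
  have pos: "0 < h * \<delta> / 2" using h0 d0 by simp
  have nz: "W a b \<noteq> 0" "W b a \<noteq> 0"
    using W_far(1)[OF e(1,2,3)] W_far(1)[OF e(2,1,4)] pos by auto
  let ?F = "bern_U n u v a b (Suc 0)"
  have F1: "\<forall>x\<in>I. ?F 1 x = W a x / W a b"
  proof
    fix x assume that: "x \<in> I"
    have "bern_start n u v a b (W a a / W a b) (W a b / W a b) x = W a x / W a b"
      by (rule bern_start_eq[where \<alpha>="- v2 a / W a b" and \<beta>="u2 a / W a b"])
         (use that in \<open>auto simp: W_def diff_divide_distrib\<close>)
    then show "?F 1 x = W a x / W a b" using nz by (simp add: W_def)
  qed
  have F0: "\<forall>x\<in>I. ?F 0 x = W b x / W b a"
  proof
    fix x assume that: "x \<in> I"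
    have "bern_start n u v a b (W b a / W b a) (W b b / W b a) x = W b x / W b a"
      by (rule bern_start_eq[where \<alpha>="- v2 b / W b a" and \<beta>="u2 b / W b a"])
         (use that in \<open>auto simp: W_def diff_divide_distrib\<close>)
    then show "?F 0 x = W b x / W b a" using nz by (simp add: W_def)
  qed
  note H1 = hat_facts[OF e(1,2,3) F1] and H0 = hat_facts[OF e(2,1,4) F0]
  have C0: "1 \<le> 8 * M\<^sup>2 / \<delta> + 3" using d0 by (simp add: add_increasing)
  have B0: "Bernstein 1 0 ((x - a) / h) = (x - b) / (a - b)" for x
  proof -
    have "(x - b) / (a - b) = 1 - (x - a) / (b - a)"
      using ab by (simp add: divide_simps) (simp add: algebra_simps)?
    then show ?thesis by (simp add: Bernstein_def)
  qed
  have B1: "Bernstein 1 1 ((x - a) / h) = (x - a) / (b - a)" for x by (simp add: Bernstein_def)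
  have i01: "i = 0 \<or> i = 1" if "i \<le> 1" for i :: nat using that by auto
  show ?thesis unfolding bernstein_like_def
  proof (intro allI impI, goal_cases)
    case (1 i)
    from i01[OF 1] show ?case
    proof
      assume i: "i = 0"
      show ?thesis unfolding i
      proof (intro conjI allI impI ballI)
        show "\<exists>\<alpha> \<beta>. \<forall>x\<in>I. nder I (1 - 1) (?F 0) x = \<alpha> * u2 x + \<beta> * v2 x"
          using H0(2) by (simp only: diff_self_eq_0 nder_0)
        show "\<bar>?F 0 x - Bernstein 1 0 ((x - a) / h)\<bar> \<le> (8 * M\<^sup>2 / \<delta> + 3) * h" if "x \<in> I" for x
          unfolding B0 by (rule H0(3)[OF that])
        show "nder I l (?F 0) b = 0" if "l < 1 - 0" for l
          using H0(5) that by (simp del: bern_U.simps)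
        show "1 \<le> (8 * M\<^sup>2 / \<delta> + 3) * (h ^ 0 * \<bar>nder I 0 (?F 0) a\<bar>)"
          using H0(6) C0 by (simp del: bern_U.simps)
        show "1 \<le> (8 * M\<^sup>2 / \<delta> + 3) * (h ^ (1 - 0) * \<bar>nder I (1 - 0) (?F 0) b\<bar>)"
          using H0(7) by (simp only: diff_zero power_one_right)
      qed (rule H0(1), use H0(4) in auto)
    next
      assume i: "i = 1"
      show ?thesis unfolding i
      proof (intro conjI allI impI ballI)
        show "\<exists>\<alpha> \<beta>. \<forall>x\<in>I. nder I (1 - 1) (?F 1) x = \<alpha> * u2 x + \<beta> * v2 x"
          using H1(2) by (simp only: diff_self_eq_0 nder_0)
        show "\<bar>?F 1 x - Bernstein 1 1 ((x - a) / h)\<bar> \<le> (8 * M\<^sup>2 / \<delta> + 3) * h" if "x \<in> I" for x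
          unfolding B1 by (rule H1(3)[OF that])
        show "nder I l (?F 1) a = 0" if "l < 1" for l
          using H1(5) that by (simp del: bern_U.simps)
        show "1 \<le> (8 * M\<^sup>2 / \<delta> + 3) * (h ^ 1 * \<bar>nder I 1 (?F 1) a\<bar>)"
          using H1(7) by (simp only: power_one_right)
        show "1 \<le> (8 * M\<^sup>2 / \<delta> + 3) * (h ^ (1 - 1) * \<bar>nder I (1 - 1) (?F 1) b\<bar>)"
          using H1(6) C0 by (simp del: bern_U.simps)
      qed (rule H1(1), use H1(4) in auto)
    qed
  qed
qed

end

context good_interval
begin

lemma quotient_split: "d \<noteq> 0 \<Longrightarrow> t \<noteq> 0 \<Longrightarrow> y / d - K / t * z = ((y - z) * t + (z * t - z * K * d)) / (d * t)"
  for d :: real by (simp add: field_simps)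

text \<open>One integration step. The integrals \<open>d i\<close> of the old functions agree with the common integral
  \<open>h / (k + 1)\<close> of the Bernstein polynomials up to \<open>C * h\<^sup>2\<close>, so for small \<open>h\<close> they are comparable to \<open>h\<close>. The
  derivatives of the new functions are differences of the old functions divided by these integrals, exactly as
  for the Bernstein polynomials, and all properties are inherited through this formula.\<close>

lemma bernstein_like_step:
  assumes B: "bernstein_like k C F" and C1: "1 \<le> C" and sm: "2 * (real k + 1) * C * h \<le> 1"
    and G: "\<And>i s. i \<le> Suc k \<Longrightarrow> s \<in> I \<Longrightarrow> G i s = (if i = 0 then 1 - bern_V a b (F 0) s
          else if i \<le> k then bern_V a b (F (i - 1)) s - bern_V a b (F i) s
          else bern_V a b (F (i - 1)) s)"
    and k1: "1 \<le> k"
  shows "bernstein_like (Suc k) (1 + 4 * (real k + 1) * (real k + 2) * C + 4 * (real k + 1) * C + 2 * C) G"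
proof -
  note BD = bernstein_likeD[OF B]
  define K where "K = real k + 1"
  have K: "K = real (Suc k)" "1 \<le> K" by (auto simp: K_def)
  define d where "d i = integral I (F i)" for i
  have aI: "a \<in> I" and bI: "b \<in> I" using ab by auto
  have cF: "continuous_on I (F i)" if "i \<le> k" for i
    using Ck_on_cont[OF BD(1)[OF that], of 0] by simp
  let ?t = "\<lambda>x. (x - a) / h"
  have t01: "0 \<le> ?t x" "?t x \<le> 1" if "x \<in> I" for x using that h0 by auto
  have dnear: "\<bar>d i - h / K\<bar> \<le> C * h * h" if "i \<le> k" for i
  proof -
    have "((\<lambda>x. F i x - Bernstein k i (?t x)) has_integral d i - h / K) I"
      unfolding d_def K using cF[OF that]
      by (intro has_integral_diff Bernstein_integral[OF ab that]) (auto intro: integrable_integral integrable_continuous_real)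
    from has_integral_bound_real[OF _ _ this, of "C * h"] show ?thesis
      using BD(3)[OF that] C1 h0 by auto
  qed
  have sm': "K * C * h \<le> 1 / 2"
  proof -
    have "2 * (real k + 1) * C * h = 2 * (K * C * h)" by (simp add: K_def)
    then show ?thesis using sm by linarith
  qed
  have Ch: "C * h * h \<le> h / K / 2"
  proof -
    have "(K * C * h) * h \<le> 1 / 2 * h" using sm' h0 by (intro mult_right_mono) auto
    then show ?thesis using K by (simp add: field_simps)
  qed
  have dlow: "h / (2 * K) \<le> d i" and dup: "d i \<le> 2 * h" if "i \<le> k" for i
  proof -
    have "h / K \<le> h / 1" using K(2) h0 by (intro divide_left_mono) auto
    then show "h / (2 * K) \<le> d i" "d i \<le> 2 * h" using dnear[OF that] Ch h0 by auto
  qed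
  have hK: "0 < h / (2 * K)" using h0 K by simp
  have dpos: "0 < d i" if "i \<le> k" for i using dlow[OF that] hK by linarith
  have hd: "h / d i \<le> 2 * K" if "i \<le> k" for i
    using dlow[OF that] dpos[OF that] K(2) by (simp add: field_simps)
  have hd2: "1 / 2 \<le> h / d i" if "i \<le> k" for i
    using dup[OF that] dpos[OF that] by (simp add: field_simps)
  have VD: "(bern_V a b (F i) has_real_derivative F i x / d i) (at x within I)" if "i \<le> k" "x \<in> I" for i x
    unfolding bern_V_def d_def by (intro DERIV_cdivide integral_has_real_derivative cF that)
  have Va: "bern_V a b (F i) a = 0" and Vb: "i \<le> k \<Longrightarrow> bern_V a b (F i) b = 1" for i
    using dpos[of i] by (auto simp: bern_V_def d_def)
  define c1 where "c1 i = (if i = 0 then 0 else 1 / d (i - 1))" for i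
  define c2 where "c2 i = (if i \<le> k then - 1 / d i else 0)" for i
  define g where "g i x = c1 i * F (i - 1) x + c2 i * F (min i k) x" for i x
  have GD: "(G i has_real_derivative g i x) (at x within I)" if i: "i \<le> Suc k" and x: "x \<in> I" for i x
  proof -
    have "((\<lambda>s. if i = 0 then 1 - bern_V a b (F 0) s
          else if i \<le> k then bern_V a b (F (i - 1)) s - bern_V a b (F i) s
          else bern_V a b (F (i - 1)) s) has_real_derivative g i x) (at x within I)"
      using i x unfolding g_def c1_def c2_def
      by (auto intro!: derivative_eq_intros VD)
    then show ?thesis unfolding has_real_derivative_iff_has_vector_derivative
      using G[OF i] x by (subst has_vector_derivative_cong_ev[where g="\<lambda>s. if i = 0 then 1 - bern_V a b (F 0) s
          else if i \<le> k then bern_V a b (F (i - 1)) s - bern_V a b (F i) s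
          else bern_V a b (F (i - 1)) s"]) (auto intro!: always_eventually)
  qed
  have gC: "Ck_on k I (g i)" if "i \<le> Suc k" for i
    unfolding g_def by (intro Ck_on_lin BD(1) nt) (use that in auto)
  have gn: "nder I l (g i) x = c1 i * nder I l (F (i - 1)) x + c2 i * nder I l (F (min i k)) x"
    if "i \<le> Suc k" "l \<le> k" "x \<in> I" for i l x
    unfolding g_def by (intro nder_lin[of k] BD(1) nt) (use that in auto)
  have GC: "Ck_on (Suc k) I (G i)" if "i \<le> Suc k" for i
    using antideriv_family(1)[OF nt GD[OF that] gC[OF that]] .
  have Gn: "nder I (Suc l) (G i) x = c1 i * nder I l (F (i - 1)) x + c2 i * nder I l (F (min i k)) x"
    if "i \<le> Suc k" "l \<le> k" "x \<in> I" for i l x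
    using antideriv_family(2)[OF nt GD[OF that(1)] gC[OF that(1)] that(2,3)] gn[OF that] by simp
  have Gtop: "\<exists>\<alpha> \<beta>. \<forall>x\<in>I. nder I (Suc k - 1) (G i) x = \<alpha> * u2 x + \<beta> * v2 x" if "i \<le> Suc k" for i
  proof -
    have "i - 1 \<le> k" using that by simp
    then obtain \<alpha> \<beta> where 1: "\<And>x. x \<in> I \<Longrightarrow> nder I (k - 1) (F (i - 1)) x = \<alpha> * u2 x + \<beta> * v2 x"
      using BD(2)[of "i - 1"] by blast
    obtain \<alpha>' \<beta>' where 2: "\<And>x. x \<in> I \<Longrightarrow> nder I (k - 1) (F (min i k)) x = \<alpha>' * u2 x + \<beta>' * v2 x"
      using BD(2)[of "min i k"] min.cobounded2 by blast
    have "nder I (Suc k - 1) (G i) x = (c1 i * \<alpha> + c2 i * \<alpha>') * u2 x + (c1 i * \<beta> + c2 i * \<beta>') * v2 x"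
      if x: "x \<in> I" for x
      using Gn[OF \<open>i \<le> Suc k\<close> _ x, of "k - 1"] 1[OF x] 2[OF x] k1 by (simp add: algebra_simps)
    then show ?thesis by blast
  qed
  \<comment> \<open>normalising the integrals turns an error of order \<open>h\<close> into a derivative error of order one\<close>
  define C2 where "C2 = 2 * K * (K + 1) * C"
  have C20: "0 \<le> C2" using K C1 by (simp add: C2_def)
  have quot: "\<bar>F i x / d i - K / h * Bernstein k i (?t x)\<bar> \<le> C2" if "i \<le> k" "x \<in> I" for i x
  proof -
    let ?b = "Bernstein k i (?t x)"
    have b: "\<bar>?b\<bar> \<le> 1" using Bernstein_le_1[OF t01[OF that(2)] that(1)] Bernstein_nonneg[OF t01[OF that(2)]] by simp
    have e1: "\<bar>(F i x - ?b) * h\<bar> \<le> C * h * h" unfolding abs_mult using BD(3)[OF that] h0 by (intro mult_mono) auto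
    have e2: "\<bar>?b * (K * (h / K - d i))\<bar> \<le> 1 * (K * (C * h * h))"
      unfolding abs_mult using b dnear[OF that(1)] K by (intro mult_mono) (auto simp: abs_minus_commute)
    have e2': "?b * (K * (h / K - d i)) = ?b * h - ?b * K * d i"
    proof -
      have "?b * (K * (h / K - d i)) = ?b * (K * (h / K)) - ?b * K * d i"
        by (simp only: right_diff_distrib mult.assoc)
      moreover have "K * (h / K) = h" using K by simp
      ultimately show ?thesis by simp
    qed
    have "F i x / d i - K / h * ?b = ((F i x - ?b) * h + ?b * (K * (h / K - d i))) / (d i * h)"
      unfolding e2' by (rule quotient_split) (use dpos[OF that(1)] ab in auto)
    also have "\<bar>\<dots>\<bar> \<le> ((K + 1) * C * h * h) / (h / (2 * K) * h)"
      unfolding abs_divide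
    proof (rule frac_le)
      show "\<bar>(F i x - ?b) * h + ?b * (K * (h / K - d i))\<bar> \<le> (K + 1) * C * h * h"
        using e1 e2 by (simp add: algebra_simps)
      show "h / (2 * K) * h \<le> \<bar>d i * h\<bar>"
        unfolding abs_mult using dlow[OF that(1)] dpos[OF that(1)] h0 by (intro mult_mono) auto
    qed (use h0 hK K C1 in auto)
    also have "\<dots> = C2"
    proof -
      have "((K + 1) * C * t * t) / (t / (2 * K) * t) = C2" if "0 < t" for t
        using that K unfolding C2_def by (simp add: field_simps)
      from this[OF h0] show ?thesis .
    qed
    finally show ?thesis .
  qed
  have Ga: "G i a = (if i = 0 then 1 else 0)" if "i \<le> Suc k" for i
    using G[OF that aI] Va by simp
  have Gb: "G i b = (if i = Suc k then 1 else 0)" if "i \<le> Suc k" for i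
    using G[OF that bI] Vb that by auto
  have near: "\<bar>G i x - Bernstein (Suc k) i (?t x)\<bar> \<le> 2 * C2 * h" if i: "i \<le> Suc k" and x: "x \<in> I" for i x
  proof -
    let ?D = "\<lambda>x. G i x - Bernstein (Suc k) i (?t x)"
    let ?B = "\<lambda>x. real (Suc k) * ((if i = 0 then 0 else Bernstein k (i - 1) (?t x)) - (if i \<le> k then Bernstein k i (?t x) else 0)) * (1 / h)"
    have DD: "(?D has_real_derivative g i x - ?B x) (at x within I)" if "x \<in> I" for x
    proof (rule DERIV_diff[OF GD[OF i that]])
      show "((\<lambda>x. Bernstein (Suc k) i (?t x)) has_real_derivative ?B x) (at x within I)"
        by (rule DERIV_chain2[OF Bernstein_deriv[OF i]]) (use ab in \<open>auto intro!: derivative_eq_intros\<close>)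
    qed
    have bd: "\<bar>g i y - ?B y\<bar> \<le> 2 * C2" if y: "y \<in> I" for y
    proof -
      have "g i y - ?B y = (if i = 0 then 0 else F (i - 1) y / d (i - 1) - K / h * Bernstein k (i - 1) (?t y))
         - (if i \<le> k then F i y / d i - K / h * Bernstein k i (?t y) else 0)"
        unfolding g_def c1_def c2_def K(1)[symmetric] by (auto simp: algebra_simps diff_divide_distrib)
      also have "\<bar>\<dots>\<bar> \<le> C2 + C2"
        using quot[OF _ y, of "i - 1"] quot[OF _ y, of i] C20 i
        by (intro order.trans[OF abs_triangle_ineq4] add_mono) auto
      finally show ?thesis by simp
    qed
    have "\<bar>?D x - ?D a\<bar> \<le> 2 * C2 * \<bar>x - a\<bar>"
      by (rule mvt_bound[OF DD bd x aI]) auto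
    also have "\<dots> \<le> 2 * C2 * h" using x C20 by (intro mult_left_mono) auto
    also have "?D a = 0" using Ga[OF i] by (simp add: Bernstein_0)
    finally show ?thesis by simp
  qed
  define C' where "C' = 1 + 2 * C2 + 4 * K * C + 2 * C"
  have C'ge: "2 * C2 \<le> C'" "1 + 2 * C2 \<le> C'" "4 * K * C \<le> C'" "2 * C \<le> C'" "1 \<le> C'"
    using C20 K C1 by (auto simp: C'_def)
  have c1b: "h * \<bar>c1 i\<bar> \<le> 2 * K" if "i \<le> Suc k" for i
  proof -
    have "i - 1 \<le> k" using that by simp
    from hd[OF this] dpos[OF this] K(2) show ?thesis by (auto simp: c1_def)
  qed
  have c2b: "h * \<bar>c2 i\<bar> \<le> 2 * K" if "i \<le> Suc k" for i
    using hd[of i] dpos[of i] K(2) by (auto simp: c2_def)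
  show ?thesis unfolding bernstein_like_def
  proof (intro allI impI, goal_cases)
    case (1 i)
    have low: "1 \<le> C' * (h * c * (h ^ j * y))" if "1 / 2 \<le> h * c" "1 \<le> C * (h ^ j * y)" "0 \<le> y" for c y j
    proof -
      have "1 \<le> C * (h ^ j * y) * 1" using that by simp
      also have "\<dots> \<le> C * (h ^ j * y) * (2 * (h * c))" using that C1 h0 by (intro mult_left_mono) auto
      also have "\<dots> = 2 * C * (h * c * (h ^ j * y))" by (simp add: algebra_simps)
      also have "\<dots> \<le> C' * (h * c * (h ^ j * y))"
        using C'ge(4) that h0 by (intro mult_right_mono) auto
      finally show ?thesis .
    qed
    have eqC: "1 + 4 * (real k + 1) * (real k + 2) * C + 4 * (real k + 1) * C + 2 * C = C'"
      unfolding C'_def C2_def K_def by (simp add: algebra_simps)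
    show ?case unfolding eqC
    proof (intro conjI allI impI ballI)
      show "Ck_on (Suc k) I (G i)" by (rule GC[OF 1])
      show "\<exists>\<alpha> \<beta>. \<forall>x\<in>I. nder I (Suc k - 1) (G i) x = \<alpha> * u2 x + \<beta> * v2 x" by (rule Gtop[OF 1])
    next
      fix x assume x: "x \<in> I"
      have "\<bar>G i x - Bernstein (Suc k) i (?t x)\<bar> \<le> 2 * C2 * h" by (rule near[OF 1 x])
      also have "\<dots> \<le> C' * h" using C'ge h0 by (intro mult_right_mono) auto
      finally show "\<bar>G i x - Bernstein (Suc k) i (?t x)\<bar> \<le> C' * h" .
    next
      fix l x assume l: "l \<le> Suc k" and x: "x \<in> I"
      show "h ^ l * \<bar>nder I l (G i) x\<bar> \<le> C'"
      proof (cases l)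
        case 0
        have "\<bar>G i x\<bar> \<le> 1 + 2 * C2 * h"
          using near[OF 1 x] Bernstein_le_1[OF t01[OF x] 1] Bernstein_nonneg[OF t01[OF x], of "Suc k" i] by linarith
        also have "\<dots> \<le> 1 + 2 * C2 * 1" using C20 h1 by (intro add_left_mono mult_left_mono) auto
        finally show ?thesis using 0 C'ge by simp
      next
        case (Suc m)
        have m: "m \<le> k" using l Suc by simp
        have F1: "h ^ m * \<bar>nder I m (F (i - 1)) x\<bar> \<le> C" "h ^ m * \<bar>nder I m (F (min i k)) x\<bar> \<le> C"
          by (intro BD(4)[OF _ m x]; use 1 in auto)+
        have "h ^ l * \<bar>nder I l (G i) x\<bar> \<le> h ^ l * (\<bar>c1 i * nder I m (F (i - 1)) x\<bar> + \<bar>c2 i * nder I m (F (min i k)) x\<bar>)"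
          unfolding Suc Gn[OF 1 m x] using h0 by (intro mult_left_mono abs_triangle_ineq) auto
        also have "\<dots> = (h * \<bar>c1 i\<bar>) * (h ^ m * \<bar>nder I m (F (i - 1)) x\<bar>) + (h * \<bar>c2 i\<bar>) * (h ^ m * \<bar>nder I m (F (min i k)) x\<bar>)"
          by (simp add: Suc abs_mult algebra_simps)
        also have "\<dots> \<le> 2 * K * C + 2 * K * C"
          by (intro add_mono mult_mono[OF c1b[OF 1] F1(1)] mult_mono[OF c2b[OF 1] F1(2)]) (use h0 K(2) in auto)
        finally show ?thesis using C'ge(3) by linarith
      qed
    next
      fix l assume l: "l < i"
      show "nder I l (G i) a = 0"
      proof (cases l)
        case 0 then show ?thesis using Ga[OF 1] l by simp
      next
        case (Suc m)
        have "nder I m (F (i - 1)) a = 0" by (rule BD(5)) (use 1 l Suc in auto)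
        moreover have "c2 i * nder I m (F (min i k)) a = 0"
          using BD(5)[of i m] 1 l Suc by (cases "i \<le> k") (auto simp: c2_def)
        ultimately show ?thesis using Gn[OF 1 _ aI, of m] l 1 Suc by simp
      qed
    next
      fix l assume l: "l < Suc k - i"
      show "nder I l (G i) b = 0"
      proof (cases l)
        case 0 then show ?thesis using Gb[OF 1] l by simp
      next
        case (Suc m)
        have "c1 i * nder I m (F (i - 1)) b = 0"
          using BD(6)[of "i - 1" m] 1 l Suc by (cases "i = 0") (auto simp: c1_def)
        moreover have "c2 i * nder I m (F (min i k)) b = 0"
          using BD(6)[of i m] 1 l Suc by (cases "i \<le> k") (auto simp: c2_def)
        moreover have "nder I (Suc m) (G i) b = c1 i * nder I m (F (i - 1)) b + c2 i * nder I m (F (min i k)) b"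
          by (rule Gn[OF 1 _ bI]) (use l Suc in auto)
        ultimately show ?thesis unfolding Suc by linarith
      qed
    next
      show "1 \<le> C' * (h ^ i * \<bar>nder I i (G i) a\<bar>)"
      proof (cases i)
        case 0 then show ?thesis using Ga[OF 1] C'ge by simp
      next
        case (Suc j)
        have j: "j \<le> k" using 1 Suc by simp
        have "c2 i * nder I j (F (min i k)) a = 0"
          using BD(5)[of i j] Suc by (cases "i \<le> k") (auto simp: c2_def)
        then have e: "nder I i (G i) a = 1 / d j * nder I j (F j) a"
          using Gn[OF 1 j aI] Suc by (simp add: c1_def)
        show ?thesis using low[of "1 / d j" j "\<bar>nder I j (F j) a\<bar>"] hd2[OF j] BD(7)[OF j] dpos[OF j]
          unfolding e by (simp add: Suc abs_mult mult_ac)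
      qed
    next
      show "1 \<le> C' * (h ^ (Suc k - i) * \<bar>nder I (Suc k - i) (G i) b\<bar>)"
      proof (cases "i = Suc k")
        case True then show ?thesis using Gb[OF 1] C'ge by simp
      next
        case False
        then have ik: "i \<le> k" using 1 by simp
        then have S: "Suc k - i = Suc (k - i)" by simp
        have "c1 i * nder I (k - i) (F (i - 1)) b = 0"
          using BD(6)[of "i - 1" "k - i"] ik by (cases "i = 0") (auto simp: c1_def)
        then have e: "nder I (Suc (k - i)) (G i) b = - (1 / d i * nder I (k - i) (F i) b)"
          using Gn[OF 1 _ bI, of "k - i"] ik by (simp add: c2_def)
        show ?thesis using low[of "1 / d i" "k - i" "\<bar>nder I (k - i) (F i) b\<bar>"] hd2[OF ik] BD(8)[OF ik] dpos[OF ik]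
          unfolding S e by (simp add: abs_mult mult_ac)
      qed
    qed
  qed
qed

end

text \<open>On short intervals the generalised Bernstein functions are as good as the polynomial ones:
  each integration step keeps the distance to the Bernstein polynomials of order \<open>b - a\<close>.\<close>

lemma bern_U_bounds:
  assumes "1 \<le> M" "0 < \<delta>" "1 \<le> k"
  shows "\<exists>C h0. 1 \<le> C \<and> 0 < h0 \<and>
    (\<forall>n u v a b. good n u v M \<delta> a b \<longrightarrow> b - a \<le> h0 \<longrightarrow> good_interval.bernstein_like n u v a b k C (bern_U n u v a b k))"
  using assms(3)
proof (induction k rule: dec_induct)
  case base
  have "good_interval.bernstein_like n u v a b 1 (8 * M\<^sup>2 / \<delta> + 3) (bern_U n u v a b 1)"
    if g: "good n u v M \<delta> a b" and h: "b - a \<le> \<delta> / (4 * M\<^sup>2)" for n u v a b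
  proof -
    have "0 < 4 * M\<^sup>2" using assms by simp
    then have "4 * M\<^sup>2 * (b - a) \<le> \<delta>" using h by (simp add: field_simps)
    then interpret short_interval n u v M \<delta> a b using g by unfold_locales auto
    from bernstein_like_base show ?thesis by simp
  qed
  moreover have "1 \<le> 8 * M\<^sup>2 / \<delta> + 3" "0 < \<delta> / (4 * M\<^sup>2)" using assms by (auto simp: add_increasing)
  ultimately show ?case by blast
next
  case (step k)
  then obtain C h0 where C: "1 \<le> C" "0 < h0"
    and IH: "\<And>n u v a b. good n u v M \<delta> a b \<Longrightarrow> b - a \<le> h0 \<Longrightarrow> good_interval.bernstein_like n u v a b k C (bern_U n u v a b k)"
    by blast
  let ?C = "1 + 4 * (real k + 1) * (real k + 2) * C + 4 * (real k + 1) * C + 2 * C"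
  let ?h = "min h0 (1 / (2 * (real k + 1) * C))"
  have pos: "0 < 2 * (real k + 1) * C" using C by simp
  have "good_interval.bernstein_like n u v a b (Suc k) ?C (bern_U n u v a b (Suc k))"
    if g: "good n u v M \<delta> a b" and h: "b - a \<le> ?h" for n u v a b
  proof -
    interpret good_interval n u v M \<delta> a b using g by unfold_locales
    obtain m where m: "k = Suc m" using step(1) by (cases k) auto
    show ?thesis
    proof (rule bernstein_like_step[OF IH[OF g]])
      have "(b - a) \<le> 1 / (2 * (real k + 1) * C)" using h by simp
      then show "2 * (real k + 1) * C * (b - a) \<le> 1" using pos by (simp add: field_simps)
    qed (use h C m in auto)
  qed
  moreover have "1 \<le> ?C" using C by simp
  moreover have "0 < ?h" using C pos by simp
  ultimately show ?case by blast
qed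

section \<open>Two-point Hermite interpolation and stable dual functionals\<close>

lemma triangular_solve:
  fixes T :: "nat \<Rightarrow> nat \<Rightarrow> real"
  assumes "\<And>l. l < N \<Longrightarrow> T l l \<noteq> 0"
  shows "\<exists>c. \<forall>l<N. (\<Sum>k\<le>l. c k * T l k) = y l"
  using assms
proof (induction N)
  case 0
  then show ?case by simp
next
  case (Suc N)
  then obtain c where c: "\<And>l. l < N \<Longrightarrow> (\<Sum>k\<le>l. c k * T l k) = y l" by auto
  let ?c = "c(N := (y N - (\<Sum>k<N. c k * T N k)) / T N N)"
  have "(\<Sum>k\<le>l. ?c k * T l k) = y l" if "l < Suc N" for l
  proof (cases "l = N")
    case True
    have "(\<Sum>k\<le>N. ?c k * T N k) = (\<Sum>k<N. ?c k * T N k) + ?c N * T N N"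
      by (simp add: lessThan_Suc_atMost[symmetric])
    also have "(\<Sum>k<N. ?c k * T N k) = (\<Sum>k<N. c k * T N k)" by (intro sum.cong) auto
    finally show ?thesis using True Suc.prems[of N] by simp
  next
    case False
    then have "(\<Sum>k\<le>l. ?c k * T l k) = (\<Sum>k\<le>l. c k * T l k)" using that by (intro sum.cong) auto
    then show ?thesis using c[of l] False that by simp
  qed
  then show ?case by blast
qed

lemma triangular_bound:
  fixes T :: "nat \<Rightarrow> nat \<Rightarrow> real"
  assumes y: "\<And>l. l < N \<Longrightarrow> \<bar>\<Sum>k\<le>l. c k * T l k\<bar> \<le> e"
    and T: "\<And>l k. l < N \<Longrightarrow> k \<le> l \<Longrightarrow> \<bar>T l k\<bar> \<le> C"
    and d: "\<And>l. l < N \<Longrightarrow> 1 \<le> C * \<bar>T l l\<bar>" and C: "1 \<le> C" and e0: "0 \<le> e"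
  shows "l < N \<Longrightarrow> \<bar>c l\<bar> \<le> C * (1 + C\<^sup>2) ^ l * e"
proof -
  have cl: "\<bar>c l\<bar> \<le> C * (e + C * (\<Sum>k<l. \<bar>c k\<bar>))" if l: "l < N" for l
  proof -
    have "(\<Sum>k\<le>l. c k * T l k) = (\<Sum>k<l. c k * T l k) + c l * T l l"
      by (simp add: lessThan_Suc_atMost[symmetric])
    then have "\<bar>c l * T l l\<bar> \<le> e + \<bar>\<Sum>k<l. c k * T l k\<bar>" using y[OF l] by linarith
    also have "\<bar>\<Sum>k<l. c k * T l k\<bar> \<le> (\<Sum>k<l. \<bar>c k\<bar> * C)"
      using T[OF l] by (intro sum_abs[THEN order.trans] sum_mono) (auto simp: abs_mult intro!: mult_left_mono)
    finally have 1: "\<bar>c l * T l l\<bar> \<le> e + C * (\<Sum>k<l. \<bar>c k\<bar>)" by (simp add: sum_distrib_left mult.commute)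
    have "\<bar>c l\<bar> * 1 \<le> \<bar>c l\<bar> * (C * \<bar>T l l\<bar>)" using d[OF l] by (intro mult_left_mono) auto
    also have "\<dots> = C * \<bar>c l * T l l\<bar>" by (simp add: abs_mult)
    also have "\<dots> \<le> C * (e + C * (\<Sum>k<l. \<bar>c k\<bar>))" using 1 C by (intro mult_left_mono) auto
    finally show ?thesis by simp
  qed
  have S: "e + C * (\<Sum>k<l. \<bar>c k\<bar>) \<le> (1 + C\<^sup>2) ^ l * e" if "l \<le> N" for l
    using that
  proof (induction l)
    case (Suc l)
    let ?s = "e + C * (\<Sum>k<l. \<bar>c k\<bar>)"
    have "e + C * (\<Sum>k<Suc l. \<bar>c k\<bar>) = ?s + C * \<bar>c l\<bar>" by (simp add: algebra_simps)
    also have "\<dots> \<le> ?s + C * (C * ?s)" using cl[of l] Suc.prems C by (intro add_left_mono mult_left_mono) auto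
    also have "\<dots> = (1 + C\<^sup>2) * ?s" by (simp add: algebra_simps power2_eq_square)
    also have "\<dots> \<le> (1 + C\<^sup>2) * ((1 + C\<^sup>2) ^ l * e)" using Suc by (intro mult_left_mono) auto
    finally show ?case by (simp add: mult.assoc)
  qed simp
  assume l: "l < N"
  show "\<bar>c l\<bar> \<le> C * (1 + C\<^sup>2) ^ l * e"
    using order.trans[OF cl[OF l] mult_left_mono[OF S[of l], of C]] l C by (simp add: mult.assoc)
qed

text \<open>Ends of an interval are truth values: \<open>False\<close> is the lower end. \<open>idx n \<sigma>\<close> counts the indices
  \<open>0..n-1\<close> from the end \<open>\<sigma>\<close>.\<close>

definition endpt :: "bool \<Rightarrow> real \<Rightarrow> real \<Rightarrow> real" where "endpt \<sigma> a b = (if \<sigma> then b else a)"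
definition idx :: "nat \<Rightarrow> bool \<Rightarrow> nat \<Rightarrow> nat" where "idx n \<sigma> i = (if \<sigma> then n - 1 - i else i)"

lemma idx_lt [simp]: "i < n \<Longrightarrow> idx n \<sigma> i < n" by (auto simp: idx_def)
lemma idx_idx [simp]: "i < n \<Longrightarrow> idx n \<sigma> (idx n \<sigma> i) = i" by (auto simp: idx_def)
lemma idx_bij: "bij_betw (idx n \<sigma>) {..<n} {..<n}"
  by (rule bij_betwI[of _ _ _ "idx n \<sigma>"]) auto

text \<open>Indices close to an end of the interval carry Hermite data, the others carry coefficients.\<close>

definition mid_index :: "nat \<Rightarrow> nat \<Rightarrow> nat \<Rightarrow> bool" where
  "mid_index n r i \<longleftrightarrow> r < i \<and> r < n - 1 - i"

definition bern_coef :: "nat \<Rightarrow> (real \<Rightarrow> real) \<Rightarrow> (real \<Rightarrow> real) \<Rightarrow> real \<Rightarrow> real \<Rightarrow> (real \<Rightarrow> real) \<Rightarrow> nat \<Rightarrow> real" where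
  "bern_coef n u v a b g = (SOME c. \<forall>x\<in>{a..b}. g x = (\<Sum>k<n. c k * bern n u v a b k x))"

text \<open>Lower and upper indices carry derivatives at the ends, scaled by the length of the interval so
  that all functionals have the same size; middle indices carry Bernstein coefficients.\<close>

definition dual_fun :: "nat \<Rightarrow> nat \<Rightarrow> (real \<Rightarrow> real) \<Rightarrow> (real \<Rightarrow> real) \<Rightarrow> real \<Rightarrow> real \<Rightarrow> nat \<Rightarrow> (real \<Rightarrow> real) \<Rightarrow> real" where
  "dual_fun n r u v a b l g = (if l \<le> r then (b - a) ^ l * nder {a..b} l g a
     else if n - 1 - l \<le> r then (b - a) ^ (n - 1 - l) * nder {a..b} (n - 1 - l) g b
     else bern_coef n u v a b g l)"

definition dual_elt :: "nat \<Rightarrow> nat \<Rightarrow> (real \<Rightarrow> real) \<Rightarrow> (real \<Rightarrow> real) \<Rightarrow> real \<Rightarrow> real \<Rightarrow> nat \<Rightarrow> real \<Rightarrow> real" where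
  "dual_elt n r u v a b l = (SOME g. g \<in> uspace n u v {a..b} \<and>
     (\<forall>m<n. dual_fun n r u v a b m g = (if m = l then 1 else 0)))"

locale bernstein_interval = good_interval +
  fixes r :: nat and C :: real
  assumes rn: "2 * r + 2 \<le> n" and C1: "1 \<le> C"
    and BI: "bernstein_like (n - 1) C (bern n u v a b)"
begin

abbreviation "B \<equiv> bern n u v a b"
abbreviation "E \<equiv> uspace n u v I"
abbreviation "la \<equiv> dual_fun n r u v a b"
abbreviation "A \<equiv> dual_elt n r u v a b"
abbreviation "co \<equiv> bern_coef n u v a b"
definition "Ct = C * (1 + C\<^sup>2) ^ n"

lemma Ct1: "1 \<le> Ct"
proof -
  have "1 * 1 \<le> C * (1 + C\<^sup>2) ^ n" using C1 by (intro mult_mono one_le_power) auto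
  then show ?thesis by (simp add: Ct_def)
qed

lemma aI [simp]: "a \<in> I" and bI [simp]: "b \<in> I" and finI [simp]: "endpt \<sigma> a b \<in> I"
  using ab by (auto simp: endpt_def)

lemma ab_le [simp]: "a \<le> b" and fin_le [simp]: "a \<le> endpt \<sigma> a b" "endpt \<sigma> a b \<le> b"
  using ab by (auto simp: endpt_def)

lemma B_E: assumes "i < n" shows "B i \<in> E"
proof -
  have i: "i \<le> n - 1" using assms by simp
  have 2: "n - 1 - 1 = n - 2" by simp
  obtain \<alpha> \<beta> where "\<forall>x\<in>I. nder I (n - 2) (B i) x = \<alpha> * u2 x + \<beta> * v2 x"
    using bernstein_likeD(2)[OF BI i] unfolding 2 by blast
  then show ?thesis
    using Ck_on_mono[OF bernstein_likeD(1)[OF BI i], of "n - 2"] by (intro E_I) auto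
qed

lemma B_Ck: "i < n \<Longrightarrow> Ck_on n I (B i)" using E_Ck B_E by blast

text \<open>Rows are orders of derivatives at the end \<open>\<sigma>\<close>, columns are Bernstein functions counted from \<open>\<sigma>\<close>.\<close>

definition "T \<sigma> l k = h ^ l * nder I l (B (idx n \<sigma> k)) (endpt \<sigma> a b)"

lemma T_zero: "l < k \<Longrightarrow> k < n \<Longrightarrow> T \<sigma> l k = 0"
  using bernstein_likeD(5)[OF BI, of k l] bernstein_likeD(6)[OF BI, of "n - 1 - k" l] by (auto simp: T_def idx_def endpt_def)

lemma T_bound: "l < n \<Longrightarrow> k < n \<Longrightarrow> \<bar>T \<sigma> l k\<bar> \<le> C"
  using bernstein_likeD(4)[OF BI, of "idx n \<sigma> k" l "endpt \<sigma> a b"] idx_lt[of k n \<sigma>] h0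
  unfolding T_def abs_mult by (auto simp del: idx_lt)

lemma T_diag: "l < n \<Longrightarrow> 1 \<le> C * \<bar>T \<sigma> l l\<bar>"
  using bernstein_likeD(7)[OF BI, of l] bernstein_likeD(8)[OF BI, of "n - 1 - l"] h0
  by (auto simp: T_def idx_def endpt_def abs_mult)

lemma T_nz: "l < n \<Longrightarrow> T \<sigma> l l \<noteq> 0" using T_diag[of l \<sigma>] by auto

lemma B_bound: "i < n \<Longrightarrow> l < n \<Longrightarrow> x \<in> I \<Longrightarrow> h ^ l * \<bar>nder I l (B i) x\<bar> \<le> C"
  using bernstein_likeD(4)[OF BI, of i l x] by auto

lemma comb_E: "(\<lambda>x. \<Sum>k<n. c k * B k x) \<in> E"
  by (rule uspace_sum) (auto intro: B_E)

lemma comb_nder: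
  assumes "\<And>x. x \<in> I \<Longrightarrow> g x = (\<Sum>k<n. c k * B k x)" "l \<le> n" "x \<in> I"
  shows "nder I l g x = (\<Sum>k<n. c k * nder I l (B k) x)"
  by (rule nder_sum[of _ n]) (use assms nt B_Ck in auto)

text \<open>At an end of the interval the derivative of order \<open>l\<close> only sees the \<open>l + 1\<close> Bernstein functions
  next to that end, hence the triangular matrix \<open>T\<close>.\<close>

lemma comb_end:
  assumes g: "\<And>x. x \<in> I \<Longrightarrow> g x = (\<Sum>k<n. c k * B k x)" and l: "l < n"
  shows "h ^ l * nder I l g (endpt \<sigma> a b) = (\<Sum>k\<le>l. c (idx n \<sigma> k) * T \<sigma> l k)"
proof -
  have "h ^ l * nder I l g (endpt \<sigma> a b) = (\<Sum>k<n. c k * (h ^ l * nder I l (B k) (endpt \<sigma> a b)))"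
    using comb_nder[OF g, of l "endpt \<sigma> a b"] l by (simp add: sum_distrib_left mult_ac)
  also have "\<dots> = (\<Sum>k<n. c (idx n \<sigma> k) * T \<sigma> l k)"
    unfolding T_def by (rule sum.reindex_bij_betw[OF idx_bij, symmetric])
  also have "\<dots> = (\<Sum>k\<le>l. c (idx n \<sigma> k) * T \<sigma> l k)"
    using l by (intro sum.mono_neutral_right) (auto simp: T_zero)
  finally show ?thesis .
qed

lemma comb_coef_bound:
  assumes g: "\<And>x. x \<in> I \<Longrightarrow> g x = (\<Sum>k<n. c k * B k x)" and m: "m \<le> n"
    and e: "\<And>l. l < m \<Longrightarrow> h ^ l * \<bar>nder I l g (endpt \<sigma> a b)\<bar> \<le> e" and e0: "0 \<le> e" and l: "l < m"
  shows "\<bar>c (idx n \<sigma> l)\<bar> \<le> Ct * e"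
proof -
  have "\<bar>c (idx n \<sigma> l)\<bar> \<le> C * (1 + C\<^sup>2) ^ l * e"
  proof (rule triangular_bound[where T="T \<sigma>" and c="\<lambda>k. c (idx n \<sigma> k)" and N=m])
    fix l assume l: "l < m"
    have "\<bar>h ^ l * nder I l g (endpt \<sigma> a b)\<bar> \<le> e" using e[OF l] h0 by (simp add: abs_mult)
    then show "\<bar>\<Sum>k\<le>l. c (idx n \<sigma> k) * T \<sigma> l k\<bar> \<le> e" using comb_end[OF g, of l \<sigma>] l m by simp
  qed (use m l e0 C1 T_bound T_diag in auto)
  also have "\<dots> \<le> Ct * e"
    unfolding Ct_def using l m e0 C1 by (intro mult_right_mono mult_left_mono power_increasing) auto
  finally show ?thesis .
qed

text \<open>The triangular system at the lower end produces a combination with the same jet there, and an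
  element of the space is determined by its jet at one point.\<close>

lemma span_B: assumes g: "g \<in> E" shows "\<exists>c. \<forall>x\<in>I. g x = (\<Sum>k<n. c k * B k x)"
proof -
  obtain c where c: "\<And>l. l < n \<Longrightarrow> (\<Sum>k\<le>l. c k * T False l k) = h ^ l * nder I l g a"
    using triangular_solve[of n "T False" "\<lambda>l. h ^ l * nder I l g a"] T_nz by blast
  let ?f = "\<lambda>x. \<Sum>k<n. c k * B k x"
  have "nder I l ?f a = nder I l g a" if "l < n" for l
    using comb_end[of ?f c l False] c[OF that] that h0 by (simp add: idx_def endpt_def)
  then have z: "nder I l (\<lambda>x. g x - ?f x) a = 0" if "l < n" for l
    using nder_diff[OF E_Ck[OF g] E_Ck[OF comb_E[of c]] nt, of l a] that by simp
  have "g x - ?f x = 0" if "x \<in> I" for x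
    using E_zero_jet[OF uspace_diff[OF g comb_E[of c]] aI z, of 0 x] that by simp
  then show ?thesis by (intro exI[of _ c] ballI) simp
qed

lemma comb_unique:
  assumes "\<And>x. x \<in> I \<Longrightarrow> (\<Sum>k<n. c k * B k x) = (\<Sum>k<n. d k * B k x)" "k < n"
  shows "c k = d k"
proof -
  have "\<bar>(\<lambda>k. c k - d k) (idx n False k)\<bar> \<le> Ct * 0"
  proof (rule comb_coef_bound[where g="\<lambda>_. 0" and m=n])
    show "h ^ l * \<bar>nder I l (\<lambda>_. 0) (endpt False a b)\<bar> \<le> 0" if "l < n" for l
      using nder_family[where G="\<lambda>_ _. 0" and g="\<lambda>_. 0" and k=l and i=l and S=I and x="endpt False a b"] nt by simp
  qed (use assms in \<open>auto simp: left_diff_distrib sum_subtractf\<close>)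
  then show ?thesis by (simp add: idx_def)
qed

lemma co: "g \<in> E \<Longrightarrow> x \<in> I \<Longrightarrow> g x = (\<Sum>k<n. co g k * B k x)"
  using someI_ex[OF span_B] unfolding bern_coef_def by blast

lemma co_eq: "(\<And>x. x \<in> I \<Longrightarrow> g x = (\<Sum>k<n. c k * B k x)) \<Longrightarrow> k < n \<Longrightarrow> co g k = c k"
proof -
  assume g: "\<And>x. x \<in> I \<Longrightarrow> g x = (\<Sum>k<n. c k * B k x)" and k: "k < n"
  have gE: "g \<in> E" using uspace_cong[of I g "\<lambda>x. \<Sum>k<n. c k * B k x"] comb_E[of c] g by simp
  show ?thesis by (rule comb_unique[OF _ k]) (use co[OF gE] g in simp)
qed

lemma comb_bound:
  assumes g: "\<And>x. x \<in> I \<Longrightarrow> g x = (\<Sum>k<n. c k * B k x)" and c: "\<And>k. k < n \<Longrightarrow> \<bar>c k\<bar> \<le> e"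
    and i: "i < n" and x: "x \<in> I"
  shows "h ^ i * \<bar>nder I i g x\<bar> \<le> n * C * e"
proof -
  have "(\<Sum>k<n. c k * (h ^ i * nder I i (B k) x)) = h ^ i * nder I i g x"
    using comb_nder[OF g, of i x] i x by (simp only: sum_distrib_left mult.left_commute less_imp_le)
  then have "h ^ i * \<bar>nder I i g x\<bar> = \<bar>\<Sum>k<n. c k * (h ^ i * nder I i (B k) x)\<bar>"
    using h0 by (simp add: abs_mult)
  also have "\<dots> \<le> (\<Sum>k<n. e * C)"
  proof (rule order.trans[OF sum_abs sum_mono])
    fix k assume k: "k \<in> {..<n}"
    have "\<bar>h ^ i * nder I i (B k) x\<bar> \<le> C" using B_bound[of k i x] k i x h0 by (simp add: abs_mult)
    then show "\<bar>c k * (h ^ i * nder I i (B k) x)\<bar> \<le> e * C"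
      unfolding abs_mult[of "c k"] using c[of k] k by (intro mult_mono) auto
  qed
  finally show ?thesis by (simp add: mult_ac)
qed

text \<open>Hermite interpolation of orders \<open>k\<close> and \<open>n - k\<close> at the two ends: the data at
  the lower end determine the first \<open>k\<close> Bernstein coefficients, those at the upper end the others.\<close>

lemma hermite_est:
  assumes g: "g \<in> E" and k: "k + m = n" and e0: "0 \<le> e"
    and lo: "\<And>i. i < k \<Longrightarrow> h ^ i * \<bar>nder I i g a\<bar> \<le> e"
    and hi: "\<And>i. i < m \<Longrightarrow> h ^ i * \<bar>nder I i g b\<bar> \<le> e"
    and i: "i < n" and x: "x \<in> I"
  shows "h ^ i * \<bar>nder I i g x\<bar> \<le> n * C * Ct * e"
proof -
  have "\<bar>co g j\<bar> \<le> Ct * e" if j: "j < n" for j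
  proof (cases "j < k")
    case True
    then show ?thesis
      using comb_coef_bound[OF co[OF g], of k False e j] k lo e0 by (simp add: idx_def endpt_def)
  next
    case False
    then show ?thesis
      using comb_coef_bound[OF co[OF g], of m True e "n - 1 - j"] k hi e0 j by (simp add: idx_def endpt_def)
  qed
  from comb_bound[OF co[OF g] this i x] show ?thesis by (simp add: mult_ac)
qed

lemma hermite_ex:
  assumes k: "k + m = n"
  obtains g where "g \<in> E" "\<And>i. i < k \<Longrightarrow> nder I i g a = y i" "\<And>i. i < m \<Longrightarrow> nder I i g b = z i"
proof -
  obtain c where c: "\<And>l. l < k \<Longrightarrow> (\<Sum>j\<le>l. c j * T False l j) = h ^ l * y l"
    using triangular_solve[of k "T False" "\<lambda>l. h ^ l * y l"] T_nz k by auto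
  obtain d where d: "\<And>l. l < m \<Longrightarrow> (\<Sum>j\<le>l. d j * T True l j) = h ^ l * z l"
    using triangular_solve[of m "T True" "\<lambda>l. h ^ l * z l"] T_nz k by auto
  define e where "e j = (if j < k then c j else d (n - 1 - j))" for j
  let ?g = "\<lambda>x. \<Sum>j<n. e j * B j x"
  show thesis
  proof (rule that[of ?g])
    show "?g \<in> E" by (rule comb_E)
    show "nder I i ?g a = y i" if i: "i < k" for i
    proof -
      have "h ^ i * nder I i ?g a = (\<Sum>j\<le>i. e j * T False i j)"
        using comb_end[of ?g e i False] i k by (simp add: idx_def endpt_def)
      also have "\<dots> = (\<Sum>j\<le>i. c j * T False i j)" using i by (intro sum.cong) (auto simp: e_def)
      finally show ?thesis using c[OF i] h0 by simp
    qed
    show "nder I i ?g b = z i" if i: "i < m" for i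
    proof -
      have "h ^ i * nder I i ?g b = (\<Sum>j\<le>i. e (n - 1 - j) * T True i j)"
        using comb_end[of ?g e i True] i k by (simp add: idx_def endpt_def)
      also have "\<dots> = (\<Sum>j\<le>i. d j * T True i j)" using i k by (intro sum.cong) (auto simp: e_def)
      finally show ?thesis using d[OF i] h0 by simp
    qed
  qed
qed

subsection \<open>The dual functionals\<close>

lemma co_lin:
  assumes "finite J" "\<And>j. j \<in> J \<Longrightarrow> f j \<in> E" "k < n"
  shows "co (\<lambda>x. \<Sum>j\<in>J. d j * f j x) k = (\<Sum>j\<in>J. d j * co (f j) k)"
proof (rule co_eq[OF _ assms(3)])
  fix x assume x: "x \<in> I"
  have "(\<Sum>j\<in>J. d j * f j x) = (\<Sum>j\<in>J. \<Sum>k<n. d j * co (f j) k * B k x)"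
    using co[OF assms(2) x] by (intro sum.cong) (simp_all add: sum_distrib_left mult_ac)
  also have "\<dots> = (\<Sum>k<n. \<Sum>j\<in>J. d j * co (f j) k * B k x)" by (rule sum.swap)
  finally show "(\<Sum>j\<in>J. d j * f j x) = (\<Sum>k<n. (\<Sum>j\<in>J. d j * co (f j) k) * B k x)"
    by (simp add: sum_distrib_right)
qed

lemma la_cong: "(\<And>x. x \<in> I \<Longrightarrow> f x = g x) \<Longrightarrow> la l f = la l g"
  using nder_cong[of I f g a l] nder_cong[of I f g b "n - 1 - l"] ab
  by (auto simp: dual_fun_def bern_coef_def)

lemma la_sum:
  assumes "finite J" "\<And>j. j \<in> J \<Longrightarrow> f j \<in> E" "l < n"
  shows "la l (\<lambda>x. \<Sum>j\<in>J. d j * f j x) = (\<Sum>j\<in>J. d j * la l (f j))"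
proof -
  have "nder I i (\<lambda>x. \<Sum>j\<in>J. d j * f j x) x = (\<Sum>j\<in>J. d j * nder I i (f j) x)" if "i < n" "x \<in> I" for i x
    by (rule nder_sum[of _ n]) (use assms that nt E_Ck in auto)
  then show ?thesis
    using co_lin[OF assms] assms(3) by (simp add: dual_fun_def sum_distrib_left mult_ac)
qed

lemma la_diff:
  assumes "f \<in> E" "g \<in> E" "l < n"
  shows "la l (\<lambda>x. f x - g x) = la l f - la l g"
proof -
  have "la l (\<lambda>x. f x - g x) = la l (\<lambda>x. \<Sum>j\<in>{0::nat,1}. (if j = 0 then 1 else -1) * (if j = 0 then f else g) x)"
    by (rule la_cong) simp
  also have "\<dots> = (\<Sum>j\<in>{0::nat,1}. (if j = 0 then 1 else -1) * la l (if j = 0 then f else g))"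
    by (rule la_sum) (use assms in auto)
  finally show ?thesis by simp
qed

lemma la_cases:
  assumes "l < n"
  obtains (hermite) \<sigma> i where "i \<le> r" "l = idx n \<sigma> i" | (mid_index) "mid_index n r l"
  using assms
  by (metis (full_types) idx_def idx_idx mid_index_def not_le)

lemma la_hermite: "i \<le> r \<Longrightarrow> la (idx n \<sigma> i) g = h ^ i * nder I i g (endpt \<sigma> a b)"
  using rn by (auto simp: dual_fun_def idx_def endpt_def)

lemma la_mid: "mid_index n r l \<Longrightarrow> la l g = co g l"
  by (auto simp: dual_fun_def mid_index_def)

lemma mid_lt: "mid_index n r l \<Longrightarrow> l < n" by (auto simp: mid_index_def)

lemma la_surj: obtains g where "g \<in> E" "\<And>l. l < n \<Longrightarrow> la l g = y l"
proof -
  have "\<exists>c. \<forall>\<sigma>. \<forall>l<r + 1. (\<Sum>j\<le>l. c \<sigma> j * T \<sigma> l j) = y (idx n \<sigma> l)"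
    using triangular_solve[of "r + 1" "T \<sigma>" "\<lambda>l. y (idx n \<sigma> l)" for \<sigma>] T_nz rn
    by (intro choice) auto
  then obtain c where c: "\<And>\<sigma> l. l < r + 1 \<Longrightarrow> (\<Sum>j\<le>l. c \<sigma> j * T \<sigma> l j) = y (idx n \<sigma> l)" by blast
  define d where "d j = (if j \<le> r then c False j else if n - 1 - j \<le> r then c True (n - 1 - j) else y j)" for j
  let ?g = "\<lambda>x. \<Sum>j<n. d j * B j x"
  show thesis
  proof (rule that[of ?g, OF comb_E])
    fix l assume l: "l < n"
    from this show "la l ?g = y l"
    proof (cases rule: la_cases)
      case (hermite \<sigma> i)
      have "la l ?g = (\<Sum>k\<le>i. d (idx n \<sigma> k) * T \<sigma> i k)"
        unfolding hermite(2) la_hermite[OF hermite(1)] using hermite rn by (intro comb_end) auto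
      also have "\<dots> = (\<Sum>k\<le>i. c \<sigma> k * T \<sigma> i k)"
        using hermite rn by (intro sum.cong) (auto simp: d_def idx_def)
      finally show ?thesis using c[of i \<sigma>] hermite by simp
    next
      case mid_index
      then show ?thesis using co_eq[of ?g d l] l by (auto simp: la_mid d_def mid_index_def)
    qed
  qed
qed

text \<open>The triangular system for the coefficients next to an end involves only functionals at
  the same end. The set \<open>L\<close> of indices allows to use this with functionals known near one end only.\<close>

lemma co_bound:
  assumes g: "g \<in> E" and e: "\<And>l. l < n \<Longrightarrow> l \<in> L \<Longrightarrow> \<bar>la l g\<bar> \<le> e" and e0: "0 \<le> e"
    and L: "\<And>\<sigma> i j. i \<le> r \<Longrightarrow> j \<le> i \<Longrightarrow> idx n \<sigma> i \<in> L \<Longrightarrow> idx n \<sigma> j \<in> L"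
    and l: "l < n" "l \<in> L"
  shows "\<bar>co g l\<bar> \<le> Ct * e"
  using l(1)
proof (cases rule: la_cases)
  case (hermite \<sigma> i)
  have "\<bar>co g (idx n \<sigma> i)\<bar> \<le> Ct * e"
  proof (rule comb_coef_bound[OF co[OF g], where m="Suc i"])
    fix j assume j: "j < Suc i"
    then have "\<bar>la (idx n \<sigma> j) g\<bar> \<le> e" using L[OF hermite(1), of j \<sigma>] hermite l rn by (intro e) auto
    then show "h ^ j * \<bar>nder I j g (endpt \<sigma> a b)\<bar> \<le> e"
      using la_hermite[of j \<sigma> g] j hermite h0 by (simp add: abs_mult)
  qed (use hermite rn e0 in auto)
  then show ?thesis using hermite by simp
next
  case mid_index
  have "\<bar>co g l\<bar> \<le> e" using e[OF l] la_mid[OF mid_index] by simp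
  also have "\<dots> \<le> Ct * e" using mult_right_mono[OF Ct1 e0] by simp
  finally show ?thesis .
qed

lemma la_est:
  assumes g: "g \<in> E" and e: "\<And>l. l < n \<Longrightarrow> \<bar>la l g\<bar> \<le> e" and e0: "0 \<le> e" and i: "i < n" and x: "x \<in> I"
  shows "h ^ i * \<bar>nder I i g x\<bar> \<le> n * C * Ct * e"
  using comb_bound[OF co[OF g], of "Ct * e" i x] co_bound[OF g, of UNIV e] e e0 i x by (simp add: mult_ac)

lemma la_inj:
  assumes "f \<in> E" "g \<in> E" "\<And>l. l < n \<Longrightarrow> la l f = la l g" "x \<in> I"
  shows "f x = g x"
  using la_est[OF uspace_diff[OF assms(1,2)], of 0 0 x] la_diff[OF assms(1,2)] assms(3,4) n3 by simp

text \<open>The converse estimate to the previous ones, again by the triangular systems: the functionals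
  are bounded by scaled derivatives.\<close>

lemma la_le:
  assumes g: "g \<in> E" and e: "\<And>i x. i < n \<Longrightarrow> x \<in> I \<Longrightarrow> h ^ i * \<bar>nder I i g x\<bar> \<le> e" and l: "l < n"
  shows "\<bar>la l g\<bar> \<le> Ct * e"
proof -
  have "0 \<le> h ^ 0 * \<bar>nder I 0 g a\<bar>" by simp
  also have "\<dots> \<le> e" using n3 by (intro e) auto
  finally have e0: "0 \<le> e" .
  from l show ?thesis
  proof (cases rule: la_cases)
    case (hermite \<sigma> i)
    have "\<bar>la l g\<bar> \<le> e"
      using la_hermite[OF hermite(1), of \<sigma> g] e[of i "endpt \<sigma> a b"] hermite rn h0
      by (simp add: abs_mult)
    also have "\<dots> \<le> Ct * e" using mult_right_mono[OF Ct1 e0] by simp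
    finally show ?thesis .
  next
    case mid_index
    have "\<bar>co g (idx n False l)\<bar> \<le> Ct * e"
      using e finI[of False] l e0 by (intro comb_coef_bound[OF co[OF g], where m=n]) auto
    then show ?thesis using la_mid[OF mid_index] by (simp add: idx_def)
  qed
qed

lemma A: "l < n \<Longrightarrow> A l \<in> E \<and> (\<forall>m<n. la m (A l) = (if m = l then 1 else 0))"
proof -
  obtain g where "g \<in> E" "\<And>m. m < n \<Longrightarrow> la m g = (if m = l then 1 else 0)"
    using la_surj[of "\<lambda>m. if m = l then 1 else 0"] by blast
  then have "\<exists>g. g \<in> E \<and> (\<forall>m<n. la m g = (if m = l then 1 else 0))" by blast
  then show ?thesis unfolding dual_elt_def by (rule someI_ex)
qed

lemma A_E: "l < n \<Longrightarrow> A l \<in> E" and la_A: "l < n \<Longrightarrow> m < n \<Longrightarrow> la m (A l) = (if m = l then 1 else 0)"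
  using A by auto

lemma A_bound: "l < n \<Longrightarrow> i < n \<Longrightarrow> x \<in> I \<Longrightarrow> h ^ i * \<bar>nder I i (A l) x\<bar> \<le> n * C * Ct"
  using la_est[OF A_E[of l], of 1 i x] la_A[of l] by auto

lemma A_expand: "g \<in> E \<Longrightarrow> x \<in> I \<Longrightarrow> g x = (\<Sum>l<n. la l g * A l x)"
proof (rule la_inj[of g "\<lambda>x. \<Sum>l<n. la l g * A l x"])
  assume g: "g \<in> E"
  show "(\<lambda>x. \<Sum>l<n. la l g * A l x) \<in> E" by (rule uspace_sum) (auto intro: A_E)
  show "la m g = la m (\<lambda>x. \<Sum>l<n. la l g * A l x)" if "m < n" for m
    using that by (subst la_sum) (auto intro: A_E simp: la_A if_distrib[of "\<lambda>x. _ * x"] cong: if_cong)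
qed

text \<open>A Bernstein function with index above \<open>r\<close> has a zero of order above \<open>r\<close> at the lower end, and
  similarly at the upper end. So the change between Bernstein coefficients and dual functionals is block
  diagonal with respect to the lower, middle and upper indices.\<close>

definition "same i l \<longleftrightarrow> (i \<le> r \<longleftrightarrow> l \<le> r) \<and> (n - 1 - i \<le> r \<longleftrightarrow> n - 1 - l \<le> r)"

lemma la_B_block: assumes l: "l < n" and i: "i < n" and ns: "\<not> same i l" shows "la l (B i) = 0"
  using l
proof (cases rule: la_cases)
  case (hermite \<sigma> j)
  have "nder I j (B i) (endpt \<sigma> a b) = 0"
  proof (cases \<sigma>)
    case True
    then have "j < n - 1 - i" using hermite ns i l rn by (auto simp: same_def idx_def)
    then show ?thesis using bernstein_likeD(6)[OF BI, of i j] i True by (simp add: endpt_def)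
  next
    case False
    then have "j < i" using hermite ns i l rn by (auto simp: same_def idx_def)
    then show ?thesis using bernstein_likeD(5)[OF BI, of i j] i False by (simp add: endpt_def)
  qed
  then show ?thesis using hermite la_hermite by simp
next
  case mid_index
  have "co (B i) l = (if l = i then 1 else 0)"
    by (rule co_eq[OF _ l]) (use i in \<open>simp add: if_distrib[of "\<lambda>x. x * _"] cong: if_cong\<close>)
  moreover have "l \<noteq> i" using ns by (auto simp: same_def)
  ultimately show ?thesis using la_mid[OF mid_index] by simp
qed

lemma co_A_block: assumes l: "l < n" and i: "i < n" and ns: "\<not> same i l" shows "co (A l) i = 0"
proof -
  let ?d = "\<lambda>j. if same j l then co (A l) j else 0"
  let ?g = "\<lambda>x. \<Sum>j<n. ?d j * B j x"
  have gE: "?g \<in> E" by (rule comb_E)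
  have "la m ?g = la m (A l)" if m: "m < n" for m
  proof -
    have g: "la m ?g = (\<Sum>j<n. ?d j * la m (B j))" by (rule la_sum) (use m B_E in auto)
    have "la m (A l) = la m (\<lambda>x. \<Sum>j<n. co (A l) j * B j x)" using co[OF A_E[OF l]] by (intro la_cong)
    also have "\<dots> = (\<Sum>j<n. co (A l) j * la m (B j))" by (rule la_sum) (use m B_E in auto)
    finally have A: "la m (A l) = (\<Sum>j<n. co (A l) j * la m (B j))" .
    show ?thesis
    proof (cases "same m l")
      case True
      then have "?d j * la m (B j) = co (A l) j * la m (B j)" if "j < n" for j
        using la_B_block[OF m that] by (auto simp: same_def)
      then show ?thesis unfolding g A by (intro sum.cong) auto
    next
      case False
      then have "?d j * la m (B j) = 0" if "j < n" for j
        using la_B_block[OF m that] by (auto simp: same_def)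
      then have "la m ?g = 0" unfolding g by (intro sum.neutral) auto
      moreover have "m \<noteq> l" using False by (auto simp: same_def)
      ultimately show ?thesis using la_A[OF l m] by simp
    qed
  qed
  then have "A l x = ?g x" if "x \<in> I" for x using la_inj[OF A_E[OF l] gE _ that] by simp
  then have "co (A l) i = ?d i" by (rule co_eq[OF _ i])
  then show ?thesis using ns by simp
qed

text \<open>Derivatives of order below \<open>n - 1 - r\<close> at the end \<open>\<sigma>\<close> only see the \<open>n - 1 - r\<close> Bernstein functions next
  to \<open>\<sigma>\<close>, and the coefficients of these do not involve the functionals at the opposite end.\<close>

lemma near_jets:
  assumes g: "g \<in> E" and e0: "0 \<le> e" and i: "i < n - 1 - r"
    and e: "\<And>k. k < n - 1 - r \<Longrightarrow> \<bar>la (idx n \<sigma> k) g\<bar> \<le> e"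
  shows "h ^ i * \<bar>nder I i g (endpt \<sigma> a b)\<bar> \<le> n * C * Ct * e"
proof -
  define L where "L = idx n \<sigma> ` {..<n - 1 - r}"
  have cb: "\<bar>co g (idx n \<sigma> k)\<bar> \<le> Ct * e" if k: "k < n - 1 - r" for k
  proof (rule co_bound[OF g, where L=L])
    show "\<bar>la l g\<bar> \<le> e" if "l < n" "l \<in> L" for l using that e by (auto simp: L_def)
    show "idx n \<tau> j \<in> L" if *: "i \<le> r" "j \<le> i" "idx n \<tau> i \<in> L" for \<tau> i j
    proof -
      have "\<tau> = \<sigma>" using *(1,3) rn unfolding L_def by (cases \<tau>; cases \<sigma>) (auto simp: idx_def)
      then show ?thesis using * rn unfolding L_def by auto
    qed
  qed (use e0 k in \<open>auto simp: L_def\<close>)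
  have "h ^ i * \<bar>nder I i g (endpt \<sigma> a b)\<bar> = \<bar>\<Sum>k\<le>i. co g (idx n \<sigma> k) * T \<sigma> i k\<bar>"
    using comb_end[OF co[OF g], of i \<sigma>, symmetric] i h0 by (simp add: abs_mult)
  also have "\<dots> \<le> (\<Sum>k\<le>i. Ct * e * C)"
    by (rule order.trans[OF sum_abs sum_mono])
       (use cb T_bound i e0 Ct1 in \<open>auto simp: abs_mult intro!: mult_mono\<close>)
  also have "\<dots> = real (Suc i) * (C * Ct * e)" by (simp add: mult_ac)
  also have "\<dots> \<le> n * (C * Ct * e)" using i C1 Ct1 e0 by (intro mult_right_mono) auto
  finally show ?thesis by (simp add: mult_ac)
qed

lemma jets_near:
  assumes g: "g \<in> E" and z: "\<And>i. i < n - 1 - r \<Longrightarrow> nder I i g (endpt \<sigma> a b) = 0" and k: "k < n - 1 - r"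
  shows "la (idx n \<sigma> k) g = 0"
proof -
  have c: "co g (idx n \<sigma> k) = 0" if "k < n - 1 - r" for k
    using comb_coef_bound[OF co[OF g], of "n - 1 - r" \<sigma> 0 k] z that by simp
  show ?thesis
  proof (cases "k \<le> r")
    case True
    then show ?thesis using la_hermite[OF True] z[OF k] by simp
  next
    case False
    then have "mid_index n r (idx n \<sigma> k)" using k by (auto simp: mid_index_def idx_def)
    then show ?thesis using la_mid c[OF k] by simp
  qed
qed

end

subsection \<open>Interpolation on an edge with data on its first segment\<close>

text \<open>The constant of \<open>hermite_est\<close>.\<close>

definition Kc :: "nat \<Rightarrow> real \<Rightarrow> real" where "Kc n C = n * C * (C * (1 + C\<^sup>2) ^ n)"

lemma Kc_ge1: "3 \<le> n \<Longrightarrow> 1 \<le> C \<Longrightarrow> 1 \<le> Kc n C"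
proof -
  assume "3 \<le> n" "1 \<le> C"
  then have "1 * 1 * (1 * 1) \<le> n * C * (C * (1 + C\<^sup>2) ^ n)"
    by (intro mult_mono one_le_power) auto
  then show ?thesis by (simp add: Kc_def)
qed

text \<open>\<open>[a, b]\<close> is a composite edge and \<open>[a', b']\<close> the cell edge in it that shares the end \<open>\<sigma>\<close>.\<close>

locale edge_interval = e: bernstein_interval n u v M \<delta> a b r C + T: bernstein_interval n u v M \<delta> a' b' r C
  for n u v M \<delta> a b a' b' r C +
  fixes \<sigma> :: bool and \<alpha> :: real
  assumes sub: "a \<le> a'" "b' \<le> b" and sh: "endpt \<sigma> a' b' = endpt \<sigma> a b"
    and al: "b - a \<le> \<alpha> * (b' - a')" "1 \<le> \<alpha>"
begin

lemma T_sub: "{a'..b'} \<subseteq> {a..b}" using sub by auto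

lemma fin_T [simp]: "a' \<le> endpt \<sigma> a b" "endpt \<sigma> a b \<le> b'"
  using T.fin_le[of \<sigma>] sh by auto

lemma nder_T: "g \<in> uspace n u v {a..b} \<Longrightarrow> i \<le> n \<Longrightarrow> x \<in> {a'..b'} \<Longrightarrow> nder {a'..b'} i g x = nder {a..b} i g x"
  by (rule nder_subset[OF e.E_Ck T_sub T.nt])

text \<open>On the cell edge \<open>[a', b']\<close> the middle functionals and the jet at the common end \<open>\<sigma>\<close>, of order \<open>r\<close>, bound
  the jet of order \<open>n - 2 - r\<close> at \<open>\<sigma>\<close>; together with the jet of order \<open>r\<close> at the other end this is
  a two-point Hermite problem on \<open>[a, b]\<close>. Passing from one length to the other costs powers of \<open>\<alpha>\<close>.\<close>

lemma edge_est:
  assumes g: "g \<in> uspace n u v {a..b}" and e0: "0 \<le> \<eta>"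
    and ends: "\<And>\<tau> i. i \<le> r \<Longrightarrow> (b - a) ^ i * \<bar>nder {a..b} i g (endpt \<tau> a b)\<bar> \<le> \<eta>"
    and md: "\<And>l. mid_index n r l \<Longrightarrow> \<bar>dual_fun n r u v a' b' l g\<bar> \<le> \<eta>"
    and i: "i < n" and x: "x \<in> {a..b}"
  shows "(b - a) ^ i * \<bar>nder {a..b} i g x\<bar> \<le> (Kc n C)\<^sup>2 * \<alpha> ^ n * \<eta>"
proof -
  have gT: "g \<in> uspace n u v {a'..b'}" using g T_sub by (rule uspace_mono)
  have K1: "1 \<le> Kc n C" by (rule Kc_ge1[OF e.n3 e.C1])
  have K: "real n * C * e.Ct = Kc n C" by (simp add: Kc_def e.Ct_def)
  have hh: "b' - a' \<le> b - a" using sub by simp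
  have near: "(b' - a') ^ j * \<bar>nder {a'..b'} j g (endpt \<sigma> a' b')\<bar> \<le> n * C * T.Ct * \<eta>" if j: "j < n - 1 - r" for j
  proof (rule T.near_jets[OF gT e0 j])
    fix k assume k: "k < n - 1 - r"
    show "\<bar>dual_fun n r u v a' b' (idx n \<sigma> k) g\<bar> \<le> \<eta>"
    proof (cases "k \<le> r")
      case True
      have "\<bar>dual_fun n r u v a' b' (idx n \<sigma> k) g\<bar> = (b' - a') ^ k * \<bar>nder {a..b} k g (endpt \<sigma> a b)\<bar>"
        using T.la_hermite[OF True, of \<sigma> g] nder_T[OF g, of k "endpt \<sigma> a' b'"] k T.h0 sh[symmetric] by (simp add: abs_mult)
      also have "\<dots> \<le> (b - a) ^ k * \<bar>nder {a..b} k g (endpt \<sigma> a b)\<bar>"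
        using hh T.h0 by (intro mult_right_mono power_mono) auto
      finally show ?thesis using ends[OF True, of \<sigma>] by linarith
    next
      case False
      then have "mid_index n r (idx n \<sigma> k)" using k by (auto simp: mid_index_def idx_def)
      then show ?thesis by (rule md)
    qed
  qed
  have A: "(b - a) ^ j * \<bar>nder {a..b} j g (endpt \<sigma> a b)\<bar> \<le> \<alpha> ^ n * (Kc n C * \<eta>)" if j: "j < n - 1 - r" for j
  proof -
    have "(b - a) ^ j * \<bar>nder {a..b} j g (endpt \<sigma> a b)\<bar> \<le> (\<alpha> * (b' - a')) ^ j * \<bar>nder {a..b} j g (endpt \<sigma> a b)\<bar>"
      using al e.h0 by (intro mult_right_mono power_mono) auto
    also have "\<dots> = \<alpha> ^ j * ((b' - a') ^ j * \<bar>nder {a'..b'} j g (endpt \<sigma> a' b')\<bar>)"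
      using nder_T[OF g, of j "endpt \<sigma> a' b'"] j sh by (simp add: power_mult_distrib)
    also have "\<dots> \<le> \<alpha> ^ n * (Kc n C * \<eta>)"
    proof (rule mult_mono)
      show "\<alpha> ^ j \<le> \<alpha> ^ n" using al j by (intro power_increasing) auto
      show "(b' - a') ^ j * \<bar>nder {a'..b'} j g (endpt \<sigma> a' b')\<bar> \<le> Kc n C * \<eta>"
        using near[OF j] K unfolding T.Ct_def e.Ct_def by simp
    qed (use al T.h0 in auto)
    finally show ?thesis .
  qed
  have B: "(b - a) ^ j * \<bar>nder {a..b} j g (endpt \<tau> a b)\<bar> \<le> \<alpha> ^ n * (Kc n C * \<eta>)" if "j < r + 1" for j \<tau>
  proof -
    have "1 * (1 * \<eta>) \<le> \<alpha> ^ n * (Kc n C * \<eta>)"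
      using al K1 e0 by (intro mult_mono one_le_power) auto
    then show ?thesis using ends[of j \<tau>] that by auto
  qed
  have pos: "0 \<le> \<alpha> ^ n * (Kc n C * \<eta>)" using al K1 e0 by auto
  have "(b - a) ^ i * \<bar>nder {a..b} i g x\<bar> \<le> n * C * e.Ct * (\<alpha> ^ n * (Kc n C * \<eta>))"
  proof (cases \<sigma>)
    case True
    show ?thesis
      by (rule e.hermite_est[OF g _ pos _ _ i x, of "r + 1" "n - 1 - r"])
         (use A B[of _ False] e.rn True in \<open>auto simp: endpt_def\<close>)
  next
    case False
    show ?thesis
      by (rule e.hermite_est[OF g _ pos _ _ i x, of "n - 1 - r" "r + 1"])
         (use A B[of _ True] e.rn False in \<open>auto simp: endpt_def\<close>)
  qed
  then show ?thesis unfolding K by (simp add: power2_eq_square mult_ac)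
qed

text \<open>Existence follows the estimate: \<open>g0\<close> realises the data belonging to the cell edge, and \<open>g\<close>
  interpolates the jet of \<open>g0\<close> at \<open>\<sigma>\<close> and the remaining data at the other end of \<open>[a, b]\<close>.\<close>

lemma edge_ex:
  obtains g where "g \<in> uspace n u v {a..b}" "\<And>\<tau> i. i \<le> r \<Longrightarrow> nder {a..b} i g (endpt \<tau> a b) = y \<tau> i"
    "\<And>l. mid_index n r l \<Longrightarrow> dual_fun n r u v a' b' l g = m l"
proof -
  obtain g0 where g0: "g0 \<in> uspace n u v {a'..b'}"
    and l0: "\<And>l. l < n \<Longrightarrow> dual_fun n r u v a' b' l g0 = (if mid_index n r l then m l else (b' - a') ^ (idx n \<sigma> l) * y \<sigma> (idx n \<sigma> l))"
    using T.la_surj[of "\<lambda>l. if mid_index n r l then m l else (b' - a') ^ (idx n \<sigma> l) * y \<sigma> (idx n \<sigma> l)"] by blast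
  have "\<exists>g. g \<in> uspace n u v {a..b} \<and> (\<forall>i<n - 1 - r. nder {a..b} i g (endpt \<sigma> a b) = nder {a'..b'} i g0 (endpt \<sigma> a b))
     \<and> (\<forall>i<r + 1. nder {a..b} i g (endpt (\<not> \<sigma>) a b) = y (\<not> \<sigma>) i)"
  proof (cases \<sigma>)
    case True
    show ?thesis
      using e.hermite_ex[of "r + 1" "n - 1 - r" "\<lambda>i. y (\<not> \<sigma>) i" "\<lambda>i. nder {a'..b'} i g0 (endpt \<sigma> a b)"] e.rn True
      by (simp add: endpt_def) metis
  next
    case False
    show ?thesis
      using e.hermite_ex[of "n - 1 - r" "r + 1" "\<lambda>i. nder {a'..b'} i g0 (endpt \<sigma> a b)" "\<lambda>i. y (\<not> \<sigma>) i"] e.rn False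
      by (simp add: endpt_def) metis
  qed
  then obtain g where g: "g \<in> uspace n u v {a..b}"
    and g1: "\<And>i. i < n - 1 - r \<Longrightarrow> nder {a..b} i g (endpt \<sigma> a b) = nder {a'..b'} i g0 (endpt \<sigma> a b)"
    and g2: "\<And>i. i < r + 1 \<Longrightarrow> nder {a..b} i g (endpt (\<not> \<sigma>) a b) = y (\<not> \<sigma>) i"
    by blast
  have gT: "g \<in> uspace n u v {a'..b'}" using g T_sub by (rule uspace_mono)
  have z: "nder {a'..b'} i (\<lambda>x. g x - g0 x) (endpt \<sigma> a' b') = 0" if i: "i < n - 1 - r" for i
    using nder_diff[OF T.E_Ck[OF gT] T.E_Ck[OF g0] T.nt, of i "endpt \<sigma> a' b'"] i
      nder_T[OF g, of i "endpt \<sigma> a' b'"] g1[OF i] sh by simp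
  have eq: "dual_fun n r u v a' b' (idx n \<sigma> k) g = dual_fun n r u v a' b' (idx n \<sigma> k) g0" if k: "k < n - 1 - r" for k
    using T.jets_near[OF uspace_diff[OF gT g0] z k] T.la_diff[OF gT g0, of "idx n \<sigma> k"] k by simp
  show thesis
  proof (rule that[OF g])
    fix l assume l: "mid_index n r l"
    have "idx n \<sigma> l < n - 1 - r" using l by (auto simp: mid_index_def idx_def)
    from eq[OF this] l0[of l] T.mid_lt[OF l] l show "dual_fun n r u v a' b' l g = m l" by simp
  next
    fix \<tau> i assume i: "i \<le> r"
    show "nder {a..b} i g (endpt \<tau> a b) = y \<tau> i"
    proof (cases "\<tau> = \<sigma>")
      case True
      have in': "i < n - 1 - r" "i < n" using i e.rn by auto
      have nm: "\<not> mid_index n r (idx n \<sigma> i)" using i e.rn by (auto simp: mid_index_def idx_def)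
      have "(b' - a') ^ i * nder {a'..b'} i g0 (endpt \<sigma> a' b') = (b' - a') ^ i * y \<sigma> i"
        using l0[of "idx n \<sigma> i"] T.la_hermite[OF i, of \<sigma> g0] in' nm by simp
      then show ?thesis using T.h0 g1[OF in'(1)] sh True by simp
    next
      case False
      then have "\<tau> = (\<not> \<sigma>)" by auto
      then show ?thesis using g2[of i] i by simp
    qed
  qed
qed

end

section \<open>Families of partial derivatives\<close>

text \<open>\<open>F i j\<close> is the derivative of order \<open>i\<close> in the first and \<open>j\<close> in the second variable, in the order of
  differentiation of \<open>Dst\<close>: first along \<open>t\<close>, then along \<open>s\<close>.\<close>

definition deriv_family :: "pt set \<Rightarrow> nat \<Rightarrow> nat \<Rightarrow> (nat \<Rightarrow> nat \<Rightarrow> pt \<Rightarrow> real) \<Rightarrow> bool" where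
  "deriv_family S m1 m2 F \<longleftrightarrow>
     (\<forall>i<m1. \<forall>j\<le>m2. \<forall>s t. (s, t) \<in> S \<longrightarrow>
        ((\<lambda>x. F i j (x, t)) has_real_derivative F (Suc i) j (s, t)) (at s within {x. (x, t) \<in> S})) \<and>
     (\<forall>j<m2. \<forall>s t. (s, t) \<in> S \<longrightarrow>
        ((\<lambda>y. F 0 j (s, y)) has_real_derivative F 0 (Suc j) (s, t)) (at t within {y. (s, y) \<in> S})) \<and>
     (\<forall>i\<le>m1. \<forall>j\<le>m2. continuous_on S (F i j))"

lemma deriv_familyD:
  assumes "deriv_family S m1 m2 F"
  shows "i < m1 \<Longrightarrow> j \<le> m2 \<Longrightarrow> (s, t) \<in> S \<Longrightarrow>
      ((\<lambda>x. F i j (x, t)) has_real_derivative F (Suc i) j (s, t)) (at s within {x. (x, t) \<in> S})"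
    and "j < m2 \<Longrightarrow> (s, t) \<in> S \<Longrightarrow>
      ((\<lambda>y. F 0 j (s, y)) has_real_derivative F 0 (Suc j) (s, t)) (at t within {y. (s, y) \<in> S})"
    and "i \<le> m1 \<Longrightarrow> j \<le> m2 \<Longrightarrow> continuous_on S (F i j)"
  using assms unfolding deriv_family_def by blast+

definition slices_nontrivial :: "pt set \<Rightarrow> bool" where
  "slices_nontrivial S \<longleftrightarrow> (\<forall>s t. (s, t) \<in> S \<longrightarrow> at s within {x. (x, t) \<in> S} \<noteq> bot \<and> at t within {y. (s, y) \<in> S} \<noteq> bot)"

lemma Dst_0_0 [simp]: "Dst S 0 0 p = p" by (simp add: Dst_def)
lemma Dst_Suc_s: "Dst S (Suc i) j p = Ds S (Dst S i j p)" by (simp add: Dst_def)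
lemma Dst_Suc_t: "Dst S 0 (Suc j) p = Dt S (Dst S 0 j p)" by (simp add: Dst_def)

lemma Cmm_deriv_family:
  assumes "Cmm_on m1 m2 S p"
  shows "deriv_family S m1 m2 (\<lambda>i j. Dst S i j p)"
proof -
  have 1: "((\<lambda>x. Dst S i j p (x, t)) has_real_derivative Dst S (Suc i) j p (s, t)) (at s within {x. (x, t) \<in> S})"
    if "i < m1" "j \<le> m2" "(s, t) \<in> S" for i j s t
    using assms that unfolding Cmm_on_def Dst_Suc_s Ds_def has_real_derivative_iff_has_vector_derivative
    by (fastforce simp: vector_derivative_works[symmetric])
  have 2: "((\<lambda>y. Dst S 0 j p (s, y)) has_real_derivative Dst S 0 (Suc j) p (s, t)) (at t within {y. (s, y) \<in> S})"
    if "j < m2" "(s, t) \<in> S" for j s t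
    using assms that unfolding Cmm_on_def Dst_Suc_t Dt_def has_real_derivative_iff_has_vector_derivative
    by (fastforce simp: vector_derivative_works[symmetric])
  show ?thesis unfolding deriv_family_def using 1 2 assms by (auto simp: Cmm_on_def)
qed

lemma vector_derivative_within_cong:
  assumes "at s within S \<noteq> bot" "s \<in> S" "\<And>x. x \<in> S \<Longrightarrow> f x = g x" "(g has_real_derivative D) (at s within S)"
  shows "vector_derivative f (at s within S) = D" "(f has_real_derivative D) (at s within S)"
proof -
  have "(f has_vector_derivative D) (at s within S) = (g has_vector_derivative D) (at s within S)"
    using assms by (intro has_vector_derivative_cong_ev) (auto intro!: always_eventually)
  then have "(f has_vector_derivative D) (at s within S)"
    using assms(4) by (simp add: has_real_derivative_iff_has_vector_derivative)
  then show "vector_derivative f (at s within S) = D" "(f has_real_derivative D) (at s within S)"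
    using vector_derivative_within assms(1) by (auto simp: has_real_derivative_iff_has_vector_derivative)
qed

text \<open>Where the slices have no isolated points, derivatives within the slices are unique, so a
  family of functions with the right derivatives consists of the iterated partial derivatives.\<close>

lemma deriv_family_Dst:
  assumes nt: "slices_nontrivial S" and F: "deriv_family S m1 m2 F" and p: "\<And>z. z \<in> S \<Longrightarrow> p z = F 0 0 z"
  shows "i \<le> m1 \<Longrightarrow> j \<le> m2 \<Longrightarrow> z \<in> S \<Longrightarrow> Dst S i j p z = F i j z" and "Cmm_on m1 m2 S p"
proof -
  have F1: "((\<lambda>x. F i j (x, t)) has_real_derivative F (Suc i) j (s, t)) (at s within {x. (x, t) \<in> S})"
    if "i < m1" "j \<le> m2" "(s, t) \<in> S" for i j s t using F that by (auto simp: deriv_family_def)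
  have F2: "((\<lambda>y. F 0 j (s, y)) has_real_derivative F 0 (Suc j) (s, t)) (at t within {y. (s, y) \<in> S})"
    if "j < m2" "(s, t) \<in> S" for j s t using F that by (auto simp: deriv_family_def)
  have A: "Dst S 0 j p z = F 0 j z" if "j \<le> m2" "z \<in> S" for j z
    using that
  proof (induction j arbitrary: z)
    case (Suc j)
    obtain s t where z: "z = (s, t)" by fastforce
    show ?case unfolding Dst_Suc_t Dt_def z prod.case
      by (rule vector_derivative_within_cong(1)[where g="\<lambda>y. F 0 j (s, y)"])
         (use Suc z nt F2[of j s t] in \<open>auto simp: slices_nontrivial_def\<close>)
  qed (use p in simp)
  have B: "Dst S i j p z = F i j z" if "i \<le> m1" "j \<le> m2" "z \<in> S" for i j z
    using that
  proof (induction i arbitrary: z)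
    case (Suc i)
    obtain s t where z: "z = (s, t)" by fastforce
    show ?case unfolding Dst_Suc_s Ds_def z prod.case
      by (rule vector_derivative_within_cong(1)[where g="\<lambda>x. F i j (x, t)"])
         (use Suc z nt F1[of i j s t] in \<open>auto simp: slices_nontrivial_def\<close>)
  qed (use A in simp)
  then show "i \<le> m1 \<Longrightarrow> j \<le> m2 \<Longrightarrow> z \<in> S \<Longrightarrow> Dst S i j p z = F i j z" .
  have 1: "(\<lambda>y. Dst S 0 j p (s, y)) differentiable (at t within {y. (s, y) \<in> S})"
    if "j < m2" "(s, t) \<in> S" for j s t
  proof -
    have "((\<lambda>y. Dst S 0 j p (s, y)) has_real_derivative F 0 (Suc j) (s, t)) (at t within {y. (s, y) \<in> S})"
      by (rule vector_derivative_within_cong(2)[where g="\<lambda>y. F 0 j (s, y)"])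
         (use that nt A F2[of j s t] in \<open>auto simp: slices_nontrivial_def\<close>)
    then show ?thesis using real_differentiable_def by blast
  qed
  have 2: "(\<lambda>x. Dst S i j p (x, t)) differentiable (at s within {x. (x, t) \<in> S})"
    if "i < m1" "j \<le> m2" "(s, t) \<in> S" for i j s t
  proof -
    have "((\<lambda>x. Dst S i j p (x, t)) has_real_derivative F (Suc i) j (s, t)) (at s within {x. (x, t) \<in> S})"
      by (rule vector_derivative_within_cong(2)[where g="\<lambda>x. F i j (x, t)"])
         (use that nt B F1[of i j s t] in \<open>auto simp: slices_nontrivial_def\<close>)
    then show ?thesis using real_differentiable_def by blast
  qed
  have 3: "continuous_on S (Dst S i j p)" if "i \<le> m1" "j \<le> m2" for i j
    using F that B by (subst continuous_on_cong[where g="F i j"]) (auto simp: deriv_family_def)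
  show "Cmm_on m1 m2 S p" unfolding Cmm_on_def using 1 2 3 by auto
qed

lemma deriv_family_subset:
  assumes "deriv_family S m1 m2 F" "T \<subseteq> S"
  shows "deriv_family T m1 m2 F"
  unfolding deriv_family_def
proof (intro conjI allI impI)
  fix i j s t assume *: "i < m1" "j \<le> m2" "(s, t) \<in> T"
  show "((\<lambda>x. F i j (x, t)) has_real_derivative F (Suc i) j (s, t)) (at s within {x. (x, t) \<in> T})"
    by (rule DERIV_subset[OF deriv_familyD(1)[OF assms(1) *(1,2)]]) (use * assms(2) in auto)
next
  fix j s t assume *: "j < m2" "(s, t) \<in> T"
  show "((\<lambda>y. F 0 j (s, y)) has_real_derivative F 0 (Suc j) (s, t)) (at t within {y. (s, y) \<in> T})"
    by (rule DERIV_subset[OF deriv_familyD(2)[OF assms(1) *(1)]]) (use * assms(2) in auto)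
next
  fix i j assume "i \<le> m1" "j \<le> m2"
  then show "continuous_on T (F i j)" by (rule continuous_on_subset[OF deriv_familyD(3)[OF assms(1)] assms(2)])
qed

text \<open>Directions are truth values: \<open>True\<close> is the direction of the first coordinate. In \<open>JJ d F i j\<close>
  and \<open>mkp d x y\<close> the first index and coordinate belong to the direction \<open>d\<close>.\<close>

definition mkp :: "bool \<Rightarrow> real \<Rightarrow> real \<Rightarrow> pt" where "mkp d x y = (if d then (x, y) else (y, x))"
definition JJ :: "bool \<Rightarrow> (nat \<Rightarrow> nat \<Rightarrow> 'a) \<Rightarrow> nat \<Rightarrow> nat \<Rightarrow> 'a" where
  "JJ d F i j = (if d then F i j else F j i)"
definition lo :: "bool \<Rightarrow> cell \<Rightarrow> real" where "lo d R = (if d then xl R else yl R)"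
definition hi :: "bool \<Rightarrow> cell \<Rightarrow> real" where "hi d R = (if d then xr R else yr R)"
abbreviation Iv :: "bool \<Rightarrow> cell \<Rightarrow> real set" where "Iv d R \<equiv> {lo d R..hi d R}"

lemma mkp_not: "mkp (\<not> d) y x = mkp d x y" by (auto simp: mkp_def)
lemma JJ_not: "JJ (\<not> d) F j i = JJ d F i j" by (auto simp: JJ_def)

lemma mkp_region [simp]: "mkp d x y \<in> region R \<longleftrightarrow> x \<in> Iv d R \<and> y \<in> Iv (\<not> d) R"
  by (auto simp: mkp_def region_def lo_def hi_def)

lemma mkp_inj [simp]: "mkp d x y = mkp d x' y' \<longleftrightarrow> x = x' \<and> y = y'" by (auto simp: mkp_def)

lemma mkp_ex: obtains x y where "z = mkp d x y"
  by (cases z; cases d) (auto simp: mkp_def)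

text \<open>Unlike in \<open>deriv_family\<close>, derivatives may be taken in either direction at every stage; this is
  needed along edges of both directions.\<close>

definition sym_deriv_family :: "cell \<Rightarrow> (bool \<Rightarrow> nat) \<Rightarrow> (nat \<Rightarrow> nat \<Rightarrow> pt \<Rightarrow> real) \<Rightarrow> bool" where
  "sym_deriv_family R m F \<longleftrightarrow> (\<forall>d i j x y. i < m d \<longrightarrow> j \<le> m (\<not> d) \<longrightarrow> x \<in> Iv d R \<longrightarrow> y \<in> Iv (\<not> d) R \<longrightarrow>
     ((\<lambda>x. JJ d F i j (mkp d x y)) has_real_derivative JJ d F (Suc i) j (mkp d x y)) (at x within Iv d R))"

text \<open>Symmetry of mixed partial derivatives, up to the boundary of a rectangle: \<open>P s\<close> is a
  primitive of \<open>PB s\<close>, and the integral is differentiated under the integral sign.\<close>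

lemma mixed_partials:
  fixes P PA PB PAB :: "real \<Rightarrow> real \<Rightarrow> real"
  assumes Ps: "\<And>s t. s \<in> S \<Longrightarrow> t \<in> {a..b} \<Longrightarrow> ((\<lambda>x. P x t) has_real_derivative PA s t) (at s within S)"
    and Pt: "\<And>s t. s \<in> S \<Longrightarrow> t \<in> {a..b} \<Longrightarrow> ((\<lambda>y. P s y) has_real_derivative PB s t) (at t within {a..b})"
    and PBs: "\<And>s t. s \<in> S \<Longrightarrow> t \<in> {a..b} \<Longrightarrow> ((\<lambda>x. PB x t) has_real_derivative PAB s t) (at s within S)"
    and c2: "\<And>s. s \<in> S \<Longrightarrow> continuous_on {a..b} (PB s)"
    and c12: "continuous_on (S \<times> {a..b}) (\<lambda>(s, t). PAB s t)"
    and S: "convex S" "\<And>s. s \<in> S \<Longrightarrow> at s within S \<noteq> bot" and s: "s \<in> S" and t: "t \<in> {a..b}"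
  shows "((\<lambda>y. PA s y) has_real_derivative PAB s t) (at t within {a..b})"
proof -
  have I: "P x y - P x a = integral {a..y} (PB x)" if "x \<in> S" "y \<in> {a..b}" for x y
  proof -
    have "(PB x has_integral P x y - P x a) {a..y}"
      using that Pt[OF that(1)]
      by (intro fundamental_theorem_of_calculus)
         (auto simp: has_real_derivative_iff_has_vector_derivative[symmetric] intro!: DERIV_subset[OF Pt[OF that(1)]])
    then show ?thesis by (simp add: integral_unique)
  qed
  have E: "PA s y = PA s a + integral {a..y} (PAB s)" if y: "y \<in> {a..b}" for y
  proof -
    have "((\<lambda>x. integral (cbox a y) (PB x)) has_field_derivative integral (cbox a y) (PAB s)) (at s within S)"
    proof (rule leibniz_rule_field_derivative)
      show "((\<lambda>x. PB x t) has_field_derivative PAB x t) (at x within S)" if "x \<in> S" "t \<in> cbox a y" for x t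
        using PBs that y by auto
      show "PB x integrable_on cbox a y" if "x \<in> S" for x
        using c2[OF that] y by (auto intro!: integrable_continuous_real intro: continuous_on_subset)
      show "continuous_on (S \<times> cbox a y) (\<lambda>(x, t). PAB x t)"
        using y by (intro continuous_on_subset[OF c12]) auto
    qed (use s S in auto)
    then have 1: "((\<lambda>x. integral {a..y} (PB x)) has_real_derivative integral {a..y} (PAB s)) (at s within S)" by simp
    have 2: "((\<lambda>x. P x y - P x a) has_real_derivative PA s y - PA s a) (at s within S)"
      using y by (intro DERIV_diff Ps s) auto
    have "integral {a..y} (PAB s) = PA s y - PA s a"
    proof (rule vector_derivative_unique_within[OF S(2)[OF s]])
      show "((\<lambda>x. P x y - P x a) has_vector_derivative PA s y - PA s a) (at s within S)"
        using 2 by (simp add: has_real_derivative_iff_has_vector_derivative)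
      have "((\<lambda>x. P x y - P x a) has_real_derivative integral {a..y} (PAB s)) (at s within S)"
        by (rule vector_derivative_within_cong(2)[OF S(2)[OF s] s _ 1]) (use I y in auto)
      then show "((\<lambda>x. P x y - P x a) has_vector_derivative integral {a..y} (PAB s)) (at s within S)"
        by (simp add: has_real_derivative_iff_has_vector_derivative)
    qed
    then show ?thesis by simp
  qed
  have "continuous_on {a..b} (PAB s)"
    using continuous_on_compose2[OF c12 continuous_on_Pair[OF continuous_on_const continuous_on_id], of s "{a..b}"] s
    by (auto simp: image_subset_iff)
  then have I12: "((\<lambda>y. PA s a + integral {a..y} (PAB s)) has_real_derivative PAB s t) (at t within {a..b})"
    using t by (auto intro!: derivative_eq_intros integral_has_real_derivative)
  moreover have "a < b \<or> {a..b} = {t}" using t by auto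
  ultimately show ?thesis
  proof (elim disjE)
    assume ab: "a < b"
    show ?thesis by (rule vector_derivative_within_cong(2)[OF at_within_Icc_nontrivial[OF ab t] t E I12])
  next
    assume *: "{a..b} = {t}"
    show ?thesis unfolding * by (simp add: has_field_derivative_def has_derivative_within_singleton_iff bounded_linear_mult_right)
  qed
qed

lemma deriv_family_sym:
  assumes F: "deriv_family (region R) (m True) (m False) F" and nd: "\<And>d. lo d R < hi d R"
  shows "sym_deriv_family R m F"
proof -
  have R: "region R = Iv True R \<times> Iv False R" by (auto simp: region_def lo_def hi_def)
  have F1: "((\<lambda>x. F i j (x, t)) has_real_derivative F (Suc i) j (s, t)) (at s within Iv True R)"
    if "i < m True" "j \<le> m False" "s \<in> Iv True R" "t \<in> Iv False R" for i j s t
  proof -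
    have "{x. (x, t) \<in> region R} = Iv True R" using that unfolding R by auto
    then show ?thesis using F that unfolding deriv_family_def R by auto
  qed
  have F2: "((\<lambda>y. F i j (s, y)) has_real_derivative F i (Suc j) (s, t)) (at t within Iv False R)"
    if "i \<le> m True" "j < m False" "s \<in> Iv True R" "t \<in> Iv False R" for i j s t
    using that
  proof (induction i arbitrary: s t)
    case 0
    have "{y. (s, y) \<in> region R} = Iv False R" using 0 unfolding R by auto
    then show ?case using F 0 unfolding deriv_family_def R by auto
  next
    case (Suc i)
    have c: "continuous_on (Iv True R \<times> Iv False R) (F k l)" if "k \<le> m True" "l \<le> m False" for k l
      using F that unfolding deriv_family_def R by auto
    show ?case
    proof (rule mixed_partials[where P="\<lambda>s t. F i j (s, t)" and PB="\<lambda>s t. F i (Suc j) (s, t)"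
        and PA="\<lambda>s t. F (Suc i) j (s, t)" and PAB="\<lambda>s t. F (Suc i) (Suc j) (s, t)" and S="Iv True R"])
      show "continuous_on (Iv False R) (\<lambda>t. F i (Suc j) (s, t))" if "s \<in> Iv True R" for s
        using continuous_on_compose2[OF c[of i "Suc j"] continuous_on_Pair[OF continuous_on_const continuous_on_id],
            of s "Iv False R"] that Suc.prems
        by (auto simp: image_subset_iff)
      show "continuous_on (Iv True R \<times> Iv False R) (\<lambda>(s, t). F (Suc i) (Suc j) (s, t))"
        using c[of "Suc i" "Suc j"] Suc.prems by simp
      show "at s within Iv True R \<noteq> bot" if "s \<in> Iv True R" for s
        using at_within_Icc_nontrivial[OF nd that] .
    qed (use Suc F1 in auto)
  qed
  show ?thesis unfolding sym_deriv_family_def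
  proof (intro allI impI, goal_cases)
    case (1 d i j x y)
    then show ?case using F1[of i j x y] F2[of j i y x] by (cases d) (auto simp: JJ_def mkp_def)
  qed
qed

section \<open>The tensor product spaces on cells\<close>

definition dir_array :: "bool \<Rightarrow> (nat \<Rightarrow> nat \<Rightarrow> real) \<Rightarrow> nat \<Rightarrow> nat \<Rightarrow> real" where
  "dir_array d Y l m = (if d then Y l m else Y m l)"

definition cell_end :: "bool \<Rightarrow> bool \<Rightarrow> cell \<Rightarrow> real" where
  "cell_end d \<sigma> R = endpt \<sigma> (lo d R) (hi d R)"

text \<open>The data of both directions, and constants \<open>C\<close>, \<open>h0\<close> for which the Bernstein bases are uniformly good on
  short intervals. In what follows \<open>ES\<close> is the univariate space, \<open>lm\<close> and \<open>AA\<close> are the functionals and the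
  basis dual to them on a side of a cell, \<open>hh\<close> is the length of a side, and \<open>K1\<close> and \<open>J1\<close> are the constants of
  \<open>hermite_est\<close> and \<open>E_jet_bound\<close>.\<close>

locale uniform_setup =
  fixes n r :: "bool \<Rightarrow> nat" and u v :: "bool \<Rightarrow> real \<Rightarrow> real" and M \<delta> C h0 :: real
  assumes all_bint: "good (n d) (u d) (v d) M \<delta> a b \<Longrightarrow> b - a \<le> h0 \<Longrightarrow>
    bernstein_interval (n d) (u d) (v d) M \<delta> a b (r d) C"
begin

abbreviation "ES d S \<equiv> uspace (n d) (u d) (v d) S"
abbreviation "AA d R l \<equiv> dual_elt (n d) (r d) (u d) (v d) (lo d R) (hi d R) l"
abbreviation "lm d R l g \<equiv> dual_fun (n d) (r d) (u d) (v d) (lo d R) (hi d R) l g"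
abbreviation "hh d R \<equiv> hi d R - lo d R"
abbreviation "K1 d \<equiv> Kc (n d) C"
abbreviation "J1 d \<equiv> real (n d) + 4 * M\<^sup>2 / \<delta>"

definition good_cell :: "cell \<Rightarrow> bool" where
  "good_cell R \<longleftrightarrow> (\<forall>d. good (n d) (u d) (v d) M \<delta> (lo d R) (hi d R) \<and> hh d R \<le> h0)"

text \<open>\<open>tensor R Y 0 0\<close> is the element of the tensor product space whose products of dual functionals
  are the entries of \<open>Y\<close>; the indices \<open>i\<close>, \<open>j\<close> stand for its partial derivatives.\<close>

definition tensor :: "cell \<Rightarrow> (nat \<Rightarrow> nat \<Rightarrow> real) \<Rightarrow> nat \<Rightarrow> nat \<Rightarrow> pt \<Rightarrow> real" where
  "tensor R Y i j z = (\<Sum>l<n True. \<Sum>m<n False. Y l m *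
     (nder (Iv True R) i (AA True R l) (fst z) * nder (Iv False R) j (AA False R m) (snd z)))"

lemma tensor_dir: "JJ d (tensor R Y) i j (mkp d x y) = (\<Sum>l<n d. \<Sum>m<n (\<not> d). dir_array d Y l m *
     (nder (Iv d R) i (AA d R l) x * nder (Iv (\<not> d) R) j (AA (\<not> d) R m) y))"
proof (cases d)
  case True
  then show ?thesis by (simp add: JJ_def mkp_def tensor_def dir_array_def)
next
  case False
  have "(\<Sum>l<n True. \<Sum>m<n False. Y l m * (nder (Iv True R) j (AA True R l) y * nder (Iv False R) i (AA False R m) x))
     = (\<Sum>m<n False. \<Sum>l<n True. Y l m * (nder (Iv True R) j (AA True R l) y * nder (Iv False R) i (AA False R m) x))"
    by (rule sum.swap)
  then show ?thesis using False by (simp add: JJ_def mkp_def tensor_def dir_array_def mult_ac)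
qed

lemma tensor_diff: "tensor R (\<lambda>l m. Y l m - Y' l m) i j z = tensor R Y i j z - tensor R Y' i j z"
  by (simp add: tensor_def left_diff_distrib sum_subtractf)

text \<open>On a short interval jets are realised by Hermite interpolation with all the data at one end. For
  a point inside, the interval is cut at this point.\<close>

lemma jet_ex:
  assumes g: "good (n d) (u d) (v d) M \<delta> a b" and h: "b - a \<le> h0" and z: "z \<in> {a..b}"
  obtains g where "g \<in> ES d {a..b}" "\<And>i. i < n d \<Longrightarrow> nder {a..b} i g z = y i"
proof -
  note outer = that
  have ab: "a < b" using g by (auto simp: good_def)
  have main: thesis if ab': "a \<le> a'" "b' \<le> b" "a' < b'" and g': "g' \<in> ES d {a'..b'}"
    and z': "z \<in> {a'..b'}" and y: "\<And>i. i < n d \<Longrightarrow> nder {a'..b'} i g' z = y i" for a' b' g'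
  proof -
    interpret G: good_interval "n d" "u d" "v d" M \<delta> a b by unfold_locales (rule g)
    interpret G': good_interval "n d" "u d" "v d" M \<delta> a' b'
      by unfold_locales (rule good_sub[OF g ab'])
    obtain c where c: "\<And>x. x \<in> {a'..b'} \<Longrightarrow> g' x = (\<Sum>k<n d. c k * ubasis (n d) (u d) (v d) k x)"
      using g' by (auto simp: uspace_def)
    let ?g = "\<lambda>x. \<Sum>k<n d. c k * ubasis (n d) (u d) (v d) k x"
    have gE: "?g \<in> ES d {a..b}" by (auto simp: uspace_def)
    show thesis
    proof (rule outer[OF gE])
      fix i assume i: "i < n d"
      have "nder {a..b} i ?g z = nder {a'..b'} i ?g z"
        by (rule nder_subset[symmetric, OF G.E_Ck[OF gE] _ G'.nt]) (use i z' ab' in auto)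
      also have "\<dots> = nder {a'..b'} i g' z" using c z' by (intro nder_cong) auto
      finally show "nder {a..b} i ?g z = y i" using y[OF i] by simp
    qed
  qed
  show thesis
  proof (cases "z < b")
    case True
    have "good (n d) (u d) (v d) M \<delta> z b" using good_sub[OF g] z True by auto
    then interpret bernstein_interval "n d" "u d" "v d" M \<delta> z b "r d" C using h z by (intro all_bint) auto
    obtain g' where "g' \<in> ES d {z..b}" "\<And>i. i < n d \<Longrightarrow> nder {z..b} i g' z = y i"
      using hermite_ex[of "n d" 0 y] by auto
    then show thesis using main[of z b g'] z True by auto
  next
    case False
    then have zb: "z = b" using z by simp
    interpret bernstein_interval "n d" "u d" "v d" M \<delta> a b "r d" C using h g by (intro all_bint)
    obtain g' where "g' \<in> ES d {a..b}" "\<And>i. i < n d \<Longrightarrow> nder {a..b} i g' b = y i"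
      using hermite_ex[of 0 "n d" _ y] by auto
    then show thesis using that zb by auto
  qed
qed

end

locale short_cell = uniform_setup +
  fixes R :: cell
  assumes gcR: "good_cell R"
begin

lemma bi: "bernstein_interval (n d) (u d) (v d) M \<delta> (lo d R) (hi d R) (r d) C"
  using gcR all_bint by (auto simp: good_cell_def)
lemma gi: "good_interval (n d) (u d) (v d) M \<delta> (lo d R) (hi d R)"
  using bi by (rule bernstein_interval.axioms)

lemma hh_pos: "0 < hh d R" using good_interval.h0[OF gi] .
lemma lohi: "lo d R < hi d R" using hh_pos[of d] by simp
lemma nt2: "x \<in> Iv d R \<Longrightarrow> at x within Iv d R \<noteq> bot" using good_interval.nt[OF gi] .
lemma cell_end_in [simp]: "cell_end d \<sigma> R \<in> Iv d R" unfolding cell_end_def using bernstein_interval.finI[OF bi] .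
lemma n3d: "3 \<le> n d" using good_interval.n3[OF gi] .
lemma rnd: "2 * r d + 2 \<le> n d" using bernstein_interval.rn[OF bi] .
lemma Ct_Kc: "n d * C * bernstein_interval.Ct (n d) C = K1 d" by (simp add: Kc_def bernstein_interval.Ct_def[OF bi])
lemma K1_ge: "1 \<le> K1 d" by (rule Kc_ge1[OF n3d bernstein_interval.C1[OF bi[of True]]])
lemma Ct_le_K1: "bernstein_interval.Ct (n d) C \<le> K1 d"
proof -
  have "1 * 1 * bernstein_interval.Ct (n d) C \<le> n d * C * bernstein_interval.Ct (n d) C"
    using bernstein_interval.C1[OF bi[of d]] n3d[of d] bernstein_interval.Ct1[OF bi[of d]] by (intro mult_right_mono mult_mono) auto
  then show ?thesis by (simp add: Ct_Kc)
qed

lemma AE: "l < n d \<Longrightarrow> AA d R l \<in> ES d (Iv d R)" by (rule bernstein_interval.A_E[OF bi])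
lemma ACk: "l < n d \<Longrightarrow> Ck_on (n d) (Iv d R) (AA d R l)" using good_interval.E_Ck[OF gi AE] .

lemma slice_coef: "JJ d (tensor R Y) 0 j (mkp d x y) = (\<Sum>l<n d. (\<Sum>m<n (\<not> d). dir_array d Y l m * nder (Iv (\<not> d) R) j (AA (\<not> d) R m) y) * AA d R l x)"
  unfolding tensor_dir by (intro sum.cong refl) (simp add: sum_distrib_left sum_distrib_right mult_ac)

lemma slice_E: "(\<lambda>x. JJ d (tensor R Y) 0 j (mkp d x y)) \<in> ES d (Iv d R)"
  unfolding slice_coef by (rule uspace_sum) (auto intro: AE)

lemma slice_nder:
  assumes "i \<le> n d" "x \<in> Iv d R"
  shows "nder (Iv d R) i (\<lambda>x. JJ d (tensor R Y) 0 j (mkp d x y)) x = JJ d (tensor R Y) i j (mkp d x y)"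
proof -
  have "nder (Iv d R) i (\<lambda>x. JJ d (tensor R Y) 0 j (mkp d x y)) x
    = (\<Sum>l<n d. (\<Sum>m<n (\<not> d). dir_array d Y l m * nder (Iv (\<not> d) R) j (AA (\<not> d) R m) y) * nder (Iv d R) i (AA d R l) x)"
    by (rule nder_sum[of _ "n d"]) (use assms nt2 ACk slice_coef in auto)
  also have "\<dots> = JJ d (tensor R Y) i j (mkp d x y)"
    unfolding tensor_dir by (intro sum.cong refl) (simp add: sum_distrib_left sum_distrib_right mult_ac)
  finally show ?thesis .
qed

lemma tensor_deriv:
  assumes "i < n d" "x \<in> Iv d R"
  shows "((\<lambda>x. JJ d (tensor R Y) i j (mkp d x y)) has_real_derivative JJ d (tensor R Y) (Suc i) j (mkp d x y)) (at x within Iv d R)"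
  unfolding tensor_dir
  by (intro DERIV_sum DERIV_cmult DERIV_cmult_right Ck_on_deriv[OF ACk]) (use assms in auto)

lemma tensor_cont:
  assumes "i \<le> n True" "j \<le> n False"
  shows "continuous_on (region R) (tensor R Y i j)"
proof -
  have R: "region R = Iv True R \<times> Iv False R" by (auto simp: region_def lo_def hi_def)
  have 1: "continuous_on (region R) (\<lambda>z. nder (Iv True R) i (AA True R l) (fst z))" if "l < n True" for l
    by (rule continuous_on_compose2[OF Ck_on_cont[OF ACk[OF that] assms(1)]]) (auto simp: R intro!: continuous_intros)
  have 2: "continuous_on (region R) (\<lambda>z. nder (Iv False R) j (AA False R l) (snd z))" if "l < n False" for l
    by (rule continuous_on_compose2[OF Ck_on_cont[OF ACk[OF that] assms(2)]]) (auto simp: R intro!: continuous_intros)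
  show ?thesis unfolding tensor_def by (intro continuous_intros 1 2) auto
qed

lemma region_slices_nontrivial: "slices_nontrivial (region R)"
  unfolding slices_nontrivial_def
proof (intro allI impI)
  fix s t assume "(s, t) \<in> region R"
  then have st: "s \<in> Iv True R" "t \<in> Iv False R" by (auto simp: region_def lo_def hi_def)
  then have "{x. (x, t) \<in> region R} = Iv True R" "{y. (s, y) \<in> region R} = Iv False R"
    by (auto simp: region_def lo_def hi_def)
  with st nt2 show "at s within {x. (x, t) \<in> region R} \<noteq> bot \<and> at t within {y. (s, y) \<in> region R} \<noteq> bot" by metis
qed

lemma tensor_fam: "deriv_family (region R) (n True) (n False) (tensor R Y)"
  unfolding deriv_family_def
proof (intro conjI allI impI tensor_cont)
  fix i j s t assume *: "i < n True" "j \<le> n False" "(s, t) \<in> region R"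
  then have st: "s \<in> Iv True R" "t \<in> Iv False R" by (auto simp: region_def lo_def hi_def)
  then have "{x. (x, t) \<in> region R} = Iv True R" by (auto simp: region_def lo_def hi_def)
  then show "((\<lambda>x. tensor R Y i j (x, t)) has_real_derivative tensor R Y (Suc i) j (s, t)) (at s within {x. (x, t) \<in> region R})"
    using tensor_deriv[of i True s Y j t] * st by (simp add: JJ_def mkp_def)
next
  fix j s t assume *: "j < n False" "(s, t) \<in> region R"
  then have st: "s \<in> Iv True R" "t \<in> Iv False R" by (auto simp: region_def lo_def hi_def)
  then have "{y. (s, y) \<in> region R} = Iv False R" by (auto simp: region_def lo_def hi_def)
  then show "((\<lambda>y. tensor R Y 0 j (s, y)) has_real_derivative tensor R Y 0 (Suc j) (s, t)) (at t within {y. (s, y) \<in> region R})"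
    using tensor_deriv[of j False t Y 0 s] * st by (simp add: JJ_def mkp_def)
qed auto

lemma tensor_Dst:
  assumes "\<And>z. z \<in> region R \<Longrightarrow> p z = tensor R Y 0 0 z" "i \<le> n True" "j \<le> n False" "z \<in> region R"
  shows "Dst (region R) i j p z = tensor R Y i j z"
  by (rule deriv_family_Dst(1)[OF region_slices_nontrivial tensor_fam]) (use assms in auto)

text \<open>The functions \<open>AA\<close> are dual to functionals that include the derivatives at the ends, so normal
  derivatives on the side \<open>\<sigma>\<close> pick out a row or column of the array.\<close>

lemma dual_fun_trace:
  assumes j: "j \<le> r (\<not> d)" and l: "l < n d"
  shows "hh (\<not> d) R ^ j * lm d R l (\<lambda>x. JJ d (tensor R Y) 0 j (mkp d x (cell_end (\<not> d) \<sigma> R))) = dir_array d Y l (idx (n (\<not> d)) \<sigma> j)"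
proof -
  let ?y = "cell_end (\<not> d) \<sigma> R"
  let ?c = "\<lambda>l. \<Sum>m<n (\<not> d). dir_array d Y l m * nder (Iv (\<not> d) R) j (AA (\<not> d) R m) ?y"
  have jn: "j < n (\<not> d)" using j rnd[of "\<not> d"] by simp
  have "lm d R l (\<lambda>x. JJ d (tensor R Y) 0 j (mkp d x ?y)) = (\<Sum>k<n d. ?c k * lm d R l (AA d R k))"
    unfolding slice_coef by (rule bernstein_interval.la_sum[OF bi]) (use l AE in auto)
  also have "\<dots> = ?c l" using l bernstein_interval.la_A[OF bi] by (simp add: if_distrib[of "\<lambda>x. _ * x"] cong: if_cong)
  finally have 1: "lm d R l (\<lambda>x. JJ d (tensor R Y) 0 j (mkp d x ?y)) = ?c l" .
  have "hh (\<not> d) R ^ j * ?c l = (\<Sum>m<n (\<not> d). dir_array d Y l m * (hh (\<not> d) R ^ j * nder (Iv (\<not> d) R) j (AA (\<not> d) R m) ?y))"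
    by (simp add: sum_distrib_left mult_ac)
  also have "\<dots> = (\<Sum>m<n (\<not> d). dir_array d Y l m * (if m = idx (n (\<not> d)) \<sigma> j then 1 else 0))"
  proof (intro sum.cong refl)
    fix m assume m: "m \<in> {..<n (\<not> d)}"
    have "hh (\<not> d) R ^ j * nder (Iv (\<not> d) R) j (AA (\<not> d) R m) ?y = lm (\<not> d) R (idx (n (\<not> d)) \<sigma> j) (AA (\<not> d) R m)"
      unfolding cell_end_def by (rule bernstein_interval.la_hermite[OF bi j, symmetric])
    then show "dir_array d Y l m * (hh (\<not> d) R ^ j * nder (Iv (\<not> d) R) j (AA (\<not> d) R m) ?y) = dir_array d Y l m * (if m = idx (n (\<not> d)) \<sigma> j then 1 else 0)"
      using bernstein_interval.la_A[OF bi, of m "\<not> d" "idx (n (\<not> d)) \<sigma> j"] m jn by auto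
  qed
  also have "\<dots> = dir_array d Y l (idx (n (\<not> d)) \<sigma> j)" using jn by (simp add: if_distrib[of "\<lambda>x. _ * x"] cong: if_cong)
  finally show ?thesis unfolding 1 .
qed

text \<open>The traces on the four sides bound all entries of the array but those with two middle indices,
  which vanish here; and the functions \<open>AA\<close> are bounded.\<close>

lemma tensor_est:
  assumes z: "\<And>l m. mid_index (n True) (r True) l \<Longrightarrow> mid_index (n False) (r False) m \<Longrightarrow> Y l m = 0"
    and e: "\<And>d \<sigma> i j x. j \<le> r (\<not> d) \<Longrightarrow> i < n d \<Longrightarrow> x \<in> Iv d R \<Longrightarrow>
      hh d R ^ i * hh (\<not> d) R ^ j * \<bar>JJ d (tensor R Y) i j (mkp d x (cell_end (\<not> d) \<sigma> R))\<bar> \<le> \<eta>"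
    and x: "x \<in> region R"
  shows "\<bar>tensor R Y 0 0 x\<bar> \<le> real (n True) * real (n False) * (K1 True + K1 False) * K1 True * K1 False * \<eta>"
proof -
  have "0 \<le> hh True R ^ 0 * hh False R ^ 0 * \<bar>JJ True (tensor R Y) 0 0 (mkp True (lo True R) (cell_end False False R))\<bar>" by simp
  also have "\<dots> \<le> \<eta>" using e[of 0 True 0 "lo True R" False] lohi[of True] n3d[of True] by simp
  finally have e0: "0 \<le> \<eta>" .
  let ?K = "K1 True + K1 False"
  have K: "1 \<le> K1 d" for d by (rule K1_ge)
  have Tr: "\<bar>dir_array d Y l (idx (n (\<not> d)) \<sigma> j)\<bar> \<le> ?K * \<eta>" if j: "j \<le> r (\<not> d)" and l: "l < n d" for d \<sigma> j l
  proof -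
    let ?y = "cell_end (\<not> d) \<sigma> R"
    let ?g = "\<lambda>x. JJ d (tensor R Y) 0 j (mkp d x ?y)"
    have "\<bar>lm d R l ?g\<bar> \<le> bernstein_interval.Ct (n d) C * (\<eta> / hh (\<not> d) R ^ j)"
    proof (rule bernstein_interval.la_le[OF bi slice_E _ l])
      fix i x assume i: "i < n d" and x: "x \<in> Iv d R"
      have "hh (\<not> d) R ^ j * (hh d R ^ i * \<bar>nder (Iv d R) i ?g x\<bar>) \<le> \<eta>"
        using e[OF j i x, of \<sigma>] slice_nder[of i d x Y j ?y] i x by (simp add: mult_ac)
      then show "hh d R ^ i * \<bar>nder (Iv d R) i ?g x\<bar> \<le> \<eta> / hh (\<not> d) R ^ j"
        using hh_pos[of "\<not> d"] by (simp add: field_simps)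
    qed
    then have "hh (\<not> d) R ^ j * \<bar>lm d R l ?g\<bar> \<le> hh (\<not> d) R ^ j * (bernstein_interval.Ct (n d) C * (\<eta> / hh (\<not> d) R ^ j))"
      using hh_pos[of "\<not> d"] by (intro mult_left_mono) auto
    also have "\<dots> = bernstein_interval.Ct (n d) C * \<eta>" using hh_pos[of "\<not> d"] by simp
    also have "\<dots> \<le> ?K * \<eta>" using Ct_le_K1[of d] K[of "\<not> d"] e0 by (cases d) (auto intro!: mult_right_mono)
    finally show ?thesis
      using arg_cong[OF dual_fun_trace[OF j l, of Y \<sigma>], of abs] hh_pos[of "\<not> d"] by (simp add: abs_mult)
  qed
  have Y: "\<bar>Y l m\<bar> \<le> ?K * \<eta>" if l: "l < n True" and m: "m < n False" for l m
  proof -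
    consider (h1) \<sigma> i where "i \<le> r True" "l = idx (n True) \<sigma> i" | (h2) \<sigma> i where "i \<le> r False" "m = idx (n False) \<sigma> i"
      | (md) "mid_index (n True) (r True) l" "mid_index (n False) (r False) m"
      using bernstein_interval.la_cases[OF bi[of True] l] bernstein_interval.la_cases[OF bi[of False] m] by metis
    then show ?thesis
    proof cases
      case h1 then show ?thesis using Tr[of i False m \<sigma>] m by (simp add: dir_array_def)
    next
      case h2 then show ?thesis using Tr[of i True l \<sigma>] l by (simp add: dir_array_def)
    next
      case md then show ?thesis using z K[of True] K[of False] e0 by simp
    qed
  qed
  have xs: "fst x \<in> Iv True R" "snd x \<in> Iv False R" using x by (auto simp: region_def lo_def hi_def)
  have A: "\<bar>AA d R l y\<bar> \<le> K1 d" if "l < n d" "y \<in> Iv d R" for d l y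
    using bernstein_interval.A_bound[OF bi that(1) _ that(2), of 0] n3d[of d] Ct_Kc[of d] by simp
  have "\<bar>tensor R Y 0 0 x\<bar> \<le> (\<Sum>l<n True. \<Sum>m<n False. ?K * \<eta> * (K1 True * K1 False))"
    unfolding tensor_def nder_0
  proof (intro order.trans[OF sum_abs sum_mono] order.trans[OF sum_abs sum_mono])
    fix l m assume lm: "l \<in> {..<n True}" "m \<in> {..<n False}"
    show "\<bar>Y l m * (AA True R l (fst x) * AA False R m (snd x))\<bar> \<le> ?K * \<eta> * (K1 True * K1 False)"
      unfolding abs_mult using Y[of l m] A[of l True "fst x"] A[of m False "snd x"] lm xs K[of True] K[of False] e0
      by (intro mult_mono) auto
  qed
  then show ?thesis by (simp add: mult_ac)
qed

text \<open>The univariate bound from jets, applied first in the horizontal and then in the vertical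
  direction.\<close>

lemma tensor_jet_bound:
  assumes z: "z \<in> region R" and e: "\<And>i j. i < n True \<Longrightarrow> j < n False \<Longrightarrow> \<bar>tensor R Y i j z\<bar> \<le> \<eta>"
    and ij: "i \<le> n True" "j \<le> n False" and x: "x \<in> region R"
  shows "\<bar>tensor R Y i j x\<bar> \<le> J1 False * (J1 True * \<eta>)"
proof -
  obtain z1 z2 where zz: "z = (z1, z2)" by fastforce
  obtain x1 x2 where xx: "x = (x1, x2)" by fastforce
  have zs: "z1 \<in> Iv True R" "z2 \<in> Iv False R" "x1 \<in> Iv True R" "x2 \<in> Iv False R"
    using z x zz xx by (auto simp: region_def lo_def hi_def)
  have 1: "\<bar>tensor R Y i j (x1, z2)\<bar> \<le> J1 True * \<eta>" if "j < n False" for j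
  proof -
    let ?g = "\<lambda>x. JJ True (tensor R Y) 0 j (mkp True x z2)"
    have "\<bar>nder (Iv True R) i ?g x1\<bar> \<le> J1 True * \<eta>"
      by (rule good_interval.E_jet_bound[OF gi slice_E zs(1) _ ij(1) zs(3)])
         (use slice_nder[of _ True z1 Y j z2] e that zs zz in \<open>auto simp: JJ_def mkp_def\<close>)
    then show ?thesis using slice_nder[of i True x1 Y j z2] ij zs by (simp add: JJ_def mkp_def)
  qed
  let ?g = "\<lambda>y. JJ False (tensor R Y) 0 i (mkp False y x1)"
  have "\<bar>nder (Iv False R) j ?g x2\<bar> \<le> J1 False * (J1 True * \<eta>)"
    by (rule good_interval.E_jet_bound[OF gi slice_E zs(2) _ ij(2) zs(4)])
       (use slice_nder[of _ False z2 Y i x1] 1 zs in \<open>auto simp: JJ_def mkp_def\<close>)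
  then show ?thesis using slice_nder[of j False x2 Y i x1] ij zs xx by (simp add: JJ_def mkp_def)
qed

text \<open>The tensor products of the univariate solutions for unit jets in both directions.\<close>

lemma tensor_hermite:
  assumes z: "z \<in> region R"
  obtains Y where "\<And>i j. i < n True \<Longrightarrow> j < n False \<Longrightarrow> tensor R Y i j z = w i j"
proof -
  obtain z1 z2 where zz: "z = (z1, z2)" by fastforce
  define zc where "zc d = (if d then z1 else z2)" for d
  have zs: "zc d \<in> Iv d R" for d using z zz by (auto simp: region_def lo_def hi_def zc_def)
  have "\<exists>g. g \<in> ES d (Iv d R) \<and> (\<forall>k<n d. nder (Iv d R) k g (zc d) = (if k = i then 1 else 0))" for d i
  proof -
    have "good (n d) (u d) (v d) M \<delta> (lo d R) (hi d R)" "hh d R \<le> h0" using gcR by (auto simp: good_cell_def)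
    from jet_ex[OF this zs[of d], of "\<lambda>k. if k = i then 1 else 0"] show ?thesis by metis
  qed
  then obtain G where G: "\<And>d i. G d i \<in> ES d (Iv d R)"
    "\<And>d i k. k < n d \<Longrightarrow> nder (Iv d R) k (G d i) (zc d) = (if k = i then 1 else 0)" by metis
  have ex: "nder (Iv d R) k (G d i) x = (\<Sum>l<n d. lm d R l (G d i) * nder (Iv d R) k (AA d R l) x)"
    if "k \<le> n d" "x \<in> Iv d R" for d i k x
    by (rule nder_sum[of _ "n d"]) (use that nt2 ACk bernstein_interval.A_expand[OF bi G(1)] in auto)
  define Y where "Y l m = (\<Sum>i<n True. \<Sum>j<n False. w i j * (lm True R l (G True i) * lm False R m (G False j)))" for l m
  have "tensor R Y k q z = w k q" if k: "k < n True" "q < n False" for k q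
  proof -
    let ?a = "\<lambda>l. nder (Iv True R) k (AA True R l) z1" and ?b = "\<lambda>m. nder (Iv False R) q (AA False R m) z2"
    have "tensor R Y k q z = (\<Sum>l<n True. \<Sum>m<n False. \<Sum>i<n True. \<Sum>j<n False.
        w i j * (lm True R l (G True i) * lm False R m (G False j)) * (?a l * ?b m))"
      unfolding tensor_def zz Y_def by (simp add: sum_distrib_right)
    also have "\<dots> = (\<Sum>l<n True. \<Sum>i<n True. \<Sum>m<n False. \<Sum>j<n False.
        w i j * (lm True R l (G True i) * lm False R m (G False j)) * (?a l * ?b m))"
      by (rule sum.cong[OF refl], rule sum.swap)
    also have "\<dots> = (\<Sum>i<n True. \<Sum>l<n True. \<Sum>m<n False. \<Sum>j<n False.
        w i j * (lm True R l (G True i) * lm False R m (G False j)) * (?a l * ?b m))"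
      by (rule sum.swap)
    also have "\<dots> = (\<Sum>i<n True. \<Sum>l<n True. \<Sum>j<n False. \<Sum>m<n False.
        w i j * (lm True R l (G True i) * lm False R m (G False j)) * (?a l * ?b m))"
      by (rule sum.cong[OF refl], rule sum.cong[OF refl], rule sum.swap)
    also have "\<dots> = (\<Sum>i<n True. \<Sum>j<n False. \<Sum>l<n True. \<Sum>m<n False.
        w i j * (lm True R l (G True i) * lm False R m (G False j)) * (?a l * ?b m))"
      by (rule sum.cong[OF refl], rule sum.swap)
    also have "\<dots> = (\<Sum>i<n True. \<Sum>j<n False. w i j * (nder (Iv True R) k (G True i) z1 * nder (Iv False R) q (G False j) z2))"
      using k zs[of True] zs[of False]
      by (intro sum.cong refl) (simp add: ex zc_def sum_product sum_distrib_left mult_ac)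
    also have "\<dots> = (\<Sum>i<n True. \<Sum>j<n False. w i j * ((if k = i then 1 else 0) * (if q = j then 1 else 0)))"
      using k G(2)[of k True] G(2)[of q False] by (intro sum.cong refl) (simp add: zc_def)
    also have "\<dots> = (\<Sum>i<n True. if k = i then w i q else 0)"
      using k by (intro sum.cong refl) (simp add: if_distrib[of "\<lambda>x. _ * x"] cong: if_cong)
    finally show ?thesis using k by simp
  qed
  then show thesis by (rule that)
qed

end

section \<open>Spans and Bernstein coefficients\<close>

lemma sum_fun_apply: "(sum f A) x = (\<Sum>a\<in>A. f a x)" for f :: "'b \<Rightarrow> 'a \<Rightarrow> real"
  by (induction A rule: infinite_finite_induct) auto

lemma fun_subspaceI:
  assumes "(\<lambda>_. 0) \<in> T" "\<And>f g. f \<in> T \<Longrightarrow> g \<in> T \<Longrightarrow> (\<lambda>x. f x + g x) \<in> T"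
    "\<And>c f. f \<in> T \<Longrightarrow> (\<lambda>x. c * f x) \<in> T"
  shows "fun_space.subspace T"
  by (rule fun_space.subspaceI) (use assms in \<open>auto simp: zero_fun_def plus_fun_def\<close>)

lemma fun_span_sum:
  assumes "\<And>a. a \<in> A \<Longrightarrow> f a \<in> fun_space.span B"
  shows "(\<lambda>x. \<Sum>a\<in>A. c a * f a x) \<in> fun_space.span B"
proof -
  have "(\<Sum>a\<in>A. (\<lambda>x. c a * f a x)) \<in> fun_space.span B"
    by (rule fun_space.span_sum) (intro fun_space.span_scale assms)
  moreover have "(\<Sum>a\<in>A. (\<lambda>x. c a * f a x)) = (\<lambda>x. \<Sum>a\<in>A. c a * f a x)"
    by (simp add: fun_eq_iff sum_fun_apply)
  ultimately show ?thesis by simp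
qed

lemma gspace_iff:
  assumes "3 \<le> n"
  shows "g \<in> gspace n u v a b \<longleftrightarrow> (\<forall>x. x \<notin> {a..b} \<longrightarrow> g x = 0) \<and> g \<in> uspace n u v {a..b}"
proof
  let ?T = "{g. (\<forall>x. x \<notin> {a..b} \<longrightarrow> g x = 0) \<and> g \<in> uspace n u v {a..b}}"
  assume "g \<in> gspace n u v a b"
  moreover have "gspace n u v a b \<subseteq> ?T" unfolding gspace_def
  proof (rule fun_space.span_minimal)
    have zb: "zext {a..b} (ubasis n u v k) \<in> ?T" if "k < n" for k
      using uspace_bas[OF that, of u v "{a..b}"]
        uspace_cong[of "{a..b}" "zext {a..b} (ubasis n u v k)" "ubasis n u v k" n u v]
      by (auto simp: zext_def)
    have "zext {a..b} (\<lambda>s. s ^ i) \<in> ?T" if "i \<le> n - 3" for i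
    proof -
      have "ubasis n u v i = (\<lambda>s. s ^ i)" "i < n" using that assms by (auto simp: ubasis_def)
      then show ?thesis using zb[of i] by simp
    qed
    moreover have "zext {a..b} u \<in> ?T"
    proof -
      have "ubasis n u v (n - 2) = u" using assms by (auto simp: ubasis_def)
      then show ?thesis using zb[of "n - 2"] assms by simp
    qed
    moreover have "zext {a..b} v \<in> ?T"
    proof -
      have "ubasis n u v (n - 1) = v" using assms by (auto simp: ubasis_def)
      then show ?thesis using zb[of "n - 1"] assms by simp
    qed
    ultimately show "(\<lambda>i. zext {a..b} (\<lambda>s. s ^ i)) ` {..n - 3} \<union> {zext {a..b} u, zext {a..b} v} \<subseteq> ?T"
      by blast
    show "fun_space.subspace ?T"
    proof (rule fun_subspaceI)
      show "(\<lambda>_. 0) \<in> ?T" by (simp add: uspace_zero)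
      show "(\<lambda>x. f x + g x) \<in> ?T" if "f \<in> ?T" "g \<in> ?T" for f g
        using uspace_lin[of f n u v "{a..b}" g 1 1] that by simp
      show "(\<lambda>x. c * f x) \<in> ?T" if "f \<in> ?T" for c f
        using uspace_lin[of f n u v "{a..b}" f c 0] that by simp
    qed
  qed
  ultimately show "(\<forall>x. x \<notin> {a..b} \<longrightarrow> g x = 0) \<and> g \<in> uspace n u v {a..b}" by blast
next
  assume g: "(\<forall>x. x \<notin> {a..b} \<longrightarrow> g x = 0) \<and> g \<in> uspace n u v {a..b}"
  then obtain c where c: "\<And>x. x \<in> {a..b} \<Longrightarrow> g x = (\<Sum>k<n. c k * ubasis n u v k x)"
    by (auto simp: uspace_def)
  have "g = (\<lambda>x. \<Sum>k<n. c k * zext {a..b} (ubasis n u v k) x)"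
  proof
    fix x
    show "g x = (\<Sum>k<n. c k * zext {a..b} (ubasis n u v k) x)"
      by (cases "x \<in> {a..b}") (use g c[of x] in \<open>simp_all add: zext_def del: atLeastAtMost_iff\<close>)
  qed
  moreover have "(\<lambda>x. \<Sum>k<n. c k * zext {a..b} (ubasis n u v k) x) \<in> gspace n u v a b"
    unfolding gspace_def
  proof (rule fun_span_sum, rule fun_space.span_base)
    fix k assume "k \<in> {..<n}"
    then show "zext {a..b} (ubasis n u v k) \<in> (\<lambda>i. zext {a..b} (\<lambda>s. s ^ i)) ` {..n - 3} \<union> {zext {a..b} u, zext {a..b} v}"
      by (auto simp: ubasis_def)
  qed
  ultimately show "g \<in> gspace n u v a b" by simp
qed

context uniform_setup
begin

abbreviation "TS R \<equiv> tspace (n True) (n False) (u True) (v True) (u False) (v False) R"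
abbreviation "Bc \<equiv> B_coeff (n True) (n False) (u True) (v True) (u False) (v False)"
abbreviation "cA d R g i \<equiv> bern_coef (n d) (u d) (v d) (lo d R) (hi d R) g i"
abbreviation "BB d R i \<equiv> bern (n d) (u d) (v d) (lo d R) (hi d R) i"

definition tensor_coef :: "cell \<Rightarrow> (nat \<Rightarrow> nat \<Rightarrow> real) \<Rightarrow> nat \<Rightarrow> nat \<Rightarrow> real" where
  "tensor_coef R Y i j = (\<Sum>l<n True. \<Sum>m<n False. Y l m * (cA True R (AA True R l) i * cA False R (AA False R m) j))"

lemma tensor_coef_diff: "tensor_coef R (\<lambda>l m. Y l m - Y' l m) i j = tensor_coef R Y i j - tensor_coef R Y' i j"
  by (simp add: tensor_coef_def left_diff_distrib sum_subtractf)

lemma tensor_sum: "finite A \<Longrightarrow> tensor R (\<lambda>l m. \<Sum>a\<in>A. c a * Y a l m) i j z = (\<Sum>a\<in>A. c a * tensor R (Y a) i j z)"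
  by (induction A rule: finite_induct)
     (auto simp: tensor_def sum.distrib sum_distrib_left distrib_right mult_ac)

lemma tensor_coef_sum: "finite A \<Longrightarrow> tensor_coef R (\<lambda>l m. \<Sum>a\<in>A. c a * Y a l m) i j = (\<Sum>a\<in>A. c a * tensor_coef R (Y a) i j)"
  by (induction A rule: finite_induct)
     (auto simp: tensor_coef_def sum.distrib sum_distrib_left distrib_right mult_ac)

end

context short_cell
begin

text \<open>The functions given by arrays form a subspace containing all products of univariate functions,
  by the expansion of the factors with respect to \<open>AA\<close>.\<close>

lemma tspace_PP:
  assumes "q \<in> TS R"
  obtains Y where "q = zext (region R) (tensor R Y 0 0)"
proof -
  let ?T = "{q. \<exists>Y. q = zext (region R) (tensor R Y 0 0)}"
  have "TS R \<subseteq> ?T" unfolding tspace_def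
  proof (rule fun_space.span_minimal)
    show "{(\<lambda>(s, t). g1 s * g2 t) | g1 g2. g1 \<in> gspace (n True) (u True) (v True) (xl R) (xr R) \<and>
         g2 \<in> gspace (n False) (u False) (v False) (yl R) (yr R)} \<subseteq> ?T"
    proof safe
      fix g1 g2 assume "g1 \<in> gspace (n True) (u True) (v True) (xl R) (xr R)"
        "g2 \<in> gspace (n False) (u False) (v False) (yl R) (yr R)"
      then have g1: "g1 \<in> ES True (Iv True R)" "\<And>x. x \<notin> Iv True R \<Longrightarrow> g1 x = 0"
        and g2: "g2 \<in> ES False (Iv False R)" "\<And>x. x \<notin> Iv False R \<Longrightarrow> g2 x = 0"
        using gspace_iff[OF n3d] by (auto simp: lo_def hi_def)
      have "(\<lambda>(s, t). g1 s * g2 t) = zext (region R) (tensor R (\<lambda>l m. lm True R l g1 * lm False R m g2) 0 0)"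
      proof
        fix z :: pt obtain s t where z: "z = (s, t)" by fastforce
        show "(case z of (s, t) \<Rightarrow> g1 s * g2 t) = zext (region R) (tensor R (\<lambda>l m. lm True R l g1 * lm False R m g2) 0 0) z"
        proof (cases "z \<in> region R")
          case True
          then have st: "s \<in> Iv True R" "t \<in> Iv False R" using z by (auto simp: region_def lo_def hi_def)
          have "g1 s * g2 t = (\<Sum>l<n True. lm True R l g1 * AA True R l s) * (\<Sum>m<n False. lm False R m g2 * AA False R m t)"
            using bernstein_interval.A_expand[OF bi g1(1) st(1)] bernstein_interval.A_expand[OF bi g2(1) st(2)] by simp
          also have "\<dots> = tensor R (\<lambda>l m. lm True R l g1 * lm False R m g2) 0 0 z"
            unfolding sum_product tensor_def z by (simp add: mult_ac)
          finally show ?thesis using True z by (simp add: zext_def)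
        next
          case False
          then have "s \<notin> Iv True R \<or> t \<notin> Iv False R" using z by (auto simp: region_def lo_def hi_def)
          then show ?thesis using False g1(2) g2(2) z by (auto simp: zext_def)
        qed
      qed
      then show "\<exists>Y. (\<lambda>(s, t). g1 s * g2 t) = zext (region R) (tensor R Y 0 0)" by blast
    qed
    show "fun_space.subspace ?T"
    proof (rule fun_subspaceI)
      show "(\<lambda>_. 0) \<in> ?T" by (auto simp: zext_def tensor_def fun_eq_iff intro!: exI[of _ "\<lambda>_ _. 0"])
      show "(\<lambda>x. f x + g x) \<in> ?T" if fg: "f \<in> ?T" "g \<in> ?T" for f g
      proof -
        obtain Y Y' where "f = zext (region R) (tensor R Y 0 0)" "g = zext (region R) (tensor R Y' 0 0)" using fg by blast
        then have "(\<lambda>x. f x + g x) = zext (region R) (tensor R (\<lambda>l m. Y l m + Y' l m) 0 0)"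
          by (auto simp: zext_def tensor_def fun_eq_iff distrib_right sum.distrib)
        then show ?thesis by blast
      qed
      show "(\<lambda>x. c * f x) \<in> ?T" if f: "f \<in> ?T" for c f
      proof -
        obtain Y where "f = zext (region R) (tensor R Y 0 0)" using f by blast
        then have "(\<lambda>x. c * f x) = zext (region R) (tensor R (\<lambda>l m. c * Y l m) 0 0)"
          by (auto simp: zext_def tensor_def fun_eq_iff sum_distrib_left mult.assoc)
        then show ?thesis by blast
      qed
    qed
  qed
  then show thesis using assms that by blast
qed

lemma tensor_tspace: "zext (region R) (tensor R Y 0 0) \<in> TS R"
proof -
  let ?z = "\<lambda>d l. zext (Iv d R) (AA d R l)"
  have gz: "?z d l \<in> gspace (n d) (u d) (v d) (lo d R) (hi d R)" if "l < n d" for d l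
    using AE[OF that] uspace_cong[of "Iv d R" "?z d l" "AA d R l"] unfolding gspace_iff[OF n3d] by (auto simp: zext_def)
  have "zext (region R) (tensor R Y 0 0) = (\<lambda>x. \<Sum>p\<in>{..<n True} \<times> {..<n False}. Y (fst p) (snd p) * (case x of (s, t) \<Rightarrow> ?z True (fst p) s * ?z False (snd p) t))"
    by (auto simp: fun_eq_iff zext_def tensor_def region_def lo_def hi_def sum.cartesian_product split_def)
  moreover have "\<dots> \<in> TS R" unfolding tspace_def
  proof (rule fun_span_sum, rule fun_space.span_base)
    fix p assume "p \<in> {..<n True} \<times> {..<n False}"
    then show "(\<lambda>x. case x of (s, t) \<Rightarrow> ?z True (fst p) s * ?z False (snd p) t) \<in>
      {(\<lambda>(s, t). g1 s * g2 t) | g1 g2. g1 \<in> gspace (n True) (u True) (v True) (xl R) (xr R) \<and>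
         g2 \<in> gspace (n False) (u False) (v False) (yl R) (yr R)}"
      using gz[of "fst p" True] gz[of "snd p" False] unfolding mem_Collect_eq
      by (intro exI[of _ "?z True (fst p)"] exI[of _ "?z False (snd p)"]) (auto simp: lo_def hi_def)
  qed
  ultimately show ?thesis by simp
qed

lemma tensor_bern: "z \<in> region R \<Longrightarrow> tensor R Y 0 0 z = (\<Sum>k<n True. \<Sum>l<n False. tensor_coef R Y k l * (BB True R k (fst z) * BB False R l (snd z)))"
proof -
  assume z: "z \<in> region R"
  then have st: "fst z \<in> Iv True R" "snd z \<in> Iv False R" by (auto simp: region_def lo_def hi_def)
  have A: "AA d R l x = (\<Sum>k<n d. cA d R (AA d R l) k * BB d R k x)" if "l < n d" "x \<in> Iv d R" for d l x
    using bernstein_interval.co[OF bi AE[OF that(1)] that(2)] .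
  let ?t = "\<lambda>l m k q. Y l m * (cA True R (AA True R l) k * cA False R (AA False R m) q) * (BB True R k (fst z) * BB False R q (snd z))"
  have "tensor R Y 0 0 z = (\<Sum>l<n True. \<Sum>m<n False. \<Sum>k<n True. \<Sum>q<n False. ?t l m k q)"
    unfolding tensor_def nder_0 using st
    by (intro sum.cong refl) (simp add: A sum_product sum_distrib_left mult_ac)
  also have "\<dots> = (\<Sum>l<n True. \<Sum>k<n True. \<Sum>m<n False. \<Sum>q<n False. ?t l m k q)"
    by (rule sum.cong[OF refl], rule sum.swap)
  also have "\<dots> = (\<Sum>k<n True. \<Sum>l<n True. \<Sum>m<n False. \<Sum>q<n False. ?t l m k q)" by (rule sum.swap)
  also have "\<dots> = (\<Sum>k<n True. \<Sum>l<n True. \<Sum>q<n False. \<Sum>m<n False. ?t l m k q)"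
    by (rule sum.cong[OF refl], rule sum.cong[OF refl], rule sum.swap)
  also have "\<dots> = (\<Sum>k<n True. \<Sum>q<n False. \<Sum>l<n True. \<Sum>m<n False. ?t l m k q)"
    by (rule sum.cong[OF refl], rule sum.swap)
  finally show ?thesis by (simp add: tensor_coef_def sum_distrib_right)
qed

lemma tensor_coef_unique:
  assumes p: "\<And>s t. s \<in> Iv True R \<Longrightarrow> t \<in> Iv False R \<Longrightarrow>
      p (s, t) = (\<Sum>k<n True. \<Sum>l<n False. c k l * (BB True R k s * BB False R l t))"
    and ij: "i < n True" "j < n False"
  shows "c i j = cA False R (\<lambda>t. cA True R (\<lambda>s. p (s, t)) i) j"
proof -
  have "cA True R (\<lambda>s. p (s, t)) i = (\<Sum>l<n False. c i l * BB False R l t)" if t: "t \<in> Iv False R" for t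
  proof (rule bernstein_interval.co_eq[OF bi _ ij(1)])
    fix s assume "s \<in> Iv True R"
    from p[OF this t] have "p (s, t) = (\<Sum>k<n True. \<Sum>l<n False. c k l * (BB True R k s * BB False R l t))" .
    also have "\<dots> = (\<Sum>k<n True. (\<Sum>l<n False. c k l * BB False R l t) * BB True R k s)"
      unfolding sum_distrib_right by (intro sum.cong refl) (simp add: mult_ac)
    finally show "p (s, t) = (\<Sum>k<n True. (\<Sum>l<n False. c k l * BB False R l t) * BB True R k s)" .
  qed
  from bernstein_interval.co_eq[OF bi this ij(2)] show ?thesis by (rule sym)
qed

text \<open>The definite description is met by \<open>tensor_coef\<close>, which expands the functions \<open>AA\<close> in the Bernstein basis in
  both directions; uniqueness is the univariate one, applied twice.\<close>

lemma Bc_eq: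
  assumes p: "\<And>z. z \<in> region R \<Longrightarrow> p z = tensor R Y 0 0 z" and ij: "i < n True" "j < n False"
  shows "Bc (R, i, j) p = tensor_coef R Y i j"
proof -
  have nn: "{..n True - 1} = {..<n True}" "{..n False - 1} = {..<n False}"
    using n3d[of True] n3d[of False] by auto
  let ?P = "\<lambda>c. \<forall>s\<in>Iv True R. \<forall>t\<in>Iv False R.
    p (s, t) = (\<Sum>k<n True. \<Sum>l<n False. c k l * BB True R k s * BB False R l t)"
  have P: "?P (tensor_coef R Y)"
    using p tensor_bern by (auto simp: region_def lo_def hi_def mult.assoc)
  have U: "c i j = cA False R (\<lambda>t. cA True R (\<lambda>s. p (s, t)) i) j" if "?P c" for c
    by (rule tensor_coef_unique[OF _ ij]) (use that in \<open>simp add: mult.assoc\<close>)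
  have "(THE x. \<exists>c. ?P c \<and> x = c i j) = tensor_coef R Y i j"
  proof (rule the_equality)
    show "\<exists>c. ?P c \<and> tensor_coef R Y i j = c i j" using P by blast
    show "x = tensor_coef R Y i j" if ex: "\<exists>c. ?P c \<and> x = c i j" for x
    proof -
      obtain c where c: "?P c" "x = c i j" using ex by (elim exE conjE)
      from U[OF P] U[OF c(1)] c(2) show ?thesis by simp
    qed
  qed
  then show ?thesis unfolding B_coeff_def prod.case nn by (simp add: lo_def hi_def)
qed

text \<open>The change between Bernstein coefficients and dual functionals is a tensor product of
  univariate changes, which never mix the lower, middle and upper indices.\<close>

lemma tensor_coef_block:
  assumes P: "\<And>i j l m. Q l m \<Longrightarrow> l < n True \<Longrightarrow> m < n False \<Longrightarrow> i < n True \<Longrightarrow> j < n False \<Longrightarrow> bernstein_interval.same (n True) (r True) i l \<Longrightarrow> bernstein_interval.same (n False) (r False) j m \<Longrightarrow> Q i j"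
  shows "(\<forall>i<n True. \<forall>j<n False. Q i j \<longrightarrow> tensor_coef R Y i j = 0) \<longleftrightarrow> (\<forall>l<n True. \<forall>m<n False. Q l m \<longrightarrow> Y l m = 0)"
proof
  assume Y: "\<forall>l<n True. \<forall>m<n False. Q l m \<longrightarrow> Y l m = 0"
  show "\<forall>i<n True. \<forall>j<n False. Q i j \<longrightarrow> tensor_coef R Y i j = 0"
  proof (intro allI impI)
    fix i j assume ij: "i < n True" "j < n False" "Q i j"
    have "Y l m * (cA True R (AA True R l) i * cA False R (AA False R m) j) = 0" if "l < n True" "m < n False" for l m
    proof (cases "bernstein_interval.same (n True) (r True) l i \<and> bernstein_interval.same (n False) (r False) m j")
      case True
      then show ?thesis using P[OF ij(3,1,2)] Y that by auto
    next
      case False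
      then have "\<not> bernstein_interval.same (n True) (r True) i l \<or> \<not> bernstein_interval.same (n False) (r False) j m"
        unfolding bernstein_interval.same_def[OF bi] by blast
      then show ?thesis using bernstein_interval.co_A_block[OF bi] that ij by auto
    qed
    then show "tensor_coef R Y i j = 0" unfolding tensor_coef_def by (intro sum.neutral ballI) auto
  qed
next
  assume c: "\<forall>i<n True. \<forall>j<n False. Q i j \<longrightarrow> tensor_coef R Y i j = 0"
  show "\<forall>l<n True. \<forall>m<n False. Q l m \<longrightarrow> Y l m = 0"
  proof (intro allI impI)
    fix l m assume lm: "l < n True" "m < n False" "Q l m"
    have A: "(\<Sum>i<n d. cA d R (AA d R k) i * lm d R q (BB d R i)) = (if q = k then 1 else 0)" if "k < n d" "q < n d" for d k q
    proof -
      have "lm d R q (AA d R k) = lm d R q (\<lambda>x. \<Sum>i<n d. cA d R (AA d R k) i * BB d R i x)"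
        using bernstein_interval.co[OF bi AE[OF that(1)]] by (intro bernstein_interval.la_cong[OF bi])
      also have "\<dots> = (\<Sum>i<n d. cA d R (AA d R k) i * lm d R q (BB d R i))"
        by (rule bernstein_interval.la_sum[OF bi]) (use that bernstein_interval.B_E[OF bi] in auto)
      finally show ?thesis using bernstein_interval.la_A[OF bi that] by simp
    qed
    let ?L = "\<lambda>i. lm True R l (BB True R i)" and ?N = "\<lambda>j. lm False R m (BB False R j)"
    let ?t = "\<lambda>p q i j. Y p q * (cA True R (AA True R p) i * cA False R (AA False R q) j) * (?L i * ?N j)"
    have "(\<Sum>i<n True. \<Sum>j<n False. tensor_coef R Y i j * (?L i * ?N j)) = (\<Sum>i<n True. \<Sum>j<n False. \<Sum>p<n True. \<Sum>q<n False. ?t p q i j)"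
      by (simp add: tensor_coef_def sum_distrib_right)
    also have "\<dots> = (\<Sum>i<n True. \<Sum>p<n True. \<Sum>j<n False. \<Sum>q<n False. ?t p q i j)"
      by (rule sum.cong[OF refl], rule sum.swap)
    also have "\<dots> = (\<Sum>p<n True. \<Sum>i<n True. \<Sum>j<n False. \<Sum>q<n False. ?t p q i j)" by (rule sum.swap)
    also have "\<dots> = (\<Sum>p<n True. \<Sum>i<n True. \<Sum>q<n False. \<Sum>j<n False. ?t p q i j)"
      by (rule sum.cong[OF refl], rule sum.cong[OF refl], rule sum.swap)
    also have "\<dots> = (\<Sum>p<n True. \<Sum>q<n False. \<Sum>i<n True. \<Sum>j<n False. ?t p q i j)"
      by (rule sum.cong[OF refl], rule sum.swap)
    also have "\<dots> = (\<Sum>p<n True. \<Sum>q<n False. Y p q * ((\<Sum>i<n True. cA True R (AA True R p) i * ?L i) * (\<Sum>j<n False. cA False R (AA False R q) j * ?N j)))"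
      by (intro sum.cong refl) (simp add: sum_product sum_distrib_left mult_ac)
    also have "\<dots> = (\<Sum>p<n True. \<Sum>q<n False. Y p q * ((if l = p then 1 else 0) * (if m = q then 1 else 0)))"
      using A[of _ True l] A[of _ False m] lm by (intro sum.cong refl) simp
    also have "\<dots> = (\<Sum>p<n True. if l = p then Y p m else 0)"
      using lm by (intro sum.cong refl) (simp add: if_distrib[of "\<lambda>x. _ * x"] cong: if_cong)
    also have "\<dots> = Y l m" using lm by simp
    finally have "Y l m = (\<Sum>i<n True. \<Sum>j<n False. tensor_coef R Y i j * (?L i * ?N j))" by simp
    also have "\<dots> = 0"
    proof (intro sum.neutral ballI)
      fix i j assume ij: "i \<in> {..<n True}" "j \<in> {..<n False}"
      show "tensor_coef R Y i j * (?L i * ?N j) = 0"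
      proof (cases "bernstein_interval.same (n True) (r True) i l \<and> bernstein_interval.same (n False) (r False) j m")
        case True
        then show ?thesis using P[OF lm(3,1,2)] c ij by auto
      next
        case False
        then show ?thesis using bernstein_interval.la_B_block[OF bi] lm ij by auto
      qed
    qed
    finally show "Y l m = 0" .
  qed
qed

end

section \<open>Composite edges of a T-mesh\<close>

definition segm :: "bool \<Rightarrow> real \<Rightarrow> real \<Rightarrow> real \<Rightarrow> seg" where
  "segm d c a b = (mkp d a c, mkp d b c)"

lemma seg_pts_segm: "a \<le> b \<Longrightarrow> seg_pts (segm d c a b) = {mkp d x c | x. a \<le> x \<and> x \<le> b}"
proof -
  assume ab: "a \<le> b"
  have "mkp d ((1 - t) * a + t * b) c = (1 - t) *\<^sub>R mkp d a c + t *\<^sub>R mkp d b c" for t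
    by (cases d) (auto simp: mkp_def algebra_simps)
  then have "seg_pts (segm d c a b) = (\<lambda>t. mkp d ((1 - t) * a + t * b) c) ` {0..1}"
    by (simp add: seg_pts_def segm_def closed_segment_image_interval)
  also have "\<dots> = (\<lambda>x. mkp d x c) ` ((\<lambda>t. (1 - t) *\<^sub>R a + t *\<^sub>R b) ` {0..1})" by (simp add: image_image)
  also have "\<dots> = (\<lambda>x. mkp d x c) ` {a..b}"
    using ab by (simp only: closed_segment_image_interval[symmetric] closed_segment_eq_real_ivl if_True)
  finally show ?thesis by (auto simp: image_def)
qed

lemma seg_int_segm: "a < b \<Longrightarrow> seg_int (segm d c a b) = {mkp d x c | x. a < x \<and> x < b}"
proof -
  assume ab: "a < b"
  have "seg_int (segm d c a b) = seg_pts (segm d c a b) - {mkp d a c, mkp d b c}"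
    by (simp add: seg_int_def seg_pts_def segm_def open_segment_def)
  then show ?thesis using seg_pts_segm[of a b d c] ab by (auto simp: order_le_less)
qed

lemma seg_ends_segm: "seg_ends (segm d c a b) = {mkp d a c, mkp d b c}"
  by (simp add: seg_ends_def segm_def)

lemma seg_len_segm: "a \<le> b \<Longrightarrow> seg_len (segm d c a b) = b - a"
  by (cases d) (auto simp: seg_len_def segm_def mkp_def dist_Pair_Pair dist_real_def)

lemma segm_hv: "a < b \<Longrightarrow> horizontal (segm d c a b) \<longleftrightarrow> d" "a < b \<Longrightarrow> vertical (segm d c a b) \<longleftrightarrow> \<not> d"
  by (auto simp: horizontal_def vertical_def segm_def mkp_def)

lemma hv_segm: "horizontal e \<or> vertical e \<Longrightarrow> \<exists>d c a b. a < b \<and> e = segm d c a b"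
proof (elim disjE)
  assume h: "horizontal e"
  obtain p q s t where e: "e = ((p, q), (s, t))" by (metis surj_pair)
  show ?thesis using h unfolding e by (intro exI[of _ True] exI[of _ q] exI[of _ p] exI[of _ s]) (auto simp: horizontal_def segm_def mkp_def)
next
  assume h: "vertical e"
  obtain p q s t where e: "e = ((p, q), (s, t))" by (metis surj_pair)
  show ?thesis using h unfolding e by (intro exI[of _ False] exI[of _ p] exI[of _ q] exI[of _ t]) (auto simp: vertical_def segm_def mkp_def)
qed

lemma segm_inj: "a < b \<Longrightarrow> a' < b' \<Longrightarrow> segm d c a b = segm d' c' a' b' \<longleftrightarrow> d = d' \<and> c = c' \<and> a = a' \<and> b = b'"
  by (cases d; cases d') (auto simp: segm_def mkp_def)

abbreviation cedge :: "bool \<Rightarrow> bool \<Rightarrow> cell \<Rightarrow> seg" where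
  "cedge d \<sigma> R \<equiv> segm d (cell_end (\<not> d) \<sigma> R) (lo d R) (hi d R)"

lemma cell_edges_cedge: "cell_edges R = {cedge d \<sigma> R | d \<sigma>. True}"
proof -
  have "left_edge R = cedge False False R" "right_edge R = cedge False True R"
    "bottom_edge R = cedge True False R" "top_edge R = cedge True True R"
    by (auto simp: left_edge_def right_edge_def bottom_edge_def top_edge_def segm_def mkp_def cell_end_def endpt_def lo_def hi_def)
  then show ?thesis unfolding cell_edges_def by (auto simp: ex_bool_eq)
qed

lemma cell_end_cases: "cell_end d \<sigma> R = lo d R \<or> cell_end d \<sigma> R = hi d R" by (auto simp: cell_end_def endpt_def)

lemma ex_cell_end: "(\<exists>\<sigma>. x = cell_end d \<sigma> R) \<longleftrightarrow> x = lo d R \<or> x = hi d R"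
  by (auto simp: cell_end_def endpt_def ex_bool_eq)

lemma ex_dir: "(\<exists>d'. P d') \<longleftrightarrow> P d \<or> P (\<not> d)" by (cases d) (auto simp: ex_bool_eq)

lemma cell_verts_iff: "mkp d x y \<in> cell_verts R \<longleftrightarrow> (\<exists>\<sigma>. x = cell_end d \<sigma> R) \<and> (\<exists>\<sigma>. y = cell_end (\<not> d) \<sigma> R)"
  by (cases d) (auto simp: cell_verts_def mkp_def cell_end_def endpt_def lo_def hi_def ex_bool_eq)

locale tmesh =
  fixes \<Delta> :: "cell set"
  assumes T: "T_mesh \<Delta>"
begin

lemma fin_D: "finite \<Delta>" and ne_D: "\<Delta> \<noteq> {}" using T by (auto simp: T_mesh_def)
lemma lh: "R \<in> \<Delta> \<Longrightarrow> lo d R < hi d R" using T by (cases d) (auto simp: T_mesh_def lo_def hi_def)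
lemma cell_end_Iv: "R \<in> \<Delta> \<Longrightarrow> cell_end d \<sigma> R \<in> Iv d R" using lh[of R d] by (auto simp: cell_end_def endpt_def)

lemma boundary_iff:
  assumes "R \<in> \<Delta>"
  shows "mkp d x y \<in> cell_boundary R \<longleftrightarrow> x \<in> Iv d R \<and> y \<in> Iv (\<not> d) R \<and> ((\<exists>\<sigma>. x = cell_end d \<sigma> R) \<or> (\<exists>\<sigma>. y = cell_end (\<not> d) \<sigma> R))"
proof -
  have e: "seg_pts (cedge d' \<sigma> R) = {mkp d' t (cell_end (\<not> d') \<sigma> R) | t. t \<in> Iv d' R}" for d' \<sigma>
    using seg_pts_segm[of "lo d' R" "hi d' R"] lh[OF assms, of d'] by simp
  have "mkp d x y \<in> cell_boundary R \<longleftrightarrow> (\<exists>d' \<sigma>. mkp d x y \<in> seg_pts (cedge d' \<sigma> R))"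
    unfolding cell_boundary_def cell_edges_cedge by blast
  also have "\<dots> \<longleftrightarrow> (\<exists>\<sigma>. mkp d x y \<in> seg_pts (cedge d \<sigma> R)) \<or> (\<exists>\<sigma>. mkp (\<not> d) y x \<in> seg_pts (cedge (\<not> d) \<sigma> R))"
    unfolding mkp_not by (rule ex_dir)
  also have "\<dots> \<longleftrightarrow> (\<exists>\<sigma>. x \<in> Iv d R \<and> y = cell_end (\<not> d) \<sigma> R) \<or> (\<exists>\<sigma>. y \<in> Iv (\<not> d) R \<and> x = cell_end d \<sigma> R)"
    unfolding e by auto
  also have "\<dots> \<longleftrightarrow> x \<in> Iv d R \<and> y \<in> Iv (\<not> d) R \<and> ((\<exists>\<sigma>. x = cell_end d \<sigma> R) \<or> (\<exists>\<sigma>. y = cell_end (\<not> d) \<sigma> R))"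
    using cell_end_Iv[OF assms] by blast
  finally show ?thesis .
qed

lemma no_boundary_inside:
  assumes R: "R \<in> \<Delta>" and x: "lo d R < x" "x < hi d R" and y: "lo (\<not> d) R < y" "y < hi (\<not> d) R"
  shows "mkp d x y \<notin> (\<Union>R\<in>\<Delta>. cell_boundary R)"
proof
  assume "mkp d x y \<in> (\<Union>R\<in>\<Delta>. cell_boundary R)"
  then obtain R' where R': "R' \<in> \<Delta>" "mkp d x y \<in> cell_boundary R'" by blast
  have nb: "mkp d x y \<notin> cell_boundary R"
    unfolding boundary_iff[OF R] ex_cell_end using x y by auto
  have "mkp d x y \<in> region R'" using R' boundary_iff by auto
  moreover have "mkp d x y \<in> region R" using x y by simp
  moreover have "R \<noteq> R'" using nb R' by auto
  ultimately show False using nb T R R'(1) unfolding T_mesh_def by blast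
qed

text \<open>A segment crossing the side of a cell between the ends of this side would enter the interior
  of the cell.\<close>

lemma no_perpendicular:
  assumes e: "mesh_segment \<Delta> (segm d c a b)" and x: "a < x" "x < b"
    and R: "R \<in> \<Delta>" "x = cell_end d \<sigma> R" "lo (\<not> d) R < c" "c < hi (\<not> d) R"
  shows False
proof -
  have "\<exists>x'. a < x' \<and> x' < b \<and> lo d R < x' \<and> x' < hi d R"
  proof (cases \<sigma>)
    case True
    then have "max a (lo d R) < x" using x R lh[OF R(1), of d] by (auto simp: cell_end_def endpt_def)
    then obtain x' where "max a (lo d R) < x'" "x' < x" using dense by blast
    then show ?thesis using x R True by (intro exI[of _ x']) (auto simp: cell_end_def endpt_def)
  next
    case False
    then have "x < min b (hi d R)" using x R lh[OF R(1), of d] by (auto simp: cell_end_def endpt_def)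
    then obtain x' where "x < x'" "x' < min b (hi d R)" using dense by blast
    then show ?thesis using x R False by (intro exI[of _ x']) (auto simp: cell_end_def endpt_def)
  qed
  then obtain x' where x': "a < x'" "x' < b" "lo d R < x'" "x' < hi d R" by blast
  have "mkp d x' c \<in> seg_pts (segm d c a b)" using x' seg_pts_segm[of a b d c] by auto
  then have "mkp d x' c \<in> (\<Union>R\<in>\<Delta>. cell_boundary R)" using e by (auto simp: mesh_segment_def)
  then show False using no_boundary_inside[OF R(1) x'(3,4) R(3,4)] by blast
qed

text \<open>An interior point of the segment lies in the relative interior of a cell edge on the segment: if it is a
  vertex, then it is a T-junction, hence interior to an edge of some cell, and that edge cannot be perpendicular.
  This carries all the geometry of composite edges below.\<close>

lemma T_segment_cover:
  assumes e: "T_segment \<Delta> (segm d c a b)" and x: "a < x" "x < b"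
  shows "\<exists>R\<in>\<Delta>. \<exists>\<sigma>. cell_end (\<not> d) \<sigma> R = c \<and> lo d R < x \<and> x < hi d R"
proof -
  have m: "mesh_segment \<Delta> (segm d c a b)" using e by (simp add: T_segment_def)
  have "\<exists>R\<in>\<Delta>. \<exists>d' \<sigma>. mkp d x c \<in> seg_int (cedge d' \<sigma> R)"
  proof (cases "mkp d x c \<in> verts \<Delta>")
    case True
    have "mkp d x c \<in> seg_int (segm d c a b)" using x seg_int_segm[of a b d c] by auto
    then have "T_junction \<Delta> (mkp d x c)" using e True by (auto simp: T_segment_def)
    then show ?thesis unfolding T_junction_def cell_edges_cedge by blast
  next
    case False
    have "mkp d x c \<in> seg_pts (segm d c a b)" using x seg_pts_segm[of a b d c] by auto
    then obtain R where R: "R \<in> \<Delta>" "mkp d x c \<in> cell_boundary R" using m by (auto simp: mesh_segment_def)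
    have nv: "\<not> ((\<exists>\<sigma>. x = cell_end d \<sigma> R) \<and> (\<exists>\<sigma>. c = cell_end (\<not> d) \<sigma> R))"
      using False R(1) unfolding verts_def cell_verts_iff[symmetric] by blast
    have s: "lo d' R < t \<and> t < hi d' R" if "t \<in> Iv d' R" "\<not> (\<exists>\<sigma>. t = cell_end d' \<sigma> R)" for d' t
    proof -
      have "t \<noteq> lo d' R" "t \<noteq> hi d' R" using that(2)
        by (auto simp: cell_end_def endpt_def ex_bool_eq)
      then show ?thesis using that(1) by auto
    qed
    consider \<sigma> where "c = cell_end (\<not> d) \<sigma> R" "lo d R < x" "x < hi d R"
      | \<sigma> where "x = cell_end d \<sigma> R" "lo (\<not> d) R < c" "c < hi (\<not> d) R"
      using R(2) nv s[of x d] s[of c "\<not> d"] unfolding boundary_iff[OF R(1)] by blast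
    then show ?thesis
    proof cases
      case 1
      then have "mkp d x c \<in> seg_int (cedge d \<sigma> R)" using seg_int_segm[OF lh[OF R(1)], of d] by auto
      then show ?thesis using R(1) by blast
    next
      case 2
      then have "mkp (\<not> d) c x \<in> seg_int (cedge (\<not> d) \<sigma> R)" using seg_int_segm[OF lh[OF R(1)], of "\<not> d"] by auto
      then show ?thesis using R(1) unfolding mkp_not by blast
    qed
  qed
  then obtain R d' \<sigma> where R: "R \<in> \<Delta>" "mkp d x c \<in> seg_int (cedge d' \<sigma> R)" by blast
  show ?thesis
  proof (cases "d' = d")
    case True
    then show ?thesis using R seg_int_segm[OF lh[OF R(1)], of d] by auto
  next
    case False
    then have d': "d' = (\<not> d)" by auto
    have "mkp (\<not> d) c x \<in> seg_int (cedge (\<not> d) \<sigma> R)" using R(2) unfolding d' mkp_not .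
    then have "x = cell_end d \<sigma> R" "lo (\<not> d) R < c" "c < hi (\<not> d) R"
      using seg_int_segm[OF lh[OF R(1)], of "\<not> d"] by auto
    then show ?thesis using no_perpendicular[OF m x R(1)] by blast
  qed
qed

text \<open>A vertex in the interior of a cell edge belongs to a different cell, so it is a T-junction.\<close>

lemma cedge_T_segment:
  assumes "R \<in> \<Delta>"
  shows "T_segment \<Delta> (cedge d \<sigma> R)"
proof -
  have l: "lo d R < hi d R" using lh[OF assms] .
  have v: "mkp d t (cell_end (\<not> d) \<sigma> R) \<in> cell_verts R" if "t = lo d R \<or> t = hi d R" for t
    unfolding cell_verts_iff using that by (auto simp: cell_end_def endpt_def ex_bool_eq)
  have m: "mesh_segment \<Delta> (cedge d \<sigma> R)"
    unfolding mesh_segment_def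
  proof (intro conjI)
    show "horizontal (cedge d \<sigma> R) \<or> vertical (cedge d \<sigma> R)" using segm_hv[OF l] by auto
    show "seg_ends (cedge d \<sigma> R) \<subseteq> verts \<Delta>" unfolding seg_ends_segm verts_def using v assms by auto
    show "seg_pts (cedge d \<sigma> R) \<subseteq> (\<Union>R\<in>\<Delta>. cell_boundary R)"
      using assms unfolding cell_boundary_def cell_edges_cedge by blast
  qed
  have "T_junction \<Delta> w" if w: "w \<in> seg_int (cedge d \<sigma> R)" "w \<in> verts \<Delta>" for w
  proof -
    obtain R1 where R1: "R1 \<in> \<Delta>" "w \<in> cell_verts R1" using w(2) by (auto simp: verts_def)
    obtain t where t: "w = mkp d t (cell_end (\<not> d) \<sigma> R)" "lo d R < t" "t < hi d R"
      using w(1) seg_int_segm[OF l] by auto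
    have "w \<notin> cell_verts R" unfolding t(1) cell_verts_iff ex_cell_end using t(2,3) by auto
    then have "R1 \<noteq> R" using R1 by auto
    then show ?thesis unfolding T_junction_def using R1 assms w(1) unfolding cell_edges_cedge by blast
  qed
  then show ?thesis unfolding T_segment_def using m by blast
qed

lemma T_segment_union:
  assumes e: "T_segment \<Delta> (segm d c a b)" "T_segment \<Delta> (segm d c a' b')" and ab: "a < b" "a' < b'"
    and ov: "a < b'" "a' < b"
  shows "T_segment \<Delta> (segm d c (min a a') (max b b'))"
proof -
  let ?e = "segm d c (min a a') (max b b')"
  have l: "min a a' < max b b'" using ab by auto
  have p: "seg_pts ?e \<subseteq> seg_pts (segm d c a b) \<union> seg_pts (segm d c a' b')"
    using seg_pts_segm[of a b d c] seg_pts_segm[of a' b' d c] seg_pts_segm[of "min a a'" "max b b'" d c] ab ov l by auto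
  have i: "seg_int ?e \<subseteq> seg_int (segm d c a b) \<union> seg_int (segm d c a' b')"
    unfolding seg_int_segm[OF ab(1)] seg_int_segm[OF ab(2)] seg_int_segm[OF l] using ab ov by auto
  have m1: "mesh_segment \<Delta> (segm d c a b)" "mesh_segment \<Delta> (segm d c a' b')" using e by (auto simp: T_segment_def)
  have "mesh_segment \<Delta> ?e"
    unfolding mesh_segment_def
  proof (intro conjI)
    show "horizontal ?e \<or> vertical ?e" using segm_hv[OF l] by auto
    show "seg_ends ?e \<subseteq> verts \<Delta>" using m1 unfolding mesh_segment_def seg_ends_segm by (auto simp: min_def max_def)
    show "seg_pts ?e \<subseteq> (\<Union>R\<in>\<Delta>. cell_boundary R)" using p m1 unfolding mesh_segment_def by blast
  qed
  then show ?thesis using i e unfolding T_segment_def by blast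
qed

definition CE :: "bool \<Rightarrow> real \<Rightarrow> real \<Rightarrow> real \<Rightarrow> bool" where
  "CE d c a b \<longleftrightarrow> a < b \<and> composite_edge \<Delta> (segm d c a b)"

lemma CE_T: "CE d c a b \<Longrightarrow> T_segment \<Delta> (segm d c a b)" by (auto simp: CE_def composite_edge_def)
lemma CE_lt: "CE d c a b \<Longrightarrow> a < b" by (auto simp: CE_def)

lemma composite_CE: "composite_edge \<Delta> e \<Longrightarrow> \<exists>d c a b. e = segm d c a b \<and> CE d c a b"
proof -
  assume c: "composite_edge \<Delta> e"
  then have "horizontal e \<or> vertical e" by (auto simp: composite_edge_def T_segment_def mesh_segment_def)
  from hv_segm[OF this] c show ?thesis by (auto simp: CE_def)
qed

lemma CE_maximal:
  assumes e: "CE d c a b" and e': "T_segment \<Delta> (segm d c a' b')" "a' < b'" and ov: "a < b'" "a' < b"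
  shows "a \<le> a' \<and> b' \<le> b"
proof -
  have ab: "a < b" using e by (rule CE_lt)
  have u: "T_segment \<Delta> (segm d c (min a a') (max b b'))"
    by (rule T_segment_union[OF CE_T[OF e] e'(1) ab e'(2) ov])
  have l: "min a a' \<le> max b b'" using ab by auto
  have "seg_pts (segm d c a b) \<subseteq> seg_pts (segm d c (min a a') (max b b'))"
    using seg_pts_segm[of a b d c] seg_pts_segm[OF l, of d c] ab by auto
  moreover have "\<not> seg_pts (segm d c a b) \<subset> seg_pts (segm d c (min a a') (max b b'))"
    using u e unfolding CE_def composite_edge_def by blast
  ultimately have "seg_pts (segm d c a b) = seg_pts (segm d c (min a a') (max b b'))" by blast
  moreover have "mkp d (min a a') c \<in> seg_pts (segm d c (min a a') (max b b'))"
    "mkp d (max b b') c \<in> seg_pts (segm d c (min a a') (max b b'))"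
    using seg_pts_segm[OF l, of d c] l by auto
  ultimately have "mkp d (min a a') c \<in> seg_pts (segm d c a b)" "mkp d (max b b') c \<in> seg_pts (segm d c a b)" by auto
  then show ?thesis using seg_pts_segm[of a b d c] ab by auto
qed

lemma finite_verts: "finite (verts \<Delta>)"
  using fin_D by (auto simp: verts_def cell_verts_def)

lemma finite_T_segments: "finite {e. T_segment \<Delta> e}"
proof (rule finite_subset)
  show "{e. T_segment \<Delta> e} \<subseteq> verts \<Delta> \<times> verts \<Delta>"
    by (auto simp: T_segment_def mesh_segment_def seg_ends_def)
qed (use finite_verts in auto)

lemma finite_composite: "finite {e. composite_edge \<Delta> e}"
  by (rule finite_subset[OF _ finite_T_segments]) (auto simp: composite_edge_def)

text \<open>Among the finitely many such segments containing the given one, a maximal one is a composite edge.\<close>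

lemma CE_exists:
  assumes e: "T_segment \<Delta> (segm d c a b)" and ab: "a < b"
  shows "\<exists>a0 b0. CE d c a0 b0 \<and> a0 \<le> a \<and> b \<le> b0"
proof -
  let ?X = "{e'. T_segment \<Delta> e' \<and> seg_pts (segm d c a b) \<subseteq> seg_pts e'}"
  have fin: "finite ?X" by (rule finite_subset[OF _ finite_T_segments]) auto
  have "\<exists>m\<in>?X. \<forall>e'\<in>?X. card {g\<in>?X. seg_pts g \<subset> seg_pts e'} \<le> card {g\<in>?X. seg_pts g \<subset> seg_pts m}"
  proof -
    let ?f = "\<lambda>e'. card {g\<in>?X. seg_pts g \<subset> seg_pts e'}"
    have ne: "?X \<noteq> {}" using e by blast
    have "Max (?f ` ?X) \<in> ?f ` ?X" using fin ne by (intro Max_in) auto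
    then obtain m where m: "m \<in> ?X" "?f m = Max (?f ` ?X)" by force
    have "?f e' \<le> ?f m" if "e' \<in> ?X" for e' unfolding m(2) using fin that by (intro Max_ge) auto
    then show ?thesis using m(1) by blast
  qed
  then obtain m where m: "m \<in> ?X"
    and mx: "\<And>e'. e' \<in> ?X \<Longrightarrow> card {g\<in>?X. seg_pts g \<subset> seg_pts e'} \<le> card {g\<in>?X. seg_pts g \<subset> seg_pts m}" by blast
  have comp: "composite_edge \<Delta> m"
    unfolding composite_edge_def
  proof (intro conjI notI)
    show "T_segment \<Delta> m" using m by blast
    assume "\<exists>e'. T_segment \<Delta> e' \<and> seg_pts m \<subset> seg_pts e'"
    then obtain e' where e': "T_segment \<Delta> e'" "seg_pts m \<subset> seg_pts e'" by blast
    then have X: "e' \<in> ?X" using m by blast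
    have "{g\<in>?X. seg_pts g \<subset> seg_pts m} \<subset> {g\<in>?X. seg_pts g \<subset> seg_pts e'}"
      using e'(2) m by blast
    then have "card {g\<in>?X. seg_pts g \<subset> seg_pts m} < card {g\<in>?X. seg_pts g \<subset> seg_pts e'}"
    proof (rule psubset_card_mono[rotated])
      show "finite {g\<in>?X. seg_pts g \<subset> seg_pts e'}" by (rule finite_subset[OF _ fin]) blast
    qed
    then show False using mx[OF X] by simp
  qed
  then obtain d' c' a0 b0 where m': "m = segm d' c' a0 b0" "CE d' c' a0 b0" using composite_CE by blast
  have lt: "a0 < b0" using m'(2) by (rule CE_lt)
  have sub: "seg_pts (segm d c a b) \<subseteq> seg_pts (segm d' c' a0 b0)" using m m'(1) by blast
  have pts: "mkp d x c \<in> seg_pts (segm d' c' a0 b0)" if "a \<le> x" "x \<le> b" for x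
    using sub that seg_pts_segm[of a b d c] ab by auto
  have d: "d' = d"
  proof (rule ccontr)
    assume "d' \<noteq> d"
    then have "d' = (\<not> d)" by auto
    then have "mkp (\<not> d) c a \<in> seg_pts (segm (\<not> d) c' a0 b0)" "mkp (\<not> d) c b \<in> seg_pts (segm (\<not> d) c' a0 b0)"
      using pts[of a] pts[of b] ab by (auto simp: mkp_not)
    then show False using seg_pts_segm[of a0 b0 "\<not> d" c'] lt ab by auto
  qed
  then have "c' = c" "a0 \<le> a" "b \<le> b0" using pts[of a] pts[of b] ab lt seg_pts_segm[of a0 b0 d c'] by auto
  then show ?thesis using m'(2) d by auto
qed

lemma CE_of_cell:
  assumes "R \<in> \<Delta>"
  shows "\<exists>a b. CE d (cell_end (\<not> d) \<sigma> R) a b \<and> a \<le> lo d R \<and> hi d R \<le> b"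
  using CE_exists[OF cedge_T_segment[OF assms] lh[OF assms]] .

lemma CE_cell_sub:
  assumes "CE d c a b" "R \<in> \<Delta>" "cell_end (\<not> d) \<sigma> R = c" "a < hi d R" "lo d R < b"
  shows "a \<le> lo d R \<and> hi d R \<le> b"
  using CE_maximal[OF assms(1) _ lh[OF assms(2)] assms(4,5)] cedge_T_segment[OF assms(2), of d \<sigma>] assms(3) by auto

text \<open>Composite edges begin and end with full cell edges: points close enough to the end are covered by
  an edge that lies on the composite edge by maximality and has no end before the end of the composite edge.\<close>

lemma CE_end_cell:
  assumes e: "CE d c a b"
  shows "\<exists>R\<in>\<Delta>. \<exists>\<sigma>. cell_end (\<not> d) \<sigma> R = c \<and> a \<le> lo d R \<and> hi d R \<le> b \<and> cell_end d \<tau> R = endpt \<tau> a b"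
proof -
  have ab: "a < b" using e by (rule CE_lt)
  let ?F = "insert a (insert b (cell_end d \<tau> ` \<Delta>))"
  have fin: "finite ?F" using fin_D by auto
  show ?thesis
  proof (cases \<tau>)
    case True
    \<comment> \<open>no end of a cell edge in question lies strictly between \<open>m\<close> and \<open>b\<close>\<close>
    define m where "m = Max {y\<in>?F. y < b}"
    have "m \<in> {y\<in>?F. y < b}" unfolding m_def using fin ab by (intro Max_in) auto
    then have mb: "m < b" by simp
    have mge: "y \<le> m" if "y \<in> ?F" "y < b" for y unfolding m_def using fin that by (intro Max_ge) auto
    obtain x where x: "m < x" "x < b" using dense[OF mb] by blast
    have "a < x" using mge[of a] ab x by auto
    then obtain R \<sigma> where R: "R \<in> \<Delta>" "cell_end (\<not> d) \<sigma> R = c" "lo d R < x" "x < hi d R"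
      using T_segment_cover[OF CE_T[OF e]] x by blast
    have s: "a \<le> lo d R \<and> hi d R \<le> b" by (rule CE_cell_sub[OF e R(1,2)]) (use R x \<open>a < x\<close> in auto)
    have "hi d R = b"
    proof (rule ccontr)
      assume "hi d R \<noteq> b"
      then have "hi d R \<le> m" using s R(1) True by (intro mge) (auto simp: cell_end_def endpt_def)
      then show False using R x by simp
    qed
    then have "cell_end d \<tau> R = endpt \<tau> a b" using True by (simp add: cell_end_def endpt_def)
    then show ?thesis using R(1,2) s by blast
  next
    case False
    define m where "m = Min {y\<in>?F. a < y}"
    have "m \<in> {y\<in>?F. a < y}" unfolding m_def using fin ab by (intro Min_in) auto
    then have ma: "a < m" by simp
    have mle: "m \<le> y" if "y \<in> ?F" "a < y" for y unfolding m_def using fin that by (intro Min_le) auto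
    obtain x where x: "a < x" "x < m" using dense[OF ma] by blast
    have "x < b" using mle[of b] ab x by auto
    then obtain R \<sigma> where R: "R \<in> \<Delta>" "cell_end (\<not> d) \<sigma> R = c" "lo d R < x" "x < hi d R"
      using T_segment_cover[OF CE_T[OF e]] x by blast
    have s: "a \<le> lo d R \<and> hi d R \<le> b" by (rule CE_cell_sub[OF e R(1,2)]) (use R x \<open>x < b\<close> in auto)
    have "lo d R = a"
    proof (rule ccontr)
      assume "lo d R \<noteq> a"
      then have "m \<le> lo d R" using s R(1) False by (intro mle) (auto simp: cell_end_def endpt_def)
      then show False using R x by simp
    qed
    then have "cell_end d \<tau> R = endpt \<tau> a b" using False by (simp add: cell_end_def endpt_def)
    then show ?thesis using R(1,2) s by blast
  qed
qed

lemma CE_cover: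
  assumes e: "CE d c a b" and x: "a \<le> x" "x \<le> b"
  shows "\<exists>R\<in>\<Delta>. \<exists>\<sigma> U. cell_end (\<not> d) \<sigma> R = c \<and> a \<le> lo d R \<and> hi d R \<le> b \<and> x \<in> Iv d R \<and> open U \<and> x \<in> U \<and> {a..b} \<inter> U \<subseteq> Iv d R"
proof -
  consider "x = a" | "x = b" | "a < x" "x < b" using x by linarith
  then show ?thesis
  proof cases
    case 1
    obtain R \<sigma> where R: "R \<in> \<Delta>" "cell_end (\<not> d) \<sigma> R = c" "a \<le> lo d R" "hi d R \<le> b" "cell_end d False R = endpt False a b"
      using CE_end_cell[OF e] by blast
    then have "lo d R = a" by (simp add: cell_end_def endpt_def)
    then show ?thesis using 1 lh[OF R(1), of d] R
      by (intro bexI[of _ R] exI[of _ \<sigma>] exI[of _ "{..<hi d R}"]) auto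
  next
    case 2
    obtain R \<sigma> where R: "R \<in> \<Delta>" "cell_end (\<not> d) \<sigma> R = c" "a \<le> lo d R" "hi d R \<le> b" "cell_end d True R = endpt True a b"
      using CE_end_cell[OF e] by blast
    then have "hi d R = b" by (simp add: cell_end_def endpt_def)
    then show ?thesis using 2 lh[OF R(1), of d] R
      by (intro bexI[of _ R] exI[of _ \<sigma>] exI[of _ "{lo d R<..}"]) auto
  next
    case 3
    obtain R \<sigma> where R: "R \<in> \<Delta>" "cell_end (\<not> d) \<sigma> R = c" "lo d R < x" "x < hi d R"
      using T_segment_cover[OF CE_T[OF e] 3] by blast
    have s: "a \<le> lo d R \<and> hi d R \<le> b" by (rule CE_cell_sub[OF e R(1,2)]) (use R x in auto)
    show ?thesis using R s
      by (intro bexI[of _ R] exI[of _ \<sigma>] exI[of _ "{lo d R<..<hi d R}"]) auto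
  qed
qed

lemma CE_same:
  assumes "CE d c a b" "CE d c a' b'" "a < x" "x < b" "a' \<le> x" "x \<le> b'"
  shows "a = a' \<and> b = b'"
proof -
  have l: "a < b" "a' < b'" using assms CE_lt by auto
  have o: "a < b'" "a' < b" using assms by auto
  show ?thesis using CE_maximal[OF assms(1) CE_T[OF assms(2)] l(2) o] CE_maximal[OF assms(2) CE_T[OF assms(1)] l(1) o(2,1)] by auto
qed

lemma CE_cross:
  assumes e: "CE d c a b" "a < x" "x < b" and e': "CE (\<not> d) x a' b'" "a' \<le> c" "c \<le> b'"
  shows "c = a' \<or> c = b'"
proof (rule ccontr)
  assume "\<not> (c = a' \<or> c = b')"
  then have c: "a' < c" "c < b'" using e' by auto
  obtain R \<sigma> where R: "R \<in> \<Delta>" "cell_end (\<not> d) \<sigma> R = c" "lo d R < x" "x < hi d R"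
    using T_segment_cover[OF CE_T[OF e(1)] e(2,3)] by blast
  have m: "mesh_segment \<Delta> (segm (\<not> d) x a' b')" using CE_T[OF e'(1)] by (simp add: T_segment_def)
  show False by (rule no_perpendicular[OF m c R(1), of \<sigma>]) (use R in auto)
qed

lemma T_junction_iff:
  assumes "w \<in> verts \<Delta>"
  shows "T_junction \<Delta> w \<longleftrightarrow> (\<exists>d c a b x. CE d c a b \<and> a < x \<and> x < b \<and> w = mkp d x c)"
proof
  assume "T_junction \<Delta> w"
  then obtain R d \<sigma> where R: "R \<in> \<Delta>" "w \<in> seg_int (cedge d \<sigma> R)"
    unfolding T_junction_def cell_edges_cedge by blast
  obtain x where x: "w = mkp d x (cell_end (\<not> d) \<sigma> R)" "lo d R < x" "x < hi d R"
    using R(2) seg_int_segm[OF lh[OF R(1)], of d] by auto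
  obtain a b where "CE d (cell_end (\<not> d) \<sigma> R) a b" "a \<le> lo d R" "hi d R \<le> b" using CE_of_cell[OF R(1)] by blast
  then show "\<exists>d c a b x. CE d c a b \<and> a < x \<and> x < b \<and> w = mkp d x c" using x
    by (intro exI[of _ d] exI[of _ "cell_end (\<not> d) \<sigma> R"] exI[of _ a] exI[of _ b] exI[of _ x]) auto
next
  assume "\<exists>d c a b x. CE d c a b \<and> a < x \<and> x < b \<and> w = mkp d x c"
  then obtain d c a b x where e: "CE d c a b" "a < x" "x < b" "w = mkp d x c" by blast
  have "w \<in> seg_int (segm d c a b)" using e seg_int_segm[OF CE_lt[OF e(1)]] by auto
  then show "T_junction \<Delta> w" using CE_T[OF e(1)] assms unfolding T_segment_def by blast
qed

subsection \<open>Mesh quantities\<close>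

text \<open>The quantity \<open>\<alpha>\<close> compares a composite edge with its first and last edge segment. The cell edge at
  the end contains such a segment, namely the part up to the vertex of the mesh that comes first on it.\<close>

lemma alpha_bound:
  assumes al: "alpha_mesh \<Delta> \<le> \<alpha>" and e: "CE d c a b"
    and R: "R \<in> \<Delta>" "cell_end (\<not> d) \<sigma> R = c" "a \<le> lo d R" "hi d R \<le> b" "cell_end d \<tau> R = endpt \<tau> a b"
  shows "b - a \<le> \<alpha> * (hi d R - lo d R)"
proof -
  have ab: "a < b" using e by (rule CE_lt)
  have lR: "lo d R < hi d R" using lh[OF R(1)] .
  have me: "mesh_segment \<Delta> (segm d c a b)" using CE_T[OF e] by (simp add: T_segment_def)
  have vR: "mkp d (cell_end d \<rho> R) c \<in> verts \<Delta>" for \<rho>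
    using R(1,2) cell_verts_iff[of d "cell_end d \<rho> R" c R] unfolding verts_def by blast
  let ?V = "{x. mkp d x c \<in> verts \<Delta> \<and> lo d R \<le> x \<and> x \<le> hi d R}"
  have "?V \<subseteq> (\<lambda>w. if d then fst w else snd w) ` verts \<Delta>"
  proof
    fix x assume "x \<in> ?V"
    then show "x \<in> (\<lambda>w. if d then fst w else snd w) ` verts \<Delta>"
      by (intro image_eqI[of _ _ "mkp d x c"]) (auto simp: mkp_def)
  qed
  then have "finite ?V" using finite_verts finite_subset by blast
  then have fV: "finite {x\<in>?V. P x}" for P by (rule finite_subset[rotated]) blast
  have "\<exists>p q. p < q \<and> lo d R \<le> p \<and> q \<le> hi d R \<and> (p = a \<or> q = b) \<and> mkp d p c \<in> verts \<Delta> \<and> mkp d q c \<in> verts \<Delta>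
     \<and> (\<forall>x. p < x \<longrightarrow> x < q \<longrightarrow> mkp d x c \<notin> verts \<Delta>)"
  proof (cases \<tau>)
    case True
    \<comment> \<open>the vertex next to the end of the composite edge\<close>
    define m where "m = Max {x\<in>?V. x < hi d R}"
    have "m \<in> {x\<in>?V. x < hi d R}" unfolding m_def
    proof (rule Max_in)
      have "lo d R \<in> {x\<in>?V. x < hi d R}" using vR[of False] lR by (simp add: cell_end_def endpt_def)
      then show "{x\<in>?V. x < hi d R} \<noteq> {}" by blast
    qed (use fV in auto)
    moreover have "x \<le> m" if "x \<in> ?V" "x < hi d R" for x unfolding m_def using fV that by (intro Max_ge) auto
    moreover have "hi d R = b" using R(5) True by (auto simp: cell_end_def endpt_def)
    ultimately show ?thesis using vR[of True]
      by (intro exI[of _ m] exI[of _ "hi d R"]) (force simp: cell_end_def endpt_def)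
  next
    case False
    define m where "m = Min {x\<in>?V. lo d R < x}"
    have "m \<in> {x\<in>?V. lo d R < x}" unfolding m_def
    proof (rule Min_in)
      have "hi d R \<in> {x\<in>?V. lo d R < x}" using vR[of True] lR by (simp add: cell_end_def endpt_def)
      then show "{x\<in>?V. lo d R < x} \<noteq> {}" by blast
    qed (use fV in auto)
    moreover have "m \<le> x" if "x \<in> ?V" "lo d R < x" for x unfolding m_def using fV that by (intro Min_le) auto
    moreover have "lo d R = a" using R(5) False by (auto simp: cell_end_def endpt_def)
    ultimately show ?thesis using vR[of False]
      by (intro exI[of _ "lo d R"] exI[of _ m]) (force simp: cell_end_def endpt_def)
  qed
  then obtain p q where pq: "p < q" "lo d R \<le> p" "q \<le> hi d R" "p = a \<or> q = b" "mkp d p c \<in> verts \<Delta>" "mkp d q c \<in> verts \<Delta>"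
    and nv: "\<And>x. p < x \<Longrightarrow> x < q \<Longrightarrow> mkp d x c \<notin> verts \<Delta>" by blast
  let ?g = "segm d c p q"
  have sub: "seg_pts ?g \<subseteq> seg_pts (segm d c a b)"
    using seg_pts_segm[of p q d c] seg_pts_segm[of a b d c] pq R ab by auto
  have "edge_segment \<Delta> ?g"
    unfolding edge_segment_def mesh_segment_def
  proof (intro conjI)
    show "horizontal ?g \<or> vertical ?g" using segm_hv[OF pq(1)] by auto
    show "seg_ends ?g \<subseteq> verts \<Delta>" using pq by (auto simp: seg_ends_segm)
    show "seg_pts ?g \<subseteq> (\<Union>R\<in>\<Delta>. cell_boundary R)" using sub me unfolding mesh_segment_def by blast
    show "seg_int ?g \<inter> verts \<Delta> = {}" unfolding seg_int_segm[OF pq(1)] using nv by auto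
  qed
  moreover have "seg_ends ?g \<inter> seg_ends (segm d c a b) \<noteq> {}" using pq(4) by (auto simp: seg_ends_segm)
  ultimately have mem: "seg_len (segm d c a b) / seg_len ?g \<in> {seg_len (segm d c a b) / seg_len g | g.
       edge_segment \<Delta> g \<and> seg_pts g \<subseteq> seg_pts (segm d c a b) \<and> seg_ends g \<inter> seg_ends (segm d c a b) \<noteq> {}}" (is "_ \<in> ?S")
    using sub by blast
  have "finite {g. edge_segment \<Delta> g}"
    by (rule finite_subset[OF _ finite_T_segments]) (auto simp: edge_segment_def T_segment_def)
  moreover have "?S \<subseteq> (\<lambda>g. seg_len (segm d c a b) / seg_len g) ` {g. edge_segment \<Delta> g}" by blast
  ultimately have "finite ?S" using finite_subset by blast
  then have "seg_len (segm d c a b) / seg_len ?g \<le> alpha_edge \<Delta> (segm d c a b)"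
    unfolding alpha_edge_def using mem by (intro Max_ge) auto
  also have "\<dots> \<le> alpha_mesh \<Delta>"
    unfolding alpha_mesh_def using e finite_composite by (intro Max_ge) (auto simp: CE_def)
  also have "\<dots> \<le> \<alpha>" by (rule al)
  finally have 1: "(b - a) / (q - p) \<le> \<alpha>" using seg_len_segm[of a b d c] seg_len_segm[of p q d c] ab pq by simp
  then have "b - a \<le> \<alpha> * (q - p)" using pq by (simp add: field_simps)
  also have "\<dots> \<le> \<alpha> * (hi d R - lo d R)"
  proof (rule mult_left_mono)
    have "0 \<le> (b - a) / (q - p)" using ab pq by simp
    then show "0 \<le> \<alpha>" using 1 by linarith
  qed (use pq in auto)
  finally show ?thesis .
qed

lemma kappa_bound:
  assumes ka: "kappa_mesh \<Delta> \<le> \<kappa>" and R: "R \<in> \<Delta>"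
  shows "hi d R - lo d R \<le> \<kappa> * (hi d' R - lo d' R)"
proof -
  let ?L = "seg_len ` cell_edges R"
  have fin: "finite ?L" by (simp add: cell_edges_def)
  have len: "seg_len (cedge d \<sigma> R) = hi d R - lo d R" for d \<sigma> using seg_len_segm lh[OF R, of d] by simp
  have mem: "hi d R - lo d R \<in> ?L" for d
    unfolding len[of d False, symmetric] cell_edges_cedge by blast
  have pos: "0 < Min ?L" 
  proof -
    have "?L \<noteq> {}" using mem[of d] by blast
    then show ?thesis using fin by (subst Min_gr_iff) (auto simp: cell_edges_cedge len lh[OF R])
  qed
  have "Max ?L / Min ?L \<le> kappa_mesh \<Delta>"
    unfolding kappa_mesh_def kappa_cell_def[symmetric] using R fin_D by (intro Max_ge) auto
  then have 1: "Max ?L / Min ?L \<le> \<kappa>" using ka by linarith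
  have M: "hi d R - lo d R \<le> Max ?L" "Min ?L \<le> hi d' R - lo d' R" using fin mem by (auto intro: Max_ge Min_le)
  have k0: "0 \<le> \<kappa>"
  proof -
    have "0 \<le> Max ?L / Min ?L" using M(1) lh[OF R, of d] pos by simp
    then show ?thesis using 1 by linarith
  qed
  have "Max ?L \<le> \<kappa> * Min ?L" using 1 pos by (simp add: field_simps)
  also have "\<dots> \<le> \<kappa> * (hi d' R - lo d' R)" using M(2) k0 by (intro mult_left_mono)
  finally show ?thesis using M(1) by linarith
qed

text \<open>The factor by which powers of lengths change when the recursion passes to the perpendicular
  edge: the last cell edge is comparable to the whole edge by \<open>\<alpha>\<close>, its perpendicular neighbour to it
  by \<open>\<kappa>\<close>, and this neighbour is a part of the perpendicular composite edge.\<close>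

lemma CE_end_length:
  assumes al: "alpha_mesh \<Delta> \<le> \<alpha>" and ka: "kappa_mesh \<Delta> \<le> \<kappa>" and a0: "0 \<le> \<alpha>" "0 \<le> \<kappa>"
    and e: "CE d c a b" and e': "CE (\<not> d) (endpt \<tau> a b) a' b'" "a' < c" "c < b'"
  shows "b - a \<le> \<alpha> * \<kappa> * (b' - a')"
proof -
  obtain R \<sigma> where R: "R \<in> \<Delta>" "cell_end (\<not> d) \<sigma> R = c" "a \<le> lo d R" "hi d R \<le> b" "cell_end d \<tau> R = endpt \<tau> a b"
    using CE_end_cell[OF e] by blast
  have l: "lo (\<not> d) R < hi (\<not> d) R" using lh[OF R(1)] .
  have "c = lo (\<not> d) R \<or> c = hi (\<not> d) R" using cell_end_cases[of "\<not> d" \<sigma> R] R(2) by auto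
  then have "a' < hi (\<not> d) R" "lo (\<not> d) R < b'" using e' l by auto
  then have "a' \<le> lo (\<not> d) R \<and> hi (\<not> d) R \<le> b'"
    by (intro CE_cell_sub[OF e'(1) R(1), of \<tau>]) (use R in auto)
  then have 1: "hi (\<not> d) R - lo (\<not> d) R \<le> b' - a'" by auto
  have "b - a \<le> \<alpha> * (hi d R - lo d R)" by (rule alpha_bound[OF al e R])
  also have "\<dots> \<le> \<alpha> * (\<kappa> * (hi (\<not> d) R - lo (\<not> d) R))" by (intro mult_left_mono kappa_bound[OF ka R(1)] a0)
  also have "\<dots> \<le> \<alpha> * (\<kappa> * (b' - a'))" by (intro mult_left_mono 1 a0)
  finally show ?thesis by (simp add: mult.assoc)
qed

text \<open>The data of \<open>e\<close> at an end in the interior of \<open>e'\<close> are taken from the traces on \<open>e'\<close>.\<close>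

definition depends_on :: "(seg \<times> seg) set" where
  "depends_on = {(e, e'). composite_edge \<Delta> e \<and> composite_edge \<Delta> e' \<and> (\<exists>w\<in>seg_ends e. w \<in> seg_int e')}"

lemma depends_on_CE: "CE d c a b \<Longrightarrow> CE (\<not> d) (endpt \<tau> a b) a' b' \<Longrightarrow> a' < c \<Longrightarrow> c < b' \<Longrightarrow> (segm d c a b, segm (\<not> d) (endpt \<tau> a b) a' b') \<in> depends_on"
  using seg_int_segm[of a' b' "\<not> d" "endpt \<tau> a b"] CE_lt[of "\<not> d" _ a' b']
  by (auto simp: depends_on_def CE_def seg_ends_segm endpt_def mkp_not)

end

locale acmesh = tmesh +
  assumes nc: "\<not> (\<exists>ws. T_cycle \<Delta> ws)"
begin

text \<open>The end points along a cycle of dependencies are T-junctions which form a cycle.\<close>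

lemma depends_on_acyclic: "acyclic depends_on"
proof (rule acyclicI, rule allI, rule notI)
  fix e assume "(e, e) \<in> depends_on\<^sup>+"
  then obtain N where N: "0 < N" "(e, e) \<in> depends_on ^^ N" using trancl_power by metis
  then obtain f where f: "f 0 = e" "f N = e" "\<And>i. i < N \<Longrightarrow> (f i, f (Suc i)) \<in> depends_on" unfolding relpow_fun_conv by blast
  have "\<exists>w. \<forall>i<N. w i \<in> seg_ends (f i) \<and> w i \<in> seg_int (f (Suc i))"
  proof -
    have "\<exists>w. w \<in> seg_ends (f i) \<and> w \<in> seg_int (f (Suc i))" if "i < N" for i using f(3)[OF that] by (auto simp: depends_on_def)
    then show ?thesis by metis
  qed
  then obtain w where w: "\<And>i. i < N \<Longrightarrow> w i \<in> seg_ends (f i)" "\<And>i. i < N \<Longrightarrow> w i \<in> seg_int (f (Suc i))" by blast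
  have ce: "composite_edge \<Delta> (f i)" "composite_edge \<Delta> (f (Suc i))" if "i < N" for i using f(3)[OF that] by (auto simp: depends_on_def)
  have "T_cycle \<Delta> (map w [0..<N])"
    unfolding T_cycle_def
  proof (intro conjI ballI allI impI)
    show "map w [0..<N] \<noteq> []" using N by simp
    show "T_junction \<Delta> x" if x: "x \<in> set (map w [0..<N])" for x
    proof -
      obtain i where i: "i < N" "x = w i" using x by auto
      have "x \<in> verts \<Delta>" using ce(1)[OF i(1)] w(1)[OF i(1)] i(2)
        unfolding composite_edge_def T_segment_def mesh_segment_def by blast
      then show ?thesis using ce(2)[OF i(1)] w(2)[OF i(1)] i(2)
        unfolding composite_edge_def T_segment_def by blast
    qed
    fix i assume "i < length (map w [0..<N])"
    then have i: "i < N" by simp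
    have "w (Suc i mod N) \<in> seg_ends (f (Suc i))"
    proof (cases "Suc i = N")
      case True
      then show ?thesis using w(1)[of 0] f N by simp
    next
      case False
      then show ?thesis using w(1)[of "Suc i"] i by simp
    qed
    then show "\<exists>e. composite_edge \<Delta> e \<and> map w [0..<N] ! i \<in> seg_int e \<and>
        map w [0..<N] ! (Suc i mod length (map w [0..<N])) \<in> seg_ends e"
      using ce(2)[OF i] w(2)[OF i] i N by (intro exI[of _ "f (Suc i)"]) auto
  qed
  then show False using nc by blast
qed

lemma depends_on_finite: "finite depends_on"
  by (rule finite_subset[of _ "{e. composite_edge \<Delta> e} \<times> {e. composite_edge \<Delta> e}"])
     (auto simp: depends_on_def finite_composite)

lemma depends_on_wf: "wf (depends_on\<inverse>)"
  using depends_on_finite depends_on_acyclic by (simp add: finite_acyclic_wf_converse)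

lemma chain_depends_on:
  assumes "edge_chain \<Delta> es e" "composite_edge \<Delta> e" "i < j" "j \<le> length es"
  shows "((es @ [e]) ! i, (es @ [e]) ! j) \<in> depends_on\<^sup>+"
  using assms(3,4)
proof (induction j)
  case (Suc j)
  have c: "composite_edge \<Delta> ((es @ [e]) ! k)" if "k \<le> length es" for k
    using assms(1,2) that unfolding edge_chain_def by (auto simp: nth_append)
  have "((es @ [e]) ! j, (es @ [e]) ! Suc j) \<in> depends_on"
    using assms(1) Suc.prems c[of j] c[of "Suc j"] unfolding edge_chain_def depends_on_def by (auto simp: nth_append)
  then show ?case using Suc by (cases "i = j") (auto intro: trancl_into_trancl)
qed simp

lemma chain_length:
  assumes "edge_chain \<Delta> es e" "composite_edge \<Delta> e"
  shows "length es \<le> card {e. composite_edge \<Delta> e}"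
proof -
  have "distinct es"
  proof (rule ccontr)
    assume "\<not> distinct es"
    then obtain i j where ij: "i < j" "j < length es" "es ! i = es ! j"
      by (metis distinct_conv_nth linorder_neqE_nat)
    then have "(es ! i, es ! i) \<in> depends_on\<^sup>+" using chain_depends_on[OF assms, of i j] by (auto simp: nth_append)
    then show False using depends_on_acyclic unfolding acyclic_def by blast
  qed
  then have "length es = card (set es)" by (simp add: distinct_card)
  also have "\<dots> \<le> card {e. composite_edge \<Delta> e}"
    using assms(1) finite_composite by (intro card_mono) (auto simp: edge_chain_def)
  finally show ?thesis .
qed

lemma chain_extend:
  assumes "edge_chain \<Delta> es e" "composite_edge \<Delta> e"
  shows "\<exists>es'. max_edge_chain \<Delta> es' e \<and> length es \<le> length es'"
  using assms(1)
proof (induction "card {e. composite_edge \<Delta> e} - length es" arbitrary: es rule: less_induct)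
  case less
  show ?case
  proof (cases "\<exists>g. edge_chain \<Delta> (g # es) e")
    case False
    then show ?thesis using less.prems unfolding max_edge_chain_def by blast
  next
    case True
    then obtain g where g: "edge_chain \<Delta> (g # es) e" by blast
    have "length (g # es) \<le> card {e. composite_edge \<Delta> e}" by (rule chain_length[OF g assms(2)])
    then have "card {e. composite_edge \<Delta> e} - length (g # es) < card {e. composite_edge \<Delta> e} - length es" by simp
    from less.hyps[OF this g] show ?thesis by fastforce
  qed
qed

text \<open>A path of dependencies between composite edges is a chain, so the length of chains bounds the
  depth of the recursion.\<close>

lemma path_beta:
  assumes be: "beta_mesh \<Delta> \<le> \<beta>" and p: "(e, e') \<in> depends_on ^^ m" and m: "0 < m"
  shows "m \<le> \<beta>"
proof -
  obtain f where f: "f 0 = e" "f m = e'" "\<And>i. i < m \<Longrightarrow> (f i, f (Suc i)) \<in> depends_on" using p unfolding relpow_fun_conv by blast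
  let ?es = "map f [0..<m]"
  have c: "composite_edge \<Delta> (f i)" if "i \<le> m" for i
    using f(3)[of i] f(3)[of "i - 1"] that m by (cases "i < m") (auto simp: depends_on_def)
  have n: "(?es @ [e']) ! k = f k" if "k \<le> m" for k using that f(2) by (auto simp: nth_append)
  have "edge_chain \<Delta> ?es e'"
    unfolding edge_chain_def
  proof (intro conjI ballI allI impI)
    show "composite_edge \<Delta> g" if "g \<in> set ?es" for g using that c by auto
    fix i assume "i < length ?es"
    then have i: "i < m" by simp
    then show "\<exists>w\<in>seg_ends (?es ! i). w \<in> seg_int ((?es @ [e']) ! Suc i)"
      using f(3)[OF i] n[of "Suc i"] by (auto simp: depends_on_def)
  qed
  then obtain es' where es': "max_edge_chain \<Delta> es' e'" "m \<le> length es'"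
    using chain_extend c[of m] f(2) by fastforce
  have ce': "composite_edge \<Delta> e'" using c[of m] f(2) by simp
  have "length ` {es. max_edge_chain \<Delta> es e'} \<subseteq> {..card {e. composite_edge \<Delta> e}}"
    using chain_length[OF _ ce'] unfolding max_edge_chain_def by blast
  then have "length es' \<le> beta_edge \<Delta> e'"
    unfolding beta_edge_def using es'(1) by (intro Max_ge) (auto intro: finite_subset)
  also have "\<dots> \<le> beta_mesh \<Delta>"
    unfolding beta_mesh_def using ce' finite_composite by (intro Max_ge) auto
  finally show ?thesis using es'(2) be by linarith
qed

end

section \<open>Gluing along composite edges\<close>

lemma Ck_on_local:
  assumes nt: "\<And>x. x \<in> S \<Longrightarrow> at x within S \<noteq> bot"
    and loc: "\<And>x. x \<in> S \<Longrightarrow> \<exists>U T. open U \<and> x \<in> U \<and> S \<inter> U = T \<inter> U \<and> Ck_on k T w"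
  shows "Ck_on k S w"
proof -
  have at: "at x within S = at x within T" if "open U" "x \<in> U" "S \<inter> U = T \<inter> U" for x U T
    by (rule at_within_nhd[of x U]) (use that in auto)
  have ev: "eventually (\<lambda>y. y \<in> S \<longrightarrow> nder S i w y = nder T i w y) (nhds x)"
    if "open U" "x \<in> U" "S \<inter> U = T \<inter> U" for x U T i
  proof -
    have "eventually (\<lambda>y. y \<in> U) (nhds x)" using that by (intro eventually_nhds_in_open) auto
    then show ?thesis by eventually_elim (use nder_local[OF that(1,3)] in auto)
  qed
  show ?thesis
  proof (rule Ck_on_family[where G="\<lambda>i. nder S i w", OF nt])
    fix i x assume i: "i < k" and x: "x \<in> S"
    obtain U T where UT: "open U" "x \<in> U" "S \<inter> U = T \<inter> U" "Ck_on k T w" using loc[OF x] by blast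
    then have xT: "x \<in> T" using x by blast
    have "(nder T i w has_real_derivative nder T (Suc i) w x) (at x within T)" by (rule Ck_on_deriv[OF UT(4) i xT])
    moreover have "nder T (Suc i) w x = nder S (Suc i) w x" by (rule nder_local[OF UT(1) UT(3)[symmetric]]) (use xT UT in auto)
    moreover have "(nder S i w has_vector_derivative D) (at x within S) = (nder T i w has_vector_derivative D) (at x within S)" for D
      by (rule has_vector_derivative_cong_ev[OF ev[OF UT(1-3)]]) (rule nder_local[OF UT(1,3)], use x UT in auto)
    ultimately show "(nder S i w has_real_derivative nder S (Suc i) w x) (at x within S)"
      unfolding has_real_derivative_iff_has_vector_derivative at[OF UT(1-3)] by simp
  next
    show "continuous_on S (nder S k w)"
      unfolding continuous_on_eq_continuous_within
    proof
      fix x assume x: "x \<in> S"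
      obtain U T where UT: "open U" "x \<in> U" "S \<inter> U = T \<inter> U" "Ck_on k T w" using loc[OF x] by blast
      then have xT: "x \<in> T" using x by blast
      have "(nder T k w \<longlongrightarrow> nder T k w x) (at x within T)"
        using Ck_on_cont[OF UT(4), of k] xT by (auto simp: continuous_on_def)
      moreover have "nder T k w x = nder S k w x" by (rule nder_local[OF UT(1) UT(3)[symmetric]]) (use xT UT in auto)
      moreover have "eventually (\<lambda>y. nder S k w y = nder T k w y) (at x within S)"
        using ev[OF UT(1-3), of k] unfolding eventually_at_filter by eventually_elim auto
      ultimately show "continuous (at x within S) (nder S k w)"
        unfolding continuous_within at[OF UT(1-3)] by (simp only: tendsto_cong)
    qed
  qed auto
qed

lemma subinterval_in_open:
  fixes a b y :: real
  assumes "a < b" "y \<in> {a..b}" "open V" "y \<in> V"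
  shows "\<exists>p q. p < q \<and> {p..q} \<subseteq> {a..b} \<inter> V"
proof -
  obtain e where e: "0 < e" "cball y e \<subseteq> V" using assms open_contains_cball by blast
  have V: "x \<in> V" if "\<bar>x - y\<bar> \<le> e" for x using e(2) that by (auto simp: cball_def dist_real_def abs_minus_commute)
  show ?thesis
  proof (cases "y < b")
    case True
    then show ?thesis using assms e V by (intro exI[of _ y] exI[of _ "min b (y + e)"]) auto
  next
    case False
    then show ?thesis using assms e V by (intro exI[of _ "max a (y - e)"] exI[of _ y]) auto
  qed
qed

text \<open>The coefficients are unique on every interval of positive length, so they are locally constant
  along the interval, which is connected.\<close>

lemma uspace_glue:
  assumes gd: "good n u v M \<delta> a b"
    and loc: "\<And>x. x \<in> {a..b} \<Longrightarrow> \<exists>T U. open U \<and> x \<in> U \<and> {a..b} \<inter> U \<subseteq> T \<and> g \<in> uspace n u v T"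
  shows "g \<in> uspace n u v {a..b}"
proof -
  interpret good_interval n u v M \<delta> a b by unfold_locales (rule gd)
  define Q where "Q x c U \<longleftrightarrow> open U \<and> x \<in> U \<and> (\<forall>k\<ge>n. c k = 0) \<and>
    (\<forall>y\<in>{a..b} \<inter> U. g y = (\<Sum>k<n. c k * ubasis n u v k y))" for x c U
  have ex: "\<forall>x\<in>{a..b}. \<exists>cU. Q x (fst cU) (snd cU)"
  proof
    fix x assume x: "x \<in> {a..b}"
    obtain T U where TU: "open U" "x \<in> U" "{a..b} \<inter> U \<subseteq> T" "g \<in> uspace n u v T" using loc[OF x] by blast
    then obtain c where c: "\<And>y. y \<in> T \<Longrightarrow> g y = (\<Sum>k<n. c k * ubasis n u v k y)" by (auto simp: uspace_def)
    show "\<exists>cU. Q x (fst cU) (snd cU)" unfolding Q_def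
      using TU c by (intro exI[of _ "(\<lambda>k. if k < n then c k else 0, U)"]) auto
  qed
  from bchoice[OF ex] obtain F where F: "\<And>x. x \<in> {a..b} \<Longrightarrow> Q x (fst (F x)) (snd (F x))" by blast
  define c where "c x = fst (F x)" for x
  define U where "U x = snd (F x)" for x
  have cU: "\<And>x. x \<in> {a..b} \<Longrightarrow> open (U x)" "\<And>x. x \<in> {a..b} \<Longrightarrow> x \<in> U x"
    "\<And>x k. x \<in> {a..b} \<Longrightarrow> n \<le> k \<Longrightarrow> c x k = 0"
    "\<And>x y. x \<in> {a..b} \<Longrightarrow> y \<in> {a..b} \<inter> U x \<Longrightarrow> g y = (\<Sum>k<n. c x k * ubasis n u v k y)"
    using F unfolding Q_def c_def U_def by blast+
  have eq: "c x = c y" if x: "x \<in> {a..b}" and y: "y \<in> {a..b}" "y \<in> U x" for x y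
  proof
    fix k
    have "open (U x \<inter> U y)" "y \<in> U x \<inter> U y" using cU x y by auto
    from subinterval_in_open[OF ab y(1) this] obtain p q where pq: "p < q" "{p..q} \<subseteq> {a..b} \<inter> (U x \<inter> U y)" by blast
    have "p \<in> {p..q}" "q \<in> {p..q}" using pq(1) by auto
    then have "p \<in> {a..b}" "q \<in> {a..b}" using pq(2) by blast+
    then have "good n u v M \<delta> p q" using good_sub[OF gd _ _ pq(1)] by auto
    then interpret J: good_interval n u v M \<delta> p q by unfold_locales
    have "(\<Sum>k<n. (c x k - c y k) * ubasis n u v k z) = 0" if "z \<in> {p..q}" for z
    proof -
      have "z \<in> {a..b} \<inter> U x" "z \<in> {a..b} \<inter> U y" using that pq(2) by blast+
      then have "(\<Sum>k<n. c x k * ubasis n u v k z) = (\<Sum>k<n. c y k * ubasis n u v k z)" using cU(4)[OF x] cU(4)[OF y(1)] by metis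
      then show ?thesis by (simp add: left_diff_distrib sum_subtractf)
    qed
    from J.coef_unique[OF this] have "k < n \<Longrightarrow> c x k = c y k" by fastforce
    then show "c x k = c y k" using cU(3)[OF x, of k] cU(3)[OF y(1), of k] by (cases "k < n") auto
  qed
  have const: "c x = c a" if x: "x \<in> {a..b}" for x
  proof (rule connected_local_const[where A="{a..b}"])
    show "\<forall>x\<in>{a..b}. eventually (\<lambda>y. c x = c y) (at x within {a..b})"
    proof
      fix x assume x: "x \<in> {a..b}"
      have "eventually (\<lambda>y. y \<in> U x) (nhds x)" using cU x by (intro eventually_nhds_in_open) auto
      then show "eventually (\<lambda>y. c x = c y) (at x within {a..b})"
        unfolding eventually_at_filter by eventually_elim (use eq x in blast)
    qed
  qed (use x ab in auto)
  have "g x = (\<Sum>k<n. c a k * ubasis n u v k x)" if x: "x \<in> {a..b}" for x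
    using cU(4)[OF x, of x] cU(2)[OF x] x const[OF x] by auto
  then show ?thesis unfolding uspace_def by blast
qed

locale spline_setting = uniform_setup n r u v M \<delta> C h0 + acmesh \<Delta>
  for n r :: "bool \<Rightarrow> nat" and u v :: "bool \<Rightarrow> real \<Rightarrow> real" and M \<delta> C h0 :: real and \<Delta> +
  fixes \<alpha> \<kappa> :: real and \<beta> :: nat and cw :: "pt \<Rightarrow> cell" and ce :: "seg \<Rightarrow> cell \<times> seg"
  assumes cells_good: "R \<in> \<Delta> \<Longrightarrow> good_cell R"
    and al: "alpha_mesh \<Delta> \<le> \<alpha>" "1 \<le> \<alpha>" and ka: "kappa_mesh \<Delta> \<le> \<kappa>" "1 \<le> \<kappa>" and be: "beta_mesh \<Delta> \<le> \<beta>"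
    and Mc: "M_choice \<Delta> cw ce"
    and elen: "CE d c a b \<Longrightarrow> b - a \<le> h0" "CE d c a b \<Longrightarrow> b - a \<le> 1"
begin

lemma short_cell: "R \<in> \<Delta> \<Longrightarrow> short_cell n r u v M \<delta> C h0 R"
  using cells_good by unfold_locales

lemma cellint: "R \<in> \<Delta> \<Longrightarrow> bernstein_interval (n d) (u d) (v d) M \<delta> (lo d R) (hi d R) (r d) C"
  using short_cell.bi[OF short_cell] .

lemma nn: "3 \<le> n d" "2 * r d + 2 \<le> n d"
  using ne_D short_cell.n3d[OF short_cell] short_cell.rnd[OF short_cell] by blast+

lemma C1: "1 \<le> C" using ne_D bernstein_interval.C1[OF cellint] by blast
lemma K1_1: "1 \<le> K1 d" by (rule Kc_ge1[OF nn(1) C1])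
lemma M1d: "1 \<le> M" "0 < \<delta>" using ne_D cells_good by (auto simp: good_cell_def good_def)

text \<open>The bounds are local, and every point of a composite edge has a neighbourhood in the edge that lies
  on a single cell edge.\<close>

lemma CE_good:
  assumes e: "CE d c a b"
  shows "good (n d) (u d) (v d) M \<delta> a b"
proof -
  have ab: "a < b" by (rule CE_lt[OF e])
  note nt = at_within_Icc_nontrivial[OF ab]
  have cov: "\<exists>R U. open U \<and> x \<in> U \<and> {a..b} \<inter> U = Iv d R \<inter> U \<and> x \<in> Iv d R \<and> good (n d) (u d) (v d) M \<delta> (lo d R) (hi d R)"
    if "x \<in> {a..b}" for x
  proof -
    have "a \<le> x" "x \<le> b" using that by auto
    from CE_cover[OF e this] obtain R \<sigma> U where R: "R \<in> \<Delta>" "a \<le> lo d R" "hi d R \<le> b" "x \<in> Iv d R"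
      "open U" "x \<in> U" "{a..b} \<inter> U \<subseteq> Iv d R" by blast
    have "{a..b} \<inter> U = Iv d R \<inter> U" using R by auto
    then show ?thesis using R cells_good[OF R(1)] unfolding good_cell_def by blast
  qed
  have C: "Ck_on (n d) {a..b} w" if w: "w = u d \<or> w = v d" for w
  proof (rule Ck_on_local[OF nt])
    fix x assume "x \<in> {a..b}"
    from cov[OF this] show "\<exists>U T. open U \<and> x \<in> U \<and> {a..b} \<inter> U = T \<inter> U \<and> Ck_on (n d) T w"
      using w unfolding good_def by blast
  qed
  have P: "(\<forall>i\<le>n d. \<bar>nder {a..b} i (u d) x\<bar> \<le> M \<and> \<bar>nder {a..b} i (v d) x\<bar> \<le> M) \<and> \<delta> \<le> \<bar>det_D (n d) (u d) (v d) {a..b} x\<bar>"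
    if x: "x \<in> {a..b}" for x
  proof -
    obtain R U where R: "open U" "x \<in> U" "{a..b} \<inter> U = Iv d R \<inter> U" "x \<in> Iv d R"
      and g: "good (n d) (u d) (v d) M \<delta> (lo d R) (hi d R)" using cov[OF x] by blast
    have "nder {a..b} i w x = nder (Iv d R) i w x" for i w by (rule nder_local[OF R(1,3)]) (use x R in auto)
    then show ?thesis using g R(4) unfolding good_def det_D_def by auto
  qed
  show ?thesis unfolding good_def using nn(1) M1d ab elen(2)[OF e] C P by auto
qed

lemma CE_bint: "CE d c a b \<Longrightarrow> bernstein_interval (n d) (u d) (v d) M \<delta> a b (r d) C"
  by (rule all_bint[OF CE_good elen(1)])

lemma CE_edgeint:
  assumes e: "CE d c a b" and R: "R \<in> \<Delta>" "cell_end (\<not> d) \<sigma> R = c" "a \<le> lo d R" "hi d R \<le> b" "cell_end d \<tau> R = endpt \<tau> a b"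
  shows "edge_interval (n d) (u d) (v d) M \<delta> a b (lo d R) (hi d R) (r d) C \<tau> \<alpha>"
proof -
  interpret e: bernstein_interval "n d" "u d" "v d" M \<delta> a b "r d" C by (rule CE_bint[OF e])
  interpret T: bernstein_interval "n d" "u d" "v d" M \<delta> "lo d R" "hi d R" "r d" C by (rule cellint[OF R(1)])
  show ?thesis
    by unfold_locales (use R al alpha_bound[OF al(1) e R] in \<open>auto simp: cell_end_def\<close>)
qed

abbreviation "\<Omega> \<equiv> mesh_domain \<Delta>"
abbreviation "GSp \<equiv> GS (n True) (n False) (r True) (r False) (u True) (v True) (u False) (v False) \<Delta>"

lemma region_sub: "R \<in> \<Delta> \<Longrightarrow> region R \<subseteq> \<Omega>" by (auto simp: mesh_domain_def)

definition represents :: "(pt \<Rightarrow> real) \<Rightarrow> (cell \<Rightarrow> nat \<Rightarrow> nat \<Rightarrow> real) \<Rightarrow> bool" where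
  "represents p Y \<longleftrightarrow> (\<forall>R\<in>\<Delta>. \<forall>z\<in>region R. p z = tensor R (Y R) 0 0 z)"

lemma GS_represents:
  assumes "p \<in> GSp"
  shows "\<exists>Y. represents p Y"
proof -
  have "\<exists>Y. \<forall>z\<in>region R. p z = tensor R Y 0 0 z" if R: "R \<in> \<Delta>" for R
  proof -
    have "zext (region R) p \<in> TS R" using assms R by (auto simp: GS_def)
    then obtain Y where "zext (region R) p = zext (region R) (tensor R Y 0 0)" using short_cell.tspace_PP[OF short_cell[OF R]] by blast
    then show ?thesis by (intro exI[of _ Y]) (auto simp: zext_def fun_eq_iff split: if_splits)
  qed
  then show ?thesis unfolding represents_def by metis
qed

text \<open>Both sides are families of derivatives on the region of the cell, whose slices are intervals.\<close>

lemma GS_Dst: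
  assumes p: "p \<in> GSp" and Y: "represents p Y" and R: "R \<in> \<Delta>" and ij: "i \<le> r True" "j \<le> r False" and z: "z \<in> region R"
  shows "Dst \<Omega> i j p z = tensor R (Y R) i j z"
proof -
  interpret short_cell n r u v M \<delta> C h0 R by (rule short_cell[OF R])
  have "deriv_family \<Omega> (r True) (r False) (\<lambda>i j. Dst \<Omega> i j p)" using p by (intro Cmm_deriv_family) (auto simp: GS_def)
  then have F: "deriv_family (region R) (r True) (r False) (\<lambda>i j. Dst \<Omega> i j p)" by (rule deriv_family_subset[OF _ region_sub[OF R]])
  have "Dst (region R) i j p z = Dst \<Omega> i j p z" by (rule deriv_family_Dst(1)[OF region_slices_nontrivial F]) (use ij z in auto)
  moreover have "Dst (region R) i j p z = tensor R (Y R) i j z"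
    by (rule tensor_Dst) (use Y R ij z rnd[of True] rnd[of False] in \<open>auto simp: represents_def\<close>)
  ultimately show ?thesis by simp
qed

lemma trace_slice:
  assumes p: "p \<in> GSp" and Y: "represents p Y" and R: "R \<in> \<Delta>" "cell_end (\<not> d) \<sigma> R = c"
    and ij: "i \<le> r d" "j \<le> r (\<not> d)" and x: "x \<in> Iv d R"
  shows "JJ d (\<lambda>i j. Dst \<Omega> i j p) i j (mkp d x c) = JJ d (tensor R (Y R)) i j (mkp d x c)"
proof -
  have "mkp d x c \<in> region R" using x R short_cell.cell_end_in[OF short_cell[OF R(1)], of "\<not> d" \<sigma>] by auto
  then show ?thesis using GS_Dst[OF p Y R(1)] ij by (cases d) (auto simp: JJ_def)
qed

text \<open>The normal derivatives of a spline along a composite edge form a single element of the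
  univariate space: every point of the edge has a neighbourhood in it that lies on one cell edge, and
  coefficients on an interval are unique.\<close>

lemma trace_E:
  assumes p: "p \<in> GSp" and Y: "represents p Y" and e: "CE d c a b" and j: "j \<le> r (\<not> d)"
  shows "(\<lambda>x. JJ d (\<lambda>i j. Dst \<Omega> i j p) 0 j (mkp d x c)) \<in> ES d {a..b}"
proof (rule uspace_glue[OF CE_good[OF e]])
  fix x assume "x \<in> {a..b}"
  then have "a \<le> x" "x \<le> b" by auto
  from CE_cover[OF e this] obtain R \<sigma> U where R: "R \<in> \<Delta>" "cell_end (\<not> d) \<sigma> R = c"
    and U: "open U" "x \<in> U" "{a..b} \<inter> U \<subseteq> Iv d R" by blast
  have "(\<lambda>x. JJ d (\<lambda>i j. Dst \<Omega> i j p) 0 j (mkp d x c)) \<in> ES d (Iv d R)"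
    using short_cell.slice_E[OF short_cell[OF R(1)], of d "Y R" j c] trace_slice[OF p Y R _ j, of 0]
    by (subst uspace_cong[where g="\<lambda>x. JJ d (tensor R (Y R)) 0 j (mkp d x c)"]) auto
  then show "\<exists>T U. open U \<and> x \<in> U \<and> {a..b} \<inter> U \<subseteq> T \<and> (\<lambda>x. JJ d (\<lambda>i j. Dst \<Omega> i j p) 0 j (mkp d x c)) \<in> ES d T"
    using U by blast
qed

lemma nder_edge_cell:
  assumes e: "CE d c a b" and g: "g \<in> ES d {a..b}" and R: "R \<in> \<Delta>" "a \<le> lo d R" "hi d R \<le> b" and i: "i \<le> n d" and x: "x \<in> Iv d R"
  shows "nder {a..b} i g x = nder (Iv d R) i g x"
  by (rule nder_subset[symmetric, OF good_interval.E_Ck[OF bernstein_interval.axioms(1)[OF CE_bint[OF e]] g] _ good_interval.nt[OF bernstein_interval.axioms(1)[OF cellint[OF R(1)]]]])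
     (use R i x in auto)

lemma trace_nder:
  assumes p: "p \<in> GSp" and Y: "represents p Y" and e: "CE d c a b" and j: "j \<le> r (\<not> d)"
    and R: "R \<in> \<Delta>" "cell_end (\<not> d) \<sigma> R = c" "a \<le> lo d R" "hi d R \<le> b" and x: "x \<in> Iv d R" and i: "i \<le> n d"
  shows "nder {a..b} i (\<lambda>x. JJ d (\<lambda>i j. Dst \<Omega> i j p) 0 j (mkp d x c)) x = JJ d (tensor R (Y R)) i j (mkp d x c)"
proof -
  let ?g = "\<lambda>x. JJ d (\<lambda>i j. Dst \<Omega> i j p) 0 j (mkp d x c)"
  have "nder {a..b} i ?g x = nder (Iv d R) i ?g x" by (rule nder_edge_cell[OF e trace_E[OF p Y e j] R(1,3,4) i x])
  also have "\<dots> = nder (Iv d R) i (\<lambda>x. JJ d (tensor R (Y R)) 0 j (mkp d x c)) x"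
    by (rule nder_cong[OF _ x]) (use trace_slice[OF p Y R(1,2) _ j, of 0] in auto)
  also have "\<dots> = JJ d (tensor R (Y R)) i j (mkp d x c)" by (rule short_cell.slice_nder[OF short_cell[OF R(1)] i x])
  finally show ?thesis .
qed

end

section \<open>The determining set\<close>

context spline_setting
begin

abbreviation "Mset \<equiv> M_set (n True) (n False) (r True) (r False) \<Delta> cw ce"
abbreviation "mi d l \<equiv> mid_index (n d) (r d) l"
definition "nr d \<sigma> i \<longleftrightarrow> i < n d \<and> idx (n d) \<sigma> i \<le> r d"

lemma nr_idx: "j \<le> r d \<Longrightarrow> nr d \<sigma> (idx (n d) \<sigma> j)"
  using nn(2)[of d] by (auto simp: nr_def)

lemma nr_ex: "nr d \<sigma> i \<Longrightarrow> \<exists>j\<le>r d. i = idx (n d) \<sigma> j"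
  unfolding nr_def by (intro exI[of _ "idx (n d) \<sigma> i"]) auto

lemma same_nr: "nr d \<sigma> l \<Longrightarrow> bernstein_interval.same (n d) (r d) i l \<Longrightarrow> i < n d \<Longrightarrow> nr d \<sigma> i"
  using ne_D bernstein_interval.same_def[OF cellint] by (cases \<sigma>) (auto simp: nr_def idx_def)

lemma same_mi: "mi d l \<Longrightarrow> bernstein_interval.same (n d) (r d) i l \<Longrightarrow> mi d i"
  using ne_D bernstein_interval.same_def[OF cellint] by (auto simp: mid_index_def)

lemma cw_corner:
  assumes "w \<in> verts \<Delta>" "\<not> T_junction \<Delta> w"
  shows "cw w \<in> \<Delta> \<and> (\<exists>\<sigma> \<tau>. w = mkp True (cell_end True \<sigma> (cw w)) (cell_end False \<tau> (cw w)))"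
proof -
  obtain ew where ew: "cw w \<in> \<Delta>" "ew \<in> cell_edges (cw w)" "w \<in> seg_ends ew"
    using Mc assms unfolding M_choice_def by blast
  obtain d \<sigma> where "ew = cedge d \<sigma> (cw w)" using ew(2) unfolding cell_edges_cedge by blast
  then have "w = mkp d (lo d (cw w)) (cell_end (\<not> d) \<sigma> (cw w)) \<or> w = mkp d (hi d (cw w)) (cell_end (\<not> d) \<sigma> (cw w))"
    using ew(3) by (auto simp: seg_ends_segm)
  then have "\<exists>\<tau>. w = mkp d (cell_end d \<tau> (cw w)) (cell_end (\<not> d) \<sigma> (cw w))"
    by (auto simp: cell_end_def endpt_def ex_bool_eq)
  then obtain \<tau> where "w = mkp d (cell_end d \<tau> (cw w)) (cell_end (\<not> d) \<sigma> (cw w))" ..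
  then show ?thesis using ew(1) by (cases d) (auto simp: mkp_def)
qed

lemma ce_edge:
  assumes e: "CE d c a b" and R: "R = fst (ce (segm d c a b))"
  shows "R \<in> \<Delta> \<and> (\<exists>\<sigma> \<tau>. snd (ce (segm d c a b)) = cedge d \<sigma> R \<and> cell_end (\<not> d) \<sigma> R = c \<and>
     a \<le> lo d R \<and> hi d R \<le> b \<and> cell_end d \<tau> R = endpt \<tau> a b)"
proof -
  have ab: "a < b" by (rule CE_lt[OF e])
  let ?g = "snd (ce (segm d c a b))"
  have "composite_edge \<Delta> (segm d c a b)" using e by (simp add: CE_def)
  then obtain w1 where w: "w1 \<in> seg_ends (segm d c a b)" "R \<in> \<Delta>" "?g \<in> cell_edges R"
      "w1 \<in> seg_ends ?g" "seg_pts ?g \<subseteq> seg_pts (segm d c a b)"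
    using Mc unfolding M_choice_def R by blast
  obtain d' \<sigma> where g: "?g = cedge d' \<sigma> R" using w(3) unfolding cell_edges_cedge by blast
  have l: "lo d' R < hi d' R" by (rule lh[OF w(2)])
  have in1: "mkp d' (lo d' R) (cell_end (\<not> d') \<sigma> R) \<in> seg_pts (segm d c a b)"
    and in2: "mkp d' (hi d' R) (cell_end (\<not> d') \<sigma> R) \<in> seg_pts (segm d c a b)"
    using w(5) l unfolding g by (auto simp: seg_pts_segm)
  have d: "d' = d"
  proof (rule ccontr)
    assume "d' \<noteq> d"
    then have d': "d' = (\<not> d)" by auto
    have "lo (\<not> d) R = c" "hi (\<not> d) R = c"
      using in1 in2 ab unfolding d' by (auto simp: seg_pts_segm mkp_not)
    then show False using l d' by auto
  qed
  have s: "cell_end (\<not> d) \<sigma> R = c" "a \<le> lo d R" "hi d R \<le> b"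
    using in1 in2 ab unfolding d by (auto simp: seg_pts_segm)
  have "(lo d R = a \<or> hi d R = a) \<or> (lo d R = b \<or> hi d R = b)"
    using w(1,4) unfolding g d by (auto simp: seg_ends_segm)
  then have "\<exists>\<tau>. cell_end d \<tau> R = endpt \<tau> a b" using s l[unfolded d] by (auto simp: cell_end_def endpt_def ex_bool_eq)
  then show ?thesis using w(2) g s unfolding d by blast
qed

text \<open>The blocks of functionals that correspond to the points of \<open>M\<close> at vertices, at composite edges and in
  cells.\<close>

definition vanishes_on_M :: "(cell \<Rightarrow> nat \<Rightarrow> nat \<Rightarrow> real) \<Rightarrow> bool" where
  "vanishes_on_M D \<longleftrightarrow>
    (\<forall>w \<sigma> \<tau> l m. w \<in> verts \<Delta> \<longrightarrow> \<not> T_junction \<Delta> w \<longrightarrow> w = mkp True (cell_end True \<sigma> (cw w)) (cell_end False \<tau> (cw w)) \<longrightarrow>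
       nr True \<sigma> l \<longrightarrow> nr False \<tau> m \<longrightarrow> D (cw w) l m = 0) \<and>
    (\<forall>d c a b \<sigma> l m. CE d c a b \<longrightarrow> snd (ce (segm d c a b)) = cedge d \<sigma> (fst (ce (segm d c a b))) \<longrightarrow>
       mi d l \<longrightarrow> nr (\<not> d) \<sigma> m \<longrightarrow> dir_array d (D (fst (ce (segm d c a b)))) l m = 0) \<and>
    (\<forall>R l m. R \<in> \<Delta> \<longrightarrow> mi True l \<longrightarrow> mi False m \<longrightarrow> D R l m = 0)"

lemma block_iff:
  assumes R: "R \<in> \<Delta>" and Q: "\<And>i j l m. Q l m \<Longrightarrow> i < n True \<Longrightarrow> j < n False \<Longrightarrow>
      bernstein_interval.same (n True) (r True) i l \<Longrightarrow> bernstein_interval.same (n False) (r False) j m \<Longrightarrow> Q i j"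
    and lt: "\<And>l m. Q l m \<Longrightarrow> l < n True \<and> m < n False"
  shows "(\<forall>i j. Q i j \<longrightarrow> tensor_coef R Y i j = 0) \<longleftrightarrow> (\<forall>l m. Q l m \<longrightarrow> Y l m = 0)"
  using short_cell.tensor_coef_block[OF short_cell[OF R], of Q Y] Q lt by blast

lemma mi_lt: "mi d l \<Longrightarrow> l < n d" by (auto simp: mid_index_def)
lemma nr_lt: "nr d \<sigma> l \<Longrightarrow> l < n d" by (auto simp: nr_def)

lemma mi_nr: "mi d i \<longleftrightarrow> i < n d \<and> \<not> nr d False i \<and> \<not> nr d True i"
  by (auto simp: nr_def mid_index_def idx_def)

lemma disk_block:
  assumes R: "R \<in> \<Delta>" and w: "w = mkp True (cell_end True \<sigma> R) (cell_end False \<tau> R)"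
  shows "disk (n True) (n False) (r True) (r False) R w = {(R, i, j) | i j. nr True \<sigma> i \<and> nr False \<tau> j}"
proof -
  have l: "xl R < xr R" "yl R < yr R" using lh[OF R, of True] lh[OF R, of False] by (auto simp: lo_def hi_def)
  have s: "(fst w = xl R \<and> i \<le> r True \<or> fst w = xr R \<and> n True - 1 - i \<le> r True) \<longleftrightarrow> idx (n True) \<sigma> i \<le> r True" for i
    unfolding w using l by (cases \<sigma>) (auto simp: mkp_def cell_end_def endpt_def lo_def hi_def idx_def)
  have t: "(snd w = yl R \<and> i \<le> r False \<or> snd w = yr R \<and> n False - 1 - i \<le> r False) \<longleftrightarrow> idx (n False) \<tau> i \<le> r False" for i
    unfolding w using l by (cases \<tau>) (auto simp: mkp_def cell_end_def endpt_def lo_def hi_def idx_def)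
  have d: "(R, i, j) \<in> dpts (n True) (n False) R \<longleftrightarrow> i < n True \<and> j < n False" for i j
    using nn(1)[of True] nn(1)[of False] by (auto simp: dpts_def)
  show ?thesis unfolding disk_def s t d nr_def by auto
qed

lemma edge_block:
  assumes e: "CE d c a b" and R: "R = fst (ce (segm d c a b))" and g: "snd (ce (segm d c a b)) = cedge d \<sigma> R"
  shows "M_edge (n True) (n False) (r True) (r False) ce (segm d c a b) =
    {(R, i, j) | i j. if d then mi True i \<and> nr False \<sigma> j else nr True \<sigma> i \<and> mi False j}"
proof -
  have RD: "R \<in> \<Delta>" using ce_edge[OF e R] by blast
  have l: "xl R < xr R" "yl R < yr R" using lh[OF RD, of True] lh[OF RD, of False] by (auto simp: lo_def hi_def)
  have d: "(R, i, j) \<in> dpts (n True) (n False) R \<longleftrightarrow> i < n True \<and> j < n False" for i j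
    using nn(1)[of True] nn(1)[of False] by (auto simp: dpts_def)
  have v: "vertical (segm d c a b) \<longleftrightarrow> \<not> d" using segm_hv(2)[OF CE_lt[OF e]] .
  have ge: "segm False (cell_end True False R) (lo False R) (hi False R) = left_edge R"
    "segm False (cell_end True True R) (lo False R) (hi False R) = right_edge R"
    "segm True (cell_end False False R) (lo True R) (hi True R) = bottom_edge R"
    "segm True (cell_end False True R) (lo True R) (hi True R) = top_edge R"
    by (auto simp: left_edge_def right_edge_def bottom_edge_def top_edge_def segm_def mkp_def cell_end_def endpt_def lo_def hi_def)
  have ne: "left_edge R \<noteq> right_edge R" "left_edge R \<noteq> bottom_edge R" "left_edge R \<noteq> top_edge R"
    "right_edge R \<noteq> bottom_edge R" "right_edge R \<noteq> top_edge R" "bottom_edge R \<noteq> top_edge R"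
    using l by (auto simp: left_edge_def right_edge_def bottom_edge_def top_edge_def)
  have near: "near_edge (n True) (n False) (if vertical (segm d c a b) then r True else r False) R (cedge d \<sigma> R)
    = {(R, i, j) | i j. i < n True \<and> j < n False \<and> (if d then nr False \<sigma> j else nr True \<sigma> i)}"
    unfolding near_edge_def d v by (cases d; cases \<sigma>) (use ne ne[symmetric] in \<open>auto simp: ge nr_def idx_def\<close>)
  have e1: "fst (cedge d \<sigma> R) = mkp True (cell_end True (if d then False else \<sigma>) R) (cell_end False (if d then \<sigma> else False) R)"
    by (cases d) (auto simp: segm_def mkp_def cell_end_def endpt_def)
  have e2: "snd (cedge d \<sigma> R) = mkp True (cell_end True (if d then True else \<sigma>) R) (cell_end False (if d then \<sigma> else True) R)"
    by (cases d) (auto simp: segm_def mkp_def cell_end_def endpt_def)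
  have "M_edge (n True) (n False) (r True) (r False) ce (segm d c a b) =
     {(R, i, j) | i j. i < n True \<and> j < n False \<and> (if d then nr False \<sigma> j else nr True \<sigma> i)} -
     ({(R, i, j) | i j. nr True (if d then False else \<sigma>) i \<and> nr False (if d then \<sigma> else False) j} \<union>
      {(R, i, j) | i j. nr True (if d then True else \<sigma>) i \<and> nr False (if d then \<sigma> else True) j})"
    unfolding M_edge_def Let_def R[symmetric] g near disk_block[OF RD e1] disk_block[OF RD e2] ..
  also have "\<dots> = {(R, i, j) | i j. if d then mi True i \<and> nr False \<sigma> j else nr True \<sigma> i \<and> mi False j}"
    by (cases d) (auto simp: mi_nr dest: nr_lt)
  finally show ?thesis .
qed

lemma M_set_sub: "(R, i, j) \<in> Mset \<Longrightarrow> R \<in> \<Delta> \<and> i < n True \<and> j < n False"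
proof -
  assume "(R, i, j) \<in> Mset"
  then consider w where "w \<in> verts \<Delta>" "\<not> T_junction \<Delta> w" "(R, i, j) \<in> disk (n True) (n False) (r True) (r False) (cw w) w"
    | e where "composite_edge \<Delta> e" "(R, i, j) \<in> M_edge (n True) (n False) (r True) (r False) ce e"
    | R' where "R' \<in> \<Delta>" "(R, i, j) \<in> M_cell (n True) (n False) (r True) (r False) R'"
    unfolding M_set_def M_vertex_def by blast
  then show ?thesis
  proof cases
    case 1
    from cw_corner[OF 1(1,2)] obtain \<sigma> \<tau> where c: "cw w \<in> \<Delta>" "w = mkp True (cell_end True \<sigma> (cw w)) (cell_end False \<tau> (cw w))" by blast
    show ?thesis using 1(3) c(1) unfolding disk_block[OF c] by (auto simp: nr_def)
  next
    case 2
    obtain d c a b where e: "e = segm d c a b" "CE d c a b" using composite_CE[OF 2(1)] by blast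
    define R' where "R' = fst (ce (segm d c a b))"
    obtain \<sigma> where g: "R' \<in> \<Delta>" "snd (ce (segm d c a b)) = cedge d \<sigma> R'" using ce_edge[OF e(2) R'_def] by blast
    show ?thesis using 2(2) g(1) unfolding e(1) edge_block[OF e(2) R'_def g(2)]
      by (auto simp: nr_def mid_index_def split: if_splits)
  next
    case 3
    then show ?thesis by (auto simp: M_cell_def)
  qed
qed

lemma finite_Mset: "finite Mset"
  by (rule finite_subset[of _ "\<Delta> \<times> {..<n True} \<times> {..<n False}"]) (use M_set_sub fin_D in auto)

text \<open>The set \<open>M\<close> is a union of blocks of indices, so that prescribing Bernstein coefficients on it is
  the same as prescribing the dual functionals.\<close>

lemma Mset_iff: "(\<forall>R i j. (R, i, j) \<in> Mset \<longrightarrow> tensor_coef R (D R) i j = 0) \<longleftrightarrow> vanishes_on_M D"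
proof -
  define cz where "cz S \<longleftrightarrow> (\<forall>R i j. (R, i, j) \<in> S \<longrightarrow> tensor_coef R (D R) i j = 0)" for S
  have V: "cz (disk (n True) (n False) (r True) (r False) (cw w) w) \<longleftrightarrow>
      (\<forall>\<sigma> \<tau> l m. w = mkp True (cell_end True \<sigma> (cw w)) (cell_end False \<tau> (cw w)) \<longrightarrow> nr True \<sigma> l \<longrightarrow> nr False \<tau> m \<longrightarrow> D (cw w) l m = 0)"
    if w: "w \<in> verts \<Delta>" "\<not> T_junction \<Delta> w" for w
  proof -
    have RD: "cw w \<in> \<Delta>" using cw_corner[OF w] by blast
    have one: "cz (disk (n True) (n False) (r True) (r False) (cw w) w) \<longleftrightarrow> (\<forall>l m. nr True \<sigma> l \<longrightarrow> nr False \<tau> m \<longrightarrow> D (cw w) l m = 0)"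
      if c: "w = mkp True (cell_end True \<sigma> (cw w)) (cell_end False \<tau> (cw w))" for \<sigma> \<tau>
    proof -
      have "cz (disk (n True) (n False) (r True) (r False) (cw w) w) \<longleftrightarrow> (\<forall>i j. nr True \<sigma> i \<and> nr False \<tau> j \<longrightarrow> tensor_coef (cw w) (D (cw w)) i j = 0)"
        unfolding disk_block[OF RD c] cz_def by blast
      also have "\<dots> \<longleftrightarrow> (\<forall>i j. nr True \<sigma> i \<and> nr False \<tau> j \<longrightarrow> D (cw w) i j = 0)"
        by (rule block_iff[OF RD]) (use same_nr nr_lt in blast)+
      finally show ?thesis by blast
    qed
    show ?thesis using one cw_corner[OF w] by blast
  qed
  have E: "cz (M_edge (n True) (n False) (r True) (r False) ce (segm d c a b)) \<longleftrightarrow>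
      (\<forall>\<sigma> l m. snd (ce (segm d c a b)) = cedge d \<sigma> (fst (ce (segm d c a b))) \<longrightarrow> mi d l \<longrightarrow> nr (\<not> d) \<sigma> m \<longrightarrow> dir_array d (D (fst (ce (segm d c a b)))) l m = 0)"
    if e: "CE d c a b" for d c a b
  proof -
    define R where "R = fst (ce (segm d c a b))"
    have RD: "R \<in> \<Delta>" using ce_edge[OF e R_def] by blast
    have one: "cz (M_edge (n True) (n False) (r True) (r False) ce (segm d c a b)) \<longleftrightarrow> (\<forall>l m. mi d l \<longrightarrow> nr (\<not> d) \<sigma> m \<longrightarrow> dir_array d (D R) l m = 0)"
      if g: "snd (ce (segm d c a b)) = cedge d \<sigma> R" for \<sigma>
    proof -
      have "cz (M_edge (n True) (n False) (r True) (r False) ce (segm d c a b)) \<longleftrightarrow>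
          (\<forall>i j. (if d then mi True i \<and> nr False \<sigma> j else nr True \<sigma> i \<and> mi False j) \<longrightarrow> tensor_coef R (D R) i j = 0)"
        unfolding edge_block[OF e R_def g] cz_def by blast
      also have "\<dots> \<longleftrightarrow> (\<forall>i j. (if d then mi True i \<and> nr False \<sigma> j else nr True \<sigma> i \<and> mi False j) \<longrightarrow> D R i j = 0)"
      proof (cases d)
        case True
        have "(\<forall>i j. mi True i \<and> nr False \<sigma> j \<longrightarrow> tensor_coef R (D R) i j = 0) \<longleftrightarrow> (\<forall>i j. mi True i \<and> nr False \<sigma> j \<longrightarrow> D R i j = 0)"
          by (rule block_iff[OF RD]) (use same_nr same_mi nr_lt mi_lt in blast)+
        then show ?thesis using True by simp
      next
        case False
        have "(\<forall>i j. nr True \<sigma> i \<and> mi False j \<longrightarrow> tensor_coef R (D R) i j = 0) \<longleftrightarrow> (\<forall>i j. nr True \<sigma> i \<and> mi False j \<longrightarrow> D R i j = 0)"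
          by (rule block_iff[OF RD]) (use same_nr same_mi nr_lt mi_lt in blast)+
        then show ?thesis using False by simp
      qed
      also have "\<dots> \<longleftrightarrow> (\<forall>l m. mi d l \<longrightarrow> nr (\<not> d) \<sigma> m \<longrightarrow> dir_array d (D R) l m = 0)"
        by (cases d) (auto simp: dir_array_def)
      finally show ?thesis .
    qed
    show ?thesis using one ce_edge[OF e R_def] unfolding R_def[symmetric] by blast
  qed
  have Ce: "cz (M_cell (n True) (n False) (r True) (r False) R) \<longleftrightarrow> (\<forall>l m. mi True l \<longrightarrow> mi False m \<longrightarrow> D R l m = 0)"
    if R: "R \<in> \<Delta>" for R
  proof -
    have "M_cell (n True) (n False) (r True) (r False) R = {(R, i, j) | i j. mi True i \<and> mi False j}"
      unfolding M_cell_def mid_index_def by auto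
    then have "cz (M_cell (n True) (n False) (r True) (r False) R) \<longleftrightarrow> (\<forall>i j. mi True i \<and> mi False j \<longrightarrow> tensor_coef R (D R) i j = 0)"
      by (simp add: cz_def)
    also have "\<dots> \<longleftrightarrow> (\<forall>i j. mi True i \<and> mi False j \<longrightarrow> D R i j = 0)"
      by (rule block_iff[OF R]) (use same_mi mi_lt in blast)+
    finally show ?thesis by blast
  qed
  have "cz Mset \<longleftrightarrow> (\<forall>w. w \<in> verts \<Delta> \<longrightarrow> \<not> T_junction \<Delta> w \<longrightarrow> cz (disk (n True) (n False) (r True) (r False) (cw w) w)) \<and>
     (\<forall>e. composite_edge \<Delta> e \<longrightarrow> cz (M_edge (n True) (n False) (r True) (r False) ce e)) \<and>
     (\<forall>R. R \<in> \<Delta> \<longrightarrow> cz (M_cell (n True) (n False) (r True) (r False) R))"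
    unfolding M_set_def M_vertex_def cz_def by blast
  also have "(\<forall>e. composite_edge \<Delta> e \<longrightarrow> cz (M_edge (n True) (n False) (r True) (r False) ce e)) \<longleftrightarrow>
     (\<forall>d c a b. CE d c a b \<longrightarrow> cz (M_edge (n True) (n False) (r True) (r False) ce (segm d c a b)))"
    using composite_CE unfolding CE_def by metis
  also have "(\<forall>w. w \<in> verts \<Delta> \<longrightarrow> \<not> T_junction \<Delta> w \<longrightarrow> cz (disk (n True) (n False) (r True) (r False) (cw w) w)) \<longleftrightarrow>
    (\<forall>w \<sigma> \<tau> l m. w \<in> verts \<Delta> \<longrightarrow> \<not> T_junction \<Delta> w \<longrightarrow> w = mkp True (cell_end True \<sigma> (cw w)) (cell_end False \<tau> (cw w)) \<longrightarrow>
       nr True \<sigma> l \<longrightarrow> nr False \<tau> m \<longrightarrow> D (cw w) l m = 0)"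
    using V by blast
  also have "(\<forall>d c a b. CE d c a b \<longrightarrow> cz (M_edge (n True) (n False) (r True) (r False) ce (segm d c a b))) \<longleftrightarrow>
    (\<forall>d c a b \<sigma> l m. CE d c a b \<longrightarrow> snd (ce (segm d c a b)) = cedge d \<sigma> (fst (ce (segm d c a b))) \<longrightarrow>
       mi d l \<longrightarrow> nr (\<not> d) \<sigma> m \<longrightarrow> dir_array d (D (fst (ce (segm d c a b)))) l m = 0)"
    using E by blast
  also have "(\<forall>R. R \<in> \<Delta> \<longrightarrow> cz (M_cell (n True) (n False) (r True) (r False) R)) \<longleftrightarrow>
    (\<forall>R l m. R \<in> \<Delta> \<longrightarrow> mi True l \<longrightarrow> mi False m \<longrightarrow> D R l m = 0)"
    using Ce by blast
  finally show ?thesis unfolding vanishes_on_M_def cz_def .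
qed

section \<open>Stability: the error travels along chains of composite edges\<close>

text \<open>The coefficients in the disk around a corner of a cell are scaled mixed derivatives at the corner.\<close>

lemma corner_jet:
  assumes R: "R \<in> \<Delta>" and z: "\<And>l m. nr True \<sigma> l \<Longrightarrow> nr False \<tau> m \<Longrightarrow> Y l m = 0"
    and ij: "i \<le> r True" "j \<le> r False"
  shows "tensor R Y i j (mkp True (cell_end True \<sigma> R) (cell_end False \<tau> R)) = 0"
proof -
  interpret short_cell n r u v M \<delta> C h0 R by (rule short_cell[OF R])
  let ?g = "\<lambda>x. JJ True (tensor R Y) 0 j (mkp True x (cell_end False \<tau> R))"
  have "hh False R ^ j * lm True R (idx (n True) \<sigma> i) ?g = Y (idx (n True) \<sigma> i) (idx (n False) \<tau> j)"
    using dual_fun_trace[of j True "idx (n True) \<sigma> i" Y \<tau>] ij rnd[of True] by (simp add: dir_array_def)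
  also have "\<dots> = 0" by (intro z nr_idx ij)
  finally have "lm True R (idx (n True) \<sigma> i) ?g = 0" using hh_pos[of False] by simp
  then have "nder (Iv True R) i ?g (cell_end True \<sigma> R) = 0"
    using bernstein_interval.la_hermite[OF bi ij(1), of \<sigma> ?g] hh_pos[of True] unfolding cell_end_def by simp
  then show ?thesis using slice_nder[of i True "cell_end True \<sigma> R" Y j "cell_end False \<tau> R", OF _ cell_end_in] ij(1) rnd[of True] by (simp add: JJ_def)
qed

lemma CE_vertex:
  assumes e: "CE d c a b"
  shows "mkp d (endpt \<tau> a b) c \<in> verts \<Delta>"
  using CE_T[OF e] by (auto simp: T_segment_def mesh_segment_def seg_ends_segm endpt_def)

text \<open>The alternative at an end of a composite edge on which the recursion rests: either the end
  carries data of the determining set, or it is inside a perpendicular composite edge.\<close>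

lemma CE_end_cases:
  assumes e: "CE d c a b"
  obtains (free) "\<not> T_junction \<Delta> (mkp d (endpt \<tau> a b) c)"
    | (inner) a' b' where "CE (\<not> d) (endpt \<tau> a b) a' b'" "a' < c" "c < b'"
proof (cases "T_junction \<Delta> (mkp d (endpt \<tau> a b) c)")
  case True
  then obtain d' c' a' b' x where e': "CE d' c' a' b'" "a' < x" "x < b'" "mkp d (endpt \<tau> a b) c = mkp d' x c'"
    using T_junction_iff[OF CE_vertex[OF e]] by blast
  have ab: "a < b" by (rule CE_lt[OF e])
  show thesis
  proof (cases "d' = d")
    case True
    then have x: "x = endpt \<tau> a b" "c' = c" using e'(4) by auto
    have "a' = a \<and> b' = b" using CE_same[of d c a' b' a b x] e' e x True ab by (auto simp: endpt_def split: if_splits)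
    then show thesis using e'(2,3) x by (auto simp: endpt_def split: if_splits)
  next
    case False
    then have d': "d' = (\<not> d)" by auto
    have "mkp d (endpt \<tau> a b) c = mkp d c' x" using e'(4) unfolding d' mkp_not .
    then have "x = c" "c' = endpt \<tau> a b" by auto
    then show thesis using e' d' inner by auto
  qed
qed (rule free)

end

text \<open>The spline \<open>p\<close>, with arrays \<open>Y\<close>, shares the data on \<open>M\<close> with the local functions given by \<open>q\<close>, and these
  approximate the function with derivatives \<open>F\<close>; \<open>\<Lambda>\<close> bounds the lengths of composite edges, \<open>\<Theta>\<close> the scaled local
  errors.\<close>

locale spline_error = spline_setting +
  fixes p :: "pt \<Rightarrow> real" and Y q :: "cell \<Rightarrow> nat \<Rightarrow> nat \<Rightarrow> real"
    and F :: "nat \<Rightarrow> nat \<Rightarrow> pt \<Rightarrow> real" and Mf \<Lambda> \<Theta> :: real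
  assumes p: "p \<in> GSp" and Y: "represents p Y" and van: "vanishes_on_M (\<lambda>R l m. Y R l m - q R l m)"
    and F: "R \<in> \<Delta> \<Longrightarrow> sym_deriv_family R n F"
    and FM: "R \<in> \<Delta> \<Longrightarrow> z \<in> region R \<Longrightarrow> i \<le> n True \<Longrightarrow> j \<le> n False \<Longrightarrow> \<bar>F i j z\<bar> \<le> Mf"
    and Lam: "CE d c a b \<Longrightarrow> b - a \<le> \<Lambda>" "\<Lambda> \<le> 1" and Th: "Mf * \<Lambda> ^ n d \<le> \<Theta>"
    and qF: "R \<in> \<Delta> \<Longrightarrow> z \<in> region R \<Longrightarrow> i < n True \<Longrightarrow> j < n False \<Longrightarrow> \<Lambda> ^ (i + j) * \<bar>tensor R (q R) i j z - F i j z\<bar> \<le> \<Theta>"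
begin

abbreviation "trc d c j \<equiv> (\<lambda>x. JJ d (\<lambda>i j. Dst \<Omega> i j p) 0 j (mkp d x c))"

lemma Mf0: "0 \<le> Mf"
proof -
  obtain R where R: "R \<in> \<Delta>" using ne_D by blast
  have "0 \<le> \<bar>F 0 0 (mkp True (lo True R) (lo False R))\<bar>" by simp
  also have "\<dots> \<le> Mf" by (rule FM[OF R]) (use lh[OF R, of True] lh[OF R, of False] in auto)
  finally show ?thesis .
qed

lemma FMd: "R \<in> \<Delta> \<Longrightarrow> mkp d x y \<in> region R \<Longrightarrow> i \<le> n d \<Longrightarrow> j \<le> n (\<not> d) \<Longrightarrow> \<bar>JJ d F i j (mkp d x y)\<bar> \<le> Mf"
  using FM[of R "mkp d x y"] by (cases d) (auto simp: JJ_def)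

lemma qFd: "R \<in> \<Delta> \<Longrightarrow> mkp d x y \<in> region R \<Longrightarrow> i < n d \<Longrightarrow> j < n (\<not> d) \<Longrightarrow>
    \<Lambda> ^ (i + j) * \<bar>JJ d (tensor R (q R)) i j (mkp d x y) - JJ d F i j (mkp d x y)\<bar> \<le> \<Theta>"
  using qF[of R "mkp d x y" i j] qF[of R "mkp d x y" j i] by (cases d) (auto simp: JJ_def add.commute)

lemma Lam0: "0 \<le> \<Lambda>"
proof -
  obtain R where R: "R \<in> \<Delta>" using ne_D by blast
  obtain a b where "CE True (cell_end False False R) a b" using CE_of_cell[OF R, of True False] by auto
  from CE_lt[OF this] Lam(1)[OF this] show ?thesis by linarith
qed

lemma Th0: "0 \<le> \<Theta>"
  using Th[of True] Mf0 Lam0 by (meson mult_nonneg_nonneg order_trans zero_le_power)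

lemma CE_region:
  assumes "CE d c a b" "R \<in> \<Delta>" "cell_end (\<not> d) \<sigma> R = c" "x \<in> Iv d R"
  shows "mkp d x c \<in> region R"
  using short_cell.cell_end_in[OF short_cell[OF assms(2)], of "\<not> d" \<sigma>] assms by auto

lemma CE_point:
  assumes "CE d c a b" "x \<in> {a..b}"
  obtains R \<sigma> U where "R \<in> \<Delta>" "cell_end (\<not> d) \<sigma> R = c" "a \<le> lo d R" "hi d R \<le> b" "x \<in> Iv d R"
    "open U" "x \<in> U" "{a..b} \<inter> U \<subseteq> Iv d R"
proof -
  have "a \<le> x" "x \<le> b" using assms(2) by auto
  from CE_cover[OF assms(1) this] that show thesis by blast
qed

lemma F_edge:
  assumes e: "CE d c a b" and x: "x \<in> {a..b}" and i: "i < n d" and j: "j \<le> n (\<not> d)"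
  shows "((\<lambda>x. JJ d F i j (mkp d x c)) has_real_derivative JJ d F (Suc i) j (mkp d x c)) (at x within {a..b})"
proof -
  obtain R \<sigma> U where R: "R \<in> \<Delta>" "cell_end (\<not> d) \<sigma> R = c" "a \<le> lo d R" "hi d R \<le> b" "x \<in> Iv d R"
    "open U" "x \<in> U" "{a..b} \<inter> U \<subseteq> Iv d R" using CE_point[OF e x] by blast
  have "at x within {a..b} = at x within Iv d R"
    by (rule at_within_nhd[of x U]) (use R in auto)
  moreover have "c \<in> Iv (\<not> d) R" using short_cell.cell_end_in[OF short_cell[OF R(1)], of "\<not> d" \<sigma>] R(2) by simp
  ultimately show ?thesis using F[OF R(1)] i j R(5) unfolding sym_deriv_family_def by metis
qed

definition "Ke d = (K1 d)\<^sup>2 * \<alpha> ^ n d * (1 + (1 + J1 d) + K1 d * (2 + J1 d)) + (1 + J1 d)"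
definition "KE = Ke True + Ke False"

lemma J1_0: "0 \<le> J1 d" using M1d by simp

lemma Ke_1: "1 \<le> Ke d"
proof -
  have "0 \<le> (K1 d)\<^sup>2 * \<alpha> ^ n d * (1 + (1 + J1 d) + K1 d * (2 + J1 d))"
    using J1_0[of d] K1_1[of d] al by (intro mult_nonneg_nonneg) auto
  then show ?thesis using J1_0[of d] by (simp add: Ke_def)
qed

lemma Ke_KE: "Ke d \<le> KE" using Ke_1[of True] Ke_1[of False] by (cases d) (auto simp: KE_def)

text \<open>One edge: \<open>G\<close> interpolates the function at an end of the edge in the univariate space, with a small
  error by Taylor's formula, and the difference of \<open>G\<close> and the trace of the spline is controlled by \<open>edge_est\<close>: at the
  ends by assumption, on the chosen cell edge because the spline shares its functionals with \<open>q\<close>.\<close>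

lemma edge_step:
  assumes e: "CE d c a b" and j: "j \<le> r (\<not> d)" and eta: "\<Theta> \<le> \<eta>"
    and ends: "\<And>\<tau> i. i \<le> r d \<Longrightarrow> (b - a) ^ (i + j) *
      \<bar>nder {a..b} i (trc d c j) (endpt \<tau> a b) - JJ d F i j (mkp d (endpt \<tau> a b) c)\<bar> \<le> \<eta>"
    and i: "i < n d" and x: "x \<in> {a..b}"
  shows "(b - a) ^ (i + j) * \<bar>nder {a..b} i (trc d c j) x - JJ d F i j (mkp d x c)\<bar> \<le> Ke d * \<eta>"
proof -
  interpret e: bernstein_interval "n d" "u d" "v d" M \<delta> a b "r d" C by (rule CE_bint[OF e])
  let ?L = "b - a"
  have L: "0 < ?L" "?L \<le> 1" "?L \<le> \<Lambda>" using CE_lt[OF e] Lam(1)[OF e] Lam(2) by auto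
  have jn: "j < n (\<not> d)" "j \<le> n (\<not> d)" using j nn(2)[of "\<not> d"] by auto
  have eta0: "0 \<le> \<eta>" using eta Th0 by simp
  have J0: "0 \<le> J1 d" by (rule J1_0)
  have tE: "trc d c j \<in> ES d {a..b}" by (rule trace_E[OF p Y e j])
  obtain G where G: "G \<in> ES d {a..b}" and Ga: "\<And>i. i < n d \<Longrightarrow> nder {a..b} i G a = JJ d F i j (mkp d a c)"
    using e.hermite_ex[of "n d" 0 "\<lambda>i. JJ d F i j (mkp d a c)"] by auto
  have FMe: "\<bar>JJ d F i j (mkp d x c)\<bar> \<le> Mf" if x: "x \<in> {a..b}" and i: "i \<le> n d" for x i
  proof -
    obtain R \<sigma> where R: "R \<in> \<Delta>" "cell_end (\<not> d) \<sigma> R = c" "x \<in> Iv d R" using CE_point[OF e x] by blast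
    show ?thesis by (rule FMd[OF R(1) CE_region[OF e R] i jn(2)])
  qed
  have GM: "\<bar>nder {a..b} i G x\<bar> \<le> J1 d * Mf" if "i \<le> n d" "x \<in> {a..b}" for i x
    by (rule e.E_jet_bound[OF G e.aI _ that]) (use Ga FMe[OF e.aI] in auto)
  define H where "H i x = JJ d F i j (mkp d x c) - nder {a..b} i G x" for i x
  have HD: "(H i has_real_derivative H (Suc i) x) (at x within {a..b})" if "i < n d" "x \<in> {a..b}" for i x
    unfolding H_def using that by (intro DERIV_diff F_edge[OF e] Ck_on_deriv[OF e.E_Ck[OF G]] jn)
  have Hb: "\<bar>H i x\<bar> \<le> (1 + J1 d) * Mf * ?L ^ (n d - i)" if i: "i \<le> n d" and x: "x \<in> {a..b}" for i x
  proof -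
    have "\<bar>H i x\<bar> \<le> real (n d - i) * 0 + ((1 + J1 d) * Mf) * ?L ^ (n d - i)"
    proof (rule taylor_descent[where G=H, OF HD e.aI order_refl])
      show "\<bar>H i a\<bar> \<le> 0" if "i < n d" for i using Ga[OF that] by (simp add: H_def)
      show "\<bar>H (n d) x\<bar> \<le> (1 + J1 d) * Mf" if "x \<in> {a..b}" for x
        using FMe[OF that, of "n d"] GM[OF _ that, of "n d"] unfolding H_def by (simp add: distrib_right)
    qed (use L i x in auto)
    then show ?thesis by simp
  qed
  have HT: "?L ^ (i + j) * \<bar>H i x\<bar> \<le> (1 + J1 d) * \<Theta>" if i: "i \<le> n d" and x: "x \<in> {a..b}" for i x
  proof -
    have "?L ^ (i + j) * \<bar>H i x\<bar> \<le> ?L ^ (i + j) * ((1 + J1 d) * Mf * ?L ^ (n d - i))"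
      using Hb[OF i x] L by (intro mult_left_mono) auto
    also have "\<dots> = (1 + J1 d) * (Mf * ?L ^ (n d + j))"
      using i by (simp add: mult_ac add.commute flip: power_add)
    also have "\<dots> \<le> (1 + J1 d) * (Mf * \<Lambda> ^ n d)"
    proof (intro mult_left_mono)
      have "?L ^ (n d + j) \<le> ?L ^ n d" using L by (intro power_decreasing) auto
      also have "\<dots> \<le> \<Lambda> ^ n d" using L by (intro power_mono) auto
      finally show "?L ^ (n d + j) \<le> \<Lambda> ^ n d" .
    qed (use Mf0 J0 in auto)
    also have "\<dots> \<le> (1 + J1 d) * \<Theta>" using Th[of d] J0 by (intro mult_left_mono) auto
    finally show ?thesis .
  qed
  define R where "R = fst (ce (segm d c a b))"
  obtain \<sigma> \<tau> where R: "R \<in> \<Delta>" "snd (ce (segm d c a b)) = cedge d \<sigma> R" "cell_end (\<not> d) \<sigma> R = c"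
     "a \<le> lo d R" "hi d R \<le> b" "cell_end d \<tau> R = endpt \<tau> a b"
    using ce_edge[OF e R_def] by blast
  interpret c: short_cell n r u v M \<delta> C h0 R by (rule short_cell[OF R(1)])
  interpret E: edge_interval "n d" "u d" "v d" M \<delta> a b "lo d R" "hi d R" "r d" C \<tau> \<alpha>
    by (rule CE_edgeint[OF e R(1,3-6)])
  have subI: "x \<in> {a..b}" if "x \<in> Iv d R" for x using that R by auto
  let ?g = "\<lambda>x. trc d c j x - G x"
  have gE: "?g \<in> ES d {a..b}" by (rule uspace_diff[OF tE G])
  have gn: "nder {a..b} i ?g x = nder {a..b} i (trc d c j) x - nder {a..b} i G x" if "i \<le> n d" "x \<in> {a..b}" for i x
    by (rule nder_diff[OF e.E_Ck[OF tE] e.E_Ck[OF G] e.nt that])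
  let ?q = "\<lambda>x. JJ d (tensor R (q R)) 0 j (mkp d x c)"
  let ?y = "\<lambda>x. JJ d (tensor R (Y R)) 0 j (mkp d x c)"
  have qE: "?q \<in> ES d (Iv d R)" and yE: "?y \<in> ES d (Iv d R)" by (rule c.slice_E)+
  have GR: "G \<in> ES d (Iv d R)" and tR: "trc d c j \<in> ES d (Iv d R)" by (rule uspace_mono[OF _ E.T_sub], fact)+
  have md: "?L ^ j * \<bar>lm d R l ?g\<bar> \<le> K1 d * ((2 + J1 d) * \<Theta>)" if l: "mi d l" for l
  proof -
    have ln: "l < n d" using mi_lt[OF l] .
    have "dir_array d (\<lambda>l m. Y R l m - q R l m) l (idx (n (\<not> d)) \<sigma> j) = 0"
      using van e R(2) l nr_idx[OF j, of \<sigma>] unfolding vanishes_on_M_def R_def by blast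
    then have eq: "dir_array d (Y R) l (idx (n (\<not> d)) \<sigma> j) = dir_array d (q R) l (idx (n (\<not> d)) \<sigma> j)" by (simp add: dir_array_def split: if_splits)
    have "hh (\<not> d) R ^ j * lm d R l ?y = hh (\<not> d) R ^ j * lm d R l ?q"
      using c.dual_fun_trace[OF j ln, of "Y R" \<sigma>] c.dual_fun_trace[OF j ln, of "q R" \<sigma>] eq R(3) by simp
    then have "lm d R l ?y = lm d R l ?q" using c.hh_pos[of "\<not> d"] by simp
    moreover have "lm d R l (trc d c j) = lm d R l ?y"
      using trace_slice[OF p Y R(1,3) _ j, of 0] by (intro E.T.la_cong) auto
    ultimately have "lm d R l ?g = lm d R l (\<lambda>x. ?q x - G x)"
      using E.T.la_diff[OF tR GR ln] E.T.la_diff[OF qE GR ln] by simp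
    moreover have "\<bar>lm d R l (\<lambda>x. ?q x - G x)\<bar> \<le> E.T.Ct * ((2 + J1 d) * \<Theta> / ?L ^ j)"
    proof (rule E.T.la_le[OF uspace_diff[OF qE GR] _ ln])
      fix i x assume i: "i < n d" and x: "x \<in> Iv d R"
      have reg: "mkp d x c \<in> region R" by (rule CE_region[OF e R(1,3) x])
      have "nder (Iv d R) i (\<lambda>x. ?q x - G x) x = JJ d (tensor R (q R)) i j (mkp d x c) - nder {a..b} i G x"
        using nder_diff[OF E.T.E_Ck[OF qE] E.T.E_Ck[OF GR] E.T.nt, of i x] c.slice_nder[of i d x "q R" j c]
          nder_edge_cell[OF e G R(1,4,5), of i x] i x by simp
      also have "\<dots> = (JJ d (tensor R (q R)) i j (mkp d x c) - JJ d F i j (mkp d x c)) + H i x"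
        by (simp add: H_def)
      finally have "?L ^ (i + j) * \<bar>nder (Iv d R) i (\<lambda>x. ?q x - G x) x\<bar>
        \<le> ?L ^ (i + j) * (\<bar>JJ d (tensor R (q R)) i j (mkp d x c) - JJ d F i j (mkp d x c)\<bar> + \<bar>H i x\<bar>)"
        using L by (intro mult_left_mono) auto
      also have "\<dots> = ?L ^ (i + j) * \<bar>JJ d (tensor R (q R)) i j (mkp d x c) - JJ d F i j (mkp d x c)\<bar> + ?L ^ (i + j) * \<bar>H i x\<bar>"
        by (simp add: distrib_left)
      also have "\<dots> \<le> \<Lambda> ^ (i + j) * \<bar>JJ d (tensor R (q R)) i j (mkp d x c) - JJ d F i j (mkp d x c)\<bar> + (1 + J1 d) * \<Theta>"
        using L HT[of i x] i subI[OF x] by (intro add_mono mult_right_mono power_mono) auto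
      also have "\<dots> \<le> (2 + J1 d) * \<Theta>" using qFd[OF R(1) reg i jn(1)] by (simp add: algebra_simps)
      finally have 1: "?L ^ i * ?L ^ j * \<bar>nder (Iv d R) i (\<lambda>x. ?q x - G x) x\<bar> \<le> (2 + J1 d) * \<Theta>" by (simp add: power_add)
      have "hh d R ^ i * \<bar>nder (Iv d R) i (\<lambda>x. ?q x - G x) x\<bar> \<le> ?L ^ i * \<bar>nder (Iv d R) i (\<lambda>x. ?q x - G x) x\<bar>"
        using c.hh_pos[of d] R by (intro mult_right_mono power_mono) auto
      also have "\<dots> \<le> (2 + J1 d) * \<Theta> / ?L ^ j" using 1 L by (simp add: field_simps)
      finally show "hh d R ^ i * \<bar>nder (Iv d R) i (\<lambda>x. ?q x - G x) x\<bar> \<le> (2 + J1 d) * \<Theta> / ?L ^ j" .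
    qed
    ultimately have "?L ^ j * \<bar>lm d R l ?g\<bar> \<le> ?L ^ j * (E.T.Ct * ((2 + J1 d) * \<Theta> / ?L ^ j))"
      using L by (intro mult_left_mono) auto
    also have "\<dots> = E.T.Ct * ((2 + J1 d) * \<Theta>)" using L by simp
    also have "\<dots> \<le> K1 d * ((2 + J1 d) * \<Theta>)"
      using c.Ct_le_K1[of d] J0 Th0 unfolding E.T.Ct_def bernstein_interval.Ct_def[OF c.bi] by (intro mult_right_mono) auto
    finally show ?thesis .
  qed
  define \<zeta> where "\<zeta> = \<eta> + (1 + J1 d) * \<eta> + K1 d * ((2 + J1 d) * \<eta>)"
  have z1: "\<eta> + (1 + J1 d) * \<Theta> \<le> \<zeta>" "K1 d * ((2 + J1 d) * \<Theta>) \<le> \<zeta>" and z0: "0 \<le> \<zeta>"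
  proof -
    have a: "(1 + J1 d) * \<Theta> \<le> (1 + J1 d) * \<eta>" "K1 d * ((2 + J1 d) * \<Theta>) \<le> K1 d * ((2 + J1 d) * \<eta>)"
      using eta J0 K1_1[of d] by (auto intro!: mult_left_mono)
    have b: "0 \<le> (1 + J1 d) * \<eta>" "0 \<le> K1 d * ((2 + J1 d) * \<eta>)" using eta0 J0 K1_1[of d] by auto
    show "\<eta> + (1 + J1 d) * \<Theta> \<le> \<zeta>" "K1 d * ((2 + J1 d) * \<Theta>) \<le> \<zeta>" "0 \<le> \<zeta>" using a b eta0 unfolding \<zeta>_def by linarith+
  qed
  have "?L ^ i * \<bar>nder {a..b} i ?g x\<bar> \<le> (Kc (n d) C)\<^sup>2 * \<alpha> ^ n d * (\<zeta> / ?L ^ j)"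
  proof (rule E.edge_est[OF gE _ _ _ i x])
    show "0 \<le> \<zeta> / ?L ^ j" using z0 L by simp
    show "\<bar>lm d R l ?g\<bar> \<le> \<zeta> / ?L ^ j" if "mi d l" for l
      using order.trans[OF md[OF that] z1(2)] L by (simp add: field_simps)
    show "?L ^ i * \<bar>nder {a..b} i ?g (endpt \<tau> a b)\<bar> \<le> \<zeta> / ?L ^ j" if i: "i \<le> r d" for \<tau> i
    proof -
      have fi: "endpt \<tau> a b \<in> {a..b}" and ind: "i \<le> n d" using i nn(2)[of d] by auto
      have "nder {a..b} i ?g (endpt \<tau> a b) = (nder {a..b} i (trc d c j) (endpt \<tau> a b) - JJ d F i j (mkp d (endpt \<tau> a b) c)) + H i (endpt \<tau> a b)"
        using gn[OF ind fi] by (simp add: H_def)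
      then have "?L ^ (i + j) * \<bar>nder {a..b} i ?g (endpt \<tau> a b)\<bar> \<le> ?L ^ (i + j) *
        (\<bar>nder {a..b} i (trc d c j) (endpt \<tau> a b) - JJ d F i j (mkp d (endpt \<tau> a b) c)\<bar> + \<bar>H i (endpt \<tau> a b)\<bar>)"
        using L by (intro mult_left_mono) auto
      also have "\<dots> \<le> \<eta> + (1 + J1 d) * \<Theta>" using ends[OF i, of \<tau>] HT[OF ind fi] by (simp add: distrib_left)
      also have "\<dots> \<le> \<zeta>" by (rule z1(1))
      finally have "?L ^ i * ?L ^ j * \<bar>nder {a..b} i ?g (endpt \<tau> a b)\<bar> \<le> \<zeta>" by (simp add: power_add)
      then show ?thesis using L by (simp add: field_simps)
    qed
  qed
  then have "?L ^ j * (?L ^ i * \<bar>nder {a..b} i ?g x\<bar>) \<le> ?L ^ j * ((K1 d)\<^sup>2 * \<alpha> ^ n d * (\<zeta> / ?L ^ j))"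
    using L by (intro mult_left_mono) auto
  then have A: "?L ^ (i + j) * \<bar>nder {a..b} i ?g x\<bar> \<le> (K1 d)\<^sup>2 * \<alpha> ^ n d * \<zeta>" using L by (simp add: power_add mult_ac)
  have "nder {a..b} i (trc d c j) x - JJ d F i j (mkp d x c) = nder {a..b} i ?g x - H i x"
    using gn[of i x] i x by (simp add: H_def)
  then have "?L ^ (i + j) * \<bar>nder {a..b} i (trc d c j) x - JJ d F i j (mkp d x c)\<bar>
    \<le> ?L ^ (i + j) * (\<bar>nder {a..b} i ?g x\<bar> + \<bar>H i x\<bar>)" using L by (intro mult_left_mono) auto
  also have "\<dots> \<le> (K1 d)\<^sup>2 * \<alpha> ^ n d * \<zeta> + (1 + J1 d) * \<Theta>" using A HT[of i x] i x by (simp add: distrib_left)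
  also have "\<dots> \<le> (K1 d)\<^sup>2 * \<alpha> ^ n d * \<zeta> + (1 + J1 d) * \<eta>" using eta J0 by (intro add_left_mono mult_left_mono) auto
  also have "\<dots> = Ke d * \<eta>" by (simp add: Ke_def \<zeta>_def algebra_simps)
  finally show ?thesis .
qed

definition "NN = n True + n False"
definition "KK m = (KE * (\<alpha> * \<kappa>) ^ NN) ^ m"

lemma ak1: "1 \<le> \<alpha> * \<kappa>" using mult_mono[OF al(2) ka(2)] al ka by simp
lemma KE_1: "1 \<le> KE" using Ke_1[of True] Ke_KE[of True] by simp
lemma KK_1: "1 \<le> KK m"
proof -
  have "1 * 1 \<le> KE * (\<alpha> * \<kappa>) ^ NN" using KE_1 ak1 by (intro mult_mono one_le_power) auto
  then show ?thesis unfolding KK_def by (intro one_le_power) simp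
qed

text \<open>Induction on a bound for the length of dependency paths issuing from the edge. An end inside
  a perpendicular edge is estimated by the induction hypothesis there, with the roles of \<open>i\<close> and \<open>j\<close> exchanged.\<close>

lemma edge_all:
  assumes "CE d c a b" "\<not> (\<exists>e'. (segm d c a b, e') \<in> depends_on ^^ m)" "j \<le> r (\<not> d)" "i < n d" "x \<in> {a..b}"
  shows "(b - a) ^ (i + j) * \<bar>nder {a..b} i (trc d c j) x - JJ d F i j (mkp d x c)\<bar> \<le> KK m * \<Theta>"
  using assms
proof (induction m arbitrary: d c a b i j x)
  case 0
  then show ?case using relpow_0_I[of "segm d c a b" depends_on] by blast
next
  case (Suc m)
  note e = Suc.prems(1) and j = Suc.prems(3)
  let ?L = "b - a"
  let ?\<eta> = "(\<alpha> * \<kappa>) ^ NN * (KK m * \<Theta>)"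
  have L: "0 < ?L" "?L \<le> \<Lambda>" using CE_lt[OF e] Lam(1)[OF e] by auto
  have jn: "j < n (\<not> d)" using j nn(2)[of "\<not> d"] by simp
  have eta: "\<Theta> \<le> ?\<eta>"
  proof -
    have "1 * (1 * \<Theta>) \<le> ?\<eta>" using ak1 KK_1[of m] Th0 by (intro mult_mono one_le_power) auto
    then show ?thesis by simp
  qed
  have ends: "?L ^ (k + j) * \<bar>nder {a..b} k (trc d c j) (endpt \<tau> a b) - JJ d F k j (mkp d (endpt \<tau> a b) c)\<bar> \<le> ?\<eta>"
    if k: "k \<le> r d" for \<tau> k
  proof -
    let ?w = "mkp d (endpt \<tau> a b) c"
    have kn: "k < n d" using k nn(2)[of d] by simp
    obtain R0 \<sigma>0 where R0: "R0 \<in> \<Delta>" "cell_end (\<not> d) \<sigma>0 R0 = c" "a \<le> lo d R0" "hi d R0 \<le> b" "cell_end d \<tau> R0 = endpt \<tau> a b"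
      using CE_end_cell[OF e] by blast
    have fR0: "endpt \<tau> a b \<in> Iv d R0" using short_cell.cell_end_in[OF short_cell[OF R0(1)], of d \<tau>] R0(5) by simp
    have nd: "nder {a..b} k (trc d c j) (endpt \<tau> a b) = JJ d (\<lambda>i j. Dst \<Omega> i j p) k j ?w"
      using trace_nder[OF p Y e j R0(1-4) fR0, of k] trace_slice[OF p Y R0(1,2) k j fR0] kn by simp
    consider (free) "\<not> T_junction \<Delta> ?w" | (inner) a' b' where "CE (\<not> d) (endpt \<tau> a b) a' b'" "a' < c" "c < b'"
      using CE_end_cases[OF e, of \<tau>] by blast
    then show ?thesis
    proof cases
      case free
      have wv: "?w \<in> verts \<Delta>" by (rule CE_vertex[OF e])
      let ?R = "cw ?w"
      obtain \<sigma> \<rho> where R: "?R \<in> \<Delta>" "?w = mkp True (cell_end True \<sigma> ?R) (cell_end False \<rho> ?R)" using cw_corner[OF wv free] by blast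
      interpret c: short_cell n r u v M \<delta> C h0 ?R by (rule short_cell[OF R(1)])
      have "mkp True (cell_end True \<sigma> ?R) (cell_end False \<rho> ?R) \<in> region ?R"
        using c.cell_end_in[of True \<sigma>] c.cell_end_in[of False \<rho>] by (subst mkp_region) auto
      then have wR: "?w \<in> region ?R" using R(2) by metis
      have D: "tensor ?R (\<lambda>l m. Y ?R l m - q ?R l m) i' j' (mkp True (cell_end True \<sigma> ?R) (cell_end False \<rho> ?R)) = 0"
        if "i' \<le> r True" "j' \<le> r False" for i' j'
      proof (rule corner_jet[OF R(1) _ that])
        fix l m' assume "nr True \<sigma> l" "nr False \<rho> m'"
        then show "Y ?R l m' - q ?R l m' = 0" using van wv free R(2) unfolding vanishes_on_M_def by blast
      qed
      have "tensor ?R (Y ?R) i' j' ?w = tensor ?R (q ?R) i' j' ?w" if "i' \<le> r True" "j' \<le> r False" for i' j'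
        using D[OF that] R(2) by (simp add: tensor_diff)
      then have "Dst \<Omega> i' j' p ?w = tensor ?R (q ?R) i' j' ?w" if "i' \<le> r True" "j' \<le> r False" for i' j'
        using GS_Dst[OF p Y R(1) that wR] that by simp
      then have "JJ d (\<lambda>i j. Dst \<Omega> i j p) k j ?w = JJ d (tensor ?R (q ?R)) k j ?w"
        using k j by (cases d) (auto simp: JJ_def)
      then have "?L ^ (k + j) * \<bar>nder {a..b} k (trc d c j) (endpt \<tau> a b) - JJ d F k j ?w\<bar>
        \<le> \<Lambda> ^ (k + j) * \<bar>JJ d (tensor ?R (q ?R)) k j ?w - JJ d F k j ?w\<bar>"
        unfolding nd using L by (intro mult_mono power_mono) auto
      also have "\<dots> \<le> \<Theta>" by (rule qFd[OF R(1) wR kn jn])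
      finally show ?thesis using eta by linarith
    next
      case (inner a' b')
      let ?L' = "b' - a'" and ?x = "endpt \<tau> a b"
      have L': "0 < ?L'" using CE_lt[OF inner(1)] by simp
      have c': "c \<in> {a'..b'}" using inner by auto
      have nr': "\<not> (\<exists>e'. (segm (\<not> d) ?x a' b', e') \<in> depends_on ^^ m)"
        using Suc.prems(2) relpow_Suc_I2[OF depends_on_CE[OF e inner]] by blast
      have IH: "?L' ^ (j + k) * \<bar>nder {a'..b'} j (trc (\<not> d) ?x k) c - JJ (\<not> d) F j k (mkp (\<not> d) c ?x)\<bar> \<le> KK m * \<Theta>"
        by (rule Suc.IH[OF inner(1) nr' _ jn c']) (use k in simp)
      obtain R1 \<sigma>1 where R1: "R1 \<in> \<Delta>" "cell_end (\<not> \<not> d) \<sigma>1 R1 = ?x" "a' \<le> lo (\<not> d) R1" "hi (\<not> d) R1 \<le> b'" "c \<in> Iv (\<not> d) R1"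
        using CE_point[OF inner(1) c'] by blast
      have k': "k \<le> r (\<not> \<not> d)" using k by simp
      have nd': "nder {a'..b'} j (trc (\<not> d) ?x k) c = JJ (\<not> d) (\<lambda>i j. Dst \<Omega> i j p) j k (mkp (\<not> d) c ?x)"
        using trace_nder[OF p Y inner(1) k' R1, of j] trace_slice[OF p Y R1(1,2) j k' R1(5)] jn by simp
      have IH': "?L' ^ (k + j) * \<bar>JJ d (\<lambda>i j. Dst \<Omega> i j p) k j ?w - JJ d F k j ?w\<bar> \<le> KK m * \<Theta>"
        using IH[unfolded nd'] by (simp add: JJ_not mkp_not add.commute)
      have "?L ^ (k + j) \<le> (\<alpha> * \<kappa> * ?L') ^ (k + j)"
        using CE_end_length[OF al(1) ka(1) _ _ e inner] al ka L by (intro power_mono) auto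
      also have "\<dots> = (\<alpha> * \<kappa>) ^ (k + j) * ?L' ^ (k + j)" by (simp add: power_mult_distrib)
      also have "\<dots> \<le> (\<alpha> * \<kappa>) ^ NN * ?L' ^ (k + j)"
        using ak1 kn jn L' by (intro mult_right_mono power_increasing) (cases d; auto simp: NN_def)+
      finally have "?L ^ (k + j) * \<bar>JJ d (\<lambda>i j. Dst \<Omega> i j p) k j ?w - JJ d F k j ?w\<bar>
        \<le> (\<alpha> * \<kappa>) ^ NN * ?L' ^ (k + j) * \<bar>JJ d (\<lambda>i j. Dst \<Omega> i j p) k j ?w - JJ d F k j ?w\<bar>"
        by (intro mult_right_mono) auto
      also have "\<dots> \<le> ?\<eta>" using IH' ak1 by (simp add: mult.assoc)
      finally show ?thesis unfolding nd .
    qed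
  qed
  have "?L ^ (i + j) * \<bar>nder {a..b} i (trc d c j) x - JJ d F i j (mkp d x c)\<bar> \<le> Ke d * ?\<eta>"
    by (rule edge_step[OF e j eta ends Suc.prems(4,5)])
  also have "\<dots> \<le> KE * ?\<eta>" using Ke_KE eta Th0 by (intro mult_right_mono) auto
  also have "\<dots> = KK (Suc m) * \<Theta>" by (simp add: KK_def mult_ac)
  finally show ?case .
qed

definition "err_const = real (n True) * real (n False) * (K1 True + K1 False) * K1 True * K1 False *
    (\<kappa> ^ NN * (KK (Suc \<beta>) + 1))"

text \<open>Every side of a cell lies on a composite edge and dependency paths have length at most \<open>\<beta>\<close>, so
  the traces on the sides are under control, and \<open>tensor_est\<close> applies.\<close>

lemma estimate:
  assumes R: "R \<in> \<Delta>" and z: "z \<in> region R"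
  shows "\<bar>p z - tensor R (q R) 0 0 z\<bar> \<le> err_const * \<Theta>"
proof -
  interpret c: short_cell n r u v M \<delta> C h0 R by (rule short_cell[OF R])
  have "p z - tensor R (q R) 0 0 z = tensor R (\<lambda>l m. Y R l m - q R l m) 0 0 z"
    using Y R z by (simp add: represents_def tensor_diff)
  moreover have "\<bar>tensor R (\<lambda>l m. Y R l m - q R l m) 0 0 z\<bar> \<le> real (n True) * real (n False) * (K1 True + K1 False) * K1 True * K1 False *
    (\<kappa> ^ NN * (KK (Suc \<beta>) + 1) * \<Theta>)"
  proof (rule c.tensor_est[OF _ _ z])
    show "Y R l m - q R l m = 0" if "mi True l" "mi False m" for l m using van R that by (auto simp: vanishes_on_M_def)
    fix d \<sigma> i j x assume j: "j \<le> r (\<not> d)" and i: "i < n d" and x: "x \<in> Iv d R"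
    let ?c = "cell_end (\<not> d) \<sigma> R"
    have jn: "j < n (\<not> d)" using j nn(2)[of "\<not> d"] by simp
    obtain a b where e: "CE d ?c a b" "a \<le> lo d R" "hi d R \<le> b" using CE_of_cell[OF R] by blast
    let ?L = "b - a"
    have L: "0 < ?L" "?L \<le> \<Lambda>" using CE_lt[OF e(1)] Lam(1)[OF e(1)] by auto
    have xe: "x \<in> {a..b}" using x e by auto
    have nr': "\<not> (\<exists>e'. (segm d ?c a b, e') \<in> depends_on ^^ Suc \<beta>)"
    proof
      assume "\<exists>e'. (segm d ?c a b, e') \<in> depends_on ^^ Suc \<beta>"
      then obtain e' where "(segm d ?c a b, e') \<in> depends_on ^^ Suc \<beta>" by blast
      from path_beta[OF be this] show False by simp
    qed
    have E: "?L ^ (i + j) * \<bar>nder {a..b} i (trc d ?c j) x - JJ d F i j (mkp d x ?c)\<bar> \<le> KK (Suc \<beta>) * \<Theta>"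
      by (rule edge_all[OF e(1) nr' j i xe])
    have nd: "nder {a..b} i (trc d ?c j) x = JJ d (tensor R (Y R)) i j (mkp d x ?c)"
      by (rule trace_nder[OF p Y e(1) j R refl e(2,3) x]) (use i in simp)
    have reg: "mkp d x ?c \<in> region R" by (rule CE_region[OF e(1) R refl x])
    have Q: "?L ^ (i + j) * \<bar>JJ d (tensor R (q R)) i j (mkp d x ?c) - JJ d F i j (mkp d x ?c)\<bar> \<le> \<Theta>"
      using L by (intro order.trans[OF mult_right_mono qFd[OF R reg i jn]] power_mono) auto
    have "JJ d (tensor R (\<lambda>l m. Y R l m - q R l m)) i j (mkp d x ?c) = JJ d (tensor R (Y R)) i j (mkp d x ?c) - JJ d (tensor R (q R)) i j (mkp d x ?c)"
      by (simp add: JJ_def tensor_diff)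
    then have "?L ^ (i + j) * \<bar>JJ d (tensor R (\<lambda>l m. Y R l m - q R l m)) i j (mkp d x ?c)\<bar> \<le> ?L ^ (i + j) *
      (\<bar>JJ d (tensor R (Y R)) i j (mkp d x ?c) - JJ d F i j (mkp d x ?c)\<bar> + \<bar>JJ d (tensor R (q R)) i j (mkp d x ?c) - JJ d F i j (mkp d x ?c)\<bar>)"
      using L by (intro mult_left_mono) auto
    also have "\<dots> \<le> (KK (Suc \<beta>) + 1) * \<Theta>" using E Q unfolding nd by (simp add: algebra_simps)
    finally have B: "?L ^ (i + j) * \<bar>JJ d (tensor R (\<lambda>l m. Y R l m - q R l m)) i j (mkp d x ?c)\<bar> \<le> (KK (Suc \<beta>) + 1) * \<Theta>" .
    have hh: "hh d R \<le> ?L" "hh (\<not> d) R \<le> \<kappa> * ?L"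
    proof -
      show 1: "hh d R \<le> ?L" using e by simp
      have "hh (\<not> d) R \<le> \<kappa> * hh d R" by (rule kappa_bound[OF ka(1) R])
      also have "\<dots> \<le> \<kappa> * ?L" using 1 ka by (intro mult_left_mono) auto
      finally show "hh (\<not> d) R \<le> \<kappa> * ?L" .
    qed
    have "hh d R ^ i * hh (\<not> d) R ^ j \<le> ?L ^ i * (\<kappa> * ?L) ^ j"
      using hh c.hh_pos[of d] c.hh_pos[of "\<not> d"] L by (intro mult_mono power_mono) auto
    also have "\<dots> = \<kappa> ^ j * ?L ^ (i + j)" by (simp add: power_mult_distrib power_add)
    also have "\<dots> \<le> \<kappa> ^ NN * ?L ^ (i + j)"
      using ka jn L by (intro mult_right_mono power_increasing) (cases d; auto simp: NN_def)+
    finally have "hh d R ^ i * hh (\<not> d) R ^ j * \<bar>JJ d (tensor R (\<lambda>l m. Y R l m - q R l m)) i j (mkp d x ?c)\<bar>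
      \<le> \<kappa> ^ NN * ?L ^ (i + j) * \<bar>JJ d (tensor R (\<lambda>l m. Y R l m - q R l m)) i j (mkp d x ?c)\<bar>"
      by (intro mult_right_mono) auto
    also have "\<dots> \<le> \<kappa> ^ NN * ((KK (Suc \<beta>) + 1) * \<Theta>)"
      unfolding mult.assoc using B ka by (intro mult_left_mono) auto
    finally show "hh d R ^ i * hh (\<not> d) R ^ j * \<bar>JJ d (tensor R (\<lambda>l m. Y R l m - q R l m)) i j (mkp d x ?c)\<bar>
      \<le> \<kappa> ^ NN * (KK (Suc \<beta>) + 1) * \<Theta>" by (simp add: mult.assoc)
  qed
  ultimately show ?thesis by (simp add: err_const_def mult.assoc)
qed

end

section \<open>Existence of splines with prescribed data\<close>

context spline_setting
begin

text \<open>The requirements on the normal derivatives \<open>t 0, ..., t r\<close> along the composite edge \<open>e\<close>: membership in the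
  univariate space, agreement with the traces \<open>g\<close> on perpendicular edges that have an end of \<open>e\<close> in their
  interior, agreement with \<open>q\<close> at other ends and on the chosen cell edge.\<close>

definition trace_cond :: "(cell \<Rightarrow> nat \<Rightarrow> nat \<Rightarrow> real) \<Rightarrow> (seg \<Rightarrow> nat \<Rightarrow> real \<Rightarrow> real) \<Rightarrow> seg \<Rightarrow> (nat \<Rightarrow> real \<Rightarrow> real) \<Rightarrow> bool" where
  "trace_cond q g e t \<longleftrightarrow> (\<forall>d c a b j. e = segm d c a b \<longrightarrow> CE d c a b \<longrightarrow> j \<le> r (\<not> d) \<longrightarrow>
     t j \<in> ES d {a..b} \<and>
     (\<forall>\<tau> i a' b'. i \<le> r d \<longrightarrow> CE (\<not> d) (endpt \<tau> a b) a' b' \<longrightarrow> a' < c \<longrightarrow> c < b' \<longrightarrow>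
        nder {a..b} i (t j) (endpt \<tau> a b) = nder {a'..b'} j (g (segm (\<not> d) (endpt \<tau> a b) a' b') i) c) \<and>
     (\<forall>\<tau> i. i \<le> r d \<longrightarrow> \<not> T_junction \<Delta> (mkp d (endpt \<tau> a b) c) \<longrightarrow>
        nder {a..b} i (t j) (endpt \<tau> a b) = JJ d (tensor (cw (mkp d (endpt \<tau> a b) c)) (q (cw (mkp d (endpt \<tau> a b) c)))) i j (mkp d (endpt \<tau> a b) c)) \<and>
     (\<forall>l. mi d l \<longrightarrow> lm d (fst (ce e)) l (t j) = lm d (fst (ce e)) l (\<lambda>x. JJ d (tensor (fst (ce e)) (q (fst (ce e)))) 0 j (mkp d x c))))"

lemma inner_T:
  assumes e: "CE d c a b" and e': "CE (\<not> d) (endpt \<tau> a b) a' b'" "a' < c" "c < b'"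
  shows "T_junction \<Delta> (mkp d (endpt \<tau> a b) c)"
proof -
  have "mkp d (endpt \<tau> a b) c = mkp (\<not> d) c (endpt \<tau> a b)" by (simp add: mkp_not)
  then show ?thesis unfolding T_junction_iff[OF CE_vertex[OF e]] using e' by blast
qed

text \<open>The conditions at the two ends and on the chosen cell edge are exactly the data of
  \<open>edge_ex\<close>; at each end only one of the two kinds of conditions is present, and at most one perpendicular edge
  has the end in its interior.\<close>

lemma trace_cond_solvable: "\<exists>t. trace_cond q g e t"
proof (cases "composite_edge \<Delta> e")
  case False
  then show ?thesis unfolding trace_cond_def CE_def by blast
next
  case True
  then obtain d c a b where e: "e = segm d c a b" and CE: "CE d c a b" using composite_CE by blast
  define R where "R = fst (ce e)"
  obtain \<sigma> \<tau> where R: "R \<in> \<Delta>" "cell_end (\<not> d) \<sigma> R = c" "a \<le> lo d R" "hi d R \<le> b" "cell_end d \<tau> R = endpt \<tau> a b"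
    using ce_edge[OF CE, folded e, OF R_def] by blast
  have val: "\<exists>y. (\<forall>a' b'. CE (\<not> d) (endpt \<rho> a b) a' b' \<longrightarrow> a' < c \<longrightarrow> c < b' \<longrightarrow>
        y = nder {a'..b'} j (g (segm (\<not> d) (endpt \<rho> a b) a' b') i) c) \<and>
     (\<not> T_junction \<Delta> (mkp d (endpt \<rho> a b) c) \<longrightarrow>
        y = JJ d (tensor (cw (mkp d (endpt \<rho> a b) c)) (q (cw (mkp d (endpt \<rho> a b) c)))) i j (mkp d (endpt \<rho> a b) c))"
    for \<rho> i j
  proof -
    consider (free) "\<not> T_junction \<Delta> (mkp d (endpt \<rho> a b) c)" | (inner) a' b' where "CE (\<not> d) (endpt \<rho> a b) a' b'" "a' < c" "c < b'"
      using CE_end_cases[OF CE, of \<rho>] by blast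
    then show ?thesis
    proof cases
      case free
      then show ?thesis using inner_T[OF CE] by blast
    next
      case inner
      have "a'' = a' \<and> b'' = b'" if "CE (\<not> d) (endpt \<rho> a b) a'' b''" "a'' < c" "c < b''" for a'' b''
        using CE_same[OF that(1) inner(1) that(2,3)] inner by simp
      then show ?thesis using inner_T[OF CE inner] inner by blast
    qed
  qed
  \<comment> \<open>the value prescribed at the end \<open>\<rho>\<close>, whichever kind of condition is present\<close>
  define y where "y j \<rho> i = (SOME y. (\<forall>a' b'. CE (\<not> d) (endpt \<rho> a b) a' b' \<longrightarrow> a' < c \<longrightarrow> c < b' \<longrightarrow>
        y = nder {a'..b'} j (g (segm (\<not> d) (endpt \<rho> a b) a' b') i) c) \<and>
     (\<not> T_junction \<Delta> (mkp d (endpt \<rho> a b) c) \<longrightarrow>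
        y = JJ d (tensor (cw (mkp d (endpt \<rho> a b) c)) (q (cw (mkp d (endpt \<rho> a b) c)))) i j (mkp d (endpt \<rho> a b) c)))" for j \<rho> i
  note y = someI_ex[OF val, folded y_def]
  interpret E: edge_interval "n d" "u d" "v d" M \<delta> a b "lo d R" "hi d R" "r d" C \<tau> \<alpha>
    by (rule CE_edgeint[OF CE R])
  have "\<exists>t. t \<in> ES d {a..b} \<and> (\<forall>\<rho> i. i \<le> r d \<longrightarrow> nder {a..b} i t (endpt \<rho> a b) = y j \<rho> i) \<and>
     (\<forall>l. mi d l \<longrightarrow> lm d R l t = lm d R l (\<lambda>x. JJ d (tensor R (q R)) 0 j (mkp d x c)))" for j
  proof -
    obtain t where "t \<in> ES d {a..b}" "\<And>\<rho> i. i \<le> r d \<Longrightarrow> nder {a..b} i t (endpt \<rho> a b) = y j \<rho> i"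
      "\<And>l. mi d l \<Longrightarrow> lm d R l t = lm d R l (\<lambda>x. JJ d (tensor R (q R)) 0 j (mkp d x c))"
      using E.edge_ex[of "y j" "\<lambda>l. lm d R l (\<lambda>x. JJ d (tensor R (q R)) 0 j (mkp d x c))"] by blast
    then show ?thesis by blast
  qed
  then obtain t where t: "\<And>j. t j \<in> ES d {a..b} \<and> (\<forall>\<rho> i. i \<le> r d \<longrightarrow> nder {a..b} i (t j) (endpt \<rho> a b) = y j \<rho> i) \<and>
     (\<forall>l. mi d l \<longrightarrow> lm d R l (t j) = lm d R l (\<lambda>x. JJ d (tensor R (q R)) 0 j (mkp d x c)))" by metis
  have "trace_cond q g e t"
    unfolding trace_cond_def
  proof (intro allI impI)
    fix d' c' a1 b1 j assume "e = segm d' c' a1 b1" "CE d' c' a1 b1" "j \<le> r (\<not> d')"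
    then have eq: "d' = d" "c' = c" "a1 = a" "b1 = b" using e segm_inj[OF CE_lt[OF CE]] CE_lt by metis+
    show "t j \<in> ES d' {a1..b1} \<and>
     (\<forall>\<tau> i a' b'. i \<le> r d' \<longrightarrow> CE (\<not> d') (endpt \<tau> a1 b1) a' b' \<longrightarrow> a' < c' \<longrightarrow> c' < b' \<longrightarrow>
        nder {a1..b1} i (t j) (endpt \<tau> a1 b1) = nder {a'..b'} j (g (segm (\<not> d') (endpt \<tau> a1 b1) a' b') i) c') \<and>
     (\<forall>\<tau> i. i \<le> r d' \<longrightarrow> \<not> T_junction \<Delta> (mkp d' (endpt \<tau> a1 b1) c') \<longrightarrow>
        nder {a1..b1} i (t j) (endpt \<tau> a1 b1) = JJ d' (tensor (cw (mkp d' (endpt \<tau> a1 b1) c')) (q (cw (mkp d' (endpt \<tau> a1 b1) c')))) i j (mkp d' (endpt \<tau> a1 b1) c')) \<and>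
     (\<forall>l. mi d' l \<longrightarrow> lm d' (fst (ce e)) l (t j) = lm d' (fst (ce e)) l (\<lambda>x. JJ d' (tensor (fst (ce e)) (q (fst (ce e)))) 0 j (mkp d' x c')))"
      unfolding eq R_def[symmetric]
    proof (intro conjI allI impI)
      show "t j \<in> ES d {a..b}" using t by blast
      show "nder {a..b} i (t j) (endpt \<tau> a b) = nder {a'..b'} j (g (segm (\<not> d) (endpt \<tau> a b) a' b') i) c"
        if "i \<le> r d" "CE (\<not> d) (endpt \<tau> a b) a' b'" "a' < c" "c < b'" for \<tau> i a' b'
        using t[of j] y[of \<tau> j i] that by metis
      show "nder {a..b} i (t j) (endpt \<tau> a b) = JJ d (tensor (cw (mkp d (endpt \<tau> a b) c)) (q (cw (mkp d (endpt \<tau> a b) c)))) i j (mkp d (endpt \<tau> a b) c)"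
        if "i \<le> r d" "\<not> T_junction \<Delta> (mkp d (endpt \<tau> a b) c)" for \<tau> i
        using t[of j] y[of \<tau> j i] that by metis
      show "lm d R l (t j) = lm d R l (\<lambda>x. JJ d (tensor R (q R)) 0 j (mkp d x c))" if "mi d l" for l
        using t that by blast
    qed
  qed
  then show ?thesis by blast
qed

text \<open>The absence of cycles makes the recursion along composite edges well founded.\<close>

lemma traces_exist: "\<exists>g. \<forall>e. trace_cond q g e (g e)"
proof (rule dependent_wf_choice[OF depends_on_wf])
  show "trace_cond q f e t = trace_cond q g e t" if fg: "\<And>z. (z, e) \<in> depends_on\<inverse> \<Longrightarrow> f z = g z" for f g e t
  proof -
    have "trace_cond q f e t \<Longrightarrow> trace_cond q g e t" if fg: "\<And>z. (z, e) \<in> depends_on\<inverse> \<Longrightarrow> f z = g z" for f g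
    proof -
      have "f (segm (\<not> d) (endpt \<tau> a b) a' b') = g (segm (\<not> d) (endpt \<tau> a b) a' b')"
        if "e = segm d c a b" "CE d c a b" "CE (\<not> d) (endpt \<tau> a b) a' b'" "a' < c" "c < b'" for d c a b \<tau> a' b'
        using fg depends_on_CE[OF that(2-5)] that(1) by auto
      then show "trace_cond q f e t \<Longrightarrow> trace_cond q g e t" unfolding trace_cond_def by (metis (no_types, lifting))
    qed
    from this[OF fg] this[of g f] fg show ?thesis by fastforce
  qed
qed (rule trace_cond_solvable)

end

locale traces = spline_setting +
  fixes q :: "cell \<Rightarrow> nat \<Rightarrow> nat \<Rightarrow> real" and g :: "seg \<Rightarrow> nat \<Rightarrow> real \<Rightarrow> real"
  assumes g: "trace_cond q g e (g e)"
begin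

lemma g_E: "CE d c a b \<Longrightarrow> j \<le> r (\<not> d) \<Longrightarrow> g (segm d c a b) j \<in> ES d {a..b}"
  using g[of "segm d c a b"] unfolding trace_cond_def by blast

lemma g_inner: "CE d c a b \<Longrightarrow> j \<le> r (\<not> d) \<Longrightarrow> i \<le> r d \<Longrightarrow> CE (\<not> d) (endpt \<tau> a b) a' b' \<Longrightarrow> a' < c \<Longrightarrow> c < b' \<Longrightarrow>
    nder {a..b} i (g (segm d c a b) j) (endpt \<tau> a b) = nder {a'..b'} j (g (segm (\<not> d) (endpt \<tau> a b) a' b') i) c"
  using g[of "segm d c a b"] unfolding trace_cond_def by blast

lemma g_free: "CE d c a b \<Longrightarrow> j \<le> r (\<not> d) \<Longrightarrow> i \<le> r d \<Longrightarrow> w = mkp d (endpt \<tau> a b) c \<Longrightarrow> \<not> T_junction \<Delta> w \<Longrightarrow>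
    nder {a..b} i (g (segm d c a b) j) (endpt \<tau> a b) = JJ d (tensor (cw w) (q (cw w))) i j w"
  using g[of "segm d c a b"] unfolding trace_cond_def by blast

lemma g_mid: "CE d c a b \<Longrightarrow> j \<le> r (\<not> d) \<Longrightarrow> R = fst (ce (segm d c a b)) \<Longrightarrow> mi d l \<Longrightarrow>
    lm d R l (g (segm d c a b) j) = lm d R l (\<lambda>x. JJ d (tensor R (q R)) 0 j (mkp d x c))"
  using g[of "segm d c a b"] unfolding trace_cond_def by blast

lemma fin_ex: "x \<in> {a..b} \<Longrightarrow> \<not> (a < x \<and> x < b) \<Longrightarrow> \<exists>\<tau>. x = endpt \<tau> a b"
  by (auto simp: endpt_def ex_bool_eq)

text \<open>The mixed derivatives at a point common to two perpendicular composite edges. They cannot both contain it in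
  their interiors. If one of them does, then the trace on the other one was constructed from it; if
  none does, then the point is not a T-junction, and both traces interpolate the same jet.\<close>

lemma cross_consistent:
  assumes e: "CE d c a b" "x \<in> {a..b}" and e': "CE (\<not> d) x a' b'" "c \<in> {a'..b'}" and ij: "i \<le> r d" "j \<le> r (\<not> d)"
  shows "nder {a..b} i (g (segm d c a b) j) x = nder {a'..b'} j (g (segm (\<not> d) x a' b') i) c"
proof (cases "a < x \<and> x < b")
  case True
  have "c = a' \<or> c = b'" by (rule CE_cross[OF e(1) _ _ e'(1)]) (use True e' in auto)
  then have "\<exists>\<tau>. c = endpt \<tau> a' b'" by (auto simp: endpt_def ex_bool_eq)
  then obtain \<tau> where \<tau>: "c = endpt \<tau> a' b'" by blast
  have "CE (\<not> \<not> d) (endpt \<tau> a' b') a b" using e(1) \<tau> by simp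
  from g_inner[OF e'(1) _ ij(2) this] True ij(1) \<tau> show ?thesis by simp
next
  case False
  then obtain \<tau> where \<tau>: "x = endpt \<tau> a b" using fin_ex e(2) by blast
  show ?thesis
  proof (cases "a' < c \<and> c < b'")
    case True
    then show ?thesis using g_inner[OF e(1) ij(2,1), of \<tau> a' b'] e'(1) \<tau> by simp
  next
    case nin: False
    then obtain \<rho> where \<rho>: "c = endpt \<rho> a' b'" using fin_ex e'(2) by blast
    have nT: "\<not> T_junction \<Delta> (mkp d x c)"
    proof
      assume T: "T_junction \<Delta> (mkp d x c)"
      then obtain a'' b'' where i: "CE (\<not> d) x a'' b''" "a'' < c" "c < b''"
        using CE_end_cases[OF e(1), of \<tau>] \<tau> by blast
      from CE_same[OF i(1) e'(1) i(2,3)] e'(2) nin i show False by auto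
    qed
    have "nder {a..b} i (g (segm d c a b) j) x = JJ d (tensor (cw (mkp d x c)) (q (cw (mkp d x c)))) i j (mkp d x c)"
      using g_free[OF e(1) ij(2,1) refl, of \<tau>] nT \<tau> by simp
    moreover have "nder {a'..b'} j (g (segm (\<not> d) x a' b') i) c = JJ (\<not> d) (tensor (cw (mkp d x c)) (q (cw (mkp d x c)))) j i (mkp d x c)"
    proof -
      have w: "mkp d x c = mkp (\<not> d) (endpt \<rho> a' b') x" using \<rho> by (simp add: mkp_not)
      show ?thesis using g_free[OF e'(1) _ ij(2) w nT] ij(1) \<rho>[symmetric] by simp
    qed
    ultimately show ?thesis by (simp add: JJ_not)
  qed
qed

text \<open>Two different collinear composite edges only meet at a common end; there both interpolate the
  same jet, that of \<open>q\<close> in the chosen cell or that of the traces on the perpendicular edge.\<close>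

lemma parallel_consistent:
  assumes e: "CE d c a b" "x \<in> {a..b}" and e': "CE d c a' b'" "x \<in> {a'..b'}" and ij: "i \<le> r d" "j \<le> r (\<not> d)"
  shows "nder {a..b} i (g (segm d c a b) j) x = nder {a'..b'} i (g (segm d c a' b') j) x"
proof (cases "a = a' \<and> b = b'")
  case False
  then have "\<not> (a < x \<and> x < b)" "\<not> (a' < x \<and> x < b')"
    using CE_same[OF e(1) e'(1)] CE_same[OF e'(1) e(1)] e(2) e'(2) by auto
  then obtain \<tau> \<rho> where \<tau>: "x = endpt \<tau> a b" "x = endpt \<rho> a' b'" using fin_ex e(2) e'(2) by metis
  consider (free) "\<not> T_junction \<Delta> (mkp d x c)" | (inner) a'' b'' where "CE (\<not> d) x a'' b''" "a'' < c" "c < b''"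
    using CE_end_cases[OF e(1), of \<tau>] \<tau> by blast
  then show ?thesis
  proof cases
    case free
    then show ?thesis using g_free[OF e(1) ij(2,1), of "mkp d x c" \<tau>] g_free[OF e'(1) ij(2,1), of "mkp d x c" \<rho>] \<tau> by simp
  next
    case inner
    then show ?thesis using g_inner[OF e(1) ij(2,1), of \<tau> a'' b''] g_inner[OF e'(1) ij(2,1), of \<rho> a'' b''] \<tau> by simp
  qed
qed simp

text \<open>The composite edge through the side \<open>\<sigma>\<close> of \<open>R\<close> in direction \<open>d\<close>; \<open>tg R d \<sigma>\<close> are the traces on it.\<close>

definition ea :: "cell \<Rightarrow> bool \<Rightarrow> bool \<Rightarrow> real \<times> real" where
  "ea R d \<sigma> = (SOME ab. CE d (cell_end (\<not> d) \<sigma> R) (fst ab) (snd ab) \<and> fst ab \<le> lo d R \<and> hi d R \<le> snd ab)"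

abbreviation "eA R d \<sigma> \<equiv> fst (ea R d \<sigma>)"
abbreviation "eB R d \<sigma> \<equiv> snd (ea R d \<sigma>)"
definition "tg R d \<sigma> = g (segm d (cell_end (\<not> d) \<sigma> R) (eA R d \<sigma>) (eB R d \<sigma>))"

lemma ea:
  assumes "R \<in> \<Delta>"
  shows "CE d (cell_end (\<not> d) \<sigma> R) (eA R d \<sigma>) (eB R d \<sigma>)" "eA R d \<sigma> \<le> lo d R" "hi d R \<le> eB R d \<sigma>"
proof -
  obtain a b where "CE d (cell_end (\<not> d) \<sigma> R) a b" "a \<le> lo d R" "hi d R \<le> b" using CE_of_cell[OF assms] by blast
  then have "\<exists>ab. CE d (cell_end (\<not> d) \<sigma> R) (fst ab) (snd ab) \<and> fst ab \<le> lo d R \<and> hi d R \<le> snd ab"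
    by (intro exI[of _ "(a, b)"]) simp
  from someI_ex[OF this, folded ea_def]
  show "CE d (cell_end (\<not> d) \<sigma> R) (eA R d \<sigma>) (eB R d \<sigma>)" "eA R d \<sigma> \<le> lo d R" "hi d R \<le> eB R d \<sigma>" by blast+
qed

lemma tg_E: "R \<in> \<Delta> \<Longrightarrow> j \<le> r (\<not> d) \<Longrightarrow> tg R d \<sigma> j \<in> ES d {eA R d \<sigma>..eB R d \<sigma>}"
  unfolding tg_def by (rule g_E[OF ea(1)])

lemma tg_ER: "R \<in> \<Delta> \<Longrightarrow> j \<le> r (\<not> d) \<Longrightarrow> tg R d \<sigma> j \<in> ES d (Iv d R)"
  by (rule uspace_mono[OF tg_E]) (use ea(2,3) in auto)

lemma tg_nder: "R \<in> \<Delta> \<Longrightarrow> j \<le> r (\<not> d) \<Longrightarrow> i \<le> n d \<Longrightarrow> x \<in> Iv d R \<Longrightarrow>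
    nder {eA R d \<sigma>..eB R d \<sigma>} i (tg R d \<sigma> j) x = nder (Iv d R) i (tg R d \<sigma> j) x"
  by (rule nder_edge_cell[OF ea(1) tg_E _ ea(2,3)])

text \<open>The horizontal sides fill their rows including the corners, the vertical sides the rest of
  their columns, and \<open>q\<close> the middle block.\<close>

definition trace_array :: "cell \<Rightarrow> nat \<Rightarrow> nat \<Rightarrow> real" where
  "trace_array R l m = (if nr False (r False < m) m
     then hh False R ^ idx (n False) (r False < m) m * lm True R l (tg R True (r False < m) (idx (n False) (r False < m) m))
     else if nr True (r True < l) l
     then hh True R ^ idx (n True) (r True < l) l * lm False R m (tg R False (r True < l) (idx (n True) (r True < l) l))
     else q R l m)"

lemma side_idx: "j \<le> r d \<Longrightarrow> (r d < idx (n d) \<sigma> j) = \<sigma>" "j \<le> r d \<Longrightarrow> idx (n d) \<sigma> (idx (n d) \<sigma> j) = j"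
  using nn(2)[of d] by (auto simp: idx_def)

text \<open>By definition for the traces on horizontal sides; on a vertical side the corner blocks were filled
  from horizontal traces, and the mixed derivatives at the corners agree by \<open>cross_consistent\<close>.\<close>

lemma trace_array_trace:
  assumes R: "R \<in> \<Delta>" and j: "j \<le> r (\<not> d)" and l: "l < n d"
  shows "dir_array d (trace_array R) l (idx (n (\<not> d)) \<sigma> j) = hh (\<not> d) R ^ j * lm d R l (tg R d \<sigma> j)"
proof (cases d)
  case True
  then show ?thesis using j nr_idx[of j False \<sigma>] side_idx[of j False \<sigma>] by (simp add: dir_array_def trace_array_def)
next
  case False
  have jT: "j \<le> r True" and lF: "l < n False" using j l False by auto
  let ?m = "idx (n True) \<sigma> j"
  show ?thesis
  proof (cases "nr False (r False < l) l")
    case nf: False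
    then show ?thesis using False jT nr_idx[of j True \<sigma>] side_idx[of j True \<sigma>] by (simp add: dir_array_def trace_array_def)
  next
    case True
    define \<tau> where "\<tau> = (r False < l)"
    define i where "i = idx (n False) \<tau> l"
    have i: "i \<le> r False" "l = idx (n False) \<tau> i" using True lF unfolding i_def \<tau>_def by (auto simp: nr_def)
    interpret c: short_cell n r u v M \<delta> C h0 R by (rule short_cell[OF R])
    have nT: "j \<le> n True" "i \<le> n False" using jT i(1) nn(2)[of True] nn(2)[of False] by auto
    have "trace_array R ?m l = hh False R ^ i * lm True R ?m (tg R True \<tau> i)"
      using True unfolding trace_array_def \<tau>_def[symmetric] i_def[symmetric] by simp
    also have "lm True R ?m (tg R True \<tau> i) = hh True R ^ j * nder (Iv True R) j (tg R True \<tau> i) (cell_end True \<sigma> R)"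
      unfolding cell_end_def by (rule bernstein_interval.la_hermite[OF c.bi jT])
    also have "nder (Iv True R) j (tg R True \<tau> i) (cell_end True \<sigma> R) = nder {eA R True \<tau>..eB R True \<tau>} j (tg R True \<tau> i) (cell_end True \<sigma> R)"
      using tg_nder[OF R _ _ c.cell_end_in, of i True j \<tau> \<sigma>] i nT by simp
    also have "\<dots> = nder {eA R False \<sigma>..eB R False \<sigma>} i (tg R False \<sigma> j) (cell_end False \<tau> R)"
    proof -
      have "cell_end True \<sigma> R \<in> {eA R True \<tau>..eB R True \<tau>}" "cell_end False \<tau> R \<in> {eA R False \<sigma>..eB R False \<sigma>}"
        using c.cell_end_in[of True \<sigma>] c.cell_end_in[of False \<tau>] ea(2,3)[OF R, of True \<tau>] ea(2,3)[OF R, of False \<sigma>] by auto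
      then show ?thesis
        using cross_consistent[OF ea(1)[OF R, of True \<tau>], of "cell_end True \<sigma> R" "eA R False \<sigma>" "eB R False \<sigma>" j i]
          ea(1)[OF R, of False \<sigma>] i jT by (simp add: tg_def)
    qed
    also have "\<dots> = nder (Iv False R) i (tg R False \<sigma> j) (cell_end False \<tau> R)"
      using tg_nder[OF R _ _ c.cell_end_in, of j False i \<sigma> \<tau>] jT nT by simp
    finally have "trace_array R ?m l = hh True R ^ j * (hh False R ^ i * nder (Iv False R) i (tg R False \<sigma> j) (cell_end False \<tau> R))"
      by (simp add: mult_ac)
    also have "hh False R ^ i * nder (Iv False R) i (tg R False \<sigma> j) (cell_end False \<tau> R) = lm False R l (tg R False \<sigma> j)"
      unfolding i(2) cell_end_def by (rule bernstein_interval.la_hermite[OF c.bi i(1), symmetric])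
    finally show ?thesis using False by (simp add: dir_array_def)
  qed
qed

lemma trace_array_slice:
  assumes R: "R \<in> \<Delta>" and j: "j \<le> r (\<not> d)" and x: "x \<in> Iv d R" and i: "i \<le> n d"
  shows "JJ d (tensor R (trace_array R)) i j (mkp d x (cell_end (\<not> d) \<sigma> R)) = nder {eA R d \<sigma>..eB R d \<sigma>} i (tg R d \<sigma> j) x"
proof -
  interpret c: short_cell n r u v M \<delta> C h0 R by (rule short_cell[OF R])
  let ?s = "\<lambda>x. JJ d (tensor R (trace_array R)) 0 j (mkp d x (cell_end (\<not> d) \<sigma> R))"
  have "?s x = tg R d \<sigma> j x" if x: "x \<in> Iv d R" for x
  proof (rule bernstein_interval.la_inj[OF c.bi c.slice_E tg_ER[OF R j] _ x])
    fix l assume l: "l < n d"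
    have "hh (\<not> d) R ^ j * lm d R l ?s = hh (\<not> d) R ^ j * lm d R l (tg R d \<sigma> j)"
      using c.dual_fun_trace[OF j l, of "trace_array R" \<sigma>] trace_array_trace[OF R j l, of \<sigma>] by simp
    then show "lm d R l ?s = lm d R l (tg R d \<sigma> j)" using c.hh_pos[of "\<not> d"] by simp
  qed
  then have "nder (Iv d R) i ?s x = nder (Iv d R) i (tg R d \<sigma> j) x" by (intro nder_cong x)
  then show ?thesis using c.slice_nder[OF i x] tg_nder[OF R j i x] by simp
qed

lemma boundary_point:
  assumes R: "R \<in> \<Delta>" and z: "z \<in> cell_boundary R"
  obtains d \<sigma> x where "z = mkp d x (cell_end (\<not> d) \<sigma> R)" "x \<in> Iv d R"
proof -
  obtain x y where xy: "z = mkp True x y" by (rule mkp_ex)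
  have *: "x \<in> Iv True R" "y \<in> Iv False R" "(\<exists>\<sigma>. x = cell_end True \<sigma> R) \<or> (\<exists>\<sigma>. y = cell_end False \<sigma> R)"
    using z boundary_iff[OF R, of True x y] unfolding xy by auto
  show thesis
  proof (cases "\<exists>\<sigma>. x = cell_end True \<sigma> R")
    case True
    then obtain \<sigma> where "x = cell_end True \<sigma> R" by blast
    then show thesis using that[of False y \<sigma>] xy * by (simp add: mkp_def)
  next
    case False
    then obtain \<sigma> where "y = cell_end False \<sigma> R" using * by blast
    then show thesis using that[of True x \<sigma>] xy * by simp
  qed
qed

text \<open>Two cells meet in boundary points only, where both arrays reproduce traces along composite
  edges; these edges are parallel or perpendicular.\<close>

lemma cells_agree:
  assumes R: "R \<in> \<Delta>" "z \<in> region R" and R': "R' \<in> \<Delta>" "z \<in> region R'" and ij: "i \<le> r True" "j \<le> r False"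
  shows "tensor R (trace_array R) i j z = tensor R' (trace_array R') i j z"
proof (cases "R = R'")
  case False
  then have bd: "z \<in> cell_boundary R" "z \<in> cell_boundary R'" using T R R' unfolding T_mesh_def by blast+
  obtain d \<sigma> x where z: "z = mkp d x (cell_end (\<not> d) \<sigma> R)" "x \<in> Iv d R" using boundary_point[OF R(1) bd(1)] .
  obtain d' \<sigma>' x' where z': "z = mkp d' x' (cell_end (\<not> d') \<sigma>' R')" "x' \<in> Iv d' R'" using boundary_point[OF R'(1) bd(2)] .
  define k where "k e = (if e then i else j)" for e
  have k: "k e \<le> r e" for e using ij by (simp add: k_def)
  have kn: "k e \<le> n e" for e using k[of e] nn(2)[of e] by simp
  have J: "JJ e (tensor Q (trace_array Q)) (k e) (k (\<not> e)) z = tensor Q (trace_array Q) i j z" for e Q by (cases e) (auto simp: JJ_def k_def)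
  have A: "tensor R (trace_array R) i j z = nder {eA R d \<sigma>..eB R d \<sigma>} (k d) (tg R d \<sigma> (k (\<not> d))) x"
    using trace_array_slice[OF R(1) k[of "\<not> d"] z(2) kn, of \<sigma>] J[of d R] z(1) by simp
  have A': "tensor R' (trace_array R') i j z = nder {eA R' d' \<sigma>'..eB R' d' \<sigma>'} (k d') (tg R' d' \<sigma>' (k (\<not> d'))) x'"
    using trace_array_slice[OF R'(1) k[of "\<not> d'"] z'(2) kn, of \<sigma>'] J[of d' R'] z'(1) by simp
  have in1: "x \<in> {eA R d \<sigma>..eB R d \<sigma>}" and in2: "x' \<in> {eA R' d' \<sigma>'..eB R' d' \<sigma>'}"
    using z(2) z'(2) ea(2,3)[OF R(1), of d \<sigma>] ea(2,3)[OF R'(1), of d' \<sigma>'] by auto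
  show ?thesis
  proof (cases "d' = d")
    case True
    have eq: "x' = x" "cell_end (\<not> d) \<sigma>' R' = cell_end (\<not> d) \<sigma> R" using z z' True by auto
    have "CE d (cell_end (\<not> d) \<sigma> R) (eA R' d \<sigma>') (eB R' d \<sigma>')" using ea(1)[OF R'(1), of d \<sigma>'] eq by simp
    from parallel_consistent[OF ea(1)[OF R(1)] in1 this _ k k] in2 show ?thesis
      unfolding A A' True eq tg_def using eq by simp
  next
    case F: False
    then have d': "d' = (\<not> d)" by auto
    have "mkp d x (cell_end (\<not> d) \<sigma> R) = mkp d (cell_end d \<sigma>' R') x'" using z z' unfolding d' by (simp add: mkp_not)
    then have eq: "x = cell_end d \<sigma>' R'" "x' = cell_end (\<not> d) \<sigma> R" by auto
    have "CE (\<not> d) x (eA R' d' \<sigma>') (eB R' d' \<sigma>')" using ea(1)[OF R'(1), of d' \<sigma>'] eq d' by simp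
    from cross_consistent[OF ea(1)[OF R(1)] in1 this _ k k] in2 show ?thesis
      unfolding A A' tg_def using eq d' by simp
  qed
qed simp

end

subsection \<open>Splines from pieces\<close>

text \<open>Closed sets not containing the point do not matter for a limit at the point.\<close>

lemma deriv_pieces:
  fixes f :: "real \<Rightarrow> real"
  assumes "finite A" "\<And>k. k \<in> A \<Longrightarrow> closed (S k)"
    "\<And>k. k \<in> A \<Longrightarrow> x \<in> S k \<Longrightarrow> (f has_real_derivative D) (at x within S k)"
  shows "(f has_real_derivative D) (at x within (\<Union>k\<in>A. S k))"
  using assms
proof (induction A rule: finite_induct)
  case empty
  then show ?case by (simp add: has_field_derivative_iff)
next
  case (insert k A)
  have "(f has_real_derivative D) (at x within S k)"
  proof (cases "x \<in> S k")
    case False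
    then have "at x within S k = bot" using insert.prems(1)[of k] by (simp add: trivial_limit_within closed_limpt) blast
    then show ?thesis by (simp add: has_field_derivative_iff)
  qed (use insert.prems(2) in blast)
  moreover have "(f has_real_derivative D) (at x within (\<Union>k\<in>A. S k))" using insert by blast
  ultimately show ?case by (simp add: has_field_derivative_iff Lim_within_Un)
qed

lemma deriv_family_pieces:
  assumes A: "finite A" and cl: "\<And>k. k \<in> A \<Longrightarrow> closed (S k)"
    and F: "\<And>k. k \<in> A \<Longrightarrow> deriv_family (S k) m1 m2 (F k)"
    and eq: "\<And>k z i j. k \<in> A \<Longrightarrow> z \<in> S k \<Longrightarrow> i \<le> m1 \<Longrightarrow> j \<le> m2 \<Longrightarrow> G i j z = F k i j z"
  shows "deriv_family (\<Union>k\<in>A. S k) m1 m2 G"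
  unfolding deriv_family_def
proof (intro conjI allI impI)
  fix i j s t assume ij: "i < m1" "j \<le> m2" and st: "(s, t) \<in> (\<Union>k\<in>A. S k)"
  have U: "{x. (x, t) \<in> (\<Union>k\<in>A. S k)} = (\<Union>k\<in>A. {x. (x, t) \<in> S k})" by blast
  show "((\<lambda>x. G i j (x, t)) has_real_derivative G (Suc i) j (s, t)) (at s within {x. (x, t) \<in> (\<Union>k\<in>A. S k)})"
    unfolding U
  proof (rule deriv_pieces[OF A])
    fix k assume k: "k \<in> A"
    have "closed ((\<lambda>x. (x, t)) -` S k)" by (intro closed_vimage cl k continuous_intros)
    then show "closed {x. (x, t) \<in> S k}" by (simp add: vimage_def)
    assume "s \<in> {x. (x, t) \<in> S k}"
    then show "((\<lambda>x. G i j (x, t)) has_real_derivative G (Suc i) j (s, t)) (at s within {x. (x, t) \<in> S k})"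
      using deriv_familyD(1)[OF F[OF k] ij, of s t] eq[OF k] ij
      by (subst has_field_derivative_cong_eventually[where g="\<lambda>x. F k i j (x, t)"])
         (auto simp: eventually_at_filter intro!: always_eventually)
  qed
next
  fix j s t assume j: "j < m2" and st: "(s, t) \<in> (\<Union>k\<in>A. S k)"
  have U: "{y. (s, y) \<in> (\<Union>k\<in>A. S k)} = (\<Union>k\<in>A. {y. (s, y) \<in> S k})" by blast
  show "((\<lambda>y. G 0 j (s, y)) has_real_derivative G 0 (Suc j) (s, t)) (at t within {y. (s, y) \<in> (\<Union>k\<in>A. S k)})"
    unfolding U
  proof (rule deriv_pieces[OF A])
    fix k assume k: "k \<in> A"
    have "closed (Pair s -` S k)" by (intro closed_vimage cl k continuous_intros)
    then show "closed {y. (s, y) \<in> S k}" by (simp add: vimage_def)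
    assume "t \<in> {y. (s, y) \<in> S k}"
    then show "((\<lambda>y. G 0 j (s, y)) has_real_derivative G 0 (Suc j) (s, t)) (at t within {y. (s, y) \<in> S k})"
      using deriv_familyD(2)[OF F[OF k] j, of s t] eq[OF k] j
      by (subst has_field_derivative_cong_eventually[where g="\<lambda>y. F k 0 j (s, y)"])
         (auto simp: eventually_at_filter intro!: always_eventually)
  qed
next
  fix i j assume ij: "i \<le> m1" "j \<le> m2"
  show "continuous_on (\<Union>k\<in>A. S k) (G i j)"
  proof (rule continuous_on_closed_Union[OF A cl])
    fix k assume k: "k \<in> A"
    show "continuous_on (S k) (G i j)"
      by (subst continuous_on_cong[OF refl eq[OF k _ ij]]) (use deriv_familyD(3)[OF F[OF k] ij] in auto)
  qed
qed

lemma slices_nontrivial_pieces: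
  assumes "\<And>k. k \<in> A \<Longrightarrow> slices_nontrivial (S k)"
  shows "slices_nontrivial (\<Union>k\<in>A. S k)"
  unfolding slices_nontrivial_def
proof (intro allI impI)
  fix s t assume "(s, t) \<in> (\<Union>k\<in>A. S k)"
  then obtain k where k: "k \<in> A" "(s, t) \<in> S k" by blast
  then have "at s within {x. (x, t) \<in> S k} \<noteq> bot" "at t within {y. (s, y) \<in> S k} \<noteq> bot"
    using assms unfolding slices_nontrivial_def by blast+
  moreover have "at s within {x. (x, t) \<in> S k} \<le> at s within {x. (x, t) \<in> (\<Union>k\<in>A. S k)}"
    "at t within {y. (s, y) \<in> S k} \<le> at t within {y. (s, y) \<in> (\<Union>k\<in>A. S k)}"
    by (rule at_le, use k in blast)+
  ultimately show "at s within {x. (x, t) \<in> (\<Union>k\<in>A. S k)} \<noteq> bot \<and> at t within {y. (s, y) \<in> (\<Union>k\<in>A. S k)} \<noteq> bot"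
    by (auto simp: le_bot)
qed

lemma closed_region: "closed (region R)"
  unfolding region_def by (intro closed_Times closed_atLeastAtMost)

context spline_setting
begin

lemma Omega_slices_nontrivial: "slices_nontrivial \<Omega>"
  unfolding mesh_domain_def by (rule slices_nontrivial_pieces) (rule short_cell.region_slices_nontrivial[OF short_cell])

text \<open>On the slices of the domain, which are finite unions of intervals, derivatives may be checked on
  each cell separately.\<close>

lemma pieces_GS:
  assumes agree: "\<And>R R' z i j. R \<in> \<Delta> \<Longrightarrow> z \<in> region R \<Longrightarrow> R' \<in> \<Delta> \<Longrightarrow> z \<in> region R' \<Longrightarrow> i \<le> r True \<Longrightarrow> j \<le> r False \<Longrightarrow>
      tensor R (Y R) i j z = tensor R' (Y R') i j z"
  shows "\<exists>p\<in>GSp. represents p Y"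
proof -
  define cl where "cl z = (SOME R. R \<in> \<Delta> \<and> z \<in> region R)" for z
  have cl: "cl z \<in> \<Delta> \<and> z \<in> region (cl z)" if "R \<in> \<Delta>" "z \<in> region R" for R z
    unfolding cl_def by (rule someI_ex) (use that in blast)
  define G where "G i j z = tensor (cl z) (Y (cl z)) i j z" for i j z
  have G: "G i j z = tensor R (Y R) i j z" if "R \<in> \<Delta>" "z \<in> region R" "i \<le> r True" "j \<le> r False" for R z i j
    unfolding G_def using agree[OF _ _ that] cl[OF that(1,2)] by blast
  have fG: "deriv_family \<Omega> (r True) (r False) G"
    unfolding mesh_domain_def
  proof (rule deriv_family_pieces[OF fin_D closed_region])
    fix R assume R: "R \<in> \<Delta>"
    have "deriv_family (region R) (n True) (n False) (tensor R (Y R))" by (rule short_cell.tensor_fam[OF short_cell[OF R]])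
    then show "deriv_family (region R) (r True) (r False) (tensor R (Y R))"
      using nn(2)[of True] nn(2)[of False] unfolding deriv_family_def by auto
  qed (rule G)
  define p where "p = zext \<Omega> (G 0 0)"
  have pR: "p z = tensor R (Y R) 0 0 z" if "R \<in> \<Delta>" "z \<in> region R" for R z
    using G[OF that] region_sub[OF that(1)] that by (auto simp: p_def zext_def)
  have "Cmm_on (r True) (r False) \<Omega> p"
    by (rule deriv_family_Dst(2)[OF Omega_slices_nontrivial fG]) (simp add: p_def zext_def)
  moreover have "zext (region R) p \<in> TS R" if R: "R \<in> \<Delta>" for R
  proof -
    have "zext (region R) p = zext (region R) (tensor R (Y R) 0 0)" using pR[OF R] by (auto simp: zext_def)
    then show ?thesis using short_cell.tensor_tspace[OF short_cell[OF R]] by simp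
  qed
  ultimately have "p \<in> GSp" by (auto simp: GS_def p_def zext_def)
  moreover have "represents p Y" unfolding represents_def using pR by blast
  ultimately show ?thesis by blast
qed

end

context traces
begin

text \<open>At vertices and on chosen cell edges the traces were made to have the functionals of \<open>q\<close>, and
  the middle block was copied from \<open>q\<close>.\<close>

lemma vanishes_on_M_trace_array: "vanishes_on_M (\<lambda>R l m. trace_array R l m - q R l m)"
  unfolding vanishes_on_M_def
proof (intro conjI allI impI)
  fix w \<sigma> \<tau> l m
  assume w: "w \<in> verts \<Delta>" "\<not> T_junction \<Delta> w" "w = mkp True (cell_end True \<sigma> (cw w)) (cell_end False \<tau> (cw w))"
    and lm: "nr True \<sigma> l" "nr False \<tau> m"
  define R where "R = cw w"
  have R: "R \<in> \<Delta>" using cw_corner[OF w(1,2)] R_def by blast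
  interpret c: short_cell n r u v M \<delta> C h0 R by (rule short_cell[OF R])
  obtain i j where i: "i \<le> r True" "l = idx (n True) \<sigma> i" and j: "j \<le> r False" "m = idx (n False) \<tau> j"
    using nr_ex lm by blast
  have ni: "i \<le> n True" using i nn(2)[of True] by simp
  let ?x = "cell_end True \<sigma> R"
  have wx: "w = mkp True ?x (cell_end False \<tau> R)" using w(3) R_def by simp
  have e: "CE True (cell_end False \<tau> R) (eA R True \<tau>) (eB R True \<tau>)" using ea(1)[OF R, of True \<tau>] by simp
  have xin: "?x \<in> {eA R True \<tau>..eB R True \<tau>}" using c.cell_end_in[of True \<sigma>] ea(2,3)[OF R, of True \<tau>] by auto
  have "\<not> (eA R True \<tau> < ?x \<and> ?x < eB R True \<tau>)" using w(2) T_junction_iff[OF w(1)] e wx by blast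
  then obtain \<rho> where \<rho>: "?x = endpt \<rho> (eA R True \<tau>) (eB R True \<tau>)" using fin_ex xin by blast
  have "trace_array R l m = hh False R ^ j * lm True R l (tg R True \<tau> j)"
    using trace_array_trace[OF R _ nr_lt[OF lm(1)], of j \<tau>] j by (simp add: dir_array_def)
  also have "lm True R l (tg R True \<tau> j) = hh True R ^ i * nder (Iv True R) i (tg R True \<tau> j) ?x"
    unfolding i(2) cell_end_def by (rule bernstein_interval.la_hermite[OF c.bi i(1)])
  also have "nder (Iv True R) i (tg R True \<tau> j) ?x = nder {eA R True \<tau>..eB R True \<tau>} i (tg R True \<tau> j) ?x"
    using tg_nder[OF R _ ni c.cell_end_in, of j \<tau> \<sigma>] j by simp
  also have "\<dots> = tensor R (q R) i j w"
    using g_free[OF e _ i(1), of j w \<rho>] wx w(2) j(1) \<rho> unfolding tg_def R_def[symmetric] by (simp add: JJ_def)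
  also have "\<dots> = nder (Iv True R) i (\<lambda>x. JJ True (tensor R (q R)) 0 j (mkp True x (cell_end False \<tau> R))) ?x"
    using c.slice_nder[OF ni c.cell_end_in, of "q R" j "cell_end False \<tau> R" \<sigma>] wx by (simp add: JJ_def)
  also have "hh True R ^ i * \<dots> = lm True R l (\<lambda>x. JJ True (tensor R (q R)) 0 j (mkp True x (cell_end False \<tau> R)))"
    unfolding i(2) cell_end_def[of True \<sigma>] by (rule bernstein_interval.la_hermite[OF c.bi i(1), symmetric])
  also have "hh False R ^ j * \<dots> = q R l m"
    using c.dual_fun_trace[of j True l "q R" \<tau>] j nr_lt[OF lm(1)] by (simp add: dir_array_def)
  finally show "trace_array (cw w) l m - q (cw w) l m = 0" unfolding R_def by simp
next
  fix d c a b \<sigma> l m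
  assume e: "CE d c a b" and g: "snd (ce (segm d c a b)) = cedge d \<sigma> (fst (ce (segm d c a b)))"
    and lm: "mi d l" "nr (\<not> d) \<sigma> m"
  define R where "R = fst (ce (segm d c a b))"
  obtain \<sigma>' where R: "R \<in> \<Delta>" "snd (ce (segm d c a b)) = cedge d \<sigma>' R" "cell_end (\<not> d) \<sigma>' R = c" "a \<le> lo d R" "hi d R \<le> b"
    using ce_edge[OF e R_def] by blast
  interpret c: short_cell n r u v M \<delta> C h0 R by (rule short_cell[OF R(1)])
  have c: "cell_end (\<not> d) \<sigma> R = c"
    using g R(2,3) segm_inj[OF lh[OF R(1), of d] lh[OF R(1), of d]] unfolding R_def[symmetric] by simp
  obtain j where j: "j \<le> r (\<not> d)" "m = idx (n (\<not> d)) \<sigma> j" using nr_ex lm by blast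
  have "CE d c (eA R d \<sigma>) (eB R d \<sigma>)" "eA R d \<sigma> \<le> lo d R" "hi d R \<le> eB R d \<sigma>" using ea[OF R(1), of d \<sigma>] c by auto
  with R(4,5) lh[OF R(1), of d] CE_same[OF e, of "eA R d \<sigma>" "eB R d \<sigma>" "(lo d R + hi d R) / 2"]
  have ab: "eA R d \<sigma> = a" "eB R d \<sigma> = b" by auto
  have "dir_array d (trace_array R) l m = hh (\<not> d) R ^ j * lm d R l (tg R d \<sigma> j)"
    unfolding j(2) by (rule trace_array_trace[OF R(1) j(1) mi_lt[OF lm(1)]])
  also have "lm d R l (tg R d \<sigma> j) = lm d R l (\<lambda>x. JJ d (tensor R (q R)) 0 j (mkp d x (cell_end (\<not> d) \<sigma> R)))"
    unfolding tg_def ab c by (rule g_mid[OF e j(1) R_def lm(1)])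
  also have "hh (\<not> d) R ^ j * \<dots> = dir_array d (q R) l m"
    unfolding j(2) by (rule c.dual_fun_trace[OF j(1) mi_lt[OF lm(1)]])
  finally show "dir_array d (\<lambda>l m. trace_array (fst (ce (segm d c a b))) l m - q (fst (ce (segm d c a b))) l m) l m = 0"
    unfolding R_def[symmetric] by (auto simp: dir_array_def split: if_splits)
next
  fix R l m assume lm: "mi True l" "mi False m"
  have nonr: "\<not> nr d \<sigma> l" if "mi d l" for d \<sigma> l using that unfolding mi_nr by (cases \<sigma>) auto
  show "trace_array R l m - q R l m = 0" using nonr[OF lm(1)] nonr[OF lm(2)] by (simp add: trace_array_def)
qed

end

lemma (in spline_setting) ex_spline: "\<exists>p\<in>GSp. \<exists>Y. represents p Y \<and> vanishes_on_M (\<lambda>R l m. Y R l m - q R l m)"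
proof -
  obtain g where g: "\<forall>e. trace_cond q g e (g e)" using traces_exist by blast
  interpret traces n r u v M \<delta> C h0 \<Delta> \<alpha> \<kappa> \<beta> cw ce q g by unfold_locales (use g in blast)
  have "\<exists>p\<in>GSp. represents p trace_array" by (rule pieces_GS) (rule cells_agree)
  then show ?thesis using vanishes_on_M_trace_array by blast
qed

section \<open>The quasi-interpolant\<close>

context short_cell
begin

lemma tensor_cc_ex: "\<exists>q. \<forall>i<n True. \<forall>j<n False. tensor_coef R q i j = w i j"
proof -
  define I where "I = {..<n True} \<times> {..<n False}"
  define q where "q l m = (\<Sum>p\<in>I. w (fst p) (snd p) * (lm True R l (BB True R (fst p)) * lm False R m (BB False R (snd p))))" for l m
  have "tensor R q 0 0 (s, t) = (\<Sum>k<n True. \<Sum>l<n False. w k l * (BB True R k s * BB False R l t))"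
    if st: "s \<in> Iv True R" "t \<in> Iv False R" for s t
  proof -
    have "tensor R q 0 0 (s, t) = (\<Sum>p\<in>I. w (fst p) (snd p) * tensor R (\<lambda>l m. lm True R l (BB True R (fst p)) * lm False R m (BB False R (snd p))) 0 0 (s, t))"
      unfolding q_def by (rule tensor_sum) (simp add: I_def)
    also have "\<dots> = (\<Sum>p\<in>I. w (fst p) (snd p) * (BB True R (fst p) s * BB False R (snd p) t))"
    proof (intro sum.cong refl)
      fix p assume "p \<in> I"
      then have p: "fst p < n True" "snd p < n False" by (auto simp: I_def)
      have "BB True R (fst p) s * BB False R (snd p) t =
          (\<Sum>l<n True. lm True R l (BB True R (fst p)) * AA True R l s) * (\<Sum>m<n False. lm False R m (BB False R (snd p)) * AA False R m t)"
        using bernstein_interval.A_expand[OF bi bernstein_interval.B_E[OF bi p(1)] st(1)] bernstein_interval.A_expand[OF bi bernstein_interval.B_E[OF bi p(2)] st(2)] by simp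
      also have "\<dots> = tensor R (\<lambda>l m. lm True R l (BB True R (fst p)) * lm False R m (BB False R (snd p))) 0 0 (s, t)"
        unfolding sum_product tensor_def by (simp add: mult_ac)
      finally show "w (fst p) (snd p) * tensor R (\<lambda>l m. lm True R l (BB True R (fst p)) * lm False R m (BB False R (snd p))) 0 0 (s, t) =
        w (fst p) (snd p) * (BB True R (fst p) s * BB False R (snd p) t)" by simp
    qed
    finally show ?thesis by (simp add: I_def sum.cartesian_product split_def)
  qed
  note 1 = tensor_coef_unique[OF this]
  have 2: "tensor_coef R q i j = cA False R (\<lambda>t. cA True R (\<lambda>s. tensor R q 0 0 (s, t)) i) j" if "i < n True" "j < n False" for i j
    by (rule tensor_coef_unique[OF _ that]) (use tensor_bern in \<open>auto simp: region_def lo_def hi_def\<close>)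
  have "tensor_coef R q i j = w i j" if "i < n True" "j < n False" for i j
    using 1[OF _ _ that] 2[OF that] by simp
  then show ?thesis by blast
qed

abbreviation "hermR z f \<equiv> hermite (n True) (n False) (u True) (v True) (u False) (v False) R z f"

text \<open>The interpolation problem has a solution by \<open>tensor_hermite\<close> and only one by \<open>tensor_jet_bound\<close>,
  so the definite description is met.\<close>

lemma hermite_PP:
  assumes z: "z \<in> region R"
  shows "\<exists>Y. (\<forall>x\<in>region R. hermR z f x = tensor R Y 0 0 x) \<and>
    (\<forall>i<n True. \<forall>j<n False. tensor R Y i j z = Dst (region R) i j f z)"
proof -
  obtain Y where Y: "\<And>i j. i < n True \<Longrightarrow> j < n False \<Longrightarrow> tensor R Y i j z = Dst (region R) i j f z"
    using tensor_hermite[OF z, of "\<lambda>i j. Dst (region R) i j f z"] by blast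
  have le: "i \<le> n d - 1 \<longleftrightarrow> i < n d" for i d using n3d[of d] by auto
  let ?p = "zext (region R) (tensor R Y 0 0)"
  have D: "Dst (region R) i j (zext (region R) (tensor R Y' 0 0)) z = tensor R Y' i j z" if "i < n True" "j < n False" for Y' i j
    by (rule tensor_Dst) (use that z in \<open>auto simp: zext_def\<close>)
  have "hermR z f = ?p"
    unfolding hermite_def
  proof (rule the_equality)
    show "?p \<in> TS R \<and> (\<forall>i\<le>n True - 1. \<forall>j\<le>n False - 1. Dst (region R) i j ?p z = Dst (region R) i j f z)"
      using tensor_tspace D Y by (simp add: le del: One_nat_def)
    fix p assume p: "p \<in> TS R \<and> (\<forall>i\<le>n True - 1. \<forall>j\<le>n False - 1. Dst (region R) i j p z = Dst (region R) i j f z)"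
    then obtain Y' where Y': "p = zext (region R) (tensor R Y' 0 0)" using tspace_PP by blast
    have "tensor R (\<lambda>l m. Y' l m - Y l m) i j z = 0" if "i < n True" "j < n False" for i j
      using p D[OF that, of Y'] Y[OF that] that by (simp add: le tensor_diff Y' del: One_nat_def)
    then have "\<bar>tensor R (\<lambda>l m. Y' l m - Y l m) 0 0 x\<bar> \<le> J1 False * (J1 True * 0)" if "x \<in> region R" for x
      by (intro tensor_jet_bound[OF z _ _ _ that]) auto
    then show "p = ?p" unfolding Y' by (auto simp: zext_def fun_eq_iff tensor_diff)
  qed
  then show ?thesis using Y by (intro exI[of _ Y]) (auto simp: zext_def)
qed

text \<open>Taylor's formula, first along a horizontal line through the point of interpolation and
  then along vertical lines.\<close>

lemma hermite_error:
  assumes F: "sym_deriv_family R n F" and FM: "\<And>i j x. x \<in> region R \<Longrightarrow> i \<le> n True \<Longrightarrow> j \<le> n False \<Longrightarrow> \<bar>F i j x\<bar> \<le> Mf"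
    and z: "z \<in> region R" and Y: "\<And>i j. i < n True \<Longrightarrow> j < n False \<Longrightarrow> tensor R Y i j z = F i j z"
    and Lam: "\<And>d. hh d R \<le> \<Lambda>" "\<Lambda> \<le> 1"
    and x: "x \<in> region R" and ij: "i < n True" "j < n False"
  shows "\<Lambda> ^ (i + j) * \<bar>tensor R Y i j x - F i j x\<bar> \<le> (n False + 1) * (1 + J1 False * J1 True) * Mf * \<Lambda> ^ min (n True) (n False)"
proof -
  obtain z1 z2 where zz: "z = (z1, z2)" by fastforce
  obtain x1 x2 where xx: "x = (x1, x2)" by fastforce
  have zs: "z1 \<in> Iv True R" "z2 \<in> Iv False R" "x1 \<in> Iv True R" "x2 \<in> Iv False R"
    using z x zz xx by (auto simp: region_def lo_def hi_def)
  define B where "B = (1 + J1 False * J1 True) * Mf"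
  define G where "G i j y = F i j y - tensor R Y i j y" for i j y
  have GB: "\<bar>G i j y\<bar> \<le> B" if "i \<le> n True" "j \<le> n False" "y \<in> region R" for i j y
  proof -
    have "\<bar>tensor R Y i j y\<bar> \<le> J1 False * (J1 True * Mf)"
      by (rule tensor_jet_bound[OF z _ that]) (use Y FM[OF z] in auto)
    then show ?thesis using FM[OF that(3,1,2)] unfolding G_def B_def by (simp add: algebra_simps)
  qed
  have B0: "0 \<le> B" using GB[OF _ _ z, of 0 0] by simp
  have L0: "0 \<le> \<Lambda>" using hh_pos[of True] Lam(1)[of True] by linarith
  have G0: "G i j z = 0" if "i < n True" "j < n False" for i j using Y[OF that] by (simp add: G_def)
  have D1: "((\<lambda>x. G i j (x, t)) has_real_derivative G (Suc i) j (s, t)) (at s within Iv True R)"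
    if "i < n True" "j \<le> n False" "s \<in> Iv True R" "t \<in> Iv False R" for i j s t
    using F tensor_deriv[of i True s Y j t] that unfolding G_def sym_deriv_family_def
    by (fastforce simp: JJ_def mkp_def intro!: DERIV_diff)
  have D2: "((\<lambda>y. G i j (s, y)) has_real_derivative G i (Suc j) (s, t)) (at t within Iv False R)"
    if "j < n False" "i \<le> n True" "s \<in> Iv True R" "t \<in> Iv False R" for i j s t
    using F tensor_deriv[of j False t Y i s] that unfolding G_def sym_deriv_family_def
    by (fastforce simp: JJ_def mkp_def intro!: DERIV_diff)
  have reg: "(s, t) \<in> region R" if "s \<in> Iv True R" "t \<in> Iv False R" for s t
    using that by (auto simp: region_def lo_def hi_def)
  have 1: "\<bar>G i j (s, z2)\<bar> \<le> B * \<Lambda> ^ (n True - i)" if "i < n True" "j < n False" "s \<in> Iv True R" for i j s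
  proof -
    have "\<bar>G i j (s, z2)\<bar> \<le> real (n True - i) * 0 + B * \<Lambda> ^ (n True - i)"
    proof (rule taylor_descent[where G="\<lambda>i s. G i j (s, z2)" and a="lo True R" and b="hi True R" and z=z1])
      show "\<bar>G i j (z1, z2)\<bar> \<le> 0" if "i < n True" for i using G0[OF that \<open>j < n False\<close>] zz by simp
      show "\<bar>G (n True) j (s, z2)\<bar> \<le> B" if "s \<in> Iv True R" for s
        using GB[of "n True" j] reg[OF that zs(2)] \<open>j < n False\<close> by auto
    qed (use that D1 zs Lam in auto)
    then show ?thesis by simp
  qed
  have 2: "\<bar>G i j (x1, x2)\<bar> \<le> real (n False - j) * (B * \<Lambda> ^ (n True - i)) + B * \<Lambda> ^ (n False - j)"
  proof (rule taylor_descent[where G="\<lambda>j t. G i j (x1, t)" and a="lo False R" and b="hi False R" and z=z2])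
    show "\<bar>G i j (x1, z2)\<bar> \<le> B * \<Lambda> ^ (n True - i)" if "j < n False" for j by (rule 1[OF ij(1) that zs(3)])
    show "\<bar>G i (n False) (x1, t)\<bar> \<le> B" if "t \<in> Iv False R" for t
      using GB[of i "n False"] reg[OF zs(3) that] ij by auto
  qed (use ij D2 zs Lam B0 L0 in auto)
  let ?k = "min (n True) (n False)"
  have "\<Lambda> ^ (i + j) * \<bar>G i j x\<bar> \<le> \<Lambda> ^ (i + j) * (real (n False - j) * (B * \<Lambda> ^ (n True - i)) + B * \<Lambda> ^ (n False - j))"
    using 2 L0 xx by (intro mult_left_mono) auto
  also have "\<dots> = real (n False - j) * (B * \<Lambda> ^ (i + j + (n True - i))) + B * \<Lambda> ^ (i + j + (n False - j))"
    by (simp add: power_add algebra_simps)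
  also have "\<dots> \<le> real (n False) * (B * \<Lambda> ^ ?k) + B * \<Lambda> ^ ?k"
    using ij B0 L0 Lam(2) by (intro add_mono mult_mono mult_left_mono power_decreasing) auto
  also have "\<dots> = (n False + 1) * (1 + J1 False * J1 True) * Mf * \<Lambda> ^ ?k" by (simp add: B_def algebra_simps)
  finally show ?thesis unfolding G_def by (simp add: abs_minus_commute)
qed

end

context spline_setting
begin

lemma GS_Bc: "represents p Y \<Longrightarrow> (R, i, j) \<in> Mset \<Longrightarrow> Bc (R, i, j) p = tensor_coef R (Y R) i j"
  using short_cell.Bc_eq[OF short_cell] M_set_sub[of R i j] unfolding represents_def by blast

lemma GS_out: "p \<in> GSp \<Longrightarrow> x \<notin> \<Omega> \<Longrightarrow> p x = 0" unfolding GS_def by blast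

text \<open>Common points of cells see the same derivatives for each summand, hence for the sum.\<close>

lemma GS_sum:
  assumes "finite A" and p: "\<And>a. a \<in> A \<Longrightarrow> p a \<in> GSp" "\<And>a. a \<in> A \<Longrightarrow> represents (p a) (Y a)"
  shows "(\<lambda>x. \<Sum>a\<in>A. c a * p a x) \<in> GSp" "represents (\<lambda>x. \<Sum>a\<in>A. c a * p a x) (\<lambda>R l m. \<Sum>a\<in>A. c a * Y a R l m)"
proof -
  let ?Y = "\<lambda>R l m. \<Sum>a\<in>A. c a * Y a R l m" and ?p = "\<lambda>x. \<Sum>a\<in>A. c a * p a x"
  show r: "represents ?p ?Y" using p(2) unfolding represents_def by (simp add: tensor_sum[OF assms(1)])
  have "\<exists>p\<in>GSp. represents p ?Y"
  proof (rule pieces_GS)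
    fix R R' z i j assume "R \<in> \<Delta>" "z \<in> region R" "R' \<in> \<Delta>" "z \<in> region R'" "i \<le> r True" "j \<le> r False"
    then have "tensor R (Y a R) i j z = tensor R' (Y a R') i j z" if "a \<in> A" for a
      using GS_Dst[OF p[OF that]] by metis
    then show "tensor R (\<lambda>l m. \<Sum>a\<in>A. c a * Y a R l m) i j z = tensor R' (\<lambda>l m. \<Sum>a\<in>A. c a * Y a R' l m) i j z"
      by (simp add: tensor_sum[OF assms(1)])
  qed
  then obtain p' where p': "p' \<in> GSp" "represents p' ?Y" by blast
  have "p' x = ?p x" for x
  proof (cases "x \<in> \<Omega>")
    case True
    then show ?thesis using r p'(2) unfolding represents_def mesh_domain_def by auto
  next
    case False
    then show ?thesis using p(1) p'(1) by (simp add: GS_out)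
  qed
  then have "p' = ?p" by blast
  then show "?p \<in> GSp" using p'(1) by simp
qed

lemma GS_diff:
  assumes "p \<in> GSp" "represents p Y" "p' \<in> GSp" "represents p' Y'"
  shows "(\<lambda>x. p x - p' x) \<in> GSp" "represents (\<lambda>x. p x - p' x) (\<lambda>R l m. Y R l m - Y' R l m)"
proof -
  have p: "(if a then p else p') \<in> GSp" "represents (if a then p else p') (if a then Y else Y')" for a using assms by auto
  note S = GS_sum[of UNIV, where p="\<lambda>a. if a then p else p'" and Y="\<lambda>a. if a then Y else Y'" and c="\<lambda>a. if a then 1 else -1", OF _ p, simplified]
  show "(\<lambda>x. p x - p' x) \<in> GSp" "represents (\<lambda>x. p x - p' x) (\<lambda>R l m. Y R l m - Y' R l m)" using S by (simp_all add: UNIV_bool)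
qed

text \<open>The stability estimate for the zero function with \<open>\<Theta> = 0\<close>.\<close>

lemma GS_zero:
  assumes p: "p \<in> GSp" and Y: "represents p Y" and van: "vanishes_on_M Y"
  shows "p = (\<lambda>_. 0)"
proof
  fix z
  interpret spline_error n r u v M \<delta> C h0 \<Delta> \<alpha> \<kappa> \<beta> cw ce p Y "\<lambda>_ _ _. 0" "\<lambda>_ _ _. 0" 0 1 0
    by unfold_locales (use p Y van elen in \<open>auto simp: sym_deriv_family_def JJ_def tensor_def\<close>)
  show "p z = 0"
  proof (cases "z \<in> \<Omega>")
    case True
    then obtain R where "R \<in> \<Delta>" "z \<in> region R" by (auto simp: mesh_domain_def)
    from estimate[OF this] show ?thesis by (simp add: tensor_def)
  next
    case False
    then show ?thesis using GS_out[OF p] by blast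
  qed
qed

abbreviation "dual \<xi> \<equiv> dual_spline (n True) (n False) (r True) (r False) (u True) (v True) (u False) (v False) \<Delta> Mset \<xi>"

lemma dual:
  assumes "\<xi> \<in> Mset"
  shows "dual \<xi> \<in> GSp \<and> (\<forall>\<eta>\<in>Mset. Bc \<eta> (dual \<xi>) = (if \<xi> = \<eta> then 1 else 0))"
  unfolding dual_spline_def
proof (rule theI'[where P="\<lambda>p. p \<in> GSp \<and> (\<forall>\<eta>\<in>Mset. Bc \<eta> p = (if \<xi> = \<eta> then 1 else 0))"])
  have "\<forall>R\<in>\<Delta>. \<exists>q. \<forall>i<n True. \<forall>j<n False. tensor_coef R q i j = (if \<xi> = (R, i, j) then 1 else 0)"
    by (intro ballI short_cell.tensor_cc_ex[OF short_cell])
  from bchoice[OF this] obtain q where q: "\<And>R i j. R \<in> \<Delta> \<Longrightarrow> i < n True \<Longrightarrow> j < n False \<Longrightarrow> tensor_coef R (q R) i j = (if \<xi> = (R, i, j) then 1 else 0)" by blast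
  obtain p Y where p: "p \<in> GSp" "represents p Y" "vanishes_on_M (\<lambda>R l m. Y R l m - q R l m)" using ex_spline[of q] by blast
  have "Bc (R, i, j) p = (if \<xi> = (R, i, j) then 1 else 0)" if "(R, i, j) \<in> Mset" for R i j
  proof -
    have "tensor_coef R (\<lambda>l m. Y R l m - q R l m) i j = 0"
      using p(3) that unfolding Mset_iff[symmetric] by blast
    then show ?thesis using GS_Bc[OF p(2) that] q[of R i j] M_set_sub[OF that] by (simp add: tensor_coef_diff)
  qed
  then have ex: "p \<in> GSp \<and> (\<forall>\<eta>\<in>Mset. Bc \<eta> p = (if \<xi> = \<eta> then 1 else 0))" using p(1) by (metis prod_cases3)
  moreover have "p' = p" if p': "p' \<in> GSp \<and> (\<forall>\<eta>\<in>Mset. Bc \<eta> p' = (if \<xi> = \<eta> then 1 else 0))" for p'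
  proof -
    obtain Y' where Y': "represents p' Y'" using GS_represents p' by blast
    have "tensor_coef R (\<lambda>l m. Y' R l m - Y R l m) i j = 0" if "(R, i, j) \<in> Mset" for R i j
      using GS_Bc[OF p(2) that] GS_Bc[OF Y' that] ex p' that by (simp add: tensor_coef_diff)
    then have "vanishes_on_M (\<lambda>R l m. Y' R l m - Y R l m)" unfolding Mset_iff[symmetric] by blast
    then have "(\<lambda>x. p' x - p x) = (\<lambda>_. 0)" using GS_zero GS_diff[of p' Y' p Y] p' p Y' by blast
    then show ?thesis by (auto simp: fun_eq_iff)
  qed
  ultimately show "\<exists>!p. p \<in> GSp \<and> (\<forall>\<eta>\<in>Mset. Bc \<eta> p = (if \<xi> = \<eta> then 1 else 0))" by blast
qed

abbreviation "Q cen f \<equiv> quasi_interp (n True) (n False) (r True) (r False) (u True) (v True) (u False) (v False) \<Delta> Mset cen f"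

text \<open>Expanding in the dual splines reproduces the coefficients on \<open>M\<close> used in the definition.\<close>

lemma quasi_GS:
  assumes herm: "\<And>R z. R \<in> \<Delta> \<Longrightarrow> z \<in> region R \<Longrightarrow> short_cell.hermR n u v R (cen R) f z = tensor R (q R) 0 0 z"
  shows "Q cen f \<in> GSp \<and> (\<exists>Y. represents (Q cen f) Y \<and> vanishes_on_M (\<lambda>R l m. Y R l m - q R l m))"
proof -
  define c where "c \<xi> = Bc \<xi> (short_cell.hermR n u v (fst \<xi>) (cen (fst \<xi>)) f)" for \<xi>
  have c: "c (R, i, j) = tensor_coef R (q R) i j" if "(R, i, j) \<in> Mset" for R i j
    using short_cell.Bc_eq[OF short_cell] M_set_sub[OF that] herm unfolding c_def by simp
  have "\<forall>\<xi>\<in>Mset. \<exists>Y. represents (dual \<xi>) Y" using GS_represents dual by blast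
  from bchoice[OF this] obtain Y where Y: "\<And>\<xi>. \<xi> \<in> Mset \<Longrightarrow> represents (dual \<xi>) (Y \<xi>)" by blast
  have Q: "Q cen f = (\<lambda>x. \<Sum>\<xi>\<in>Mset. c \<xi> * dual \<xi> x)" by (simp add: quasi_interp_def c_def)
  let ?Y = "\<lambda>R l m. \<Sum>\<xi>\<in>Mset. c \<xi> * Y \<xi> R l m"
  have 1: "Q cen f \<in> GSp" "represents (Q cen f) ?Y"
    unfolding Q by (rule GS_sum[OF finite_Mset]; use dual Y in blast)+
  have "tensor_coef R (\<lambda>l m. ?Y R l m - q R l m) i j = 0" if m: "(R, i, j) \<in> Mset" for R i j
  proof -
    have "tensor_coef R (?Y R) i j = (\<Sum>\<xi>\<in>Mset. c \<xi> * tensor_coef R (Y \<xi> R) i j)" by (rule tensor_coef_sum[OF finite_Mset])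
    also have "\<dots> = (\<Sum>\<xi>\<in>Mset. c \<xi> * (if \<xi> = (R, i, j) then 1 else 0))"
    proof (intro sum.cong refl)
      fix \<xi> assume "\<xi> \<in> Mset"
      then have "tensor_coef R (Y \<xi> R) i j = (if \<xi> = (R, i, j) then 1 else 0)" using GS_Bc[OF Y m] dual m by metis
      then show "c \<xi> * tensor_coef R (Y \<xi> R) i j = c \<xi> * (if \<xi> = (R, i, j) then 1 else 0)" by simp
    qed
    also have "\<dots> = c (R, i, j)" using m finite_Mset by (simp add: if_distrib[of "\<lambda>x. _ * x"] cong: if_cong)
    finally show ?thesis using c[OF m] by (simp add: tensor_coef_diff)
  qed
  then have "vanishes_on_M (\<lambda>R l m. ?Y R l m - q R l m)" unfolding Mset_iff[symmetric] by blast
  then show ?thesis using 1 by blast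
qed

end

context spline_setting
begin

text \<open>Stability turns the local error of the Hermite interpolants, measured by \<open>\<Theta>\<close>, into the
  error of the quasi-interpolant.\<close>

lemma quasi_error:
  assumes f: "Cmm_on (n True) (n False) \<Omega> f"
    and fM: "\<And>i j z. i \<le> n True \<Longrightarrow> j \<le> n False \<Longrightarrow> z \<in> \<Omega> \<Longrightarrow> \<bar>Dst \<Omega> i j f z\<bar> \<le> Mf"
    and cen: "\<And>R. R \<in> \<Delta> \<Longrightarrow> cen R \<in> region R"
    and Lam: "\<And>d c a b. CE d c a b \<Longrightarrow> b - a \<le> \<Lambda>" "\<Lambda> \<le> 1"
    and R: "R \<in> \<Delta>" and z: "z \<in> region R"
  shows "\<bar>f z - Q cen f z\<bar> \<le> (1 + spline_error.err_const n M \<delta> C \<alpha> \<kappa> \<beta>) *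
    ((n False + 1) * (1 + J1 False * J1 True) * Mf * \<Lambda> ^ min (n True) (n False))"
    and "continuous_on (region R) (Q cen f)"
proof -
  define F where "F i j = Dst \<Omega> i j f" for i j
  have deriv_family: "deriv_family (region R) (n True) (n False) F" if "R \<in> \<Delta>" for R
    unfolding F_def by (rule deriv_family_subset[OF Cmm_deriv_family[OF f] region_sub[OF that]])
  have sf: "sym_deriv_family R n F" if "R \<in> \<Delta>" for R by (rule deriv_family_sym[OF deriv_family[OF that] lh[OF that]])
  have FD: "Dst (region R) i j f z = F i j z" if "R \<in> \<Delta>" "i \<le> n True" "j \<le> n False" "z \<in> region R" for R i j z
    by (rule deriv_family_Dst(1)[OF short_cell.region_slices_nontrivial[OF short_cell[OF that(1)]] deriv_family[OF that(1)]]) (use that in \<open>auto simp: F_def\<close>)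
  have FM: "\<bar>F i j z\<bar> \<le> Mf" if "R \<in> \<Delta>" "z \<in> region R" "i \<le> n True" "j \<le> n False" for R z i j
    unfolding F_def using fM region_sub[OF that(1)] that by blast
  have "\<forall>R\<in>\<Delta>. \<exists>Y. (\<forall>x\<in>region R. short_cell.hermR n u v R (cen R) f x = tensor R Y 0 0 x) \<and>
    (\<forall>i<n True. \<forall>j<n False. tensor R Y i j (cen R) = Dst (region R) i j f (cen R))"
    by (intro ballI short_cell.hermite_PP[OF short_cell cen])
  from bchoice[OF this] obtain q where q: "\<And>R x. R \<in> \<Delta> \<Longrightarrow> x \<in> region R \<Longrightarrow> short_cell.hermR n u v R (cen R) f x = tensor R (q R) 0 0 x"
    "\<And>R i j. R \<in> \<Delta> \<Longrightarrow> i < n True \<Longrightarrow> j < n False \<Longrightarrow> tensor R (q R) i j (cen R) = Dst (region R) i j f (cen R)" by blast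
  obtain Y where Yr: "Q cen f \<in> GSp" "represents (Q cen f) Y" "vanishes_on_M (\<lambda>R l m. Y R l m - q R l m)"
    using quasi_GS[of cen f q] q(1) by blast
  have hL: "hh d R \<le> \<Lambda>" if R: "R \<in> \<Delta>" for d R
  proof -
    obtain a b where "CE d (cell_end (\<not> d) False R) a b" "a \<le> lo d R" "hi d R \<le> b" using CE_of_cell[OF R] by blast
    then show ?thesis using Lam(1) by fastforce
  qed
  let ?k = "min (n True) (n False)"
  define \<Theta> where "\<Theta> = (n False + 1) * (1 + J1 False * J1 True) * Mf * \<Lambda> ^ ?k"
  have L0: "0 \<le> \<Lambda>" using hL[OF R, of True] lh[OF R, of True] by simp
  have J0: "0 \<le> J1 d" for d using M1d by simp
  have Mf0: "0 \<le> Mf" using FM[OF R z, of 0 0] by simp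
  have Th: "Mf * \<Lambda> ^ n d \<le> \<Theta>" for d
  proof -
    have "Mf * \<Lambda> ^ n d \<le> 1 * Mf * \<Lambda> ^ ?k"
      using Mf0 L0 Lam(2) by (simp, intro mult_left_mono power_decreasing) (cases d; auto)+
    also have "\<dots> \<le> ((n False + 1) * (1 + J1 False * J1 True)) * Mf * \<Lambda> ^ ?k"
    proof (intro mult_right_mono)
      have "0 \<le> J1 False * J1 True" by (intro mult_nonneg_nonneg J0)
      then have "1 * 1 \<le> (real (n False + 1)) * (1 + J1 False * J1 True)" by (intro mult_mono) auto
      then show "1 \<le> (n False + 1) * (1 + J1 False * J1 True)" by simp
    qed (use Mf0 L0 in auto)
    finally show ?thesis by (simp add: \<Theta>_def)
  qed
  have loc: "\<Lambda> ^ (i + j) * \<bar>tensor R (q R) i j z - F i j z\<bar> \<le> \<Theta>"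
    if R: "R \<in> \<Delta>" and z: "z \<in> region R" and ij: "i < n True" "j < n False" for R z i j
    unfolding \<Theta>_def
    by (rule short_cell.hermite_error[OF short_cell[OF R] sf[OF R] FM[OF R] cen[OF R] _ hL[OF R] Lam(2) z ij])
       (use q(2)[OF R] FD[OF R _ _ cen[OF R]] in auto)
  interpret spline_error n r u v M \<delta> C h0 \<Delta> \<alpha> \<kappa> \<beta> cw ce "Q cen f" Y q F Mf \<Lambda> \<Theta>
    by unfold_locales (use Yr sf FM Lam Th loc in auto)
  have "\<bar>f z - tensor R (q R) 0 0 z\<bar> \<le> \<Theta>"
    using loc[OF R z, of 0 0] nn(1)[of True] nn(1)[of False] by (simp add: F_def)
  moreover have "\<bar>Q cen f z - tensor R (q R) 0 0 z\<bar> \<le> err_const * \<Theta>" by (rule estimate[OF R z])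
  ultimately have "\<bar>f z - Q cen f z\<bar> \<le> (1 + err_const) * \<Theta>" by (simp add: distrib_right)
  then show "\<bar>f z - Q cen f z\<bar> \<le> (1 + err_const) * ((n False + 1) * (1 + J1 False * J1 True) * Mf * \<Lambda> ^ ?k)"
    unfolding \<Theta>_def .
  have "continuous_on (region R) (tensor R (Y R) 0 0)" by (rule short_cell.tensor_cont[OF short_cell[OF R]]) auto
  then show "continuous_on (region R) (Q cen f)"
    using Yr(2) R by (subst continuous_on_cong[where g="tensor R (Y R) 0 0"]) (auto simp: represents_def)
qed

end

section \<open>Uniformity over all meshes\<close>

lemma (in good_interval) bernstein_like_mono: "bernstein_like k C F \<Longrightarrow> C \<le> C' \<Longrightarrow> bernstein_like k C' F"
proof -
  assume B: "bernstein_like k C F" and C: "C \<le> C'"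
  have m: "C * (h ^ i * \<bar>y\<bar>) \<le> C' * (h ^ i * \<bar>y\<bar>)" for i y using C h0 by (intro mult_right_mono) auto
  have m': "C * h \<le> C' * h" using C h0 by (intro mult_right_mono) auto
  show "bernstein_like k C' F"
    using B unfolding bernstein_like_def
    by (meson C m m' order_trans)
qed

text \<open>The constants of \<open>bern_U_bounds\<close> for both directions, made common by monotonicity.\<close>

lemma uniform_setup_ex:
  assumes "1 \<le> M" "0 < \<delta>" and n: "\<And>d. 3 \<le> n d" "\<And>d. 2 * r d + 2 \<le> n d"
  shows "\<exists>C h0. 0 < h0 \<and> uniform_setup n r u v M \<delta> C h0"
proof -
  have "\<exists>C h0. 1 \<le> C \<and> 0 < h0 \<and>
    (\<forall>n' u v a b. good n' u v M \<delta> a b \<longrightarrow> b - a \<le> h0 \<longrightarrow> good_interval.bernstein_like n' u v a b (n d - 1) C (bern_U n' u v a b (n d - 1)))" for d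
    by (rule bern_U_bounds[OF assms(1,2)]) (use n(1)[of d] in linarith)
  then obtain C h0 where C: "\<And>d. 1 \<le> C d" "\<And>d. 0 < h0 d"
    "\<And>d n' u v a b. good n' u v M \<delta> a b \<Longrightarrow> b - a \<le> h0 d \<Longrightarrow> good_interval.bernstein_like n' u v a b (n d - 1) (C d) (bern_U n' u v a b (n d - 1))"
    by metis
  define C' where "C' = max (C True) (C False)"
  define h' where "h' = min (h0 True) (h0 False)"
  have le: "C d \<le> C'" "h' \<le> h0 d" for d by (cases d; simp add: C'_def h'_def)+
  have "uniform_setup n r u v M \<delta> C' h'"
  proof (rule uniform_setup.intro)
    fix d a b assume g: "good (n d) (u d) (v d) M \<delta> a b" and h: "b - a \<le> h'"
    interpret good_interval "n d" "u d" "v d" M \<delta> a b by unfold_locales (rule g)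
    have "bernstein_like (n d - 1) (C d) (bern_U (n d) (u d) (v d) a b (n d - 1))"
      by (rule C(3)[OF g]) (use h le(2)[of d] in simp)
    then have "bernstein_like (n d - 1) C' (bern_U (n d) (u d) (v d) a b (n d - 1))" by (rule bernstein_like_mono[OF _ le(1)])
    moreover have "bern (n d) (u d) (v d) a b = bern_U (n d) (u d) (v d) a b (n d - 1)" by (simp add: fun_eq_iff bern_def)
    ultimately show "bernstein_interval (n d) (u d) (v d) M \<delta> a b (r d) C'"
      using n(2)[of d] C(1)[of d] le(1)[of d] by unfold_locales auto
  qed
  moreover have "0 < h'" using C(2) by (simp add: h'_def)
  ultimately show ?thesis by blast
qed

definition piecewise_Ck :: "(bool \<Rightarrow> nat) \<Rightarrow> (bool \<Rightarrow> real \<Rightarrow> real) \<Rightarrow> cell set \<Rightarrow> bool" where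
  "piecewise_Ck n w \<Delta> \<longleftrightarrow> (\<forall>R\<in>\<Delta>. \<forall>d. Ck_on (n d) (Iv d R) (w d))"

lemma (in tmesh) piecewise_Ck_bound:
  assumes "piecewise_Ck n w \<Delta>"
  shows "\<exists>M\<ge>1. \<forall>R\<in>\<Delta>. \<forall>d. \<forall>i\<le>n d. \<forall>x\<in>Iv d R. \<bar>nder (Iv d R) i (w d) x\<bar> \<le> M"
proof -
  have "\<exists>B. 0 \<le> B \<and> (\<forall>x\<in>Iv d R. \<bar>nder (Iv d R) i (w d) x\<bar> \<le> B)" if "R \<in> \<Delta>" "i \<le> n d" for R d i
  proof -
    have "compact (nder (Iv d R) i (w d) ` Iv d R)"
      by (rule compact_continuous_image[OF Ck_on_cont[of "n d"] compact_Icc]) (use assms that in \<open>auto simp: piecewise_Ck_def\<close>)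
    then have "bounded (nder (Iv d R) i (w d) ` Iv d R)" by (rule compact_imp_bounded)
    then obtain B where "0 < B" "\<forall>y\<in>nder (Iv d R) i (w d) ` Iv d R. norm y \<le> B" unfolding bounded_pos by blast
    then show ?thesis by (intro exI[of _ B]) auto
  qed
  note ex = this
  define B where "B R d i = (SOME B. 0 \<le> B \<and> (\<forall>x\<in>Iv d R. \<bar>nder (Iv d R) i (w d) x\<bar> \<le> B))" for R d i
  note B = someI_ex[OF ex, folded B_def]
  define M where "M = 1 + (\<Sum>R\<in>\<Delta>. \<Sum>d\<in>UNIV. \<Sum>i\<le>n d. B R d i)"
  have s0: "0 \<le> (\<Sum>i\<le>n d. B R d i)" if "R \<in> \<Delta>" for R d using B that by (intro sum_nonneg) auto
  have s1: "0 \<le> (\<Sum>d\<in>UNIV. \<Sum>i\<le>n d. B R d i)" if "R \<in> \<Delta>" for R by (intro sum_nonneg s0 that)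
  have BM: "B R d i \<le> M" if R: "R \<in> \<Delta>" and i: "i \<le> n d" for R d i
  proof -
    have "B R d i \<le> (\<Sum>i\<le>n d. B R d i)" by (rule member_le_sum) (use B[OF R] i in auto)
    also have "\<dots> \<le> (\<Sum>d\<in>UNIV. \<Sum>i\<le>n d. B R d i)"
      by (rule member_le_sum[where f="\<lambda>d. \<Sum>i\<le>n d. B R d i"]) (use s0[OF R] in auto)
    also have "\<dots> \<le> (\<Sum>R\<in>\<Delta>. \<Sum>d\<in>UNIV. \<Sum>i\<le>n d. B R d i)"
      by (rule member_le_sum[where f="\<lambda>R. \<Sum>d\<in>UNIV. \<Sum>i\<le>n d. B R d i"]) (use R s1 fin_D in auto)
    finally show ?thesis by (simp add: M_def)
  qed
  show ?thesis
  proof (intro exI[of _ M] conjI ballI allI impI)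
    show "1 \<le> M" unfolding M_def using sum_nonneg[OF s1, of \<Delta> "\<lambda>R. R"] by simp
    show "\<bar>nder (Iv d R) i (w d) x\<bar> \<le> M" if "R \<in> \<Delta>" "i \<le> n d" "x \<in> Iv d R" for R d i x
      using B[OF that(1,2)] BM[OF that(1,2)] that(3) by fastforce
  qed
qed

text \<open>Away from the finitely many end points, the derivatives on the cells of two meshes with the same
  domain coincide; the bound extends to the remaining points by continuity.\<close>

lemma piecewise_Ck_bound_transfer:
  assumes \<Delta>0: "T_mesh \<Delta>0" "\<forall>R\<in>\<Delta>0. \<forall>d. \<forall>i\<le>n d. \<forall>x\<in>Iv d R. \<bar>nder (Iv d R) i (w d) x\<bar> \<le> M"
    and \<Delta>: "T_mesh \<Delta>" "piecewise_Ck n w \<Delta>" and eq: "mesh_domain \<Delta> = mesh_domain \<Delta>0"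
    and R: "R \<in> \<Delta>" and i: "i \<le> n d" and x: "x \<in> Iv d R"
  shows "\<bar>nder (Iv d R) i (w d) x\<bar> \<le> M"
proof -
  interpret A: tmesh \<Delta> by unfold_locales (rule \<Delta>(1))
  interpret Z: tmesh \<Delta>0 by unfold_locales (rule \<Delta>0(1))
  define K where "K = {lo d R, hi d R} \<union> lo d ` \<Delta>0 \<union> hi d ` \<Delta>0"
  have fK: "finite K" using Z.fin_D by (simp add: K_def)
  let ?g = "nder (Iv d R) i (w d)"
  have out: "\<bar>?g y\<bar> \<le> M" if y: "y \<in> Iv d R" "y \<notin> K" for y
  proof -
    have "mkp d y (lo (\<not> d) R) \<in> region R" using y A.lh[OF R, of "\<not> d"] by simp
    moreover have "region R \<subseteq> mesh_domain \<Delta>" unfolding mesh_domain_def using R by (rule UN_upper)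
    then have "region R \<subseteq> mesh_domain \<Delta>0" by (simp only: eq)
    ultimately have "mkp d y (lo (\<not> d) R) \<in> mesh_domain \<Delta>0" by (rule rev_subsetD)
    then obtain R0 where R0: "R0 \<in> \<Delta>0" "mkp d y (lo (\<not> d) R) \<in> region R0" unfolding mesh_domain_def by (rule UN_E)
    then have y0: "y \<in> Iv d R0" by simp
    have "y \<noteq> lo d R0" "y \<noteq> hi d R0" "y \<noteq> lo d R" "y \<noteq> hi d R" using y(2) R0(1) by (auto simp: K_def)
    then have yy: "lo d R < y" "y < hi d R" "lo d R0 < y" "y < hi d R0" using y(1) y0 by auto
    let ?U = "{max (lo d R) (lo d R0)<..<min (hi d R) (hi d R0)}"
    have "?g y = nder (Iv d R0) i (w d) y"
      by (rule nder_local[of ?U]) (use yy in auto)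
    then show ?thesis using \<Delta>0(2) R0(1) i y0 by metis
  qed
  have "closed (K - {x})" using fK by (intro finite_imp_closed) auto
  then have "eventually (\<lambda>y. y \<in> - (K - {x})) (nhds x)" by (intro eventually_nhds_in_open open_Compl) auto
  then have ev: "eventually (\<lambda>y. \<bar>?g y\<bar> \<le> M) (at x within Iv d R)"
    unfolding eventually_at_filter by eventually_elim (use out in auto)
  have "Ck_on (n d) (Iv d R) (w d)" using \<Delta>(2) R by (auto simp: piecewise_Ck_def)
  then have "(?g \<longlongrightarrow> ?g x) (at x within Iv d R)" using Ck_on_cont[OF _ i] x unfolding continuous_on_def by blast
  then have "((\<lambda>y. \<bar>?g y\<bar>) \<longlongrightarrow> \<bar>?g x\<bar>) (at x within Iv d R)" by (rule tendsto_rabs)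
  then show ?thesis by (rule tendsto_upperbound[OF _ ev at_within_Icc_nontrivial[OF A.lh[OF R] x]])
qed

text \<open>\<open>assumption_A4\<close> bounds the product of powers of the two determinants from below. Both factors are bounded
  above, so each of them is bounded below.\<close>

lemma det_split:
  fixes x y K \<delta> :: real
  assumes "0 \<le> x" "0 \<le> y" "y \<le> K" "1 \<le> K" "1 \<le> p" "0 < \<delta>" "\<delta> \<le> x ^ p * y ^ q"
  shows "min 1 (\<delta> / K ^ (p + q)) \<le> x"
proof (cases "1 \<le> x")
  case False
  have "x ^ p \<le> x" using power_decreasing[of 1 p x] assms False by simp
  moreover have "y ^ q \<le> K ^ (p + q)"
    by (rule order_trans[OF power_mono power_increasing]) (use assms in auto)
  ultimately have "\<delta> \<le> x * K ^ (p + q)"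
    using assms by (intro order_trans[OF assms(7)] mult_mono) auto
  moreover have "0 < K ^ (p + q)" using assms by simp
  ultimately have "\<delta> / K ^ (p + q) \<le> x" by (simp add: divide_simps)
  then show ?thesis by simp
qed simp

text \<open>The determinant is Lipschitz with constant \<open>2 * M\<^sup>2\<close>, so a lower bound at one point persists on a short
  interval.\<close>

lemma good_near:
  assumes n: "3 \<le> n" and M: "1 \<le> M" and ab: "a < b" "b - a \<le> 1" and C: "Ck_on n {a..b} u" "Ck_on n {a..b} v"
    and bd: "\<And>i x. i \<le> n \<Longrightarrow> x \<in> {a..b} \<Longrightarrow> \<bar>nder {a..b} i u x\<bar> \<le> M \<and> \<bar>nder {a..b} i v x\<bar> \<le> M"
    and z: "z \<in> {a..b}" "\<rho> \<le> \<bar>det_D n u v {a..b} z\<bar>" "0 < \<rho>" and sm: "4 * M\<^sup>2 * (b - a) \<le> \<rho>"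
  shows "good n u v M (\<rho> / 2) a b"
proof -
  let ?n = "nder {a..b}"
  let ?D' = "\<lambda>x. ?n (n - 2) u x * ?n n v x - ?n n u x * ?n (n - 2) v x"
  have S: "Suc (n - 2) = n - 1" "Suc (n - 1) = n" using n by auto
  have der: "(det_D n u v {a..b} has_real_derivative ?D' x) (at x within {a..b})" if x: "x \<in> {a..b}" for x
  proof -
    have d: "(?n (n - 2) w has_real_derivative ?n (n - 1) w x) (at x within {a..b})"
      "(?n (n - 1) w has_real_derivative ?n n w x) (at x within {a..b})" if "w = u \<or> w = v" for w
      using Ck_on_deriv[of n "{a..b}" w "n - 2" x] Ck_on_deriv[of n "{a..b}" w "n - 1" x] that C x n S by auto
    have "((\<lambda>x. ?n (n - 2) u x * ?n (n - 1) v x - ?n (n - 1) u x * ?n (n - 2) v x) has_real_derivative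
       (?n (n - 1) u x * ?n (n - 1) v x + ?n n v x * ?n (n - 2) u x) - (?n n u x * ?n (n - 2) v x + ?n (n - 1) v x * ?n (n - 1) u x)) (at x within {a..b})"
      by (intro DERIV_diff DERIV_mult d) auto
    moreover have "det_D n u v {a..b} = (\<lambda>x. ?n (n - 2) u x * ?n (n - 1) v x - ?n (n - 1) u x * ?n (n - 2) v x)"
      by (simp add: fun_eq_iff det_D_def)
    ultimately show ?thesis by (simp add: mult_ac)
  qed
  have D': "\<bar>?D' x\<bar> \<le> 2 * M\<^sup>2" if x: "x \<in> {a..b}" for x
  proof -
    have "\<bar>?D' x\<bar> \<le> \<bar>?n (n - 2) u x\<bar> * \<bar>?n n v x\<bar> + \<bar>?n n u x\<bar> * \<bar>?n (n - 2) v x\<bar>"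
      unfolding abs_mult[symmetric] by (rule abs_triangle_ineq4)
    also have "\<dots> \<le> M * M + M * M" using bd[OF _ x] M by (intro add_mono mult_mono) auto
    finally show ?thesis by (simp add: power2_eq_square)
  qed
  have "\<rho> / 2 \<le> \<bar>det_D n u v {a..b} x\<bar>" if x: "x \<in> {a..b}" for x
  proof -
    have "\<bar>det_D n u v {a..b} x - det_D n u v {a..b} z\<bar> \<le> 2 * M\<^sup>2 * \<bar>x - z\<bar>"
      by (rule mvt_bound[OF der D' x z(1)])
    also have "\<dots> \<le> 2 * M\<^sup>2 * (b - a)" using x z(1) by (intro mult_left_mono) auto
    finally show ?thesis using sm z(2) by linarith
  qed
  then show ?thesis unfolding good_def using n M ab C bd z(3) by auto
qed

text \<open>Discs of radius zero show that the largest radius is not negative, so the center is in the region.\<close>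

lemma circle_center_in: "circle_center R z \<Longrightarrow> xl R \<le> xr R \<Longrightarrow> yl R \<le> yr R \<Longrightarrow> z \<in> region R"
proof -
  assume "circle_center R z" and l: "xl R \<le> xr R" "yl R \<le> yr R"
  then obtain \<rho> where \<rho>: "cball z \<rho> \<subseteq> region R" "\<And>z' \<rho>'. cball z' \<rho>' \<subseteq> region R \<Longrightarrow> \<rho>' \<le> \<rho>"
    unfolding circle_center_def by blast
  have "0 \<le> \<rho>" by (rule \<rho>(2)[of "(xl R, yl R)"]) (use l in \<open>auto simp: region_def\<close>)
  then show "z \<in> region R" using \<rho>(1) by auto
qed

lemma (in tmesh) length_mesh_size:
  assumes R: "R \<in> \<Delta>"
  shows "hi d R - lo d R \<le> mesh_size \<Delta>"
proof -
  have "compact (region R)" unfolding region_def by (intro compact_Times compact_Icc)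
  then have "dist (mkp d (lo d R) (lo (\<not> d) R)) (mkp d (hi d R) (lo (\<not> d) R)) \<le> diameter (region R)"
    using lh[OF R, of d] lh[OF R, of "\<not> d"] by (intro diameter_bounded_bound compact_imp_bounded) auto
  moreover have "dist (mkp d (lo d R) (lo (\<not> d) R)) (mkp d (hi d R) (lo (\<not> d) R)) = hi d R - lo d R"
    using lh[OF R, of d] by (cases d) (auto simp: mkp_def dist_Pair_Pair dist_real_def)
  moreover have "diameter (region R) \<le> mesh_size \<Delta>" unfolding mesh_size_def using R fin_D by (intro Max_ge) auto
  ultimately show ?thesis by simp
qed

section \<open>The norm\<close>

lemma Lq_norm_le:
  assumes q: "1 \<le> q" and g: "continuous_on (region R) g" and B: "\<And>x. x \<in> region R \<Longrightarrow> \<bar>g x\<bar> \<le> B" "0 \<le> B"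
    and R: "xl R \<le> xr R" "yl R \<le> yr R" "xr R - xl R \<le> 1" "yr R - yl R \<le> 1"
  shows "Lq_norm q (region R) g \<le> ennreal B"
proof -
  let ?N = "lebesgue_on (region R)"
  have cb: "region R = cbox (xl R, yl R) (xr R, yr R)" by (auto simp: region_def cbox_Pair_eq)
  have S: "region R \<in> sets lebesgue" unfolding cb by simp
  have sp: "space ?N = region R" by simp
  have meas: "g \<in> borel_measurable ?N" by (rule continuous_imp_measurable_on_sets_lebesgue[OF g S])
  have em: "emeasure ?N (region R) \<le> 1"
  proof -
    have "emeasure ?N (region R) = emeasure lborel (cbox (xl R, yl R) (xr R, yr R))"
      using S unfolding cb by (simp add: emeasure_restrict_space)
    also have "\<dots> = ennreal (measure lborel (cbox (xl R, yl R) (xr R, yr R)))"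
      by (rule emeasure_eq_ennreal_measure) (use emeasure_lborel_cbox_finite in \<open>simp add: less_top\<close>)
    also have "measure lborel (cbox (xl R, yl R) (xr R, yr R)) = (xr R - xl R) * (yr R - yl R)"
      using R by (simp add: content_Pair)
    also have "ennreal \<dots> \<le> ennreal 1" using R by (intro ennreal_leI mult_le_one) auto
    finally show ?thesis by simp
  qed
  show ?thesis
  proof (cases "q = \<infinity>")
    case True
    have "esssup ?N (\<lambda>x. ennreal \<bar>g x\<bar>) \<le> ennreal B"
    proof (rule esssup_I)
      show "(\<lambda>x. ennreal \<bar>g x\<bar>) \<in> borel_measurable ?N" using meas by measurable
      show "AE x in ?N. ennreal \<bar>g x\<bar> \<le> ennreal B" by (rule AE_I2) (use B sp in \<open>auto intro: ennreal_leI\<close>)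
    qed
    then show ?thesis using True by (simp add: Lq_norm_def)
  next
    case False
    define p where "p = real_of_ereal q"
    have p: "1 \<le> p" using q False by (cases q) (auto simp: p_def)
    define I where "I = (\<integral>\<^sup>+x. ennreal (\<bar>g x\<bar> powr p) \<partial>?N)"
    have "I \<le> (\<integral>\<^sup>+x. ennreal (B powr p) \<partial>?N)"
      unfolding I_def by (rule nn_integral_mono) (use B p sp in \<open>auto intro!: ennreal_leI powr_mono2\<close>)
    also have "\<dots> = ennreal (B powr p) * emeasure ?N (region R)" by simp
    also have "\<dots> \<le> ennreal (B powr p) * 1" by (intro mult_left_mono em) auto
    finally have I: "I \<le> ennreal (B powr p)" by simp
    have fin: "I \<noteq> \<infinity>" unfolding infinity_ennreal_def by (rule neq_top_trans[OF _ I]) simp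
    have "enn2real I \<le> B powr p" using enn2real_mono[OF I] by simp
    then have "enn2real I powr (1 / p) \<le> (B powr p) powr (1 / p)" using p by (intro powr_mono2) auto
    also have "\<dots> = B" using p B(2) by (simp add: powr_powr)
    finally have "ennreal (enn2real I powr (1 / p)) \<le> ennreal B" by (rule ennreal_leI)
    then show ?thesis using False fin by (simp add: Lq_norm_def p_def[symmetric] I_def[symmetric] Let_def)
  qed
qed

section \<open>The order of approximation\<close>

lemma (in tmesh) Dst_bound:
  assumes "Cmm_on m1 m2 (mesh_domain \<Delta>) f"
  shows "\<exists>B. \<forall>i\<le>m1. \<forall>j\<le>m2. \<forall>z\<in>mesh_domain \<Delta>. \<bar>Dst (mesh_domain \<Delta>) i j f z\<bar> \<le> B"
proof -
  let ?S = "mesh_domain \<Delta>"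
  have S: "compact ?S" unfolding mesh_domain_def region_def by (intro compact_UN fin_D compact_Times compact_Icc)
  have "\<exists>B\<ge>0. \<forall>z\<in>?S. \<bar>Dst ?S i j f z\<bar> \<le> B" if "i \<le> m1" "j \<le> m2" for i j
  proof -
    have "compact (Dst ?S i j f ` ?S)"
      by (rule compact_continuous_image[OF _ S]) (use assms that in \<open>auto simp: Cmm_on_def\<close>)
    then have "bounded (Dst ?S i j f ` ?S)" by (rule compact_imp_bounded)
    then obtain B where "0 < B" "\<forall>y\<in>Dst ?S i j f ` ?S. norm y \<le> B" unfolding bounded_pos by blast
    then show ?thesis by (intro exI[of _ B]) auto
  qed
  note ex = this
  define B where "B i j = (SOME B. 0 \<le> B \<and> (\<forall>z\<in>?S. \<bar>Dst ?S i j f z\<bar> \<le> B))" for i j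
  note B = someI_ex[OF ex, folded B_def]
  define M where "M = (\<Sum>i\<le>m1. \<Sum>j\<le>m2. B i j)"
  have "B i j \<le> M" if ij: "i \<le> m1" "j \<le> m2" for i j
  proof -
    have "B i j \<le> (\<Sum>j\<le>m2. B i j)" by (rule member_le_sum) (use B ij in auto)
    also have "\<dots> \<le> M" unfolding M_def
      by (rule member_le_sum[where f="\<lambda>i. \<Sum>j\<le>m2. B i j"]) (use B ij in \<open>auto intro!: sum_nonneg\<close>)
    finally show ?thesis .
  qed
  then show ?thesis using B by (intro exI[of _ M]) fastforce
qed

lemma det_D_le:
  assumes "\<And>i. i \<le> n \<Longrightarrow> \<bar>nder S i u x\<bar> \<le> M \<and> \<bar>nder S i v x\<bar> \<le> M" "0 \<le> M"
  shows "\<bar>det_D n u v S x\<bar> \<le> 2 * M\<^sup>2"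
proof -
  have "\<bar>det_D n u v S x\<bar> \<le> \<bar>nder S (n - 2) u x\<bar> * \<bar>nder S (n - 1) v x\<bar> + \<bar>nder S (n - 1) u x\<bar> * \<bar>nder S (n - 2) v x\<bar>"
    unfolding abs_mult[symmetric] det_D_def by (rule abs_triangle_ineq4)
  also have "\<dots> \<le> M * M + M * M" using assms by (intro add_mono mult_mono) auto
  finally show ?thesis by (simp add: power2_eq_square)
qed

text \<open>One admissible mesh supplies the bounds for \<open>u\<close>, \<open>v\<close> and \<open>f\<close>, valid for all of them; then \<open>H0\<close> makes cells and
  composite edges short enough for every step: \<open>\<alpha>' * H0\<close> bounds the length of composite edges.\<close>

lemma uniform_error:
  assumes n3: "\<And>d. 3 \<le> n d" and rn: "\<And>d. 2 * r d + 2 \<le> n d" and d0: "0 < \<delta>"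
    and \<Delta>0: "T_mesh \<Delta>0" "mesh_domain \<Delta>0 = \<Omega>" "piecewise_Ck n u \<Delta>0" "piecewise_Ck n v \<Delta>0"
    and f: "Cmm_on (n True) (n False) \<Omega> f"
  shows "\<exists>K H0. 0 < H0 \<and> H0 \<le> 1 \<and> (\<forall>\<Delta> cw ce cen. T_mesh \<Delta> \<longrightarrow> \<not> (\<exists>ws. T_cycle \<Delta> ws) \<longrightarrow> mesh_domain \<Delta> = \<Omega> \<longrightarrow>
    piecewise_Ck n u \<Delta> \<longrightarrow> piecewise_Ck n v \<Delta> \<longrightarrow> M_choice \<Delta> cw ce \<longrightarrow> (\<forall>R\<in>\<Delta>. circle_center R (cen R)) \<longrightarrow>
    assumption_A4 (n True) (n False) (u True) (v True) (u False) (v False) \<delta> cen \<Delta> \<longrightarrow>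
    alpha_mesh \<Delta> \<le> \<alpha> \<longrightarrow> beta_mesh \<Delta> \<le> \<beta> \<longrightarrow> kappa_mesh \<Delta> \<le> \<kappa> \<longrightarrow> mesh_size \<Delta> \<le> H0 \<longrightarrow>
    (\<forall>R\<in>\<Delta>. continuous_on (region R) (quasi_interp (n True) (n False) (r True) (r False) (u True) (v True) (u False) (v False) \<Delta>
        (M_set (n True) (n False) (r True) (r False) \<Delta> cw ce) cen f) \<and>
      (\<forall>z\<in>region R. \<bar>f z - quasi_interp (n True) (n False) (r True) (r False) (u True) (v True) (u False) (v False) \<Delta>
        (M_set (n True) (n False) (r True) (r False) \<Delta> cw ce) cen f z\<bar> \<le> K * mesh_size \<Delta> ^ min (n True) (n False))))"
proof -
  interpret Z: tmesh \<Delta>0 by unfold_locales (rule \<Delta>0(1))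
  obtain Mu where Mu: "1 \<le> Mu" "\<forall>R\<in>\<Delta>0. \<forall>d. \<forall>i\<le>n d. \<forall>x\<in>Iv d R. \<bar>nder (Iv d R) i (u d) x\<bar> \<le> Mu"
    using Z.piecewise_Ck_bound[OF \<Delta>0(3)] by blast
  obtain Mv where Mv: "1 \<le> Mv" "\<forall>R\<in>\<Delta>0. \<forall>d. \<forall>i\<le>n d. \<forall>x\<in>Iv d R. \<bar>nder (Iv d R) i (v d) x\<bar> \<le> Mv"
    using Z.piecewise_Ck_bound[OF \<Delta>0(4)] by blast
  define M where "M = max Mu Mv"
  have M1: "1 \<le> M" and MM: "Mu \<le> M" "Mv \<le> M" using Mu(1) by (auto simp: M_def)
  obtain Mf where Mf: "\<forall>i\<le>n True. \<forall>j\<le>n False. \<forall>z\<in>\<Omega>. \<bar>Dst \<Omega> i j f z\<bar> \<le> Mf"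
    using Z.Dst_bound f unfolding \<Delta>0(2) by blast
  \<comment> \<open>each determinant is at most \<open>2 * M\<^sup>2\<close>, so \<open>det_split\<close> bounds it below by \<open>\<rho>\<close> at the centers\<close>
  define \<rho> where "\<rho> = min 1 (\<delta> / (2 * M\<^sup>2) ^ (n True + n False))"
  have K1: "1 \<le> 2 * M\<^sup>2" using one_le_power[OF M1, of 2] by simp
  have r0: "0 < \<rho>" using d0 K1 M1 by (simp add: \<rho>_def)
  obtain C h0 where h0: "0 < h0" and S: "uniform_setup n r u v M (\<rho> / 2) C h0"
    using uniform_setup_ex[where n=n and r=r and \<delta>="\<rho> / 2" and u=u and v=v, OF M1 _ n3 rn] r0 by auto
  interpret S: uniform_setup n r u v M "\<rho> / 2" C h0 by (rule S)
  define \<alpha>' \<kappa>' where "\<alpha>' = max 1 \<alpha>" and "\<kappa>' = max 1 \<kappa>"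
  have a1: "1 \<le> \<alpha>'" and ak: "\<alpha> \<le> \<alpha>'" "\<kappa> \<le> \<kappa>'" "1 \<le> \<kappa>'" by (auto simp: \<alpha>'_def \<kappa>'_def)
  define H0 where "H0 = min (min 1 (1 / \<alpha>')) (min (h0 / \<alpha>') (\<rho> / (4 * M\<^sup>2)))"
  have H0: "0 < H0" "H0 \<le> 1" "\<alpha>' * H0 \<le> 1" "\<alpha>' * H0 \<le> h0" "4 * M\<^sup>2 * H0 \<le> \<rho>"
  proof -
    have M0: "0 < 4 * M\<^sup>2" using M1 by simp
    have le: "H0 \<le> 1 / \<alpha>'" "H0 \<le> h0 / \<alpha>'" "H0 \<le> \<rho> / (4 * M\<^sup>2)" by (auto simp: H0_def)
    show "\<alpha>' * H0 \<le> 1" "\<alpha>' * H0 \<le> h0" using le(1,2) a1 by (auto simp: field_simps)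
    show "4 * M\<^sup>2 * H0 \<le> \<rho>" using le(3) M0 by (simp add: pos_le_divide_eq mult.commute)
    show "0 < H0" using a1 h0 r0 M0 by (auto simp: H0_def)
    show "H0 \<le> 1" unfolding H0_def by linarith
  qed
  define k where "k = min (n True) (n False)"
  define K where "K = (1 + spline_error.err_const n M (\<rho> / 2) C \<alpha>' \<kappa>' \<beta>) *
    ((n False + 1) * (1 + S.J1 False * S.J1 True) * Mf * \<alpha>' ^ k)"
  show ?thesis
  proof (rule exI[of _ K], rule exI[of _ H0], intro conjI allI impI ballI)
    fix \<Delta> cw ce cen
    assume \<Delta>: "T_mesh \<Delta>" "\<not> (\<exists>ws. T_cycle \<Delta> ws)" "mesh_domain \<Delta> = \<Omega>" "piecewise_Ck n u \<Delta>" "piecewise_Ck n v \<Delta>" "M_choice \<Delta> cw ce"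
      "\<forall>R\<in>\<Delta>. circle_center R (cen R)" and A4: "assumption_A4 (n True) (n False) (u True) (v True) (u False) (v False) \<delta> cen \<Delta>"
      and mq: "alpha_mesh \<Delta> \<le> \<alpha>" "beta_mesh \<Delta> \<le> \<beta>" "kappa_mesh \<Delta> \<le> \<kappa>" and H: "mesh_size \<Delta> \<le> H0"
    interpret A: acmesh \<Delta> by unfold_locales (use \<Delta> in auto)
    let ?h = "mesh_size \<Delta>"
    have hh: "hi d R - lo d R \<le> ?h" if "R \<in> \<Delta>" for d R by (rule A.length_mesh_size[OF that])
    have eqd: "mesh_domain \<Delta> = mesh_domain \<Delta>0" using \<Delta> \<Delta>0 by simp
    have bd: "\<bar>nder (Iv d R) i (u d) x\<bar> \<le> M \<and> \<bar>nder (Iv d R) i (v d) x\<bar> \<le> M" if "R \<in> \<Delta>" "i \<le> n d" "x \<in> Iv d R" for R d i x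
      using piecewise_Ck_bound_transfer[OF \<Delta>0(1) Mu(2) \<Delta>(1,4) eqd that] piecewise_Ck_bound_transfer[OF \<Delta>0(1) Mv(2) \<Delta>(1,5) eqd that] MM by linarith
    have cen: "cen R \<in> region R" if "R \<in> \<Delta>" for R
      using \<Delta>(7) A.lh[OF that, of True] A.lh[OF that, of False] that by (intro circle_center_in) (auto simp: lo_def hi_def)
    define z where "z d R = (if d then fst (cen R) else snd (cen R))" for d R
    have z: "z d R \<in> Iv d R" if "R \<in> \<Delta>" for d R
      using cen[OF that] by (auto simp: z_def region_def lo_def hi_def)
    have det: "\<rho> \<le> \<bar>det_D (n d) (u d) (v d) (Iv d R) (z d R)\<bar>" if R: "R \<in> \<Delta>" for d R
    proof -
      let ?D = "\<lambda>d. \<bar>det_D (n d) (u d) (v d) (Iv d R) (z d R)\<bar>"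
      have le: "?D d \<le> 2 * M\<^sup>2" for d by (rule det_D_le) (use bd[OF R _ z[OF R]] M1 in auto)
      have "\<delta> \<le> ?D True ^ n False * ?D False ^ n True"
        using A4 R unfolding assumption_A4_def by (simp add: z_def lo_def hi_def)
      then have "\<delta> \<le> ?D d ^ n (\<not> d) * ?D (\<not> d) ^ n d" by (cases d) (auto simp: mult.commute)
      from det_split[OF _ _ le K1 _ d0 this] have "min 1 (\<delta> / (2 * M\<^sup>2) ^ (n (\<not> d) + n d)) \<le> ?D d" using n3[of "\<not> d"] by simp
      then show ?thesis by (cases d) (simp_all add: \<rho>_def add.commute)
    qed
    have good: "good (n d) (u d) (v d) M (\<rho> / 2) (lo d R) (hi d R)" if R: "R \<in> \<Delta>" for d R
    proof (rule good_near[OF n3 M1 A.lh[OF R] _ _ _ bd[OF R] z[OF R] det[OF R] r0])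
      show "hi d R - lo d R \<le> 1" using hh[OF R, of d] H H0 by simp
      have "4 * M\<^sup>2 * (hi d R - lo d R) \<le> 4 * M\<^sup>2 * H0" using hh[OF R, of d] H by (intro mult_left_mono) auto
      then show "4 * M\<^sup>2 * (hi d R - lo d R) \<le> \<rho>" using H0(5) by simp
    qed (use \<Delta>(4,5) R in \<open>auto simp: piecewise_Ck_def\<close>)
    have h0': "0 \<le> ?h" using A.ne_D hh A.lh by (metis diff_ge_0_iff_ge ex_in_conv less_imp_le order_trans)
    have aH: "\<alpha>' * ?h \<le> \<alpha>' * H0" using H a1 by (intro mult_left_mono) auto
    have hle: "?h \<le> \<alpha>' * ?h" using mult_right_mono[OF a1 h0'] by simp
    have good_cell: "S.good_cell R" if "R \<in> \<Delta>" for R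
      unfolding S.good_cell_def using good[OF that] hh[OF that] aH hle H0(4) by (meson order_trans)
    have CEl: "b - a \<le> \<alpha>' * ?h" if e: "A.CE d c a b" for d c a b
    proof -
      obtain R \<sigma> where R: "R \<in> \<Delta>" "cell_end (\<not> d) \<sigma> R = c" "a \<le> lo d R" "hi d R \<le> b" "cell_end d False R = endpt False a b"
        using A.CE_end_cell[OF e, of False] by blast
      have "alpha_mesh \<Delta> \<le> \<alpha>'" using mq ak by simp
      from A.alpha_bound[OF this e R] have "b - a \<le> \<alpha>' * (hi d R - lo d R)" .
      also have "\<dots> \<le> \<alpha>' * ?h" using hh[OF R(1)] a1 by (intro mult_left_mono) auto
      finally show ?thesis .
    qed
    have CEl': "b - a \<le> h0 \<and> b - a \<le> 1" if "A.CE d c a b" for d c a b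
      using CEl[OF that] aH H0(3,4) by linarith
    interpret spline_setting n r u v M "\<rho> / 2" C h0 \<Delta> \<alpha>' \<kappa>' \<beta> cw ce
      by unfold_locales (use good_cell mq ak a1 \<Delta>(6) CEl' in \<open>auto intro: order_trans\<close>)
    fix R assume R: "R \<in> \<Delta>"
    have f': "Cmm_on (n True) (n False) (mesh_domain \<Delta>) f" using f \<Delta>(3) by simp
    have fM: "\<bar>Dst (mesh_domain \<Delta>) i j f z\<bar> \<le> Mf" if "i \<le> n True" "j \<le> n False" "z \<in> mesh_domain \<Delta>" for i j z
      using Mf that \<Delta>(3) by simp
    have L1: "\<alpha>' * ?h \<le> 1" using aH H0(3) by simp
    show "continuous_on (region R) (Q cen f)"
      by (rule quasi_error(2)[OF f' _ _ _ L1 R cen[OF R]]) (use fM cen CEl in blast)+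
    fix z assume z: "z \<in> region R"
    have "\<bar>f z - Q cen f z\<bar> \<le> (1 + spline_error.err_const n M (\<rho> / 2) C \<alpha>' \<kappa>' \<beta>) *
      ((n False + 1) * (1 + S.J1 False * S.J1 True) * Mf * (\<alpha>' * ?h) ^ k)"
      unfolding k_def by (rule quasi_error(1)[OF f' _ _ _ L1 R z]) (use fM cen CEl in blast)+
    then show "\<bar>f z - Q cen f z\<bar> \<le> K * ?h ^ min (n True) (n False)"
      unfolding K_def k_def[symmetric] by (simp add: power_mult_distrib mult_ac)
  qed (rule H0(1,2))+
qed

theorem mainTheorem3:
  fixes n1 n2 r1 r2 :: nat
    and u1 v1 u2 v2 :: "real \<Rightarrow> real"
    and \<Omega> :: "(real \<times> real) set"
    and f :: "real \<times> real \<Rightarrow> real"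
    and q :: ereal
    and \<alpha> \<kappa> \<delta> :: real
    and \<beta> :: nat
  assumes "n1 \<ge> 3" "n2 \<ge> 3"
    and "n1 - 1 \<ge> 2 * r1 + 1" "n2 - 1 \<ge> 2 * r2 + 1"
    and "Cmm_on n1 n2 \<Omega> f"
    and "1 \<le> q"
    and "\<delta> > 0"
  shows "\<exists>C H0. H0 > 0 \<and>
    (\<forall>\<Delta> cw ce cen.
       T_mesh \<Delta> \<and> regular_mesh \<Delta> \<and> \<not> (\<exists>ws. T_cycle \<Delta> ws) \<and> mesh_domain \<Delta> = \<Omega> \<and>
       fun_regularity n1 n2 u1 v1 u2 v2 \<Delta> \<and>
       assumption_A1 n1 n2 u1 v1 u2 v2 \<Delta> \<and>
       assumption_A2 n1 n2 u1 v1 u2 v2 \<Delta> \<and>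
       assumption_A3 n1 n2 u1 v1 u2 v2 \<Delta> \<and>
       M_choice \<Delta> cw ce \<and>
       (\<forall>R\<in>\<Delta>. circle_center R (cen R)) \<and>
       assumption_A4 n1 n2 u1 v1 u2 v2 \<delta> cen \<Delta> \<and>
       alpha_mesh \<Delta> \<le> \<alpha> \<and> beta_mesh \<Delta> \<le> \<beta> \<and> kappa_mesh \<Delta> \<le> \<kappa> \<and>
       mesh_size \<Delta> \<le> H0 \<longrightarrow>
       (\<forall>R\<in>\<Delta>.
          Lq_norm q (region R)
            (\<lambda>x. f x - quasi_interp n1 n2 r1 r2 u1 v1 u2 v2 \<Delta> (M_set n1 n2 r1 r2 \<Delta> cw ce) cen f x)
          \<le> ennreal (C * mesh_size \<Delta> ^ (min (n1 - 1) (n2 - 1) + 1))))"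
proof (cases "\<exists>\<Delta>. T_mesh \<Delta> \<and> mesh_domain \<Delta> = \<Omega> \<and> fun_regularity n1 n2 u1 v1 u2 v2 \<Delta>")
  case False
  then show ?thesis by (intro exI[of _ 0] exI[of _ 1]) (simp, blast)
next
  case True
  then obtain \<Delta>0 where \<Delta>0: "T_mesh \<Delta>0" "mesh_domain \<Delta>0 = \<Omega>" "fun_regularity n1 n2 u1 v1 u2 v2 \<Delta>0" by blast
  define n r where "n d = (if d then n1 else n2)" and "r d = (if d then r1 else r2)" for d
  define u v where "u d = (if d then u1 else u2)" and "v d = (if d then v1 else v2)" for d
  have fr: "piecewise_Ck n u \<Delta>" "piecewise_Ck n v \<Delta>" if "fun_regularity n1 n2 u1 v1 u2 v2 \<Delta>" for \<Delta>
    using that by (auto simp: fun_regularity_def piecewise_Ck_def n_def u_def v_def lo_def hi_def)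
  have TF [simp]: "n True = n1" "n False = n2" "r True = r1" "r False = r2" "u True = u1" "u False = u2" "v True = v1" "v False = v2"
    by (simp_all add: n_def r_def u_def v_def)
  have n3: "3 \<le> n d" and rn: "2 * r d + 2 \<le> n d" for d using assms by (auto simp: n_def r_def)
  have k: "min (n1 - 1) (n2 - 1) + 1 = min n1 n2" using assms by simp
  have f: "Cmm_on (n True) (n False) \<Omega> f" using assms(5) by simp
  from uniform_error[where n=n and r=r, OF n3 rn assms(7) \<Delta>0(1,2) fr[OF \<Delta>0(3)] f, of \<alpha> \<beta> \<kappa>] show ?thesis
    unfolding k TF
  proof (elim exE conjE, goal_cases)
    case (1 K H0)
    note H0 = 1(1,2) and E = 1(3)
  show ?case
  proof (rule exI[of _ K], rule exI[of _ H0], intro conjI allI impI ballI)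
    fix \<Delta> cw ce cen R
    assume A: "T_mesh \<Delta> \<and> regular_mesh \<Delta> \<and> \<not> (\<exists>ws. T_cycle \<Delta> ws) \<and> mesh_domain \<Delta> = \<Omega> \<and>
       fun_regularity n1 n2 u1 v1 u2 v2 \<Delta> \<and>
       assumption_A1 n1 n2 u1 v1 u2 v2 \<Delta> \<and>
       assumption_A2 n1 n2 u1 v1 u2 v2 \<Delta> \<and>
       assumption_A3 n1 n2 u1 v1 u2 v2 \<Delta> \<and>
       M_choice \<Delta> cw ce \<and>
       (\<forall>R\<in>\<Delta>. circle_center R (cen R)) \<and>
       assumption_A4 n1 n2 u1 v1 u2 v2 \<delta> cen \<Delta> \<and>
       alpha_mesh \<Delta> \<le> \<alpha> \<and> beta_mesh \<Delta> \<le> \<beta> \<and> kappa_mesh \<Delta> \<le> \<kappa> \<and>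
       mesh_size \<Delta> \<le> H0" and R: "R \<in> \<Delta>"
    let ?Q = "quasi_interp n1 n2 r1 r2 u1 v1 u2 v2 \<Delta> (M_set n1 n2 r1 r2 \<Delta> cw ce) cen f"
    interpret tmesh \<Delta> by unfold_locales (use A in blast)
    have E: "continuous_on (region R) ?Q" "\<And>z. z \<in> region R \<Longrightarrow> \<bar>f z - ?Q z\<bar> \<le> K * mesh_size \<Delta> ^ min n1 n2"
      using E[THEN spec[of _ \<Delta>], THEN spec[of _ cw], THEN spec[of _ ce], THEN spec[of _ cen]] A R fr[of \<Delta>] by blast+
    have "continuous_on \<Omega> (Dst \<Omega> 0 0 f)" using assms(5) unfolding Cmm_on_def by blast
    then have "continuous_on \<Omega> f" by simp
    then have cf: "continuous_on (region R) f"
      by (rule continuous_on_subset) (use A R in \<open>auto simp: mesh_domain_def\<close>)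
    have l: "xl R < xr R" "yl R < yr R" using lh[OF R, of True] lh[OF R, of False] by (auto simp: lo_def hi_def)
    have "hi d R - lo d R \<le> 1" for d using length_mesh_size[OF R, of d] A H0(2) by linarith
    from this[of True] this[of False] have s: "xr R - xl R \<le> 1" "yr R - yl R \<le> 1" by (auto simp: lo_def hi_def)
    have "0 \<le> K * mesh_size \<Delta> ^ min n1 n2"
      using E(2)[of "(xl R, yl R)"] l by (force simp: region_def)
    then show "Lq_norm q (region R) (\<lambda>x. f x - ?Q x) \<le> ennreal (K * mesh_size \<Delta> ^ min n1 n2)"
      by (intro Lq_norm_le assms(6) continuous_on_diff cf E) (use l s in auto)
  qed (rule H0(1))
  qed
qed

end
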